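(* For $\kappa>0$ let $\tilde{\mathbb P}_{1,\kappa}$ be the 2D inhomogeneous percolation measure with density $$p(z)=p_c+\alpha\!\left(\frac{r}{\kappa\log\log r}\right),\qquad r=r(z)=\|z\|,$$ for $r$ large enough that all quantities are positive, and $p(z)=1$ otherwise. Then there is a critical value $\kappa_c\in(0,+\infty)$ such that for $\kappa>\kappa_c$ there exists $\tilde{\mathbb P}_{1,\kappa}$-a.s. an infinite cluster, while for $\kappa<\kappa_c$ there is $\tilde{\mathbb P}_{1,\kappa}$-a.s. no infinite cluster.
   Context: Percolation model. We consider an independent (bond or site) percolation model on a planar lattice which has reflection symmetry about the vertical axis and is invariant under a rotation by some angle in $(0,\pi)$, and for which Kesten's results on critical and near-critical 2D percolation hold (in particular the Russo–Seymour–Welsh bounds: at $p=p_c$ crossing probabilities of parallelograms are bounded away from $0$ and $1$ by constants depending only on the aspect ratio, for both the model and its dual; and the same for $p>p_c$ on length scales up to $L(p)$, where $L(p)$ is the finite-size correlation length, i.e. the smallest scale $n$ at which the long-way occupied crossing of a $3n\times n$ parallelogram has probability larger than $1-c\delta$, for a suitable fixed constant $c$ and fixed $\delta\in(0,1)$). Bond or site percolation on the square or triangular lattice are the models to keep in mind. Bonds or sites (as appropriate) are independently occupied with probability $p$ and vacant with probability $1-p$; $\mathbb P_p$ is the corresponding homogeneous measure, and $p_c\in(0,1)$ is its threshold: the origin is connected to infinity with positive $\mathbb P_p$-probability iff $p>p_c$. Geometry. $r(z)=\|z\|$ is the infinity norm of $z$ with respect to the coordinates along the $x$-axis and the axis obtained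 from it by the symmetry rotation. Correlation length. For $p>p_c$, let $\tau^*_{0^*,z^*}(p)$ be the probability that the dual sites $0^*$ (the dual origin) and $z^*$ are connected by a path in the dual model, and let $\tau^*_n(p)$ be the maximum of $\tau^*_{0^*,z^*}(p)$ over $z^*$ with $\|z^*\|$ within a lattice spacing of $n$. The correlation length $\xi(p)$ is defined by $\lim_{n\to\infty}[\tau^*_n(p)]^{1/n}=e^{-1/\xi(p)}$, with $\xi(1)=0$. It is continuous and monotone on $(p_c,1]$ and diverges as $p\downarrow p_c$. Let $\alpha:[0,\infty)\to(0,1-p_c]$ be the inverse function defined by $\xi(p_c+\alpha(r))=r$. Inhomogeneous model. Under $\tilde{\mathbb P}_{1,\kappa}$, sites (or bonds) are independently occupied, with probability $p(z)$ at location $z$. Thus the local correlation length at distance $r$ from the origin is $\xi(p(z))=r/(\kappa\log\log r)$. *)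

theory Defs
  imports "HOL-Probability.Probability"
begin

section \<open>Coordinates\<close>

text \<open>Coordinates along the x-axis and along the axis at angle \<open>\<theta>\<close>:
  \<open>z = coord1 \<theta> z + coord2 \<theta> z * cis \<theta>\<close> when \<open>0 < \<theta> < pi\<close>.\<close>

definition coord2 :: "real \<Rightarrow> complex \<Rightarrow> real" where
  "coord2 \<theta> z = Im z / sin \<theta>"

definition coord1 :: "real \<Rightarrow> complex \<Rightarrow> real" where
  "coord1 \<theta> z = Re z - coord2 \<theta> z * cos \<theta>"

definition oblique_norm :: "real \<Rightarrow> complex \<Rightarrow> real" where
  "oblique_norm \<theta> z = max \<bar>coord1 \<theta> z\<bar> \<bar>coord2 \<theta> z\<bar>"


section \<open>Percolation models on planar lattices\<close>

datatype percolation_kind = Bond | Site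

text \<open>A bond is the two-element set of its end points, drawn as a straight segment.
  The dual sites are the sites of the matching lattice for site percolation, and one
  point per face for bond percolation (see \<open>planar_lattice\<close>). The site \<open>origin\<close> and the dual
  site \<open>dual_origin\<close> need not lie at \<open>0\<close>, the centre of the rotation.\<close>

record percolation_model =
  kind :: percolation_kind
  sites :: "complex set"
  bonds :: "complex set set"
  dual_sites :: "complex set"
  spacing :: real
  rot_angle :: real
  origin :: complex
  dual_origin :: complex

definition drawing :: "percolation_model \<Rightarrow> complex set" where
  "drawing M = (\<Union>e\<in>bonds M. convex hull e)"

definition faces :: "percolation_model \<Rightarrow> complex set set" where
  "faces M = components (- drawing M)"

definition invariant_under :: "percolation_model \<Rightarrow> (complex \<Rightarrow> complex) \<Rightarrow> bool" where
  "invariant_under M f \<longleftrightarrow>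
     f ` sites M = sites M \<and> (image f) ` bonds M = bonds M \<and> f ` dual_sites M = dual_sites M"

text \<open>The map \<open>z \<mapsto> - cnj z\<close> is the reflection in the vertical axis. Periodicity in the second
  direction, by \<open>spacing M * cis (rot_angle M)\<close>, follows from the horizontal one and the
  rotation.\<close>

definition planar_lattice :: "percolation_model \<Rightarrow> bool" where
  "planar_lattice M \<longleftrightarrow>
     0 < spacing M \<and> 0 < rot_angle M \<and> rot_angle M < pi \<and>
     origin M \<in> sites M \<and> dual_origin M \<in> dual_sites M \<and>
     (\<forall>R. finite (sites M \<inter> cball 0 R)) \<and>
     (\<forall>e\<in>bonds M. e \<subseteq> sites M \<and> card e = 2) \<and>
     (\<forall>v\<in>sites M. finite {e\<in>bonds M. v \<in> e}) \<and>
     (\<forall>u\<in>sites M. \<forall>v\<in>sites M. (u, v) \<in> {(x, y). {x, y} \<in> bonds M}\<^sup>*) \<and>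
     (\<forall>e\<in>bonds M. sites M \<inter> convex hull e = e) \<and>
     (\<forall>e\<in>bonds M. \<forall>e'\<in>bonds M. e \<noteq> e' \<longrightarrow> convex hull e \<inter> convex hull e' = e \<inter> e') \<and>
     invariant_under M (\<lambda>z. z + of_real (spacing M)) \<and>
     invariant_under M (\<lambda>z. - cnj z) \<and>
     invariant_under M (\<lambda>z. cis (rot_angle M) * z) \<and>
     (case kind M of
        Site \<Rightarrow> dual_sites M = sites M
      | Bond \<Rightarrow> dual_sites M \<subseteq> \<Union>(faces M) \<and> (\<forall>F\<in>faces M. \<exists>!w. w \<in> dual_sites M \<and> w \<in> F))"


section \<open>Configurations and measures\<close>

text \<open>The random elements are the bonds, respectively the sites; a site \<open>v\<close> is encoded as the
  singleton \<open>{v}\<close>, so that configurations have the same type in both cases. A configuration is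
  \<open>True\<close> at the occupied elements.\<close>

type_synonym config = "complex set \<Rightarrow> bool"

definition elements :: "percolation_model \<Rightarrow> complex set set" where
  "elements M = (case kind M of Bond \<Rightarrow> bonds M | Site \<Rightarrow> (\<lambda>v. {v}) ` sites M)"

text \<open>The location of a bond is its midpoint.\<close>

definition location :: "complex set \<Rightarrow> complex" where
  "location b = (\<Sum>z\<in>b. z) / of_nat (card b)"

definition perc_measure :: "percolation_model \<Rightarrow> (complex \<Rightarrow> real) \<Rightarrow> config measure" where
  "perc_measure M q = Pi\<^sub>M (elements M) (\<lambda>b. measure_pmf (bernoulli_pmf (q (location b))))"

definition hom_prob :: "percolation_model \<Rightarrow> real \<Rightarrow> (config \<Rightarrow> bool) \<Rightarrow> real" where
  "hom_prob M p A =
     measure (perc_measure M (\<lambda>_. p)) {\<omega> \<in> space (perc_measure M (\<lambda>_. p)). A \<omega>}"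


section \<open>Paths and clusters\<close>

definition occupied_site :: "percolation_model \<Rightarrow> config \<Rightarrow> complex \<Rightarrow> bool" where
  "occupied_site M \<omega> v \<longleftrightarrow> v \<in> sites M \<and> (kind M = Site \<longrightarrow> \<omega> {v})"

definition occupied_step :: "percolation_model \<Rightarrow> config \<Rightarrow> complex \<Rightarrow> complex \<Rightarrow> bool" where
  "occupied_step M \<omega> u v \<longleftrightarrow> {u, v} \<in> bonds M \<and> (kind M = Bond \<longrightarrow> \<omega> {u, v})"

definition occupied_path :: "percolation_model \<Rightarrow> config \<Rightarrow> complex list \<Rightarrow> bool" where
  "occupied_path M \<omega> xs \<longleftrightarrow>
     xs \<noteq> [] \<and> (\<forall>v\<in>set xs. occupied_site M \<omega> v) \<and> successively (occupied_step M \<omega>) xs"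

text \<open>Dual model. For site percolation: vacant sites on the matching lattice, in which any two
  sites on the boundary of a common face are adjacent. For bond percolation: a dual bond joins
  the dual sites of the two faces on either side of a bond, and is open iff that bond is vacant.\<close>

definition dual_open_site :: "percolation_model \<Rightarrow> config \<Rightarrow> complex \<Rightarrow> bool" where
  "dual_open_site M \<omega> v \<longleftrightarrow> v \<in> dual_sites M \<and> (kind M = Site \<longrightarrow> \<not> \<omega> {v})"

definition dual_open_step :: "percolation_model \<Rightarrow> config \<Rightarrow> complex \<Rightarrow> complex \<Rightarrow> bool" where
  "dual_open_step M \<omega> u v \<longleftrightarrow> u \<noteq> v \<and>
     (case kind M of
        Site \<Rightarrow> {u, v} \<in> bonds M \<or> (\<exists>F\<in>faces M. u \<in> frontier F \<and> v \<in> frontier F)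
      | Bond \<Rightarrow> (\<exists>F\<in>faces M. \<exists>G\<in>faces M. \<exists>e\<in>bonds M. u \<in> F \<and> v \<in> G \<and>
                   convex hull e \<subseteq> frontier F \<inter> frontier G \<and> \<not> \<omega> e))"

definition dual_path :: "percolation_model \<Rightarrow> config \<Rightarrow> complex list \<Rightarrow> bool" where
  "dual_path M \<omega> xs \<longleftrightarrow>
     xs \<noteq> [] \<and> (\<forall>v\<in>set xs. dual_open_site M \<omega> v) \<and> successively (dual_open_step M \<omega>) xs"

definition cluster :: "percolation_model \<Rightarrow> config \<Rightarrow> complex \<Rightarrow> complex set" where
  "cluster M \<omega> v = {w. \<exists>xs. occupied_path M \<omega> xs \<and> hd xs = v \<and> last xs = w}"

definition has_infinite_cluster :: "percolation_model \<Rightarrow> config \<Rightarrow> bool" where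
  "has_infinite_cluster M \<omega> \<longleftrightarrow> (\<exists>v\<in>sites M. infinite (cluster M \<omega> v))"

definition is_threshold :: "percolation_model \<Rightarrow> real \<Rightarrow> bool" where
  "is_threshold M pc \<longleftrightarrow> 0 < pc \<and> pc < 1 \<and>
     (\<forall>p. 0 \<le> p \<and> p \<le> 1 \<longrightarrow>
        (0 < hom_prob M p (\<lambda>\<omega>. infinite (cluster M \<omega> (origin M))) \<longleftrightarrow> pc < p))"


section \<open>Crossings, finite-size correlation length, RSW bounds\<close>

text \<open>The path \<open>xs\<close> crosses the parallelogram \<open>a \<le> f \<le> b\<close>, \<open>c \<le> g \<le> d\<close> in the \<open>f\<close>-direction:
  it stays in the strip \<open>c \<le> g \<le> d\<close>, its end points lie on or beyond the two opposite sides and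
  all its other points lie between these.\<close>

definition crosses ::
  "(complex \<Rightarrow> real) \<Rightarrow> real \<Rightarrow> real \<Rightarrow> (complex \<Rightarrow> real) \<Rightarrow> real \<Rightarrow> real \<Rightarrow> complex list \<Rightarrow> bool" where
  "crosses f a b g c d xs \<longleftrightarrow>
     f (hd xs) \<le> a \<and> b \<le> f (last xs) \<and> (\<forall>v\<in>set xs. c \<le> g v \<and> g v \<le> d) \<and>
     (\<forall>v\<in>set (butlast (tl xs)). a < f v \<and> f v < b)"

text \<open>Crossings of the parallelogram with lower left corner \<open>(s, t)\<close>, width \<open>w\<close> and height \<open>h\<close>
  in the oblique coordinates; \<open>conn\<close> is \<open>occupied_path M\<close> or \<open>dual_path M\<close>.\<close>

definition crossing1 :: "percolation_model \<Rightarrow> (config \<Rightarrow> complex list \<Rightarrow> bool) \<Rightarrow>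
    real \<Rightarrow> real \<Rightarrow> real \<Rightarrow> real \<Rightarrow> config \<Rightarrow> bool" where
  "crossing1 M conn s t w h \<omega> \<longleftrightarrow>
     (\<exists>xs. conn \<omega> xs \<and>
        crosses (coord1 (rot_angle M)) s (s + w) (coord2 (rot_angle M)) t (t + h) xs)"

definition crossing2 :: "percolation_model \<Rightarrow> (config \<Rightarrow> complex list \<Rightarrow> bool) \<Rightarrow>
    real \<Rightarrow> real \<Rightarrow> real \<Rightarrow> real \<Rightarrow> config \<Rightarrow> bool" where
  "crossing2 M conn s t w h \<omega> \<longleftrightarrow>
     (\<exists>xs. conn \<omega> xs \<and>
        crosses (coord2 (rot_angle M)) t (t + h) (coord1 (rot_angle M)) s (s + w) xs)"

definition crossing_bounds ::
  "percolation_model \<Rightarrow> real \<Rightarrow> real \<Rightarrow> real \<Rightarrow> real \<Rightarrow> bool" where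
  "crossing_bounds M p w h \<epsilon> \<longleftrightarrow>
     (\<forall>conn\<in>{occupied_path M, dual_path M}. \<forall>s t.
        hom_prob M p (crossing1 M conn s t w h) \<in> {\<epsilon>..1 - \<epsilon>} \<and>
        hom_prob M p (crossing2 M conn s t w h) \<in> {\<epsilon>..1 - \<epsilon>})"

definition finite_size_length :: "percolation_model \<Rightarrow> real \<Rightarrow> real \<Rightarrow> nat" where
  "finite_size_length M \<eta> p =
     (LEAST n. 1 \<le> n \<and>
        1 - \<eta> < hom_prob M p (crossing1 M (occupied_path M) 0 0 (3 * real n) (real n)))"

text \<open>The bounds start at a scale \<open>n0\<close> because parallelograms smaller than the lattice spacing
  need not contain any site. The parameter \<open>\<rho>\<close> is the aspect ratio.\<close>

definition RSW_bounds :: "percolation_model \<Rightarrow> real \<Rightarrow> bool" where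
  "RSW_bounds M pc \<longleftrightarrow>
     (\<forall>\<rho>>0. \<exists>\<epsilon>>0. \<exists>n0::nat. \<forall>n\<ge>n0. crossing_bounds M pc (\<rho> * real n) (real n) \<epsilon>) \<and>
     (\<exists>c>0. \<forall>\<delta>. 0 < \<delta> \<and> \<delta> < 1 \<longrightarrow>
        (\<forall>\<rho>>0. \<exists>\<epsilon>>0. \<exists>n0::nat. \<forall>p n. pc < p \<and> p \<le> 1 \<and>
           n0 \<le> n \<and> n \<le> finite_size_length M (c * \<delta>) p \<longrightarrow>
             crossing_bounds M p (\<rho> * real n) (real n) \<epsilon>))"


section \<open>Correlation length\<close>

definition dual_connectivity :: "percolation_model \<Rightarrow> real \<Rightarrow> complex \<Rightarrow> real" where
  "dual_connectivity M p z =
     hom_prob M p (\<lambda>\<omega>. \<exists>xs. dual_path M \<omega> xs \<and> hd xs = dual_origin M \<and> last xs = z)"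

definition max_dual_connectivity :: "percolation_model \<Rightarrow> real \<Rightarrow> nat \<Rightarrow> real" where
  "max_dual_connectivity M p n =
     Max (dual_connectivity M p `
       {z \<in> dual_sites M. \<bar>oblique_norm (rot_angle M) z - real n\<bar> \<le> spacing M})"

definition is_corr_length :: "percolation_model \<Rightarrow> real \<Rightarrow> real \<Rightarrow> bool" where
  "is_corr_length M p x \<longleftrightarrow> 0 < x \<and>
     (\<lambda>n. max_dual_connectivity M p n powr (1 / real n)) \<longlonglongrightarrow> exp (- 1 / x)"

definition corr_length :: "percolation_model \<Rightarrow> real \<Rightarrow> real" where
  "corr_length M p = (if p = 1 then 0 else (THE x. is_corr_length M p x))"

text \<open>The standing properties of the correlation length, which make \<open>alpha\<close> below a genuine
  inverse function.\<close>

definition corr_length_regular :: "percolation_model \<Rightarrow> real \<Rightarrow> bool" where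
  "corr_length_regular M pc \<longleftrightarrow>
     (\<forall>p. pc < p \<and> p < 1 \<longrightarrow> (\<exists>x. is_corr_length M p x)) \<and>
     continuous_on {pc<..1} (corr_length M) \<and>
     (\<forall>p q. pc < p \<and> p < q \<and> q \<le> 1 \<longrightarrow> corr_length M q < corr_length M p) \<and>
     filterlim (corr_length M) at_top (at_right pc)"

definition alpha :: "percolation_model \<Rightarrow> real \<Rightarrow> real \<Rightarrow> real" where
  "alpha M pc = the_inv_into {0<..1 - pc} (\<lambda>s. corr_length M (pc + s))"

definition kesten_percolation :: "percolation_model \<Rightarrow> real \<Rightarrow> bool" where
  "kesten_percolation M pc \<longleftrightarrow>
     planar_lattice M \<and> is_threshold M pc \<and> RSW_bounds M pc \<and> corr_length_regular M pc"


section \<open>The inhomogeneous model\<close>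

text \<open>The condition \<open>exp 1 < r\<close> says that \<open>r\<close>, \<open>ln r\<close> and \<open>ln (ln r)\<close> are all positive.\<close>

definition inhom_density :: "percolation_model \<Rightarrow> real \<Rightarrow> real \<Rightarrow> complex \<Rightarrow> real" where
  "inhom_density M pc \<kappa> z =
     (let r = oblique_norm (rot_angle M) z in
      if exp 1 < r then pc + alpha M pc (r / (\<kappa> * ln (ln r))) else 1)"

definition inhom_measure :: "percolation_model \<Rightarrow> real \<Rightarrow> real \<Rightarrow> config measure" where
  "inhom_measure M pc \<kappa> = perc_measure M (inhom_density M pc \<kappa>)"

end

theory Submission
  imports Defs "HOL-Real_Asymp.Real_Asymp"
begin

text \<open>At distance \<open>r\<close> from the origin the model looks like homogeneous percolation with correlation
  length \<open>r / (\<kappa> ln ln r)\<close>, so a crossing on the scale \<open>r\<close> fails with probability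
  \<open>exp (- const * \<kappa> ln ln r) = (ln r) powr (- const * \<kappa>)\<close>. At \<open>r = 2 ^ k\<close> this is \<open>k\<close> to the power
  \<open>- const * \<kappa>\<close>.

  For large \<open>\<kappa>\<close> it is summable, so by Borel--Cantelli all but finitely many of the crossings of a chain
  of overlapping parallelograms of sizes \<open>2 ^ k\<close> occur, and together they form an infinite cluster. The
  failure probability is bounded by squaring: a dual crossing of a parallelogram of doubled thickness
  contains two independent ones, so once dual crossings are rare on one scale their probability decays
  exponentially in the ratio of the scales. That scale is at most a constant times the correlation length,
  because below it the RSW bounds and the Harris inequality produce long dual paths.

  For small \<open>\<kappa>\<close> the probability that no occupied path crosses a thin annulus of radius \<open>8 ^ k\<close> is, by
  the RSW bounds and the Harris inequality, at least of order \<open>1 / k\<close>. As this is not summable and the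
  annuli are disjoint, almost surely infinitely many of them block.

  The density increases with \<open>\<kappa>\<close>, so monotonicity and the zero-one law yield a single threshold.\<close>

text \<open>The hypotheses speak of two lengths: the RSW bounds hold up to the finite-size length
  L(p), while the density is prescribed through the correlation length \<xi>(p). So L and \<xi> have
  to be compared near the threshold in both directions. From \<open>corr_length_le\<close> comes
  \<xi> \<le> 4 L, which makes RSW available on the scale \<xi> / 8 for the blocking annuli; from
  \<open>corr_length_ge\<close> comes L \<le> C \<xi>, which makes dual crossings rare on the scale
  C \<xi> for the infinite cluster. That the minimum defining L is attained rests on the exponential
  decay of dual crossings (\<open>ocross_likely\<close>). The obstacle is planar duality for an
  arbitrary periodic planar graph, with random bonds or random sites. An occupied crossing excludes
  a dual crossing in the other direction (\<open>occupied_blocks_dual\<close>), and its absence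
  forces one (\<open>dual_crossing_exists\<close>), but only up to margins of a few times
  \<open>mesh\<close>, a bound for the lengths of steps and the widths of faces. These margins are
  the origin of the additive constants in the estimates.\<close>

section \<open>Finite product Bernoulli measures\<close>

text \<open>The expectation of \<open>f\<close> of the random set of occupied elements. As a finite
  sum it needs no measurability, and the inequalities below become inductions on
  \<open>E\<close>.\<close>

definition bern_sum :: "'b set \<Rightarrow> ('b \<Rightarrow> real) \<Rightarrow> ('b set \<Rightarrow> real) \<Rightarrow> real" where
  "bern_sum E q f = (\<Sum>S\<in>Pow E. (\<Prod>b\<in>S. q b) * (\<Prod>b\<in>E - S. 1 - q b) * f S)"

lemma bern_sum_empty [simp]: "bern_sum {} q f = f {}"
  by (simp add: bern_sum_def)

text \<open>Conditioning on the state of \<open>b\<close>: the induction step for monotonicity, for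
  the Harris inequality and for independence.\<close>

lemma bern_sum_insert:
  assumes "finite E" "b \<notin> E"
  shows "bern_sum (insert b E) q f =
    q b * bern_sum E q (\<lambda>S. f (insert b S)) + (1 - q b) * bern_sum E q f"
proof -
  define w where "w E S = (\<Prod>b\<in>S. q b) * (\<Prod>b\<in>E - S. 1 - q b)" for E S
  have bw: "bern_sum E q f = (\<Sum>S\<in>Pow E. w E S * f S)" for E f
    by (simp add: bern_sum_def w_def)
  have inj: "inj_on (insert b) (Pow E)"
    using assms(2) by (auto simp: inj_on_def)
  have 1: "w (insert b E) S = (1 - q b) * w E S" if "S \<subseteq> E" for S
  proof -
    have "insert b E - S = insert b (E - S)" using that assms by auto
    then show ?thesis using assms that by (simp add: w_def)
  qed
  have 2: "w (insert b E) (insert b S) = q b * w E S" if "S \<subseteq> E" for S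
  proof -
    have "insert b E - insert b S = E - S" "b \<notin> S" "finite S"
      using that assms by (auto intro: finite_subset)
    then show ?thesis by (simp add: w_def)
  qed
  have "bern_sum (insert b E) q f = (\<Sum>S\<in>Pow E \<union> insert b ` Pow E. w (insert b E) S * f S)"
    by (simp add: bw Pow_insert)
  also have "\<dots> = (\<Sum>S\<in>Pow E. w (insert b E) S * f S) + (\<Sum>S\<in>insert b ` Pow E. w (insert b E) S * f S)"
    using assms by (intro sum.union_disjoint) auto
  also have "(\<Sum>S\<in>Pow E. w (insert b E) S * f S) = (1 - q b) * bern_sum E q f"
    unfolding bw sum_distrib_left by (rule sum.cong) (auto simp: 1)
  also have "(\<Sum>S\<in>insert b ` Pow E. w (insert b E) S * f S) = q b * bern_sum E q (\<lambda>S. f (insert b S))"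
    unfolding bw sum_distrib_left sum.reindex[OF inj]
    by (rule sum.cong) (auto simp: 2)
  finally show ?thesis by simp
qed

lemma bern_sum_mono:
  assumes "finite E" "\<And>b. b \<in> E \<Longrightarrow> 0 \<le> q b \<and> q b \<le> 1" "\<And>S. S \<subseteq> E \<Longrightarrow> f S \<le> g S"
  shows "bern_sum E q f \<le> bern_sum E q g"
  unfolding bern_sum_def using assms
  by (intro sum_mono mult_left_mono mult_nonneg_nonneg prod_nonneg) auto

lemma bern_sum_cong:
  assumes "\<And>S. S \<subseteq> E \<Longrightarrow> f S = g S" "\<And>b. b \<in> E \<Longrightarrow> q b = q' b"
  shows "bern_sum E q f = bern_sum E q' g"
  unfolding bern_sum_def using assms
  by (intro sum.cong arg_cong2[where f="(*)"] prod.cong) auto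

lemma bern_sum_cmult: "bern_sum E q (\<lambda>S. c * f S) = c * bern_sum E q f"
  by (simp add: bern_sum_def sum_distrib_left algebra_simps)

lemma mono_insert: "mono f \<Longrightarrow> mono (\<lambda>S. f (insert b S))"
  by (rule monoI, erule monoD) blast

text \<open>Raising the weight of \<open>b\<close> moves mass from configurations without
  \<open>b\<close> to the same ones with \<open>b\<close>, where a monotone \<open>f\<close> is no
  smaller; induction handles the remaining elements.\<close>

lemma bern_sum_mono_density:
  assumes "finite E" "\<And>b. b \<in> E \<Longrightarrow> 0 \<le> q b \<and> q b \<le> q' b \<and> q' b \<le> 1" "mono f"
  shows "bern_sum E q f \<le> bern_sum E q' f"
  using assms
proof (induction E arbitrary: f rule: finite_induct)
  case empty
  then show ?case by simp
next
  case (insert b E)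
  have m1: "mono (\<lambda>S. f (insert b S))"
    using insert.prems(2) by (rule mono_insert)
  have q: "0 \<le> q b" "q b \<le> q' b" "q' b \<le> 1" using insert.prems(1)[of b] by auto
  let ?x = "bern_sum E q (\<lambda>S. f (insert b S))" and ?y = "bern_sum E q f"
  let ?x' = "bern_sum E q' (\<lambda>S. f (insert b S))" and ?y' = "bern_sum E q' f"
  have "?y \<le> ?x"
    using insert.prems(1) insert.hyps(1)
    by (intro bern_sum_mono monoD[OF insert.prems(2)] subset_insertI) (blast intro: order_trans)+
  have "?x \<le> ?x'" "?y \<le> ?y'" using insert.IH insert.prems m1 by auto
  have "q b * ?x + (1 - q b) * ?y = ?y + q b * (?x - ?y)" by (simp add: algebra_simps)
  also have "\<dots> \<le> ?y + q' b * (?x - ?y)"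
    using q \<open>?y \<le> ?x\<close> by (intro add_left_mono mult_right_mono) auto
  also have "\<dots> = q' b * ?x + (1 - q' b) * ?y" by (simp add: algebra_simps)
  also have "\<dots> \<le> q' b * ?x' + (1 - q' b) * ?y'"
    using q \<open>?x \<le> ?x'\<close> \<open>?y \<le> ?y'\<close> by (intro add_mono mult_left_mono) auto
  finally show ?case using insert.hyps by (simp add: bern_sum_insert)
qed

text \<open>The difference of the two sides is a covariance on two points,
  \<open>q * (1 - q) * ((a - b) * (c - d))\<close>.\<close>

lemma two_point_chebyshev:
  fixes q :: real
  assumes "0 \<le> q" "q \<le> 1" "0 \<le> (a - b) * (c - d)"
  shows "(q * a + (1 - q) * b) * (q * c + (1 - q) * d) \<le> q * (a * c) + (1 - q) * (b * d)"
proof -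
  have "q * (a * c) + (1 - q) * (b * d) - (q * a + (1 - q) * b) * (q * c + (1 - q) * d)
    = q * (1 - q) * ((a - b) * (c - d))"
    by (simp add: algebra_simps)
  moreover have "0 \<le> q * (1 - q)" using assms by simp
  note mult_nonneg_nonneg[OF this assms(3)]
  ultimately show ?thesis by linarith
qed

text \<open>Given the state of \<open>b\<close>, induction bounds the conditional expectation of the
  product from below. The conditional expectations of \<open>f\<close> and \<open>g\<close> are
  monotone in that state, so the two-point inequality combines them.\<close>

lemma bern_sum_harris:
  assumes "finite E" "\<And>b. b \<in> E \<Longrightarrow> 0 \<le> q b \<and> q b \<le> 1" "mono f" "mono g"
  shows "bern_sum E q f * bern_sum E q g \<le> bern_sum E q (\<lambda>S. f S * g S)"
  using assms
proof (induction E arbitrary: f g rule: finite_induct)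
  case empty
  then show ?case by simp
next
  case (insert b E)
  have q: "0 \<le> q b" "q b \<le> 1" using insert.prems(1)[of b] by auto
  have m: "mono (\<lambda>S. f (insert b S))" "mono (\<lambda>S. g (insert b S))"
    by (rule mono_insert, fact)+
  let ?f1 = "bern_sum E q (\<lambda>S. f (insert b S))" and ?f0 = "bern_sum E q f"
  let ?g1 = "bern_sum E q (\<lambda>S. g (insert b S))" and ?g0 = "bern_sum E q g"
  have "?f0 \<le> ?f1" "?g0 \<le> ?g1"
    using insert.prems(1) insert.hyps(1)
    by (intro bern_sum_mono monoD[OF insert.prems(2)] monoD[OF insert.prems(3)] subset_insertI; blast)+
  then have "0 \<le> (?f1 - ?f0) * (?g1 - ?g0)" by (intro mult_nonneg_nonneg) linarith+
  then have "(q b * ?f1 + (1 - q b) * ?f0) * (q b * ?g1 + (1 - q b) * ?g0)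
      \<le> q b * (?f1 * ?g1) + (1 - q b) * (?f0 * ?g0)"
    by (rule two_point_chebyshev[OF q])
  also have "\<dots> \<le> q b * bern_sum E q (\<lambda>S. f (insert b S) * g (insert b S))
      + (1 - q b) * bern_sum E q (\<lambda>S. f S * g S)"
    using q insert.IH insert.prems m by (intro add_mono mult_left_mono) auto
  finally show ?case using insert.hyps by (simp add: bern_sum_insert)
qed

lemma bern_sum_indep:
  assumes "finite E" "finite F" "E \<inter> F = {}" "\<And>S. f S = f (S \<inter> E)" "\<And>S. g S = g (S \<inter> F)"
  shows "bern_sum (E \<union> F) q (\<lambda>S. f S * g S) = bern_sum E q f * bern_sum F q g"
  using assms
proof (induction E arbitrary: f rule: finite_induct)
  case empty
  have "f S = f {}" for S using empty(3)[of S] by simp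
  then have "bern_sum F q (\<lambda>S. f S * g S) = bern_sum F q (\<lambda>S. f {} * g S)" by metis
  then show ?case by (simp add: bern_sum_cmult)
next
  case (insert b E)
  have g: "g (insert b S) = g S" for S
  proof -
    have "insert b S \<inter> F = S \<inter> F" using insert.prems by auto
    then show ?thesis by (metis insert.prems(4))
  qed
  \<comment> \<open>\<open>f\<close> may still look at \<open>b\<close>, which is outside of the
    smaller set, so the induction hypothesis is applied to \<open>?f0\<close>; the two agree on
    subsets of \<open>E \<union> F\<close>.\<close>
  let ?f0 = "\<lambda>S. f (S \<inter> E)"
  have 0: "bern_sum (E \<union> F) q (\<lambda>S. f S * g S) = bern_sum (E \<union> F) q (\<lambda>S. ?f0 S * g S)"
  proof (rule bern_sum_cong)
    fix S assume "S \<subseteq> E \<union> F"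
    then have "S \<inter> insert b E = S \<inter> E" using insert by auto
    then show "f S * g S = ?f0 S * g S" using insert.prems(3)[of S] by simp
  qed auto
  have 1: "f (insert b S) = f (insert b (S \<inter> E))" for S
  proof -
    have "insert b S \<inter> insert b E = insert b (S \<inter> E) \<inter> insert b E" by auto
    then show ?thesis by (metis insert.prems(3))
  qed
  have 2: "bern_sum E q ?f0 = bern_sum E q f"
    by (rule bern_sum_cong) (auto simp: Int_absorb2)
  have *: "b \<notin> E \<union> F" "finite (E \<union> F)" using insert by auto
  have "bern_sum (insert b E \<union> F) q (\<lambda>S. f S * g S) =
    q b * bern_sum (E \<union> F) q (\<lambda>S. f (insert b S) * g S) + (1 - q b) * bern_sum (E \<union> F) q (\<lambda>S. ?f0 S * g S)"
    using bern_sum_insert[OF *(2,1), of q "\<lambda>S. f S * g S"] by (simp add: g 0)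
  also have "bern_sum (E \<union> F) q (\<lambda>S. f (insert b S) * g S) = bern_sum E q (\<lambda>S. f (insert b S)) * bern_sum F q g"
    using insert.prems 1 by (intro insert.IH) auto
  also have "bern_sum (E \<union> F) q (\<lambda>S. ?f0 S * g S) = bern_sum E q ?f0 * bern_sum F q g"
    using insert.prems by (intro insert.IH) auto
  finally show ?case using insert.hyps 2 by (simp add: bern_sum_insert algebra_simps)
qed

lemma bern_sum_reindex:
  assumes "inj_on h E"
  shows "bern_sum (h ` E) q f = bern_sum E (q \<circ> h) (\<lambda>S. f (h ` S))"
proof -
  have inj: "inj_on (image h) (Pow E)"
    using assms by (simp add: inj_on_image_Pow)
  show ?thesis
    unfolding bern_sum_def image_Pow_surj[OF refl, symmetric] sum.reindex[OF inj]
  proof (rule sum.cong[OF refl])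
    fix S assume S: "S \<in> Pow E"
    have "h ` E - h ` S = h ` (E - S)" using assms S by (auto simp: inj_on_def)
    moreover have "inj_on h S" "inj_on h (E - S)" using assms S by (auto intro: inj_on_subset)
    ultimately show "((\<lambda>S. (\<Prod>b\<in>S. q b) * (\<Prod>b\<in>h ` E - S. 1 - q b) * f S) \<circ> image h) S =
      (\<Prod>b\<in>S. (q \<circ> h) b) * (\<Prod>b\<in>E - S. 1 - (q \<circ> h) b) * f (h ` S)"
      by (simp add: prod.reindex)
  qed
qed

lemma continuous_on_bern_sum: "continuous_on UNIV (\<lambda>p. bern_sum E (\<lambda>_. p) f)"
  unfolding bern_sum_def by (intro continuous_intros)

section \<open>Events depending on finitely many elements\<close>

text \<open>Configurations range over all functions, not only over the extensional ones in the space
  of the measure, so that an event may be evaluated at an indicator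
  \<open>\<lambda>b. b \<in> S\<close>.\<close>

definition depends_on :: "(('b \<Rightarrow> bool) \<Rightarrow> bool) \<Rightarrow> 'b set \<Rightarrow> bool" where
  "depends_on A E \<longleftrightarrow> (\<forall>\<omega> \<omega>'. (\<forall>b\<in>E. \<omega> b = \<omega>' b) \<longrightarrow> A \<omega> = A \<omega>')"

definition up_event :: "(('b \<Rightarrow> bool) \<Rightarrow> bool) \<Rightarrow> bool" where
  "up_event A \<longleftrightarrow> (\<forall>\<omega> \<omega>'. (\<forall>b. \<omega> b \<longrightarrow> \<omega>' b) \<longrightarrow> A \<omega> \<longrightarrow> A \<omega>')"

definition perc_prob :: "percolation_model \<Rightarrow> (complex \<Rightarrow> real) \<Rightarrow> (config \<Rightarrow> bool) \<Rightarrow> real" where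
  "perc_prob M q A = measure (perc_measure M q) {\<omega> \<in> space (perc_measure M q). A \<omega>}"

lemma hom_prob_eq: "hom_prob M p A = perc_prob M (\<lambda>_. p) A"
  by (simp add: hom_prob_def perc_prob_def)

lemma depends_on_mono: "depends_on A E \<Longrightarrow> E \<subseteq> F \<Longrightarrow> depends_on A F"
  unfolding depends_on_def by blast

lemma depends_on_not: "depends_on A E \<Longrightarrow> depends_on (\<lambda>\<omega>. \<not> A \<omega>) E"
  unfolding depends_on_def by blast

lemma depends_on_conj:
  "depends_on A E \<Longrightarrow> depends_on B F \<Longrightarrow> depends_on (\<lambda>\<omega>. A \<omega> \<and> B \<omega>) (E \<union> F)"
  unfolding depends_on_def by (metis UnCI)

lemma depends_on_ball:
  "(\<And>i. i \<in> I \<Longrightarrow> depends_on (A i) (E i)) \<Longrightarrow> depends_on (\<lambda>\<omega>. \<forall>i\<in>I. A i \<omega>) (\<Union>i\<in>I. E i)"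
  unfolding depends_on_def by (metis UN_iff)

lemma depends_on_bex:
  "(\<And>i. i \<in> I \<Longrightarrow> depends_on (A i) (E i)) \<Longrightarrow> depends_on (\<lambda>\<omega>. \<exists>i\<in>I. A i \<omega>) (\<Union>i\<in>I. E i)"
  unfolding depends_on_def by (metis UN_iff)

lemma up_event_mono: "up_event A \<Longrightarrow> mono (\<lambda>S. of_bool (A (\<lambda>b. b \<in> S)) :: real)"
  unfolding up_event_def mono_def by (metis in_mono of_bool_eq(1,2) of_bool_less_eq_iff)

lemma depends_on_Int: "depends_on A E \<Longrightarrow> A (\<lambda>b. b \<in> S) = A (\<lambda>b. b \<in> S \<inter> E)"
  unfolding depends_on_def by (metis IntE IntI)

locale bernoulli_field =
  fixes M :: percolation_model and q :: "complex \<Rightarrow> real"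
  assumes q01: "0 \<le> q z" "q z \<le> 1"
begin

abbreviation "\<mu> \<equiv> perc_measure M q"
abbreviation "P \<equiv> perc_prob M q"

sublocale B: product_prob_space "\<lambda>b. measure_pmf (bernoulli_pmf (q (location b)))" "elements M"
  by standard

lemma prob_space_perc: "prob_space \<mu>"
  unfolding perc_measure_def by (rule B.P.prob_space_axioms)

sublocale prob_space \<mu>
  by (rule prob_space_perc)

lemma space_perc: "space \<mu> = PiE (elements M) (\<lambda>_. UNIV)"
  by (simp add: perc_measure_def space_PiM)

definition cyl :: "complex set set \<Rightarrow> complex set set \<Rightarrow> config set" where
  "cyl E S = {\<omega> \<in> space \<mu>. \<forall>b\<in>E. \<omega> b = (b \<in> S)}"

lemma cyl_emb:
  assumes "E \<subseteq> elements M"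
  shows "cyl E S = prod_emb (elements M) (\<lambda>b. measure_pmf (bernoulli_pmf (q (location b)))) E
     (Pi\<^sub>E E (\<lambda>b. {b \<in> S}))"
  using assms unfolding cyl_def space_perc prod_emb_def
  by (auto simp: PiE_def Pi_def extensional_def restrict_def)

lemma cyl_sets: "finite E \<Longrightarrow> E \<subseteq> elements M \<Longrightarrow> cyl E S \<in> sets \<mu>"
  unfolding cyl_emb perc_measure_def by (rule sets_PiM_I) auto

lemma prob_cyl:
  assumes "finite E" "E \<subseteq> elements M" "S \<subseteq> E"
  shows "prob (cyl E S) = (\<Prod>b\<in>S. q (location b)) * (\<Prod>b\<in>E - S. 1 - q (location b))"
proof -
  have "prob (cyl E S) = (\<Prod>b\<in>E. measure (measure_pmf (bernoulli_pmf (q (location b)))) {b \<in> S})"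
    unfolding cyl_emb[OF assms(2)] unfolding perc_measure_def
    by (rule B.measure_PiM_emb) (use assms in auto)
  also have "\<dots> = (\<Prod>b\<in>E. if b \<in> S then q (location b) else 1 - q (location b))"
    by (rule prod.cong) (auto simp: measure_pmf_single q01)
  also have "\<dots> = (\<Prod>b\<in>S \<union> (E - S). if b \<in> S then q (location b) else 1 - q (location b))"
    by (rule prod.cong) (use assms in auto)
  also have "(\<Prod>b\<in>S \<union> (E - S). if b \<in> S then q (location b) else 1 - q (location b)) =
    (\<Prod>b\<in>S. if b \<in> S then q (location b) else 1 - q (location b)) *
    (\<Prod>b\<in>E - S. if b \<in> S then q (location b) else 1 - q (location b))"
    by (rule prod.union_disjoint) (use assms in \<open>auto intro: finite_subset\<close>)
  finally show ?thesis by simp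
qed

lemma event_decomp:
  assumes "depends_on A E"
  shows "{\<omega> \<in> space \<mu>. A \<omega>} = (\<Union>S\<in>{S \<in> Pow E. A (\<lambda>b. b \<in> S)}. cyl E S)" (is "?L = ?R")
proof
  show "?L \<subseteq> ?R"
  proof
    fix \<omega> assume w: "\<omega> \<in> ?L"
    let ?S = "{b \<in> E. \<omega> b}"
    have "A (\<lambda>b. b \<in> ?S) = A \<omega>"
      using assms unfolding depends_on_def by (metis (mono_tags, lifting) mem_Collect_eq)
    then show "\<omega> \<in> ?R" using w by (intro UN_I[of ?S]) (auto simp: cyl_def)
  qed
  show "?R \<subseteq> ?L"
  proof
    fix \<omega> assume "\<omega> \<in> ?R"
    then obtain S where S: "S \<subseteq> E" "A (\<lambda>b. b \<in> S)" "\<omega> \<in> space \<mu>" "\<forall>b\<in>E. \<omega> b = (b \<in> S)"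
      by (auto simp: cyl_def)
    then have "A \<omega>" using assms unfolding depends_on_def by metis
    then show "\<omega> \<in> ?L" using S by auto
  qed
qed

lemma event_sets [measurable]:
  assumes "depends_on A E" "finite E" "E \<subseteq> elements M"
  shows "{\<omega> \<in> space \<mu>. A \<omega>} \<in> sets \<mu>"
  unfolding event_decomp[OF assms(1)] using assms by (intro sets.finite_UN cyl_sets) auto

text \<open>The bridge from the infinite product measure to finite sums: the event is a disjoint
  union of cylinders, one for each admissible set of occupied elements of \<open>E\<close>.\<close>

lemma P_bern_sum:
  assumes "depends_on A E" "finite E" "E \<subseteq> elements M"
  shows "P A = bern_sum E (q \<circ> location) (\<lambda>S. of_bool (A (\<lambda>b. b \<in> S)))"
proof -
  let ?T = "{S \<in> Pow E. A (\<lambda>b. b \<in> S)}"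
  have "P A = prob (\<Union>S\<in>?T. cyl E S)"
    unfolding perc_prob_def event_decomp[OF assms(1)] ..
  also have "\<dots> = (\<Sum>S\<in>?T. prob (cyl E S))"
  proof (rule finite_measure_finite_Union)
    show "disjoint_family_on (cyl E) ?T"
      unfolding disjoint_family_on_def cyl_def by blast
  qed (use assms cyl_sets in auto)
  also have "\<dots> = (\<Sum>S\<in>?T. (\<Prod>b\<in>S. q (location b)) * (\<Prod>b\<in>E - S. 1 - q (location b)))"
    by (rule sum.cong) (use assms prob_cyl in auto)
  also have "\<dots> = (\<Sum>S\<in>Pow E. if A (\<lambda>b. b \<in> S) then (\<Prod>b\<in>S. q (location b)) * (\<Prod>b\<in>E - S. 1 - q (location b)) else 0)"
    by (rule sum.inter_filter) (use assms in auto)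
  finally show ?thesis unfolding bern_sum_def 
    by (auto intro!: sum.cong simp: of_bool_def)
qed

lemma P_le_1: "P A \<le> 1" and P_nonneg: "0 \<le> P A"
  by (simp_all add: perc_prob_def)

lemma P_mono_event:
  assumes "depends_on B E" "finite E" "E \<subseteq> elements M" "\<And>\<omega>. A \<omega> \<Longrightarrow> B \<omega>"
  shows "P A \<le> P B"
  unfolding perc_prob_def using event_sets[OF assms(1-3)] assms(4)
  by (intro finite_measure_mono) auto

lemma P_not:
  assumes "depends_on A E" "finite E" "E \<subseteq> elements M"
  shows "P (\<lambda>\<omega>. \<not> A \<omega>) = 1 - P A"
proof -
  have "{\<omega> \<in> space \<mu>. \<not> A \<omega>} = space \<mu> - {\<omega> \<in> space \<mu>. A \<omega>}" by auto
  then show ?thesis unfolding perc_prob_def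
    using prob_compl[OF event_sets[OF assms]] by simp
qed

lemma P_bex_le:
  assumes "finite I" "\<And>i. i \<in> I \<Longrightarrow> depends_on (A i) (E i)"
    "\<And>i. i \<in> I \<Longrightarrow> finite (E i)" "\<And>i. i \<in> I \<Longrightarrow> E i \<subseteq> elements M"
  shows "P (\<lambda>\<omega>. \<exists>i\<in>I. A i \<omega>) \<le> (\<Sum>i\<in>I. P (A i))"
proof -
  have "{\<omega> \<in> space \<mu>. \<exists>i\<in>I. A i \<omega>} = (\<Union>i\<in>I. {\<omega> \<in> space \<mu>. A i \<omega>})" by auto
  then show ?thesis unfolding perc_prob_def
    using assms event_sets by (auto intro!: finite_measure_subadditive_finite)
qed

lemma P_indep:
  assumes "depends_on A E" "finite E" "E \<subseteq> elements M"
    "depends_on B F" "finite F" "F \<subseteq> elements M" "E \<inter> F = {}"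
  shows "P (\<lambda>\<omega>. A \<omega> \<and> B \<omega>) = P A * P B"
proof -
  let ?f = "\<lambda>S. of_bool (A (\<lambda>b. b \<in> S)) :: real" and ?g = "\<lambda>S. of_bool (B (\<lambda>b. b \<in> S)) :: real"
  have "P (\<lambda>\<omega>. A \<omega> \<and> B \<omega>) = bern_sum (E \<union> F) (q \<circ> location) (\<lambda>S. ?f S * ?g S)"
    using P_bern_sum[OF depends_on_conj[OF assms(1,4)]] assms by (simp add: of_bool_conj)
  also have "\<dots> = bern_sum E (q \<circ> location) ?f * bern_sum F (q \<circ> location) ?g"
    by (rule bern_sum_indep)
      (use assms depends_on_Int[OF assms(1)] depends_on_Int[OF assms(4)] in \<open>auto simp: \<close>)
  finally show ?thesis using P_bern_sum assms by simp
qed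

lemma P_harris:
  assumes "depends_on A E" "finite E" "E \<subseteq> elements M" "up_event A"
    "depends_on B F" "finite F" "F \<subseteq> elements M" "up_event B"
  shows "P A * P B \<le> P (\<lambda>\<omega>. A \<omega> \<and> B \<omega>)"
proof -
  let ?f = "\<lambda>S. of_bool (A (\<lambda>b. b \<in> S)) :: real" and ?g = "\<lambda>S. of_bool (B (\<lambda>b. b \<in> S)) :: real"
  have d: "depends_on A (E \<union> F)" "depends_on B (E \<union> F)"
    using assms depends_on_mono by blast+
  have "P (\<lambda>\<omega>. A \<omega> \<and> B \<omega>) = bern_sum (E \<union> F) (q \<circ> location) (\<lambda>S. ?f S * ?g S)"
    using P_bern_sum[OF depends_on_conj[OF assms(1,5)]] assms by (simp add: of_bool_conj)
  also have "\<dots> \<ge> bern_sum (E \<union> F) (q \<circ> location) ?f * bern_sum (E \<union> F) (q \<circ> location) ?g"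
    by (rule bern_sum_harris) (use assms q01 up_event_mono in auto)
  finally show ?thesis using P_bern_sum[OF d(1)] P_bern_sum[OF d(2)] assms by (simp add: comp_def)
qed

text \<open>By inclusion-exclusion two complements have the same covariance as the events
  themselves. Occupied crossings are increasing, so this is the form for their absence.\<close>

lemma P_harris_not:
  assumes "depends_on A E" "finite E" "E \<subseteq> elements M" "up_event A"
    "depends_on B F" "finite F" "F \<subseteq> elements M" "up_event B"
  shows "P (\<lambda>\<omega>. \<not> A \<omega>) * P (\<lambda>\<omega>. \<not> B \<omega>) \<le> P (\<lambda>\<omega>. \<not> A \<omega> \<and> \<not> B \<omega>)"
proof -
  have sA: "{\<omega> \<in> space \<mu>. A \<omega>} \<in> sets \<mu>" and sB: "{\<omega> \<in> space \<mu>. B \<omega>} \<in> sets \<mu>"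
    using event_sets assms by auto
  have "prob ({\<omega> \<in> space \<mu>. A \<omega>} \<union> {\<omega> \<in> space \<mu>. B \<omega>}) = 
    P A + P B - prob ({\<omega> \<in> space \<mu>. A \<omega>} \<inter> {\<omega> \<in> space \<mu>. B \<omega>})"
    unfolding perc_prob_def using sA sB by (simp add: measure_Un3 fmeasurable_eq_sets)
  moreover have "{\<omega> \<in> space \<mu>. A \<omega>} \<inter> {\<omega> \<in> space \<mu>. B \<omega>} = {\<omega> \<in> space \<mu>. A \<omega> \<and> B \<omega>}"
    by auto
  moreover have "{\<omega> \<in> space \<mu>. \<not> A \<omega> \<and> \<not> B \<omega>} = space \<mu> - ({\<omega> \<in> space \<mu>. A \<omega>} \<union> {\<omega> \<in> space \<mu>. B \<omega>})"
    by auto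
  ultimately have "P (\<lambda>\<omega>. \<not> A \<omega> \<and> \<not> B \<omega>) = 1 - (P A + P B - P (\<lambda>\<omega>. A \<omega> \<and> B \<omega>))"
    unfolding perc_prob_def using prob_compl[of "{\<omega> \<in> space \<mu>. A \<omega>} \<union> {\<omega> \<in> space \<mu>. B \<omega>}"] sA sB by simp
  then show ?thesis
    using P_harris[OF assms] unfolding P_not[OF assms(1-3)] P_not[OF assms(5-7)] by (simp add: algebra_simps)
qed

lemma P_harris_ball:
  assumes "finite I" "\<And>i. i \<in> I \<Longrightarrow> depends_on (A i) (E i)" "\<And>i. i \<in> I \<Longrightarrow> finite (E i)"
    "\<And>i. i \<in> I \<Longrightarrow> E i \<subseteq> elements M" "\<And>i. i \<in> I \<Longrightarrow> up_event (A i)"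
  shows "(\<Prod>i\<in>I. P (\<lambda>\<omega>. \<not> A i \<omega>)) \<le> P (\<lambda>\<omega>. \<forall>i\<in>I. \<not> A i \<omega>)"
  using assms
proof (induction I rule: finite_induct)
  case empty
  have "{\<omega> \<in> space \<mu>. True} = space \<mu>" by auto
  then show ?case by (simp add: perc_prob_def prob_space)
next
  case (insert j I)
  have "(\<Prod>i\<in>insert j I. P (\<lambda>\<omega>. \<not> A i \<omega>)) = P (\<lambda>\<omega>. \<not> A j \<omega>) * (\<Prod>i\<in>I. P (\<lambda>\<omega>. \<not> A i \<omega>))"
    using insert by simp
  also have "\<dots> \<le> P (\<lambda>\<omega>. \<not> A j \<omega>) * P (\<lambda>\<omega>. \<not> (\<exists>i\<in>I. A i \<omega>))"
    using insert by (intro mult_left_mono P_nonneg) auto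
  also have "\<dots> \<le> P (\<lambda>\<omega>. \<not> A j \<omega> \<and> \<not> (\<exists>i\<in>I. A i \<omega>))"
  proof (rule P_harris_not)
    show "depends_on (\<lambda>\<omega>. \<exists>i\<in>I. A i \<omega>) (\<Union>i\<in>I. E i)"
      using insert by (intro depends_on_bex) auto
    show "up_event (\<lambda>\<omega>. \<exists>i\<in>I. A i \<omega>)"
      using insert.prems(4) unfolding up_event_def by blast
  qed (use insert in auto)
  finally show ?case by simp
qed

lemma P_indep_ball:
  assumes "finite I" "\<And>i. i \<in> I \<Longrightarrow> depends_on (A i) (E i)" "\<And>i. i \<in> I \<Longrightarrow> finite (E i)"
    "\<And>i. i \<in> I \<Longrightarrow> E i \<subseteq> elements M" "disjoint_family_on E I"
  shows "P (\<lambda>\<omega>. \<forall>i\<in>I. A i \<omega>) = (\<Prod>i\<in>I. P (A i))"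
  using assms
proof (induction I rule: finite_induct)
  case empty
  have "{\<omega> \<in> space \<mu>. True} = space \<mu>" by auto
  then show ?case by (simp add: perc_prob_def prob_space)
next
  case (insert j I)
  have "P (\<lambda>\<omega>. A j \<omega> \<and> (\<forall>i\<in>I. A i \<omega>)) = P (A j) * P (\<lambda>\<omega>. \<forall>i\<in>I. A i \<omega>)"
  proof (rule P_indep)
    show "depends_on (\<lambda>\<omega>. \<forall>i\<in>I. A i \<omega>) (\<Union>i\<in>I. E i)"
      using insert by (intro depends_on_ball) auto
    show "E j \<inter> (\<Union>i\<in>I. E i) = {}"
    proof -
      have "E j \<inter> E i = {}" if "i \<in> I" for i
        by (rule disjoint_family_onD[OF insert.prems(4)]) (use that insert.hyps in auto)
      then show ?thesis by blast
    qed
  qed (use insert in auto)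
  moreover have "P (\<lambda>\<omega>. \<forall>i\<in>I. A i \<omega>) = (\<Prod>i\<in>I. P (A i))"
    by (intro insert.IH insert.prems disjoint_family_on_mono[OF _ insert.prems(4)]) auto
  ultimately show ?case using insert.hyps by simp
qed

lemma P_vacant:
  assumes "finite E" "E \<subseteq> elements M"
  shows "P (\<lambda>\<omega>. \<forall>b\<in>E. \<not> \<omega> b) = (\<Prod>b\<in>E. 1 - q (location b))"
  using prob_cyl[OF assms, of "{}"] by (simp add: perc_prob_def cyl_def)

end

lemma perc_prob_mono_density:
  assumes "bernoulli_field q" "bernoulli_field q'"
    "depends_on A E" "finite E" "E \<subseteq> elements M" "up_event A"
    "\<And>b. b \<in> E \<Longrightarrow> q (location b) \<le> q' (location b)"
  shows "perc_prob M q A \<le> perc_prob M q' A"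
proof -
  interpret Q: bernoulli_field M q by fact
  interpret Q': bernoulli_field M q' by fact
  show ?thesis
    unfolding Q.P_bern_sum[OF assms(3-5)] Q'.P_bern_sum[OF assms(3-5)]
    using assms Q.q01 Q'.q01 by (intro bern_sum_mono_density up_event_mono) auto
qed

lemma bernoulli_field_const: "0 \<le> p \<Longrightarrow> p \<le> 1 \<Longrightarrow> bernoulli_field (\<lambda>_. p)"
  by standard auto

text \<open>Near \<open>p\<close> the probability is a polynomial. The end points 0 and 1 are
  excluded because a whole neighbourhood of \<open>p\<close> has to consist of
  probabilities.\<close>

lemma hom_prob_isCont:
  assumes "depends_on A E" "finite E" "E \<subseteq> elements M" "0 < p" "p < 1"
  shows "isCont (\<lambda>p. hom_prob M p A) p"
proof -
  let ?g = "\<lambda>p. bern_sum E (\<lambda>_. p) (\<lambda>S. of_bool (A (\<lambda>b. b \<in> S)))"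
  have "isCont ?g p"
    using continuous_on_bern_sum continuous_on_eq_continuous_at open_UNIV by blast
  moreover have "eventually (\<lambda>p. hom_prob M p A = ?g p) (nhds p)"
  proof -
    have "eventually (\<lambda>p. p \<in> {0<..<1}) (nhds p)"
      using assms by (intro eventually_nhds_in_open) auto
    then show ?thesis
    proof eventually_elim
      case (elim p)
      interpret bernoulli_field M "\<lambda>_. p" using elim by (intro bernoulli_field_const) auto
      show ?case using P_bern_sum[OF assms(1-3)] by (simp add: hom_prob_eq comp_def)
    qed
  qed
  ultimately show ?thesis by (simp add: isCont_cong)
qed

text \<open>A relabelling of the elements preserves a homogeneous measure; this is how lattice
  symmetries act on probabilities.\<close>

lemma hom_prob_reindex:
  assumes "depends_on A E" "finite E" "E \<subseteq> elements M" "inj h" "h ` E \<subseteq> elements M" "0 \<le> p" "p \<le> 1"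
    "\<And>\<omega>. B \<omega> = A (\<lambda>b. \<omega> (h b))"
  shows "hom_prob M p A = hom_prob M p B"
proof -
  interpret bernoulli_field M "\<lambda>_. p" using assms by (intro bernoulli_field_const)
  have dB: "depends_on B (h ` E)"
    using assms(1,8) unfolding depends_on_def by auto
  have "P B = bern_sum (h ` E) ((\<lambda>_. p) \<circ> location) (\<lambda>S. of_bool (A (\<lambda>b. h b \<in> S)))"
    using P_bern_sum[OF dB] assms by simp
  also have "\<dots> = bern_sum E ((\<lambda>_. p) \<circ> location) (\<lambda>S. of_bool (A (\<lambda>b. b \<in> S)))"
    using assms(4) by (subst bern_sum_reindex) (auto simp: inj_image_mem_iff inj_on_def comp_def intro!: bern_sum_cong)
  finally show ?thesis using P_bern_sum[OF assms(1-3)] by (simp add: hom_prob_eq)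
qed

section \<open>Paths in a restricted relation\<close>

text \<open>Paths as a closure relation: concatenation, reversal and enlarging \<open>S\<close> need
  no lists. The conjunct \<open>u \<in> S\<close> takes care of the path without steps.\<close>

definition linked :: "('v \<Rightarrow> 'v \<Rightarrow> bool) \<Rightarrow> 'v set \<Rightarrow> 'v \<Rightarrow> 'v \<Rightarrow> bool" where
  "linked R S u v \<longleftrightarrow> u \<in> S \<and> (\<lambda>x y. R x y \<and> x \<in> S \<and> y \<in> S)\<^sup>*\<^sup>* u v"

lemma linked_refl: "u \<in> S \<Longrightarrow> linked R S u u"
  by (simp add: linked_def)

lemma linked_in:
  assumes "linked R S u v"
  shows "u \<in> S" "v \<in> S"
proof -
  show "u \<in> S" using assms by (simp add: linked_def)
  have "(\<lambda>x y. R x y \<and> x \<in> S \<and> y \<in> S)\<^sup>*\<^sup>* u v" using assms by (simp add: linked_def)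
  then show "v \<in> S" by (cases rule: rtranclp.cases) (use \<open>u \<in> S\<close> in auto)
qed

lemma linked_trans: "linked R S u v \<Longrightarrow> linked R S v w \<Longrightarrow> linked R S u w"
  unfolding linked_def by (meson rtranclp_trans)

lemma linked_step: "R u v \<Longrightarrow> u \<in> S \<Longrightarrow> v \<in> S \<Longrightarrow> linked R S u v"
  unfolding linked_def by (simp add: r_into_rtranclp)

lemma linked_mono:
  assumes "linked R S u v" "S \<subseteq> T" "\<And>x y. x \<in> S \<Longrightarrow> y \<in> S \<Longrightarrow> R x y \<Longrightarrow> Q x y"
  shows "linked Q T u v"
proof -
  have "(\<lambda>x y. R x y \<and> x \<in> S \<and> y \<in> S) \<le> (\<lambda>x y. Q x y \<and> x \<in> T \<and> y \<in> T)"
    using assms by blast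
  then show ?thesis using assms(1,2) rtranclp_mono unfolding linked_def by blast
qed

lemma linked_sym:
  assumes "linked R S u v" "symp R"
  shows "linked R S v u"
proof -
  have "symp (\<lambda>x y. R x y \<and> x \<in> S \<and> y \<in> S)"
    using assms(2) by (auto simp: symp_def)
  then have "symp ((\<lambda>x y. R x y \<and> x \<in> S \<and> y \<in> S)\<^sup>*\<^sup>*)" by (rule symp_rtranclp)
  then show ?thesis using assms(1) linked_in[OF assms(1)] unfolding linked_def symp_def by blast
qed

lemma linked_induct [consumes 1, case_names base step]:
  assumes "linked R S u v" "u \<in> S \<Longrightarrow> P u"
    "\<And>x y. linked R S u x \<Longrightarrow> P x \<Longrightarrow> R x y \<Longrightarrow> x \<in> S \<Longrightarrow> y \<in> S \<Longrightarrow> P y"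
  shows "P v"
proof -
  have u: "u \<in> S" using assms(1) by (rule linked_in)
  have "(\<lambda>x y. R x y \<and> x \<in> S \<and> y \<in> S)\<^sup>*\<^sup>* u v" using assms(1) by (simp add: linked_def)
  then show ?thesis
    by (induction rule: rtranclp_induct) (use assms(2,3) u in \<open>auto simp: linked_def\<close>)
qed

lemma linked_image:
  assumes "linked R S u v" "\<And>x y. x \<in> S \<Longrightarrow> y \<in> S \<Longrightarrow> R x y \<Longrightarrow> Q (h x) (h y)" "h ` S \<subseteq> T"
  shows "linked Q T (h u) (h v)"
  using assms(1)
proof (induction rule: linked_induct)
  case base
  then show ?case using assms(3) by (intro linked_refl) auto
next
  case (step x y)
  then show ?case
    using assms(2,3) by (meson image_subset_iff linked_step linked_trans)
qed

lemma linked_set: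
  assumes "xs \<noteq> []" "successively R xs" "x \<in> set xs"
  shows "linked R (set xs) (hd xs) x"
  using assms
proof (induction xs rule: induct_list012)
  case (3 a b xs)
  show ?case
  proof (cases "x = a")
    case True
    then show ?thesis by (simp add: linked_refl)
  next
    case False
    then have "linked R (set (b # xs)) (hd (b # xs)) x" using 3 by (intro 3) auto
    then have "linked R (set (a # b # xs)) b x" by (auto elim!: linked_mono)
    moreover have "linked R (set (a # b # xs)) a b" using 3 by (intro linked_step) auto
    ultimately show ?thesis by (auto intro: linked_trans)
  qed
qed (auto simp: linked_refl)

lemma linked_iff_list:
  "linked R S u v \<longleftrightarrow> (\<exists>xs. xs \<noteq> [] \<and> hd xs = u \<and> last xs = v \<and> set xs \<subseteq> S \<and> successively R xs)"
proof
  assume "linked R S u v"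
  then show "\<exists>xs. xs \<noteq> [] \<and> hd xs = u \<and> last xs = v \<and> set xs \<subseteq> S \<and> successively R xs"
  proof (induction rule: linked_induct)
    case base
    then show ?case by (intro exI[of _ "[u]"]) auto
  next
    case (step x y)
    then obtain xs where "xs \<noteq> []" "hd xs = u" "last xs = x" "set xs \<subseteq> S" "successively R xs"
      by auto
    then show ?case using step
      by (intro exI[of _ "xs @ [y]"]) (auto simp: successively_append_iff)
  qed
next
  assume "\<exists>xs. xs \<noteq> [] \<and> hd xs = u \<and> last xs = v \<and> set xs \<subseteq> S \<and> successively R xs"
  then obtain xs where "xs \<noteq> []" "hd xs = u" "last xs = v" "set xs \<subseteq> S" "successively R xs"
    by auto
  then show "linked R S u v" using linked_set[of xs R "last xs"] by (auto elim!: linked_mono)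
qed

text \<open>In contrast to \<open>crosses\<close> there is no condition on inner points, which makes
  the notion monotone in \<open>R\<close>, in \<open>S\<close> and in all four bounds.
  \<open>cross_trim_list\<close> and \<open>crosses_imp_cross\<close> show that the existence of a
  crossing means the same for both.\<close>

definition cross :: "('v \<Rightarrow> 'v \<Rightarrow> bool) \<Rightarrow> 'v set \<Rightarrow> ('v \<Rightarrow> real) \<Rightarrow> ('v \<Rightarrow> real) \<Rightarrow>
    real \<Rightarrow> real \<Rightarrow> real \<Rightarrow> real \<Rightarrow> bool" where
  "cross R S f g a b c d \<longleftrightarrow>
     (\<exists>u v. linked R (S \<inter> {z. c \<le> g z \<and> g z \<le> d}) u v \<and> f u \<le> a \<and> b \<le> f v)"

lemma crossI: "linked R (S \<inter> {z. c \<le> g z \<and> g z \<le> d}) u v \<Longrightarrow> f u \<le> a \<Longrightarrow> b \<le> f v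
    \<Longrightarrow> cross R S f g a b c d"
  unfolding cross_def by blast

lemma cross_mono:
  assumes "cross R S f g a b c d" "S \<subseteq> T" "\<And>x y. x \<in> S \<Longrightarrow> y \<in> S \<Longrightarrow> R x y \<Longrightarrow> Q x y"
    "a \<le> a'" "b' \<le> b" "c' \<le> c" "d \<le> d'"
  shows "cross Q T f g a' b' c' d'"
proof -
  obtain u v where "linked R (S \<inter> {z. c \<le> g z \<and> g z \<le> d}) u v" "f u \<le> a" "b \<le> f v"
    using assms(1) unfolding cross_def by blast
  then have "linked Q (T \<inter> {z. c' \<le> g z \<and> g z \<le> d'}) u v" "f u \<le> a'" "b' \<le> f v"
    using assms by (auto elim!: linked_mono)
  then show ?thesis unfolding cross_def by blast
qed

text \<open>A shortest path among those from \<open>f \<le> a\<close> to \<open>b \<le> f\<close> has all its inner points strictly between.\<close>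

lemma cross_trim_list:
  assumes "cross R S f g a b c d"
  obtains xs where "xs \<noteq> []" "set xs \<subseteq> S" "successively R xs" "crosses f a b g c d xs"
proof -
  define Q where "Q xs \<longleftrightarrow> xs \<noteq> [] \<and> set xs \<subseteq> S \<inter> {z. c \<le> g z \<and> g z \<le> d} \<and> successively R xs
    \<and> f (hd xs) \<le> a \<and> b \<le> f (last xs)" for xs
  have "\<exists>xs. Q xs"
    using assms unfolding cross_def linked_iff_list Q_def by blast
  then obtain xs where xs: "Q xs" and least: "\<And>ys. Q ys \<Longrightarrow> length xs \<le> length ys"
    using ex_has_least_nat[of Q _ length] by blast
  have "a < f v \<and> f v < b" if "v \<in> set (butlast (tl xs))" for v
  proof -
    obtain x ys where x: "xs = x # ys" using xs unfolding Q_def by (cases xs) auto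
    have ne: "ys \<noteq> []" using that x by auto
    have "v \<in> set (butlast ys)" using that x by simp
    from split_list[OF this] obtain p q where "butlast ys = p @ v # q" by (elim exE)
    then have xs': "xs = x # p @ v # q @ [last ys]"
      using append_butlast_last_id[OF ne] x by simp
    show ?thesis
    proof (rule ccontr)
      assume "\<not> ?thesis"
      then have "Q (v # q @ [last ys]) \<or> Q (x # p @ [v])"
        using xs unfolding Q_def xs'
        by (auto simp: successively_append_iff successively_Cons hd_append split: if_splits)
      then show False using least[of "v # q @ [last ys]"] least[of "x # p @ [v]"] xs' by auto
    qed
  qed
  then have "crosses f a b g c d xs"
    using xs unfolding Q_def crosses_def by auto
  then show thesis using that xs unfolding Q_def by blast
qed

lemma crosses_imp_cross:
  assumes "xs \<noteq> []" "set xs \<subseteq> S" "successively R xs" "crosses f a b g c d xs"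
  shows "cross R S f g a b c d"
proof (rule crossI)
  show "linked R (S \<inter> {z. c \<le> g z \<and> g z \<le> d}) (hd xs) (last xs)"
    unfolding linked_iff_list using assms by (intro exI[of _ xs]) (auto simp: crosses_def)
qed (use assms in \<open>auto simp: crosses_def\<close>)

text \<open>In a shortest crossing only the two end points can lie outside the slab, and each is one
  step away from a point on the other side of its own line. Confining the path to a bounded region
  is what makes crossings depend on finitely many elements.\<close>

lemma cross_trim:
  fixes f :: "complex \<Rightarrow> real"
  assumes "cross R S f g a b c d" "a < b" "0 \<le> D"
    and D: "\<And>x y. x \<in> S \<Longrightarrow> y \<in> S \<Longrightarrow> R x y \<Longrightarrow> \<bar>f x - f y\<bar> \<le> D"
  shows "cross R (S \<inter> {z. a - D \<le> f z \<and> f z \<le> b + D}) f g a b c d"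
proof -
  obtain xs where xs: "xs \<noteq> []" "set xs \<subseteq> S" "successively R xs" "crosses f a b g c d xs"
    using cross_trim_list[OF assms(1)] by blast
  have cr: "f (hd xs) \<le> a" "b \<le> f (last xs)" "\<forall>v\<in>set (butlast (tl xs)). a < f v \<and> f v < b"
    using xs(4) by (auto simp: crosses_def)
  obtain x ys where x: "xs = x # ys" using xs by (cases xs) auto
  have "ys \<noteq> []" using cr x assms(2) by (cases ys) auto
  then obtain p l where ys: "ys = p @ [l]" by (metis append_butlast_last_id)
  have p: "\<forall>v\<in>set p. a < f v \<and> f v < b" using cr x ys by simp
  have "f x \<ge> a - D"
  proof -
    obtain y where y: "y \<in> set xs" "R x y" "a < f y"
    proof (cases p)
      case Nil
      then show ?thesis using that[of l] xs(3) x ys cr(2) assms(2) by (auto simp: successively_Cons)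
    next
      case (Cons y p')
      then show ?thesis using that[of y] xs(3) x ys p by (auto simp: successively_Cons)
    qed
    then show ?thesis using D[of x y] xs(2) x by auto
  qed
  moreover have "f l \<le> b + D"
  proof -
    obtain y where y: "y \<in> set xs" "R y l" "f y < b"
    proof (cases p rule: rev_cases)
      case Nil
      then show ?thesis using that[of x] xs(3) x ys cr(1) assms(2) by (auto simp: successively_Cons)
    next
      case (snoc p' y)
      then show ?thesis using that[of y] xs(3) x ys p
        by (auto simp: successively_Cons successively_append_iff split: if_splits)
    qed
    then show ?thesis using D[of y l] xs(2) x ys by auto
  qed
  ultimately have "set xs \<subseteq> {z. a - D \<le> f z \<and> f z \<le> b + D}"
    using p cr x ys assms(2,3) by force
  then show ?thesis using xs by (intro crosses_imp_cross[of xs]) auto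
qed

text \<open>If the path is confined to a window of \<open>g\<close>-length \<open>2 m\<close>, it crosses that window the short way;
  otherwise it travels a \<open>g\<close>-distance \<open>m\<close> inside the strip.\<close>

lemma cross_cover:
  fixes f :: "complex \<Rightarrow> real"
  assumes "cross R S f g a b c d" "a < b" "0 \<le> D" "symp R"
    and D: "\<And>x y. x \<in> S \<Longrightarrow> y \<in> S \<Longrightarrow> R x y \<Longrightarrow> \<bar>f x - f y\<bar> \<le> D"
    and m: "b - a \<le> m" "2 * D \<le> m" "0 < m" "d - c \<le> real k * m"
  shows "\<exists>i\<le>k. cross R S f g a b (c + real i * m) (c + real i * m + 2 * m) \<or>
    cross R S g f (c + real i * m) (c + real i * m + m) (a - m / 2) (a + 3 * m / 2)"
proof -
  define S' where "S' = S \<inter> {z. a - D \<le> f z \<and> f z \<le> b + D} \<inter> {z. c \<le> g z \<and> g z \<le> d}"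
  obtain u v where "linked R S' u v" and uv: "f u \<le> a" "b \<le> f v"
    using cross_trim[OF assms(1,2,3) D] unfolding cross_def S'_def by blast
  then obtain xs where xs: "xs \<noteq> []" "hd xs = u" "last xs = v" "set xs \<subseteq> S'" "successively R xs"
    unfolding linked_iff_list by blast
  obtain x where x: "x \<in> set xs" "\<And>y. y \<in> set xs \<Longrightarrow> g x \<le> g y"
    using xs(1) by (metis (no_types, lifting) arg_min_if_finite(1) arg_min_least finite_set set_empty)
  \<comment> \<open>The windows have length \<open>2 * m\<close> and start at multiples of
    \<open>m\<close>; this is the one whose lower half contains the lowest point of the
    path.\<close>
  define i where "i = nat \<lfloor>(g x - c) / m\<rfloor>"
  have gx: "c \<le> g x" "g x \<le> d" using x xs by (auto simp: S'_def)
  have i: "c + real i * m \<le> g x" "g x < c + real i * m + m"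
  proof -
    have "real i = of_int \<lfloor>(g x - c) / m\<rfloor>" using gx m unfolding i_def by simp
    then have "real i \<le> (g x - c) / m" "(g x - c) / m < real i + 1" by linarith+
    then show "c + real i * m \<le> g x" "g x < c + real i * m + m"
      using m(3) by (auto simp: field_simps)
  qed
  have "real i * m \<le> real k * m" using i gx m by linarith
  then have ik: "i \<le> k" using m by simp
  show ?thesis
  proof (cases "\<forall>y\<in>set xs. g y \<le> c + real i * m + 2 * m")
    case True
    have "linked R (S \<inter> {z. c + real i * m \<le> g z \<and> g z \<le> c + real i * m + 2 * m}) u v"
      unfolding linked_iff_list using xs True x i(1) 
      by (intro exI[of _ xs]) (force simp: S'_def)
    then show ?thesis using ik uv unfolding cross_def by blast
  next
    case False
    then obtain y where y: "y \<in> set xs" "c + real i * m + 2 * m < g y" by auto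
    have "c + real (Suc i) * m + m < c + real k * m"
      using y xs(4) m(4) by (auto simp: S'_def algebra_simps)
    then have "real (Suc i) * m < real k * m" using m(3) by linarith
    then have "Suc i \<le> k" using m(3) by simp
    have "linked R (set xs) x u" "linked R (set xs) u y"
      using linked_set[OF xs(1,5)] x(1) y(1) xs(2) linked_sym[OF _ assms(4)] by auto
    then have "linked R (set xs) x y" by (rule linked_trans)
    moreover have "set xs \<subseteq> S \<inter> {z. a - m / 2 \<le> f z \<and> f z \<le> a + 3 * m / 2}"
    proof
      fix z assume "z \<in> set xs"
      then have "z \<in> S'" using xs(4) by blast
      then show "z \<in> S \<inter> {z. a - m / 2 \<le> f z \<and> f z \<le> a + 3 * m / 2}"
        using m(1,2) by (auto simp: S'_def)
    qed
    ultimately have "linked R (S \<inter> {z. a - m / 2 \<le> f z \<and> f z \<le> a + 3 * m / 2}) x y"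
      by (auto elim: linked_mono)
    then have "cross R S g f (c + real (Suc i) * m) (c + real (Suc i) * m + m) (a - m / 2) (a + 3 * m / 2)"
      by (rule crossI) (use i y in \<open>auto simp: algebra_simps\<close>)
    then show ?thesis using \<open>Suc i \<le> k\<close> by blast
  qed
qed

text \<open>Stop the path at its first point outside the open box of radius
  \<open>\<rho> + m\<close>. Up to there both coordinates stay within \<open>h\<close>, because the
  last step overshoots by at most \<open>D\<close>, and one coordinate has gone from at most
  \<open>\<rho>\<close> to at least \<open>\<rho> + m\<close> in absolute value; the four cases are
  the four sides. The induction carries the alternative that the exit has already happened.\<close>

lemma linked_exit:
  assumes "linked R S u v" "\<bar>f u\<bar> \<le> \<rho>" "\<bar>g u\<bar> \<le> \<rho>" "\<rho> + m \<le> \<bar>f v\<bar> \<or> \<rho> + m \<le> \<bar>g v\<bar>" "0 < m" "symp R"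
    and D: "\<And>x y. x \<in> S \<Longrightarrow> y \<in> S \<Longrightarrow> R x y \<Longrightarrow> \<bar>f x - f y\<bar> \<le> D \<and> \<bar>g x - g y\<bar> \<le> D"
    and h: "\<rho> + m + D \<le> h"
  shows "cross R S f g \<rho> (\<rho> + m) (- h) h \<or> cross R S f g (- (\<rho> + m)) (- \<rho>) (- h) h \<or>
    cross R S g f \<rho> (\<rho> + m) (- h) h \<or> cross R S g f (- (\<rho> + m)) (- \<rho>) (- h) h" (is ?C)
proof -
  let ?B = "S \<inter> {z. \<bar>f z\<bar> < \<rho> + m \<and> \<bar>g z\<bar> < \<rho> + m}"
  have "?C \<or> linked R ?B u v" using assms(1)
  proof (induction rule: linked_induct)
    case base
    then show ?case using assms by (auto intro!: linked_refl)
  next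
    case (step x y)
    show ?case
    proof (cases "?C \<or> y \<in> ?B")
      case True
      then show ?thesis using step linked_trans linked_step linked_in by (metis (no_types, lifting))
    next
      case False
      then have l: "linked R ?B u x" using step.IH by blast
      then have xB: "x \<in> ?B" by (rule linked_in)
      have Dxy: "\<bar>f x - f y\<bar> \<le> D" "\<bar>g x - g y\<bar> \<le> D" using D step.hyps by auto
      then have D0: "0 \<le> D" by linarith
      have bd: "\<bar>f y\<bar> \<le> h" "\<bar>g y\<bar> \<le> h" using Dxy xB h by auto
      have "linked R (S \<inter> {z. - h \<le> g z \<and> g z \<le> h} \<inter> {z. - h \<le> f z \<and> f z \<le> h}) u x"
        using l by (rule linked_mono) (use h D0 in auto)
      moreover have "linked R (S \<inter> {z. - h \<le> g z \<and> g z \<le> h} \<inter> {z. - h \<le> f z \<and> f z \<le> h}) x y"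
        by (rule linked_step) (use step.hyps bd xB h D0 in auto)
      ultimately have L: "linked R (S \<inter> {z. - h \<le> g z \<and> g z \<le> h} \<inter> {z. - h \<le> f z \<and> f z \<le> h}) u y"
        by (rule linked_trans)
      then have L1: "linked R (S \<inter> {z. - h \<le> g z \<and> g z \<le> h}) u y"
        and L2: "linked R (S \<inter> {z. - h \<le> f z \<and> f z \<le> h}) u y"
        by (auto elim!: linked_mono)
      note L1' = linked_sym[OF L1 assms(6)] and L2' = linked_sym[OF L2 assms(6)]
      have "\<rho> + m \<le> f y \<or> f y \<le> - (\<rho> + m) \<or> \<rho> + m \<le> g y \<or> g y \<le> - (\<rho> + m)"
        using False step.hyps by auto
      then have ?C
        using assms(2,3) crossI[OF L1, of f \<rho> "\<rho> + m"] crossI[OF L2, of g \<rho> "\<rho> + m"]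
          crossI[OF L1', of f "- (\<rho> + m)" "- \<rho>"] crossI[OF L2', of g "- (\<rho> + m)" "- \<rho>"] 
        by (smt (verit))
      then show ?thesis ..
    qed
  qed
  moreover have "\<not> linked R ?B u v" using linked_in(2)[of R ?B u v] assms(4) by auto
  ultimately show ?thesis by blast
qed

section \<open>Paths of the percolation model\<close>

abbreviation occupied_sites :: "percolation_model \<Rightarrow> config \<Rightarrow> complex set" where
  "occupied_sites M \<omega> \<equiv> {v. occupied_site M \<omega> v}"

abbreviation dual_open_sites :: "percolation_model \<Rightarrow> config \<Rightarrow> complex set" where
  "dual_open_sites M \<omega> \<equiv> {v. dual_open_site M \<omega> v}"

lemma occupied_path_iff:
  "occupied_path M \<omega> xs \<longleftrightarrow> xs \<noteq> [] \<and> set xs \<subseteq> occupied_sites M \<omega> \<and> successively (occupied_step M \<omega>) xs"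
  by (auto simp: occupied_path_def)

lemma dual_path_iff:
  "dual_path M \<omega> xs \<longleftrightarrow> xs \<noteq> [] \<and> set xs \<subseteq> dual_open_sites M \<omega> \<and> successively (dual_open_step M \<omega>) xs"
  by (auto simp: dual_path_def)

lemma crossing1_iff:
  "crossing1 M (occupied_path M) s t w h \<omega> \<longleftrightarrow>
    cross (occupied_step M \<omega>) (occupied_sites M \<omega>) (coord1 (rot_angle M)) (coord2 (rot_angle M)) s (s + w) t (t + h)"
  unfolding crossing1_def occupied_path_iff by (meson cross_trim_list crosses_imp_cross)

lemma crossing2_iff:
  "crossing2 M (occupied_path M) s t w h \<omega> \<longleftrightarrow>
    cross (occupied_step M \<omega>) (occupied_sites M \<omega>) (coord2 (rot_angle M)) (coord1 (rot_angle M)) t (t + h) s (s + w)"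
  unfolding crossing2_def occupied_path_iff by (meson cross_trim_list crosses_imp_cross)

lemma cluster_iff:
  "w \<in> cluster M \<omega> v \<longleftrightarrow> linked (occupied_step M \<omega>) (occupied_sites M \<omega>) v w"
  unfolding cluster_def linked_iff_list occupied_path_iff by auto

lemma dual_connectivity_eq:
  "dual_connectivity M p z = hom_prob M p (\<lambda>\<omega>. linked (dual_open_step M \<omega>) (dual_open_sites M \<omega>) (dual_origin M) z)"
  unfolding dual_connectivity_def linked_iff_list dual_path_iff by (metis (no_types, lifting))

lemma symp_occupied_step: "symp (occupied_step M \<omega>)"
  unfolding occupied_step_def symp_def by (auto simp: insert_commute)

lemma symp_dual_open_step: "symp (dual_open_step M \<omega>)"
proof (cases "kind M")
  case Site
  then show ?thesis unfolding dual_open_step_def symp_def by (auto simp: insert_commute)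
next
  case Bond
  then show ?thesis unfolding dual_open_step_def symp_def by (simp add: Int_commute) blast
qed

section \<open>Crossing paths in oblique coordinates\<close>

text \<open>Reduces the closedness of a locally finite union to that of finite unions.\<close>

lemma closed_if_closed_Int_cball:
  fixes S :: "'a::real_normed_vector set"
  assumes "\<And>R. closed (S \<inter> cball 0 R)"
  shows "closed S"
  unfolding closed_sequential_limits
proof (intro allI impI, elim conjE)
  fix x l assume x: "\<forall>n. x n \<in> S" and lim: "x \<longlonglongrightarrow> l"
  obtain R where "\<And>n. norm (x n) \<le> R"
    using convergent_imp_Bseq[of x] lim by (auto simp: convergent_def Bseq_def)
  then have "\<forall>n. x n \<in> S \<inter> cball 0 R" using x by auto
  then show "l \<in> S" using assms[of R] lim unfolding closed_sequential_limits by blast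
qed

text \<open>Two coordinates of the plane without a preferred order, so that geometric statements can
  be used with the axes exchanged.\<close>

locale oblique =
  fixes f g :: "complex \<Rightarrow> real"
  assumes linf: "linear f" and ling: "linear g" and injfg: "f z = 0 \<Longrightarrow> g z = 0 \<Longrightarrow> z = 0"
begin

lemma eqI: "f x = f y \<Longrightarrow> g x = g y \<Longrightarrow> x = y"
  using injfg[of "x - y"] linf ling by (simp add: linear_diff)

lemma f_add: "f (x + y) = f x + f y" and g_add: "g (x + y) = g x + g y"
  and f_diff: "f (x - y) = f x - f y" and g_diff: "g (x - y) = g x - g y"
  using linf ling by (simp_all add: linear_add linear_diff)

lemma cont: "continuous_on S f" "continuous_on S g"
  using linf ling linear_continuous_on linear_conv_bounded_linear by blast+

lemma swapped: "oblique g f"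
  by (rule oblique.intro[OF ling linf injfg])

text \<open>Straight segments prolong both paths to the sides of a large square, where the Fashoda
  theorem gives a common point. A prolongation moves one coordinate only, away from the strip of the
  other path, so a common point on it can only be its end on the original path.\<close>

lemma strip_paths_meet:
  assumes 1: "path_component S\<^sub>1 z\<^sub>1 z\<^sub>1'" "S\<^sub>1 \<subseteq> {z. a \<le> f z \<and> f z \<le> b}" "g z\<^sub>1 \<le> c" "d \<le> g z\<^sub>1'"
    and 2: "path_component S\<^sub>2 z\<^sub>2 z\<^sub>2'" "S\<^sub>2 \<subseteq> {z. c \<le> g z \<and> g z \<le> d}" "f z\<^sub>2 \<le> a" "b \<le> f z\<^sub>2'"
  shows "S\<^sub>1 \<inter> S\<^sub>2 \<noteq> {}"
proof -
  obtain p1 where p1: "path p1" "path_image p1 \<subseteq> S\<^sub>1" "pathstart p1 = z\<^sub>1" "pathfinish p1 = z\<^sub>1'"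
    using 1(1) unfolding path_component_def by blast
  obtain p2 where p2: "path p2" "path_image p2 \<subseteq> S\<^sub>2" "pathstart p2 = z\<^sub>2" "pathfinish p2 = z\<^sub>2'"
    using 2(1) unfolding path_component_def by blast
  have mem: "z\<^sub>1 \<in> S\<^sub>1" "z\<^sub>1' \<in> S\<^sub>1" "z\<^sub>2 \<in> S\<^sub>2" "z\<^sub>2' \<in> S\<^sub>2"
    using p1 p2 pathstart_in_path_image pathfinish_in_path_image by blast+
  define h :: "complex \<Rightarrow> real^2" where "h z = vector [f z, g z]" for z
  have h1: "h z $ 1 = f z" and h2: "h z $ 2 = g z" for z by (simp_all add: h_def)
  have heq: "h x = h y \<Longrightarrow> x = y" for x y by (metis eqI h1 h2)
  have hc: "continuous_on S h" for S
  proof -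
    have "continuous_on S (\<lambda>z. h z $ i)" for i
      using exhaust_2[of i] by (auto simp: h1 h2 cont)
    then have "continuous_on S (\<lambda>z. \<chi> i. h z $ i)" by (rule continuous_on_vec_lambda)
    then show ?thesis by simp
  qed
  have "bounded (h ` (path_image p1 \<union> path_image p2))"
    using p1 p2 by (intro compact_imp_bounded compact_continuous_image hc compact_Un compact_path_image)
  then obtain R where R: "\<And>z. z \<in> path_image p1 \<union> path_image p2 \<Longrightarrow> norm (h z) \<le> R"
    by (auto simp: bounded_iff)
  have Rc: "\<bar>f z\<bar> \<le> R" "\<bar>g z\<bar> \<le> R" if "z \<in> path_image p1 \<union> path_image p2" for z
    using R[OF that] component_le_norm_cart[of "h z" 1] component_le_norm_cart[of "h z" 2]
    by (simp_all add: h1 h2)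
  have ends: "z\<^sub>1 \<in> path_image p1" "z\<^sub>1' \<in> path_image p1" "z\<^sub>2 \<in> path_image p2" "z\<^sub>2' \<in> path_image p2"
    using p1 p2 by (metis pathstart_in_path_image pathfinish_in_path_image)+
  define lo hi :: "real^2" where "lo = vector [-R, -R]" and "hi = vector [R, R]"
  have lohi: "lo $ 1 = - R" "lo $ 2 = - R" "hi $ 1 = R" "hi $ 2 = R"
    by (simp_all add: lo_def hi_def)
  define q2 where "q2 = linepath (vector [-R, g z\<^sub>2]) (h z\<^sub>2) +++ (h \<circ> p2) +++ linepath (h z\<^sub>2') (vector [R, g z\<^sub>2'])"
  define q1 where "q1 = linepath (vector [f z\<^sub>1, -R]) (h z\<^sub>1) +++ (h \<circ> p1) +++ linepath (h z\<^sub>1') (vector [f z\<^sub>1', R])"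
  have im2: "path_image q2 = closed_segment (vector [-R, g z\<^sub>2]) (h z\<^sub>2) \<union> h ` path_image p2
      \<union> closed_segment (h z\<^sub>2') (vector [R, g z\<^sub>2'])"
    unfolding q2_def using p2 by (simp add: path_image_join pathstart_compose pathfinish_compose path_image_compose Un_assoc)
  have im1: "path_image q1 = closed_segment (vector [f z\<^sub>1, -R]) (h z\<^sub>1) \<union> h ` path_image p1
      \<union> closed_segment (h z\<^sub>1') (vector [f z\<^sub>1', R])"
    unfolding q1_def using p1 by (simp add: path_image_join pathstart_compose pathfinish_compose path_image_compose Un_assoc)
  have seg: "w $ i \<le> max (x $ i) (y $ i)" "min (x $ i) (y $ i) \<le> w $ i"
    if w: "w \<in> closed_segment x y" for w x y :: "real^2" and i
  proof -
    obtain u where u: "0 \<le> u" "u \<le> 1" "w = (1 - u) *\<^sub>R x + u *\<^sub>R y"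
      using w by (auto simp: in_segment)
    have "w $ i = (1 - u) * x $ i + u * y $ i" using u by simp
    then show "w $ i \<le> max (x $ i) (y $ i)" "min (x $ i) (y $ i) \<le> w $ i"
      using convex_bound_le[of "x $ i" "max (x $ i) (y $ i)" "y $ i" "1 - u" u]
        convex_bound_le[of "- x $ i" "- min (x $ i) (y $ i)" "- y $ i" "1 - u" u] u by auto
  qed
  have path2: "path q2" and path1: "path q1"
    unfolding q1_def q2_def using p1 p2 hc
    by (auto intro!: path_join_imp path_continuous_image simp: pathstart_compose pathfinish_compose)
  have b2: "path_image q2 \<subseteq> cbox lo hi"
  proof
    fix w assume "w \<in> path_image q2"
    then have "\<bar>w $ 1\<bar> \<le> R \<and> \<bar>w $ 2\<bar> \<le> R"
      unfolding im2 using Rc ends seg[of w "vector [-R, g z\<^sub>2]" "h z\<^sub>2" 1] seg[of w "vector [-R, g z\<^sub>2]" "h z\<^sub>2" 2]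
        seg[of w "h z\<^sub>2'" "vector [R, g z\<^sub>2']" 1] seg[of w "h z\<^sub>2'" "vector [R, g z\<^sub>2']" 2]
      by (auto simp: h1 h2 abs_le_iff; smt (verit) UnI2)
    then show "w \<in> cbox lo hi" by (auto simp: mem_box_cart forall_2 lohi)
  qed
  have b1: "path_image q1 \<subseteq> cbox lo hi"
  proof
    fix w assume "w \<in> path_image q1"
    then have "\<bar>w $ 1\<bar> \<le> R \<and> \<bar>w $ 2\<bar> \<le> R"
      unfolding im1 using Rc ends seg[of w "vector [f z\<^sub>1, -R]" "h z\<^sub>1" 1] seg[of w "vector [f z\<^sub>1, -R]" "h z\<^sub>1" 2]
        seg[of w "h z\<^sub>1'" "vector [f z\<^sub>1', R]" 1] seg[of w "h z\<^sub>1'" "vector [f z\<^sub>1', R]" 2]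
      by (auto simp: h1 h2 abs_le_iff; smt (verit) UnI1)
    then show "w \<in> cbox lo hi" by (auto simp: mem_box_cart forall_2 lohi)
  qed
  obtain w where w: "w \<in> path_image q2" "w \<in> path_image q1"
    by (rule fashoda[OF path2 path1 b2 b1]) (simp_all add: q1_def q2_def lohi)
  \<comment> \<open>The prolongations of the first path are vertical and keep it between
    \<open>a\<close> and \<open>b\<close>; in the same way \<open>w2\<close> follows from the second
    path.\<close>
  have w1: "a \<le> w $ 1 \<and> w $ 1 \<le> b"
    using w(2) 1(2) mem p1(2) seg[of w "vector [f z\<^sub>1, -R]" "h z\<^sub>1" 1] seg[of w "h z\<^sub>1'" "vector [f z\<^sub>1', R]" 1]
    unfolding im1 by (auto simp: h1)
  have w2: "c \<le> w $ 2 \<and> w $ 2 \<le> d"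
    using w(1) 2(2) mem p2(2) seg[of w "vector [-R, g z\<^sub>2]" "h z\<^sub>2" 2] seg[of w "h z\<^sub>2'" "vector [R, g z\<^sub>2']" 2]
    unfolding im2 by (auto simp: h2)
  have ext: "w = x" if "w $ 1 = x $ 1" "w $ 2 = x $ 2" for x :: "real^2"
    using that by (simp add: vec_eq_iff forall_2)
  have "w \<in> h ` S\<^sub>2"
  proof -
    consider "w \<in> closed_segment (vector [-R, g z\<^sub>2]) (h z\<^sub>2)" | "w \<in> h ` path_image p2"
      | "w \<in> closed_segment (h z\<^sub>2') (vector [R, g z\<^sub>2'])" using w(1) unfolding im2 by blast
    then show ?thesis
    proof cases
      case 1
      have "w = h z\<^sub>2"
        using seg[OF 1, of 1] seg[OF 1, of 2] w1 2(3) Rc(1)[of z\<^sub>2] ends by (intro ext) (auto simp: h1 h2 abs_le_iff)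
      then show ?thesis using mem by auto
    next
      case 2
      then show ?thesis using p2(2) by auto
    next
      case 3
      have "w = h z\<^sub>2'"
        using seg[OF 3, of 1] seg[OF 3, of 2] w1 2(4) Rc(1)[of z\<^sub>2'] ends by (intro ext) (auto simp: h1 h2 abs_le_iff)
      then show ?thesis using mem by auto
    qed
  qed
  moreover have "w \<in> h ` S\<^sub>1"
  proof -
    consider "w \<in> closed_segment (vector [f z\<^sub>1, -R]) (h z\<^sub>1)" | "w \<in> h ` path_image p1"
      | "w \<in> closed_segment (h z\<^sub>1') (vector [f z\<^sub>1', R])" using w(2) unfolding im1 by blast
    then show ?thesis
    proof cases
      case A: 1
      have "w = h z\<^sub>1"
        using seg[OF A, of 1] seg[OF A, of 2] w2 1(3) Rc(2)[of z\<^sub>1] ends by (intro ext) (auto simp: h1 h2 abs_le_iff)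
      then show ?thesis using mem by auto
    next
      case 2
      then show ?thesis using p1(2) by auto
    next
      case 3
      have "w = h z\<^sub>1'"
        using seg[OF 3, of 1] seg[OF 3, of 2] w2 1(4) Rc(2)[of z\<^sub>1'] ends by (intro ext) (auto simp: h1 h2 abs_le_iff)
      then show ?thesis using mem by auto
    qed
  qed
  ultimately obtain x y where "x \<in> S\<^sub>1" "y \<in> S\<^sub>2" "h x = h y" by auto
  then show ?thesis using heq by blast
qed

end

section \<open>Geometry of a planar lattice\<close>

locale lattice =
  fixes M :: percolation_model
  assumes planar: "planar_lattice M"
begin

abbreviation "a \<equiv> spacing M"
abbreviation "c1 \<equiv> coord1 (rot_angle M)"
abbreviation "c2 \<equiv> coord2 (rot_angle M)"

lemma a_pos: "0 < a" and sin_pos: "0 < sin (rot_angle M)"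
  using planar sin_gt_zero by (auto simp: planar_lattice_def)

lemma linear_c1: "linear c1" and linear_c2: "linear c2"
  unfolding coord1_def coord2_def using sin_pos
  by (auto intro!: linearI simp: field_simps)

lemma coords_eq: "z = of_real (c1 z) + of_real (c2 z) * cis (rot_angle M)"
  using sin_pos by (auto simp: coord1_def coord2_def complex_eq_iff)

lemma oblique_c: "oblique c1 c2"
  by (rule oblique.intro[OF linear_c1 linear_c2]) (metis coords_eq add_0 mult_zero_left of_real_0)

text \<open>The two orders of the coordinate axes; crossing statements quantify over them to treat
  both directions at once.\<close>

definition axes :: "(complex \<Rightarrow> real) \<Rightarrow> (complex \<Rightarrow> real) \<Rightarrow> bool" where
  "axes f g \<longleftrightarrow> f = c1 \<and> g = c2 \<or> f = c2 \<and> g = c1"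

lemma axes_sym: "axes f g \<Longrightarrow> axes g f"
  by (auto simp: axes_def)

lemma axes12: "axes c1 c2" and axes21: "axes c2 c1"
  by (auto simp: axes_def)

lemma axes_oblique: "axes f g \<Longrightarrow> oblique f g"
  using oblique_c oblique.swapped by (auto simp: axes_def)

lemma axes_linear: "axes f g \<Longrightarrow> linear f"
  using linear_c1 linear_c2 by (auto simp: axes_def)

definition nrm :: "complex \<Rightarrow> real" where "nrm = oblique_norm (rot_angle M)"

lemma nrm_eq: "nrm z = max \<bar>c1 z\<bar> \<bar>c2 z\<bar>"
  by (simp add: nrm_def oblique_norm_def)

lemma axes_nrm: "axes f g \<Longrightarrow> nrm z = max \<bar>f z\<bar> \<bar>g z\<bar>"
  by (auto simp: nrm_eq axes_def)

lemma nrm_ge0: "0 \<le> nrm z"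
  by (simp add: nrm_eq)

lemma nrm_triangle: "nrm (x + y) \<le> nrm x + nrm y"
  unfolding nrm_eq linear_add[OF linear_c1] linear_add[OF linear_c2]
  by (intro max.boundedI order_trans[OF abs_triangle_ineq] add_mono max.cobounded1 max.cobounded2)

lemma nrm_minus: "nrm (- x) = nrm x"
  using linear_neg[OF linear_c1, of x] linear_neg[OF linear_c2, of x] by (simp add: nrm_eq)

lemma nrm_minus_commute: "nrm (x - y) = nrm (y - x)"
  using nrm_minus[of "x - y"] by simp

lemma nrm_triangle': "nrm (x - z) \<le> nrm (x - y) + nrm (y - z)"
  using nrm_triangle[of "x - y" "y - z"] by simp

lemma norm_le_nrm: "norm z \<le> 2 * nrm z"
proof -
  have "norm z \<le> norm (complex_of_real (c1 z)) + norm (complex_of_real (c2 z) * cis (rot_angle M))"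
    by (subst coords_eq) (rule norm_triangle_ineq)
  then show ?thesis by (simp add: norm_mult nrm_eq)
qed

lemma nrm_le_norm: "\<exists>K>0. \<forall>z. nrm z \<le> K * norm z"
proof -
  obtain K1 where K1: "K1 > 0" "\<And>z. norm (c1 z) \<le> norm z * K1"
    using linear_conv_bounded_linear linear_c1 bounded_linear.pos_bounded by blast
  obtain K2 where K2: "K2 > 0" "\<And>z. norm (c2 z) \<le> norm z * K2"
    using linear_conv_bounded_linear linear_c2 bounded_linear.pos_bounded by blast
  have "nrm z \<le> max K1 K2 * norm z" for z
    using K1(2)[of z] K2(2)[of z] mult_left_mono[of K1 "max K1 K2" "norm z"] mult_left_mono[of K2 "max K1 K2" "norm z"]
    by (simp add: nrm_eq mult.commute)
  then show ?thesis using K1 by (intro exI[of _ "max K1 K2"]) auto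
qed

lemma bounded_iff_nrm: "bounded S \<longleftrightarrow> (\<exists>R. \<forall>z\<in>S. nrm z \<le> R)"
proof
  assume "bounded S"
  then obtain R where R: "\<And>z. z \<in> S \<Longrightarrow> norm z \<le> R" by (auto simp: bounded_iff)
  obtain K where K: "K > 0" "\<And>z. nrm z \<le> K * norm z" using nrm_le_norm by blast
  have "nrm z \<le> K * R" if "z \<in> S" for z
    using K(2)[of z] mult_left_mono[OF R[OF that], of K] K(1) by linarith
  then show "\<exists>R. \<forall>z\<in>S. nrm z \<le> R" by blast
next
  assume "\<exists>R. \<forall>z\<in>S. nrm z \<le> R"
  then obtain R where "\<forall>z\<in>S. nrm z \<le> R" by blast
  then have "norm z \<le> 2 * R" if "z \<in> S" for z using norm_le_nrm[of z] that by fastforce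
  then show "bounded S" by (auto simp: bounded_iff)
qed

lemma finite_sites: "bounded S \<Longrightarrow> finite (sites M \<inter> S)"
proof -
  assume "bounded S"
  then obtain R where "\<forall>z\<in>S. norm z \<le> R" by (auto simp: bounded_iff)
  then have "S \<subseteq> cball 0 R" by auto
  moreover have "finite (sites M \<inter> cball 0 R)" using planar by (simp add: planar_lattice_def)
  ultimately show ?thesis by (meson Int_mono finite_subset order_refl)
qed

lemma bond_cases:
  assumes "e \<in> bonds M"
  obtains u v where "e = {u, v}" "u \<noteq> v" "u \<in> sites M" "v \<in> sites M"
proof -
  have "e \<subseteq> sites M" "card e = 2" using planar assms by (auto simp: planar_lattice_def)
  then show thesis using that by (auto simp: card_2_iff)
qed

lemma hull_sites: "e \<in> bonds M \<Longrightarrow> sites M \<inter> convex hull e = e"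
  using planar by (auto simp: planar_lattice_def)

lemma hull_Int: "e \<in> bonds M \<Longrightarrow> e' \<in> bonds M \<Longrightarrow> e \<noteq> e' \<Longrightarrow> convex hull e \<inter> convex hull e' = e \<inter> e'"
  using planar by (auto simp: planar_lattice_def)

subsection \<open>Symmetries\<close>

lemma invariant_comp:
  "invariant_under M f \<Longrightarrow> invariant_under M g \<Longrightarrow> invariant_under M (f \<circ> g)"
  unfolding invariant_under_def
proof (elim conjE, intro conjI)
  assume "image f ` bonds M = bonds M" "image g ` bonds M = bonds M"
  then have "(\<lambda>e. f ` (g ` e)) ` bonds M = bonds M"
    by (metis image_image)
  then show "image (f \<circ> g) ` bonds M = bonds M" by (simp add: image_comp)
qed (metis image_comp)+

lemma invariant_inv:
  assumes "invariant_under M f" "\<And>z. h (f z) = z"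
  shows "invariant_under M h"
proof -
  have *: "h ` f ` S = S" for S by (simp add: image_image assms(2))
  then have "(\<lambda>e. h ` f ` e) ` bonds M = bonds M" by simp
  then have "image h ` image f ` bonds M = bonds M" by (simp add: image_image)
  then show ?thesis using assms(1) * unfolding invariant_under_def by metis
qed

definition period :: "complex set" where
  "period = {t. invariant_under M (\<lambda>z. z + t)}"

lemma period_add: "s \<in> period \<Longrightarrow> t \<in> period \<Longrightarrow> s + t \<in> period"
  using invariant_comp[of "\<lambda>z. z + s" "\<lambda>z. z + t"] by (simp add: period_def comp_def add.assoc add.commute[of t s])

lemma period_minus: "t \<in> period \<Longrightarrow> - t \<in> period"
  using invariant_inv[of "\<lambda>z. z + t" "\<lambda>z. z + - t"] by (simp add: period_def)

lemma period_of_int: "t \<in> period \<Longrightarrow> of_int n * t \<in> period"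
proof (induction n rule: int_induct[where k=0])
  case base
  have "invariant_under M (\<lambda>z. z)" by (simp add: invariant_under_def)
  then show ?case by (simp add: period_def)
next
  case (step1 i)
  then show ?case using period_add[of "of_int i * t" t] by (simp add: algebra_simps)
next
  case (step2 i)
  then show ?case using period_add[of "of_int i * t" "- t"] period_minus[of t] by (simp add: algebra_simps)
qed

lemma invariant_rot: "invariant_under M (\<lambda>z. cis (rot_angle M) * z)"
  and invariant_refl: "invariant_under M (\<lambda>z. - cnj z)"
  using planar by (auto simp: planar_lattice_def)

lemma period_1: "of_real a \<in> period"
  using planar by (auto simp: planar_lattice_def period_def)

text \<open>The horizontal translation conjugated by the rotation.\<close>

lemma period_2: "of_real a * cis (rot_angle M) \<in> period"
proof -
  have "invariant_under M (\<lambda>z. cis (- rot_angle M) * z)"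
    by (rule invariant_inv[OF invariant_rot]) (simp add: mult.assoc[symmetric] cis_mult)
  from invariant_comp[OF invariant_rot invariant_comp[OF _ this]] period_1
  have "invariant_under M (\<lambda>z. cis (rot_angle M) * (cis (- rot_angle M) * z + of_real a))"
    by (simp add: period_def comp_def)
  moreover have "cis (rot_angle M) * (cis (- rot_angle M) * z + of_real a) = z + of_real a * cis (rot_angle M)" for z
    by (simp add: algebra_simps mult.assoc[symmetric] cis_mult)
  ultimately show ?thesis by (simp add: period_def)
qed

definition lat :: "int \<Rightarrow> int \<Rightarrow> complex" where
  "lat m n = of_int m * of_real a + of_int n * (of_real a * cis (rot_angle M))"

lemma lat_period: "lat m n \<in> period"
  unfolding lat_def by (intro period_add period_of_int period_1 period_2)

lemma c1_lat: "c1 (lat m n) = real_of_int m * a" and c2_lat: "c2 (lat m n) = real_of_int n * a"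
  using sin_pos by (simp_all add: lat_def coord1_def coord2_def)

lemma axes_lat: "axes f g \<Longrightarrow> \<exists>t\<in>period. f t = real_of_int m * a \<and> g t = real_of_int n * a"
  unfolding axes_def using c1_lat c2_lat lat_period by metis

lemma lat_reduce:
  assumes "axes f g"
  obtains t where "t \<in> period" "0 \<le> f (z - t)" "f (z - t) < a" "0 \<le> g (z - t)" "g (z - t) < a"
proof -
  obtain t where t: "t \<in> period" "f t = real_of_int \<lfloor>f z / a\<rfloor> * a" "g t = real_of_int \<lfloor>g z / a\<rfloor> * a"
    using axes_lat[OF assms] by blast
  interpret oblique f g using assms by (rule axes_oblique)
  have fl: "real_of_int \<lfloor>x / a\<rfloor> * a \<le> x" "x < real_of_int \<lfloor>x / a\<rfloor> * a + a" for x
    using floor_divide_lower[OF a_pos, of x] floor_divide_upper[OF a_pos, of x] by (auto simp: algebra_simps)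
  show thesis
    by (rule that[OF t(1)]) (use fl[of "f z"] fl[of "g z"] in \<open>auto simp: f_diff g_diff t(2,3)\<close>)
qed

text \<open>The rotation alone does not preserve the pair of axes unless its angle is a right one.
  Composed with the reflection it exchanges them, up to signs.\<close>

definition swap :: "complex \<Rightarrow> complex" where
  "swap z = cis (rot_angle M) * (- cnj z)"

lemma invariant_swap: "invariant_under M swap"
  using invariant_comp[OF invariant_rot invariant_refl] by (simp add: comp_def swap_def[abs_def])

lemma c1_combo: "c1 (of_real x + of_real y * cis (rot_angle M)) = x"
  and c2_combo: "c2 (of_real x + of_real y * cis (rot_angle M)) = y"
  using sin_pos by (simp_all add: coord1_def coord2_def)

lemma swap_combo: "swap z = of_real (- c2 z) + of_real (- c1 z) * cis (rot_angle M)"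
proof -
  have "cnj z = of_real (c1 z) + of_real (c2 z) * cis (- rot_angle M)"
    by (subst coords_eq[of z]) (simp add: cis_cnj)
  then have "swap z = - of_real (c1 z) * cis (rot_angle M)
      - of_real (c2 z) * (cis (rot_angle M) * cis (- rot_angle M))"
    by (simp add: swap_def algebra_simps)
  also have "cis (rot_angle M) * cis (- rot_angle M) = 1" by (simp add: cis_mult)
  finally show ?thesis by simp
qed

lemma c1_swap: "c1 (swap z) = - c2 z" and c2_swap: "c2 (swap z) = - c1 z"
  unfolding swap_combo c1_combo c2_combo by simp_all

lemma swap_swap: "swap (swap z) = z"
  by (subst swap_combo) (simp only: c1_swap c2_swap minus_minus coords_eq[symmetric])

lemma period_sites: "t \<in> period \<Longrightarrow> v + t \<in> sites M \<longleftrightarrow> v \<in> sites M"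
  and period_dual: "t \<in> period \<Longrightarrow> v + t \<in> dual_sites M \<longleftrightarrow> v \<in> dual_sites M"
proof -
  have *: "(v + t \<in> S) = (v \<in> S)" if "(\<lambda>z. z + t) ` S = S" for S
  proof
    assume "v + t \<in> S"
    then have "v + t \<in> (\<lambda>z. z + t) ` S" using that by simp
    then show "v \<in> S" by auto
  next
    assume "v \<in> S"
    then have "v + t \<in> (\<lambda>z. z + t) ` S" by simp
    then show "v + t \<in> S" using that by simp
  qed
  show "t \<in> period \<Longrightarrow> v + t \<in> sites M \<longleftrightarrow> v \<in> sites M"
    "t \<in> period \<Longrightarrow> v + t \<in> dual_sites M \<longleftrightarrow> v \<in> dual_sites M"
    using *[of "sites M"] *[of "dual_sites M"] by (simp_all add: period_def invariant_under_def)
qed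

lemma bond_translate:
  assumes "t \<in> period"
  shows "(\<lambda>z. z + t) ` e \<in> bonds M \<longleftrightarrow> e \<in> bonds M"
proof -
  have b: "image (\<lambda>z. z + t) ` bonds M = bonds M" using assms by (auto simp: period_def invariant_under_def)
  have "inj (image (\<lambda>z::complex. z + t))"
    by (rule injI) (simp add: inj_image_eq_iff inj_def)
  from inj_image_mem_iff[OF this, of e "bonds M"] show ?thesis using b by simp
qed

lemma drawing_translate:
  assumes "t \<in> period"
  shows "z + t \<in> drawing M \<longleftrightarrow> z \<in> drawing M"
proof -
  have hull: "(\<lambda>z. z + t) ` (convex hull e) = convex hull ((\<lambda>z. z + t) ` e)" for e t
    using convex_hull_translation[of t e] by (simp add: add.commute)
  have *: "z + t \<in> drawing M" if z: "z \<in> drawing M" and t: "t \<in> period" for z t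
  proof -
    obtain e where e: "e \<in> bonds M" "z \<in> convex hull e" using z by (auto simp: drawing_def)
    have "z + t \<in> convex hull ((\<lambda>z. z + t) ` e)" using hull[of t e] e(2) by blast
    then show ?thesis using bond_translate[OF t, of e] e(1) unfolding drawing_def by blast
  qed
  show ?thesis using *[of z t] *[of "z + t" "- t"] assms period_minus by auto
qed

lemma path_component_drawing:
  assumes "u \<in> sites M" "v \<in> sites M"
  shows "path_component (drawing M) u v"
proof -
  have conn: "(u, v) \<in> {(x, y). {x, y} \<in> bonds M}\<^sup>*" if "u \<in> sites M" "v \<in> sites M" for u v
    using planar that by (auto simp: planar_lattice_def)
  \<comment> \<open>A site is connected to its translate, a different site, and therefore has a
    bond.\<close>
  have "u \<in> drawing M"
  proof -
    have "u + of_real a \<in> sites M" using assms period_sites[OF period_1] by simp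
    with conn[OF assms(1)] have "(u, u + of_real a) \<in> {(x, y). {x, y} \<in> bonds M}\<^sup>*" by simp
    then obtain x where "{u, x} \<in> bonds M" using a_pos by (auto elim: converse_rtranclE)
    then show ?thesis unfolding drawing_def using hull_inc[of u "{u, x}"] by blast
  qed
  from conn[OF assms] show ?thesis
  proof (induction rule: rtrancl_induct)
    case base
    then show ?case using \<open>u \<in> drawing M\<close> by (simp add: path_component_refl)
  next
    case (step y z)
    then have yz: "{y, z} \<in> bonds M" by simp
    have "path_component (convex hull {y, z}) y z"
      by (rule path_connected_component[THEN iffD1, OF convex_imp_path_connected, rule_format])
        (auto intro: hull_inc)
    then have "path_component (drawing M) y z"
      by (rule path_component_of_subset[rotated]) (use yz in \<open>auto simp: drawing_def\<close>)
    then show ?case using step.IH path_component_trans by blast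
  qed
qed

lemma sites_in_drawing: "sites M \<subseteq> drawing M"
  using path_component_drawing path_component_mem(1) by blast

lemma hull_strip:
  fixes f :: "complex \<Rightarrow> real"
  assumes "linear f" "z \<in> convex hull e" "\<And>v. v \<in> e \<Longrightarrow> lo \<le> f v \<and> f v \<le> hi"
  shows "lo \<le> f z \<and> f z \<le> hi"
proof -
  have "convex (f -` {lo..hi})" using assms(1) by (rule convex_linear_vimage) (rule convex_real_interval(5))
  moreover have "e \<subseteq> f -` {lo..hi}" using assms(3) by auto
  ultimately have "convex hull e \<subseteq> f -` {lo..hi}" by (simp add: hull_minimal)
  then show ?thesis using assms(2) by auto
qed

text \<open>Up to translation by periods there are only finitely many bonds.\<close>

lemma bond_length_bound:
  "\<exists>D. \<forall>e\<in>bonds M. \<forall>u\<in>e. \<forall>v\<in>e. nrm (u - v) \<le> D"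
proof -
  define V where "V = sites M \<inter> {z. nrm z \<le> a}"
  have "bounded {z. nrm z \<le> a}" by (auto simp: bounded_iff_nrm)
  then have fV: "finite V" unfolding V_def by (rule finite_sites)
  define B where "B = (\<Union>v\<in>V. {e\<in>bonds M. v \<in> e})"
  have "finite B" unfolding B_def using fV planar by (auto simp: planar_lattice_def V_def)
  moreover have "finite e" if "e \<in> B" for e
    using that bond_cases[of e] unfolding B_def by (metis (no_types, lifting) UN_iff finite.simps mem_Collect_eq)
  ultimately have fin: "finite (\<Union>e\<in>B. (\<lambda>(u, v). nrm (u - v)) ` (e \<times> e))" by auto
  obtain D where D: "\<And>x. x \<in> (\<Union>e\<in>B. (\<lambda>(u, v). nrm (u - v)) ` (e \<times> e)) \<Longrightarrow> x \<le> D"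
    using finite_imp_bounded[OF fin] bounded_iff by (metis abs_le_D1 real_norm_def)
  show ?thesis
  proof (intro exI[of _ D] ballI)
    fix e u v assume e: "e \<in> bonds M" "u \<in> e" "v \<in> e"
    obtain t where t: "t \<in> period" "0 \<le> c1 (u - t)" "c1 (u - t) < a" "0 \<le> c2 (u - t)" "c2 (u - t) < a"
      using lat_reduce[OF axes12] by blast
    have "u \<in> sites M" using e by (elim bond_cases) auto
    then have "u - t \<in> V"
      using period_sites[OF period_minus[OF t(1)], of u] t by (auto simp: V_def nrm_eq)
    moreover have "(\<lambda>z. z + - t) ` e \<in> bonds M"
      using e t bond_translate[OF period_minus] by blast
    moreover have "u - t \<in> (\<lambda>z. z + - t) ` e" "v - t \<in> (\<lambda>z. z + - t) ` e" using e by auto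
    ultimately have "nrm ((u - t) - (v - t)) \<in> (\<Union>e\<in>B. (\<lambda>(u, v). nrm (u - v)) ` (e \<times> e))"
      unfolding B_def
      by (intro UN_I[of "(\<lambda>z. z + - t) ` e"] image_eqI[where x = "(u - t, v - t)"]) auto
    then show "nrm (u - v) \<le> D" using D by force
  qed
qed

lemma nrm_hull:
  assumes "e \<in> bonds M" "\<And>v. v \<in> e \<Longrightarrow> nrm (v - u) \<le> D" "x \<in> convex hull e"
  shows "nrm (x - u) \<le> D"
proof -
  have "f u - D \<le> f x \<and> f x \<le> f u + D" if ax: "axes f g" for f g
  proof (rule hull_strip[OF axes_linear[OF ax] assms(3)])
    interpret oblique f g using ax by (rule axes_oblique)
    fix v assume "v \<in> e"
    then show "f u - D \<le> f v \<and> f v \<le> f u + D"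
      using assms(2) by (force simp: axes_nrm[OF ax] f_diff abs_le_iff)
  qed
  from this[OF axes12] this[OF axes21] show ?thesis
    by (simp add: nrm_eq linear_diff[OF linear_c1] linear_diff[OF linear_c2] abs_le_iff)
qed

lemma finite_bonds_meeting:
  assumes "bounded B"
  shows "finite {e \<in> bonds M. convex hull e \<inter> B \<noteq> {}}"
proof -
  obtain D where D: "\<And>e u v. e \<in> bonds M \<Longrightarrow> u \<in> e \<Longrightarrow> v \<in> e \<Longrightarrow> nrm (u - v) \<le> D"
    using bond_length_bound by blast
  obtain R where R: "\<And>z. z \<in> B \<Longrightarrow> nrm z \<le> R" using assms by (auto simp: bounded_iff_nrm)
  have "e \<subseteq> sites M \<inter> {z. nrm z \<le> R + D}" if e: "e \<in> bonds M" "convex hull e \<inter> B \<noteq> {}" for e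
  proof
    fix u assume u: "u \<in> e"
    obtain x where x: "x \<in> convex hull e" "x \<in> B" using e by blast
    have "nrm (x - u) \<le> D" using nrm_hull[OF e(1) D[OF e(1) _ u] x(1)] by blast
    then have "nrm u \<le> R + D"
      using nrm_triangle[of x "u - x"] nrm_minus_commute[of x u] R[OF x(2)] by simp
    then show "u \<in> sites M \<inter> {z. nrm z \<le> R + D}" using u e(1) by (auto elim: bond_cases)
  qed
  then have "{e \<in> bonds M. convex hull e \<inter> B \<noteq> {}} \<subseteq> Pow (sites M \<inter> {z. nrm z \<le> R + D})" by blast
  moreover have "finite (sites M \<inter> {z. nrm z \<le> R + D})"
    by (rule finite_sites) (auto simp: bounded_iff_nrm)
  ultimately show ?thesis by (meson finite_Pow_iff finite_subset)
qed

lemma compact_hull: "e \<in> bonds M \<Longrightarrow> compact (convex hull e)"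
  by (rule compact_convex_hull, rule finite_imp_compact) (auto elim: bond_cases)

lemma closed_Union_hulls:
  assumes "B \<subseteq> bonds M"
  shows "closed (\<Union>e\<in>B. convex hull e)"
proof (rule closed_if_closed_Int_cball)
  fix R
  have "(\<Union>e\<in>B. convex hull e) \<inter> cball 0 R =
    (\<Union>e\<in>B \<inter> {e \<in> bonds M. convex hull e \<inter> cball 0 R \<noteq> {}}. convex hull e) \<inter> cball 0 R"
    using assms by blast
  moreover have "closed \<dots>"
    using assms compact_hull finite_bonds_meeting[of "cball 0 R"]
    by (intro closed_Int closed_UN) (auto intro!: compact_imp_closed)
  ultimately show "closed ((\<Union>e\<in>B. convex hull e) \<inter> cball 0 R)" by simp
qed

lemma closed_drawing: "closed (drawing M)"
  unfolding drawing_def by (rule closed_Union_hulls) simp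

lemma face_facts:
  assumes "F \<in> faces M"
  shows "open F" "connected F" "F \<noteq> {}" "F \<inter> drawing M = {}"
proof -
  have F: "F \<in> components (- drawing M)" using assms by (simp add: faces_def)
  show "open F" using F closed_drawing open_components[of "- drawing M" F] by (simp add: open_Compl)
  show "connected F" "F \<noteq> {}" using F in_components_connected in_components_nonempty by auto
  show "F \<inter> drawing M = {}" using in_components_subset[OF F] by auto
qed

lemma faces_disjoint: "F \<in> faces M \<Longrightarrow> G \<in> faces M \<Longrightarrow> F \<noteq> G \<Longrightarrow> F \<inter> G = {}"
  unfolding faces_def by (metis components_eq)

lemma face_maximal: "F \<in> faces M \<Longrightarrow> connected S \<Longrightarrow> S \<inter> drawing M = {} \<Longrightarrow> S \<inter> F \<noteq> {} \<Longrightarrow> S \<subseteq> F"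
  unfolding faces_def by (rule components_maximal) auto

lemma face_exists: "z \<notin> drawing M \<Longrightarrow> \<exists>F\<in>faces M. z \<in> F"
  unfolding faces_def by (metis ComplI UnionE Union_components)

text \<open>A path in the drawing from a site to its translate, repeated periodically, is a wall
  inside a strip of width \<open>2 * R\<close>. A path inside a face avoids the drawing, so no
  translate of the wall can lie between its ends.\<close>

lemma face_width_bound:
  assumes ax: "axes f g"
  shows "\<exists>D. \<forall>F\<in>faces M. \<forall>z\<in>F. \<forall>z'\<in>F. f z' - f z \<le> D"
proof -
  interpret oblique f g using ax by (rule axes_oblique)
  obtain t where t: "t \<in> period" "f t = 0" "g t = a" using axes_lat[OF ax, of 0 1] by auto
  define v where "v = origin M"
  have vs: "v \<in> sites M" using planar by (simp add: v_def planar_lattice_def)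
  then have "path_component (drawing M) v (v + t)"
    using path_component_drawing period_sites[OF t(1)] by simp
  then obtain p where p: "path p" "path_image p \<subseteq> drawing M" "pathstart p = v" "pathfinish p = v + t"
    unfolding path_component_def by blast
  have "bounded (path_image p)" using p(1) by (rule bounded_path_image)
  then obtain R where R: "\<And>z. z \<in> path_image p \<Longrightarrow> nrm (z - v) \<le> R"
  proof -
    have "bounded ((\<lambda>z. z - v) ` path_image p)"
      using \<open>bounded (path_image p)\<close> by (rule bounded_translation_minus)
    then show thesis using that by (auto simp: bounded_iff_nrm)
  qed
  have R0: "0 \<le> R" using R[of v] p(3) nrm_ge0 by (metis order_trans pathstart_in_path_image)
  have fR: "\<bar>f z - f v\<bar> \<le> R" if "z \<in> path_image p" for z
    using R[OF that] by (simp add: axes_nrm[OF ax] f_diff)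
  define A where "A s = drawing M \<inter> {z. f v + f s - R \<le> f z \<and> f z \<le> f v + f s + R}" for s
  have one: "path_component (A s) (v + s) (v + s + t)" if "s \<in> period" for s
  proof -
    define q where "q = (\<lambda>z. z + s) \<circ> p"
    have "path q" unfolding q_def by (intro path_continuous_image p continuous_intros)
    moreover have "pathstart q = v + s" "pathfinish q = v + s + t"
      using p by (simp_all add: q_def pathstart_compose pathfinish_compose)
    moreover have "path_image q \<subseteq> A s"
      using p(2) fR drawing_translate[OF that] by (force simp: q_def path_image_compose A_def f_add abs_le_iff)
    ultimately show ?thesis unfolding path_component_def by blast
  qed
  have many: "path_component (A s) (v + s) (v + s + of_nat n * t)" if "s \<in> period" for s n
  proof (induction n)
    case 0
    then show ?case using one[OF that] path_component_mem(1) path_component_refl by fastforce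
  next
    case (Suc n)
    have "of_nat n * t \<in> period" using period_of_int[OF t(1), of "int n"] by simp
    then have "s + of_nat n * t \<in> period" using that period_add by blast
    from one[OF this] have "path_component (A s) (v + s + of_nat n * t) (v + s + of_nat (Suc n) * t)"
      using t(2) linear_scale[OF linf, of "real n" t] by (simp add: A_def f_add algebra_simps scaleR_conv_of_real)
    then show ?case using Suc path_component_trans by blast
  qed
  show ?thesis
  proof (intro exI[of _ "2 * R + a"] ballI, rule ccontr)
    fix F z z' assume F: "F \<in> faces M" "z \<in> F" "z' \<in> F" and gt: "\<not> f z' - f z \<le> 2 * R + a"
    have comp: "F \<in> components (- drawing M)" using F by (simp add: faces_def)
    have "path_connected F"
      using face_facts[OF F(1)] by (simp add: connected_open_path_connected)
    then obtain r where r: "path r" "path_image r \<subseteq> F" "pathstart r = z" "pathfinish r = z'"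
      using F(2,3) unfolding path_connected_def by blast
    have sub: "path_image r \<inter> drawing M = {}" using r(2) comp in_components_subset by blast
    obtain G where G: "\<And>w. w \<in> path_image r \<Longrightarrow> nrm w \<le> G"
      using bounded_path_image[OF r(1)] by (auto simp: bounded_iff_nrm)
    \<comment> \<open>The first translate of the wall that lies entirely to the right of
      \<open>z\<close>. Rounding up costs at most one spacing, hence the bound
      \<open>2 * R + a\<close>.\<close>
    define m where "m = \<lceil>(f z + R - f v) / a\<rceil>"
    have m: "f z + R - f v \<le> real_of_int m * a" "real_of_int m * a \<le> f z + R - f v + a"
      using ceiling_divide_upper[OF a_pos, of "f z + R - f v"] ceiling_divide_lower[OF a_pos, of "f z + R - f v"]
      by (auto simp: m_def algebra_simps)
    \<comment> \<open>With \<open>k\<close> periods in either direction the wall reaches beyond all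
      values of \<open>g\<close> on the path.\<close>
    obtain k :: nat where k: "(G + \<bar>g v\<bar>) / a < real k" using reals_Archimedean2 by blast
    then have k: "G + \<bar>g v\<bar> < real k * a" using a_pos by (simp add: field_simps)
    obtain s where s: "s \<in> period" "f s = real_of_int m * a" "g s = real_of_int (- int k) * a"
      using axes_lat[OF ax] by blast
    have gn: "g (of_nat n * t) = real n * a" for n
      using linear_scale[OF ling, of "real n" t] t(3) by (simp add: scaleR_conv_of_real)
    have "A s \<inter> path_image r \<noteq> {}"
    proof (rule strip_paths_meet)
      show "path_component (A s) (v + s) (v + s + of_nat (2 * k) * t)" by (rule many[OF s(1)])
      show "A s \<subseteq> {z. f v + f s - R \<le> f z \<and> f z \<le> f v + f s + R}" by (auto simp: A_def)
      show "g (v + s) \<le> - G" "G \<le> g (v + s + of_nat (2 * k) * t)"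
        using k by (auto simp: g_add gn s(3) simp del: of_nat_mult) 
      show "path_component (path_image r) z z'" unfolding path_component_def using r by blast
      show "path_image r \<subseteq> {z. - G \<le> g z \<and> g z \<le> G}"
        using G by (force simp: axes_nrm[OF ax] abs_le_iff)
      show "f z \<le> f v + f s - R" "f v + f s + R \<le> f z'" using m gt s(2) by auto
    qed
    then show False using sub by (auto simp: A_def)
  qed
qed

subsection \<open>Faces\<close>

lemma nrm_hull2:
  assumes "e \<in> bonds M" "\<And>u v. u \<in> e \<Longrightarrow> v \<in> e \<Longrightarrow> nrm (u - v) \<le> D" "x \<in> convex hull e" "y \<in> convex hull e"
  shows "nrm (x - y) \<le> D"
proof -
  have "nrm (v - y) \<le> D" if v: "v \<in> e" for v
    unfolding nrm_minus_commute[of v y]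
    by (rule nrm_hull[OF assms(1) assms(2)[OF _ v] assms(4)])
  then show ?thesis by (rule nrm_hull[OF assms(1) _ assms(3)])
qed

text \<open>One length for all local errors. The halves are there because a dual step for bonds
  passes through two faces; in this way every step, occupied or dual, has length at most
  \<open>mesh\<close>.\<close>

definition mesh :: real where
  "mesh = (SOME D. 1 \<le> D \<and> a \<le> D \<and>
     (\<forall>e\<in>bonds M. \<forall>u\<in>convex hull e. \<forall>v\<in>convex hull e. nrm (u - v) \<le> D / 2) \<and>
     (\<forall>F\<in>faces M. \<forall>u\<in>closure F. \<forall>v\<in>closure F. nrm (u - v) \<le> D / 2))"

lemma mesh_ex: "1 \<le> mesh \<and> a \<le> mesh \<and>
     (\<forall>e\<in>bonds M. \<forall>u\<in>convex hull e. \<forall>v\<in>convex hull e. nrm (u - v) \<le> mesh / 2) \<and>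
     (\<forall>F\<in>faces M. \<forall>u\<in>closure F. \<forall>v\<in>closure F. nrm (u - v) \<le> mesh / 2)"
  unfolding mesh_def
proof (rule someI_ex)
  obtain B where B: "\<forall>e\<in>bonds M. \<forall>u\<in>e. \<forall>v\<in>e. nrm (u - v) \<le> B" using bond_length_bound by blast
  obtain D1 where D1: "\<forall>F\<in>faces M. \<forall>z\<in>F. \<forall>z'\<in>F. c1 z' - c1 z \<le> D1" using face_width_bound[OF axes12] by blast
  obtain D2 where D2: "\<forall>F\<in>faces M. \<forall>z\<in>F. \<forall>z'\<in>F. c2 z' - c2 z \<le> D2" using face_width_bound[OF axes21] by blast
  define D where "D = Max {1, a, 2 * B, 2 * D1, 2 * D2}"
  have D: "1 \<le> D" "a \<le> D" "B \<le> D / 2" "D1 \<le> D / 2" "D2 \<le> D / 2"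
  proof -
    have "x \<le> D" if "x \<in> {1, a, 2 * B, 2 * D1, 2 * D2}" for x
      unfolding D_def by (rule Max_ge) (use that in auto)
    from this[of 1] this[of a] this[of "2 * B"] this[of "2 * D1"] this[of "2 * D2"]
    show "1 \<le> D" "a \<le> D" "B \<le> D / 2" "D1 \<le> D / 2" "D2 \<le> D / 2" by auto
  qed
  have "nrm (u - v) \<le> D / 2" if F: "F \<in> faces M" "u \<in> closure F" "v \<in> closure F" for F u v
  proof -
    have 1: "nrm (x - y) \<le> D / 2" if "x \<in> F" "y \<in> F" for x y
    proof -
      have "c1 x - c1 y \<le> D1" "c1 y - c1 x \<le> D1" "c2 x - c2 y \<le> D2" "c2 y - c2 x \<le> D2"
        using D1 D2 F(1) that by auto
      then show ?thesis
        using D(4,5) unfolding nrm_eq linear_diff[OF linear_c1] linear_diff[OF linear_c2]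
        by (intro max.boundedI) linarith+
    qed
    have cl: "closed {z. nrm (z - w) \<le> D / 2}" for w
    proof -
      have "continuous_on UNIV (\<lambda>z. max \<bar>c1 (z - w)\<bar> \<bar>c2 (z - w)\<bar>)"
        unfolding coord1_def coord2_def divide_inverse by (intro continuous_intros)
      then show ?thesis unfolding nrm_eq by (intro closed_Collect_le) auto
    qed
    have "closure F \<subseteq> {z. nrm (z - y) \<le> D / 2}" if "y \<in> F" for y
      by (rule closure_minimal[OF _ cl]) (use 1 that in auto)
    then have "F \<subseteq> {z. nrm (z - u) \<le> D / 2}" using F(2) nrm_minus_commute by fastforce
    then have "closure F \<subseteq> {z. nrm (z - u) \<le> D / 2}" by (rule closure_minimal[OF _ cl])
    then show ?thesis using F(3) nrm_minus_commute[of u v] by auto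
  qed
  moreover have "nrm (u - v) \<le> D / 2" if "e \<in> bonds M" "u \<in> convex hull e" "v \<in> convex hull e" for e u v
  proof (rule nrm_hull2[OF that(1) _ that(2,3)])
    show "nrm (x - y) \<le> D / 2" if "x \<in> e" "y \<in> e" for x y
      using B D(3) \<open>e \<in> bonds M\<close> that by fastforce
  qed
  ultimately show "\<exists>D. 1 \<le> D \<and> a \<le> D \<and>
     (\<forall>e\<in>bonds M. \<forall>u\<in>convex hull e. \<forall>v\<in>convex hull e. nrm (u - v) \<le> D / 2) \<and>
     (\<forall>F\<in>faces M. \<forall>u\<in>closure F. \<forall>v\<in>closure F. nrm (u - v) \<le> D / 2)"
    using D by blast
qed

lemma mesh_ge: "1 \<le> mesh" "a \<le> mesh"
  and mesh_hull: "e \<in> bonds M \<Longrightarrow> u \<in> convex hull e \<Longrightarrow> v \<in> convex hull e \<Longrightarrow> nrm (u - v) \<le> mesh / 2"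
  and mesh_face: "F \<in> faces M \<Longrightarrow> u \<in> closure F \<Longrightarrow> v \<in> closure F \<Longrightarrow> nrm (u - v) \<le> mesh / 2"
  using mesh_ex by auto

lemma axes_le: "axes f g \<Longrightarrow> nrm (x - y) \<le> D \<Longrightarrow> \<bar>f x - f y\<bar> \<le> D"
  using linear_diff[of f x y] axes_linear by (auto simp: axes_nrm)

lemma occupied_step_length:
  "occupied_step M \<omega> x y \<Longrightarrow> nrm (x - y) \<le> mesh"
  using mesh_hull[of "{x, y}" x y] hull_inc[of _ "{x, y}"] mesh_ge
  unfolding occupied_step_def by fastforce

lemma dual_open_step_length:
  assumes "dual_open_step M \<omega> x y"
  shows "nrm (x - y) \<le> mesh"
proof (cases "kind M")
  case Site
  then consider "{x, y} \<in> bonds M" | F where "F \<in> faces M" "x \<in> frontier F" "y \<in> frontier F"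
    using assms by (auto simp: dual_open_step_def)
  then show ?thesis
  proof cases
    case 1
    then show ?thesis using mesh_hull[of "{x, y}" x y] hull_inc[of _ "{x, y}"] mesh_ge by fastforce
  next
    case 2
    then show ?thesis using mesh_face[of F x y] mesh_ge by (simp add: frontier_def)
  qed
next
  case Bond
  then obtain F G e where F: "F \<in> faces M" "G \<in> faces M" "e \<in> bonds M" "x \<in> F" "y \<in> G"
    "convex hull e \<subseteq> frontier F \<inter> frontier G"
    using assms by (auto simp: dual_open_step_def)
  obtain w where "w \<in> e" using F(3) by (auto elim: bond_cases)
  then have "w \<in> closure F" "w \<in> closure G" using F(6) hull_inc[of w e] by (auto simp: frontier_def)
  moreover have "x \<in> closure F" "y \<in> closure G" using F closure_subset by auto
  ultimately have "nrm (x - w) \<le> mesh / 2" "nrm (w - y) \<le> mesh / 2"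
    using mesh_face[OF F(1)] mesh_face[OF F(2)] by blast+
  then show ?thesis using nrm_triangle'[of x y w] by simp
qed

lemma bond_line:
  assumes "e \<in> bonds M"
  shows "\<exists>n c. n \<noteq> 0 \<and> convex hull e \<subseteq> {x. n \<bullet> x = c}"
proof -
  obtain u v where e: "e = {u, v}" "u \<noteq> v" using assms by (auto elim: bond_cases)
  have "(\<i> * (v - u)) \<bullet> v = (\<i> * (v - u)) \<bullet> u" by (simp add: inner_complex_def algebra_simps)
  then have "convex hull e \<subseteq> {x. (\<i> * (v - u)) \<bullet> x = (\<i> * (v - u)) \<bullet> u}"
    unfolding e by (intro hull_minimal convex_hyperplane) auto
  moreover have "\<i> * (v - u) \<noteq> 0" using e by simp
  ultimately show ?thesis by blast
qed

lemma bounded_finite_lines: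
  assumes "bounded B"
  obtains n c where "finite {e \<in> bonds M. convex hull e \<inter> B \<noteq> {}}"
    "\<forall>e\<in>bonds M. n e \<noteq> 0 \<and> convex hull e \<subseteq> {x. n e \<bullet> x = c e}"
    "negligible (\<Union>e\<in>{e \<in> bonds M. convex hull e \<inter> B \<noteq> {}}. {x. n e \<bullet> x = c e})"
proof -
  have "\<forall>e\<in>bonds M. \<exists>nc. fst nc \<noteq> 0 \<and> convex hull e \<subseteq> {x. fst nc \<bullet> x = snd nc}"
    using bond_line by simp
  then obtain nc where "\<forall>e\<in>bonds M. fst (nc e) \<noteq> 0 \<and> convex hull e \<subseteq> {x. fst (nc e) \<bullet> x = snd (nc e)}"
    by metis
  moreover have "finite {e \<in> bonds M. convex hull e \<inter> B \<noteq> {}}" using assms by (rule finite_bonds_meeting)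
  ultimately show thesis
    by (intro that[of "\<lambda>e. fst (nc e)" "\<lambda>e. snd (nc e)"] negligible_Union)
      (auto intro!: negligible_hyperplane)
qed

text \<open>Two faces meeting a ball are distinguished by the sides of the finitely many lines, spanned by the
  bonds meeting the ball, on which they have a point.\<close>

lemma finite_faces_meeting:
  assumes "bounded B"
  shows "finite {F \<in> faces M. closure F \<inter> B \<noteq> {}}"
proof -
  obtain R where R: "B \<subseteq> ball 0 R" using assms bounded_subset_ballD by blast
  obtain n c where nc: "finite {e \<in> bonds M. convex hull e \<inter> ball 0 R \<noteq> {}}"
    "\<forall>e\<in>bonds M. n e \<noteq> 0 \<and> convex hull e \<subseteq> {x. n e \<bullet> x = c e}"
    "negligible (\<Union>e\<in>{e \<in> bonds M. convex hull e \<inter> ball 0 R \<noteq> {}}. {x. n e \<bullet> x = c e})"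
    using bounded_finite_lines[OF bounded_ball] by blast
  define E where "E = {e \<in> bonds M. convex hull e \<inter> ball 0 R \<noteq> {}}"
  define \<F> where "\<F> = {F \<in> faces M. F \<inter> ball 0 R \<noteq> {}}"
  have "\<exists>z. z \<in> F \<inter> ball 0 R \<and> (\<forall>e\<in>E. n e \<bullet> z \<noteq> c e)" if "F \<in> \<F>" for F
  proof (rule ccontr)
    assume "\<not> ?thesis"
    then have "F \<inter> ball 0 R \<subseteq> (\<Union>e\<in>E. {x. n e \<bullet> x = c e})" by blast
    then have "negligible (F \<inter> ball 0 R)" using nc(3) negligible_subset unfolding E_def by blast
    moreover have "open (F \<inter> ball 0 R)" using that face_facts(1) by (auto simp: \<F>_def)
    ultimately show False using that open_not_negligible by (auto simp: \<F>_def)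
  qed
  then obtain z where z: "\<And>F. F \<in> \<F> \<Longrightarrow> z F \<in> F \<inter> ball 0 R \<and> (\<forall>e\<in>E. n e \<bullet> z F \<noteq> c e)" by metis
  have "inj_on (\<lambda>F. {e \<in> E. n e \<bullet> z F > c e}) \<F>"
  proof (rule inj_onI, rule ccontr)
    fix F G assume FG: "F \<in> \<F>" "G \<in> \<F>" "{e \<in> E. n e \<bullet> z F > c e} = {e \<in> E. n e \<bullet> z G > c e}" "F \<noteq> G"
    have "closed_segment (z F) (z G) \<inter> drawing M = {}"
    proof (rule ccontr)
      assume "\<not> ?thesis"
      then obtain x e where x: "x \<in> closed_segment (z F) (z G)" "e \<in> bonds M" "x \<in> convex hull e"
        by (auto simp: drawing_def)
      have "closed_segment (z F) (z G) \<subseteq> ball 0 R" using z FG by (intro closed_segment_subset) auto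
      then have eE: "e \<in> E" using x by (auto simp: E_def)
      have xl: "n e \<bullet> x = c e" using x nc(2) by auto
      consider "n e \<bullet> z F > c e" "n e \<bullet> z G > c e" | "n e \<bullet> z F < c e" "n e \<bullet> z G < c e"
        using FG eE z[OF FG(1)] z[OF FG(2)] by (metis (mono_tags, lifting) linorder_neqE_linordered_idom mem_Collect_eq)
      then show False
      proof cases
        case 1
        then have "closed_segment (z F) (z G) \<subseteq> {x. n e \<bullet> x > c e}"
          by (intro closed_segment_subset convex_halfspace_gt) auto
        then show False using x xl by auto
      next
        case 2
        then have "closed_segment (z F) (z G) \<subseteq> {x. n e \<bullet> x < c e}"
          by (intro closed_segment_subset convex_halfspace_lt) auto
        then show False using x xl by auto
      qed
    qed
    moreover have FGf: "F \<in> faces M" "G \<in> faces M" using FG by (auto simp: \<F>_def)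
    ultimately have "closed_segment (z F) (z G) \<subseteq> F"
      using z FG by (intro face_maximal) auto
    then show False using faces_disjoint[OF FGf FG(4)] z[OF FG(2)] by auto
  qed
  moreover have "finite (Pow E)" using nc(1) by (simp add: E_def)
  moreover have "(\<lambda>F. {e \<in> E. n e \<bullet> z F > c e}) ` \<F> \<subseteq> Pow E" by auto
  ultimately have "finite \<F>" by (meson inj_on_finite)
  moreover have "{F \<in> faces M. closure F \<inter> B \<noteq> {}} \<subseteq> \<F>"
  proof
    fix F assume "F \<in> {F \<in> faces M. closure F \<inter> B \<noteq> {}}"
    then have F: "F \<in> faces M" "closure F \<inter> ball 0 R \<noteq> {}" using R by auto
    then have "F \<inter> ball 0 R \<noteq> {}"
      using open_Int_closure_eq_empty[OF open_ball, of 0 R F] by (simp add: Int_commute)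
    then show "F \<in> \<F>" using F by (simp add: \<F>_def)
  qed
  ultimately show ?thesis using finite_subset by blast
qed

text \<open>Inside a ball the drawing lies on finitely many lines, a null set, so \<open>z\<close>
  is a limit of points in faces. Only finitely many faces come near \<open>z\<close>, so the union
  of their closures is closed.\<close>

lemma closure_faces_cover: "\<exists>F\<in>faces M. z \<in> closure F"
proof -
  define \<F> where "\<F> = {F \<in> faces M. closure F \<inter> ball z 1 \<noteq> {}}"
  have fin: "finite \<F>" unfolding \<F>_def by (rule finite_faces_meeting) simp
  have "z \<in> closure (\<Union>\<F>)"
    unfolding closure_approachable
  proof (intro allI impI)
    fix r :: real assume r: "0 < r"
    let ?B = "ball z (min r 1)"
    obtain n c where "finite {e \<in> bonds M. convex hull e \<inter> ?B \<noteq> {}}" and nc: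
      "\<forall>e\<in>bonds M. n e \<noteq> 0 \<and> convex hull e \<subseteq> {x. n e \<bullet> x = c e}"
      "negligible (\<Union>e\<in>{e \<in> bonds M. convex hull e \<inter> ?B \<noteq> {}}. {x. n e \<bullet> x = c e})"
      by (rule bounded_finite_lines[OF bounded_ball[of z "min r 1"]])
    have "\<not> ?B \<subseteq> (\<Union>e\<in>{e \<in> bonds M. convex hull e \<inter> ?B \<noteq> {}}. {x. n e \<bullet> x = c e})"
    proof
      assume "?B \<subseteq> (\<Union>e\<in>{e \<in> bonds M. convex hull e \<inter> ?B \<noteq> {}}. {x. n e \<bullet> x = c e})"
      then have "negligible ?B" by (rule negligible_subset[OF nc(2)])
      moreover have "?B \<noteq> {}" using r by simp
      ultimately show False using open_not_negligible[OF open_ball] by blast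
    qed
    then obtain x where x: "x \<in> ?B" "\<And>e. e \<in> bonds M \<Longrightarrow> convex hull e \<inter> ?B \<noteq> {} \<Longrightarrow> n e \<bullet> x \<noteq> c e" by blast
    then have "x \<notin> drawing M" using nc(1) unfolding drawing_def by fastforce
    then obtain F where F: "F \<in> faces M" "x \<in> F" using face_exists by blast
    then have "F \<in> \<F>" using x(1) closure_subset[of F] by (auto simp: \<F>_def)
    then show "\<exists>y\<in>\<Union>\<F>. dist y z < r" using F x(1) by (auto simp: dist_commute)
  qed
  moreover have "closure (\<Union>\<F>) \<subseteq> (\<Union>F\<in>\<F>. closure F)"
    using fin closure_subset by (intro closure_minimal closed_UN) auto
  ultimately show ?thesis by (auto simp: \<F>_def)
qed

text \<open>The points of the open bond that belong to the closure of \<open>F\<close> form a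
  relatively closed and open set, hence all of it. It is open because near an inner point the
  drawing is just a straight segment: a nearby point of \<open>F\<close> is off its line and sees
  all nearby points of the bond.\<close>

lemma frontier_contains_bond:
  assumes e: "e \<in> bonds M" "x \<in> convex hull e" "x \<notin> sites M" and F: "F \<in> faces M" "x \<in> closure F"
  shows "convex hull e \<subseteq> frontier F"
proof -
  obtain u v where uv: "e = {u, v}" "u \<noteq> v" "u \<in> sites M" "v \<in> sites M" by (rule bond_cases[OF e(1)])
  have hull: "convex hull e = closed_segment u v" by (simp add: uv segment_convex_hull)
  define I where "I = open_segment u v"
  have I: "I \<subseteq> convex hull e" "x \<in> I"
  proof -
    show "I \<subseteq> convex hull e" by (simp add: I_def hull segment_open_subset_closed)
    have "x \<in> closed_segment u v" "x \<noteq> u" "x \<noteq> v" using e(2,3) uv(3,4) hull by auto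
    then show "x \<in> I" by (simp add: I_def open_segment_def)
  qed
  define O' where "O' = (\<Union>e'\<in>bonds M - {e}. convex hull e')"
  have closedO: "closed O'" unfolding O'_def by (rule closed_Union_hulls) auto
  have IO: "I \<inter> O' = {}"
  proof -
    have "y \<notin> convex hull e'" if "y \<in> I" "e' \<in> bonds M" "e' \<noteq> e" for y e'
      using hull_Int[OF e(1) that(2)] that I(1) unfolding I_def uv open_segment_def by auto
    then show ?thesis by (auto simp: O'_def)
  qed
  have dr: "drawing M = convex hull e \<union> O'" using e(1) by (auto simp: drawing_def O'_def)
  define d where "d = v - u"
  have d0: "d \<noteq> 0" using uv by (simp add: d_def)
  have par: "\<exists>s. y = u + s *\<^sub>R d \<and> 0 \<le> s \<and> s \<le> 1" if "y \<in> convex hull e" for y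
    using that unfolding hull in_segment d_def by (auto simp: algebra_simps)
  have loc: "\<exists>\<delta>>0. ball y \<delta> \<inter> I \<subseteq> closure F" if y: "y \<in> I" "y \<in> closure F" for y
  proof -
    obtain s where s: "0 < s" "s < 1" "y = u + s *\<^sub>R d"
      using y(1) uv(2) unfolding I_def in_segment d_def by (auto simp: algebra_simps)
    obtain \<delta>1 where \<delta>1: "\<delta>1 > 0" "ball y \<delta>1 \<inter> O' = {}"
    proof -
      have "open (- O')" "y \<in> - O'" using closedO IO y(1) by auto
      then obtain r where "r > 0" "ball y r \<subseteq> - O'" by (rule openE)
      then show thesis by (intro that[of r]) auto
    qed
    \<comment> \<open>\<open>\<delta>1\<close> keeps away from all other bonds; the second bound
      ensures that points of the ball on the line through the bond belong to the bond.\<close>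
    define \<delta> where "\<delta> = min \<delta>1 (min s (1 - s) * norm d)"
    have \<delta>: "\<delta> > 0" using \<delta>1 s d0 by (simp add: \<delta>_def)
    obtain w where w: "w \<in> F" "w \<in> ball y \<delta>"
      using y(2) \<delta> unfolding closure_approachable by (auto simp: dist_commute)
    have wd: "w \<notin> drawing M" using face_facts(4)[OF F(1)] w by blast
    have wl: "w \<noteq> u + r *\<^sub>R d" for r
    proof
      assume wr: "w = u + r *\<^sub>R d"
      have "dist y w = \<bar>s - r\<bar> * norm d"
        by (simp add: dist_norm s(3) wr scaleR_diff_left[symmetric])
      then have "\<bar>s - r\<bar> * norm d < min s (1 - s) * norm d" using w(2) by (simp add: \<delta>_def)
      then have "\<bar>s - r\<bar> < min s (1 - s)" using d0 by simp
      then have "0 \<le> r" "r \<le> 1" by auto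
      then have "w \<in> convex hull e" unfolding hull in_segment wr d_def by (auto simp: algebra_simps)
      then show False using wd dr by blast
    qed
    have "y' \<in> closure F" if y': "y' \<in> ball y \<delta>" "y' \<in> I" for y'
    proof -
      obtain s' where s': "y' = u + s' *\<^sub>R d" using par[of y'] y' I(1) by blast
      \<comment> \<open>A second point of the bond on this segment would put \<open>w\<close> on the
        line through the bond.\<close>
      have "q \<notin> drawing M" if q: "q \<in> closed_segment y' w" "q \<noteq> y'" for q
      proof
        assume qd: "q \<in> drawing M"
        have "closed_segment y' w \<subseteq> ball y \<delta>" using y' w by (intro closed_segment_subset) auto
        then have "q \<in> ball y \<delta>1" using q(1) by (auto simp: \<delta>_def)
        then have "q \<in> convex hull e" using qd \<delta>1(2) dr by blast
        then obtain t where t: "q = u + t *\<^sub>R d" using par by blast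
        obtain \<tau> where \<tau>: "0 \<le> \<tau>" "q = (1 - \<tau>) *\<^sub>R y' + \<tau> *\<^sub>R w" using q(1) by (auto simp: in_segment)
        have "\<tau> \<noteq> 0" using \<tau> q(2) by auto
        have "\<tau> *\<^sub>R w = q - (1 - \<tau>) *\<^sub>R y'" using \<tau>(2) by simp
        also have "\<dots> = \<tau> *\<^sub>R u + (t - (1 - \<tau>) * s') *\<^sub>R d"
          unfolding t s' by (simp add: algebra_simps)
        also have "\<dots> = \<tau> *\<^sub>R (u + ((t - (1 - \<tau>) * s') / \<tau>) *\<^sub>R d)"
          using \<open>\<tau> \<noteq> 0\<close> by (simp add: scaleR_add_right)
        finally have "w = u + ((t - (1 - \<tau>) * s') / \<tau>) *\<^sub>R d" using \<open>\<tau> \<noteq> 0\<close> by simp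
        then show False using wl by blast
      qed
      moreover have "y' \<notin> closed_segment z w" if "z \<in> open_segment y' w" for z
      proof
        assume "y' \<in> closed_segment z w"
        then have "dist z w = dist z y' + dist y' w" by (metis between between_mem_segment)
        moreover have "z \<in> closed_segment y' w" using that by (simp add: open_segment_def)
        then have "dist y' w = dist y' z + dist z w" by (metis between between_mem_segment)
        moreover have "z \<noteq> y'" using that by (auto simp: open_segment_def)
        then have "0 < dist y' z" by simp
        ultimately show False by (simp add: dist_commute)
      qed
      moreover have "closed_segment z w \<subseteq> closed_segment y' w" if "z \<in> open_segment y' w" for z
        using that by (simp add: open_segment_def subset_closed_segment)
      ultimately have "closed_segment z w \<inter> drawing M = {}" if "z \<in> open_segment y' w" for z
        using that by blast
      then have "closed_segment z w \<subseteq> F" if "z \<in> open_segment y' w" for z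
        using face_maximal[OF F(1), of "closed_segment z w"] that w(1) by auto
      then have "open_segment y' w \<subseteq> F" by auto
      then have "closure (open_segment y' w) \<subseteq> closure F" by (rule closure_mono)
      moreover have "y' \<noteq> w" using wl s' by blast
      ultimately show ?thesis by (auto simp: closure_open_segment)
    qed
    then show ?thesis using \<delta> by blast
  qed
  have "openin (top_of_set I) (I \<inter> closure F)"
    unfolding openin_contains_ball using loc by (auto; blast)
  moreover have "closedin (top_of_set I) (I \<inter> closure F)" by (simp add: closedin_closed_Int)
  moreover have "connected I" unfolding I_def by (rule convex_connected[OF convex_open_segment])
  ultimately have "I \<inter> closure F = {} \<or> I \<inter> closure F = I" unfolding connected_clopen by blast
  then have "I \<subseteq> closure F" using I(2) F(2) by blast
  then have "closure I \<subseteq> closure F" by (simp add: closure_minimal)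
  then have "convex hull e \<subseteq> closure F" using uv(2) by (simp add: I_def hull closure_open_segment)
  moreover have "convex hull e \<inter> F = {}" using face_facts(4)[OF F(1)] e(1) by (auto simp: drawing_def)
  ultimately show ?thesis using face_facts(1)[OF F(1)] by (auto simp: frontier_def interior_open)
qed

subsection \<open>Intersecting and blocking paths\<close>

text \<open>Turns sites and steps into a subset of the plane, where paths of sites become continuous
  paths.\<close>

definition trace :: "(complex \<Rightarrow> complex \<Rightarrow> bool) \<Rightarrow> complex set \<Rightarrow> complex set" where
  "trace R S = S \<union> (\<Union>e\<in>{{x, y} |x y. x \<in> S \<and> y \<in> S \<and> R x y}. convex hull e)"

lemma linked_reach: "linked R S u v \<Longrightarrow> linked R {x. linked R S u x} u v"
proof (induction rule: linked_induct)
  case base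
  then show ?case by (auto intro!: linked_refl)
next
  case (step x y)
  then have "linked R S u y" using linked_trans linked_step by metis
  then show ?case using step by (auto intro: linked_trans linked_step)
qed

lemma linked_trace:
  assumes "linked R S u v"
  shows "path_component (trace R S) u v"
  using assms
proof (induction rule: linked_induct)
  case base
  then show ?case by (intro path_component_refl) (simp add: trace_def)
next
  case (step x y)
  have "convex hull {x, y} \<subseteq> trace R S"
    using step.hyps unfolding trace_def by blast
  moreover have "path_component (convex hull {x, y}) x y"
    by (rule path_connected_component[THEN iffD1, OF convex_imp_path_connected, rule_format])
      (auto intro: hull_inc)
  ultimately have "path_component (trace R S) x y" by (rule path_component_of_subset)
  then show ?case using step.IH path_component_trans by blast
qed

lemma trace_strip:
  fixes f :: "complex \<Rightarrow> real"
  assumes "linear f" "S \<subseteq> {z. lo \<le> f z \<and> f z \<le> hi}"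
  shows "trace R S \<subseteq> {z. lo \<le> f z \<and> f z \<le> hi}"
proof
  fix z assume "z \<in> trace R S"
  then consider "z \<in> S" | x y where "x \<in> S" "y \<in> S" "z \<in> convex hull {x, y}"
    by (auto simp: trace_def)
  then show "z \<in> {z. lo \<le> f z \<and> f z \<le> hi}"
  proof cases
    case 2
    then show ?thesis using hull_strip[OF assms(1) 2(3), of lo hi] assms(2) by auto
  qed (use assms in auto)
qed

lemma trace_cases:
  assumes "z \<in> trace (occupied_step M \<omega>) S"
  obtains "z \<in> S" | e where "e \<in> bonds M" "e \<subseteq> S" "z \<in> convex hull e" "kind M = Bond \<Longrightarrow> \<omega> e"
proof -
  consider "z \<in> S" | x y where "x \<in> S" "y \<in> S" "occupied_step M \<omega> x y" "z \<in> convex hull {x, y}"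
    using assms by (auto simp: trace_def)
  then show thesis
  proof cases
    case 2
    then show thesis using that(2)[of "{x, y}"] by (auto simp: occupied_step_def)
  qed (use that in blast)
qed

lemma trace_sites:
  assumes "z \<in> trace (occupied_step M \<omega>) S" "z \<in> sites M"
  shows "z \<in> S"
  using assms(1)
proof (cases rule: trace_cases)
  case (2 e)
  then show ?thesis using hull_sites[OF 2(1)] assms(2) by blast
qed

lemma closed_trace:
  assumes "S \<subseteq> sites M"
  shows "closed (trace (occupied_step M \<omega>) S)"
proof -
  have "closed S"
  proof (rule closed_if_closed_Int_cball)
    fix R
    have "finite (sites M \<inter> cball 0 R)" by (rule finite_sites) simp
    then show "closed (S \<inter> cball 0 R)" 
      by (intro finite_imp_closed) (rule finite_subset[OF _ \<open>finite (sites M \<inter> cball 0 R)\<close>], use assms in auto)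
  qed
  moreover have "closed (\<Union>e\<in>{{x, y} |x y. x \<in> S \<and> y \<in> S \<and> occupied_step M \<omega> x y}. convex hull e)"
    by (rule closed_Union_hulls) (auto simp: occupied_step_def)
  ultimately show ?thesis unfolding trace_def by (rule closed_Un)
qed

text \<open>Distinct bonds meet only in common end points, so two drawn paths cannot cross without
  sharing a site.\<close>

lemma traces_meet:
  assumes "S \<subseteq> sites M" "T \<subseteq> sites M"
    "trace (occupied_step M \<omega>) S \<inter> trace (occupied_step M \<omega>) T \<noteq> {}"
  shows "S \<inter> T \<noteq> {}"
proof -
  obtain z where z: "z \<in> trace (occupied_step M \<omega>) S" "z \<in> trace (occupied_step M \<omega>) T"
    using assms(3) by blast
  show ?thesis
  proof (cases "z \<in> sites M")
    case True
    then show ?thesis using z trace_sites by blast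
  next
    case False
    then obtain e where e: "e \<in> bonds M" "e \<subseteq> S" "z \<in> convex hull e"
      using z(1) assms(1) by (elim trace_cases) auto
    obtain e' where e': "e' \<in> bonds M" "e' \<subseteq> T" "z \<in> convex hull e'"
      using False z(2) assms(2) by (elim trace_cases) auto
    have "e = e'"
    proof (rule ccontr)
      assume "e \<noteq> e'"
      then have "z \<in> e" using hull_Int[OF e(1) e'(1)] e(3) e'(3) by blast
      then show False using False e(2) assms(1) by blast
    qed
    moreover have "e \<noteq> {}" using e(1) by (auto elim: bond_cases)
    ultimately show ?thesis using e(2) e'(2) by blast
  qed
qed

lemma occupied_sites_subset: "occupied_sites M \<omega> \<subseteq> sites M"
  by (auto simp: occupied_site_def)

lemma occupied_crossings_meet:
  assumes ax: "axes f g"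
    and 1: "linked (occupied_step M \<omega>) (occupied_sites M \<omega> \<inter> {z. c \<le> g z \<and> g z \<le> d}) u v" "f u \<le> b" "b' \<le> f v"
    and 2: "linked (occupied_step M \<omega>) (occupied_sites M \<omega> \<inter> {z. b \<le> f z \<and> f z \<le> b'}) u' v'" "g u' \<le> c" "d \<le> g v'"
  shows "\<exists>x. linked (occupied_step M \<omega>) (occupied_sites M \<omega>) u x \<and> linked (occupied_step M \<omega>) (occupied_sites M \<omega>) u' x"
proof -
  interpret oblique f g using ax by (rule axes_oblique)
  let ?R = "occupied_step M \<omega>"
  define S where "S = {x. linked ?R (occupied_sites M \<omega> \<inter> {z. c \<le> g z \<and> g z \<le> d}) u x}"
  define T where "T = {x. linked ?R (occupied_sites M \<omega> \<inter> {z. b \<le> f z \<and> f z \<le> b'}) u' x}"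
  have sub: "S \<subseteq> occupied_sites M \<omega> \<inter> {z. c \<le> g z \<and> g z \<le> d}" "T \<subseteq> occupied_sites M \<omega> \<inter> {z. b \<le> f z \<and> f z \<le> b'}"
    unfolding S_def T_def by (auto dest!: linked_in(2))
  have "trace ?R T \<inter> trace ?R S \<noteq> {}"
  proof (rule strip_paths_meet)
    show "path_component (trace ?R T) u' v'" unfolding T_def by (intro linked_trace linked_reach 2)
    show "path_component (trace ?R S) u v" unfolding S_def by (intro linked_trace linked_reach 1)
    show "trace ?R T \<subseteq> {z. b \<le> f z \<and> f z \<le> b'}" by (rule trace_strip[OF linf]) (use sub(2) in auto)
    show "trace ?R S \<subseteq> {z. c \<le> g z \<and> g z \<le> d}" by (rule trace_strip[OF ling]) (use sub(1) in auto)
  qed (use 1 2 in auto)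
  moreover have "S \<subseteq> sites M" "T \<subseteq> sites M" using sub occupied_sites_subset[of \<omega>] by auto
  ultimately have "T \<inter> S \<noteq> {}" using traces_meet by blast
  then obtain x where "x \<in> S" "x \<in> T" by blast
  then have "linked ?R (occupied_sites M \<omega>) u x" "linked ?R (occupied_sites M \<omega>) u' x"
    unfolding S_def T_def by (auto elim: linked_mono)
  then show ?thesis by blast
qed

text \<open>A dual path becomes a continuous path in \<open>\<Omega>\<close>, the open strip without
  the drawn occupied path: it runs through faces, along bonds with vacant end points, or across the
  midpoint of a vacant bond. Such a path would have to meet the occupied one. The margin
  \<open>mesh\<close> leaves room for the continuous path to deviate from the dual sites.\<close>

lemma occupied_blocks_dual:
  assumes ax: "axes f g"
    and 1: "cross (occupied_step M \<omega>) (occupied_sites M \<omega>) g f c d b b'"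
    and 2: "cross (dual_open_step M \<omega>) (dual_open_sites M \<omega>) f g b b' (c + mesh) (d - mesh)"
  shows False
proof -
  interpret oblique f g using ax by (rule axes_oblique)
  let ?R = "occupied_step M \<omega>"
  let ?S = "occupied_sites M \<omega> \<inter> {z. b \<le> f z \<and> f z \<le> b'}"
  obtain u v where uv: "linked ?R ?S u v" "g u \<le> c" "d \<le> g v" using 1 unfolding cross_def by blast
  let ?T = "dual_open_sites M \<omega> \<inter> {z. c + mesh \<le> g z \<and> g z \<le> d - mesh}"
  obtain u' v' where uv': "linked (dual_open_step M \<omega>) ?T u' v'" "f u' \<le> b" "b' \<le> f v'"
    using 2 unfolding cross_def by blast
  define K where "K = trace ?R ?S"
  have "?S \<subseteq> sites M" using occupied_sites_subset by blast
  then have clK: "closed K" unfolding K_def by (rule closed_trace)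
  define \<Omega> where "\<Omega> = - K \<inter> {z. c < g z \<and> g z < d}"
  have op: "open \<Omega>"
  proof -
    have "open {z. c < g z \<and> g z < d}" by (intro open_Collect_conj open_Collect_less cont continuous_intros)
    then show ?thesis unfolding \<Omega>_def using clK by (intro open_Int) auto
  qed
  have Kd: "K \<subseteq> drawing M"
  proof
    fix z assume "z \<in> K"
    then show "z \<in> drawing M" unfolding K_def
    proof (cases rule: trace_cases)
      case 1
      then show ?thesis using sites_in_drawing occupied_sites_subset by blast
    next
      case (2 e)
      then show ?thesis by (auto simp: drawing_def)
    qed
  qed
  have near: "z \<in> \<Omega>" if "x \<in> ?T" "z \<notin> K" "nrm (z - x) \<le> mesh / 2" for x z
  proof -
    have "\<bar>g z - g x\<bar> \<le> mesh / 2" by (rule axes_le[OF axes_sym[OF ax] that(3)])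
    moreover have "c + mesh \<le> g x" "g x \<le> d - mesh" using that by auto
    ultimately have "c < g z" "g z < d" using mesh_ge(1) by linarith+
    then show ?thesis using that(2) by (simp add: \<Omega>_def)
  qed
  have vac: "x \<notin> K" if "kind M = Site" "x \<in> ?T" for x
  proof
    assume "x \<in> K"
    moreover have "x \<in> sites M" using that planar by (auto simp: dual_open_site_def planar_lattice_def)
    ultimately have "x \<in> ?S" unfolding K_def by (rule trace_sites)
    then show False using that by (auto simp: occupied_site_def dual_open_site_def)
  qed
  have face: "F \<subseteq> \<Omega>" if F: "F \<in> faces M" "x \<in> closure F" "x \<in> ?T" for F x
  proof
    fix z assume "z \<in> F"
    then have "z \<notin> K" "nrm (z - x) \<le> mesh / 2"
      using face_facts(4)[OF F(1)] Kd closure_subset mesh_face[OF F(1) _ F(2)] by blast+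
    then show "z \<in> \<Omega>" using near F by blast
  qed
  have joined: "path_component \<Omega> x y" if "x \<in> W" "y \<in> W" "open W" "connected W" "W \<subseteq> \<Omega>" for x y W
    using that connected_open_path_connected path_connected_component path_component_of_subset by metis
  \<comment> \<open>A point of \<open>\<Omega>\<close> in the closure of a face has a ball inside
    \<open>\<Omega>\<close> that meets the face.\<close>
  have facep: "path_component \<Omega> x y" if F: "F \<in> faces M" and x: "x \<in> closure F" "x \<in> \<Omega>" and y: "y \<in> F" and sub: "F \<subseteq> \<Omega>" for F x y
  proof -
    obtain \<epsilon> where \<epsilon>: "\<epsilon> > 0" "ball x \<epsilon> \<subseteq> \<Omega>" using op x(2) by (auto elim: openE)
    obtain w where "w \<in> F" "dist w x < \<epsilon>" using x(1) \<epsilon>(1) unfolding closure_approachable by blast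
    then have "F \<inter> ball x \<epsilon> \<noteq> {}" by (auto simp: dist_commute)
    then have "connected (F \<union> ball x \<epsilon>)" using face_facts(2)[OF F] by (intro connected_Un) auto
    then show ?thesis using \<epsilon> y face_facts(1)[OF F] sub by (intro joined[of x "F \<union> ball x \<epsilon>" y]) auto
  qed
  have joint: "path_component \<Omega> x y" if xy: "x \<in> ?T" "y \<in> ?T" "dual_open_step M \<omega> x y" for x y
  proof (cases "kind M")
    case Site
    have xy\<Omega>: "x \<in> \<Omega>" "y \<in> \<Omega>" using near[of x x] near[of y y] vac[OF Site] xy mesh_ge by (auto simp: nrm_eq coord1_def coord2_def)
    consider "{x, y} \<in> bonds M" | F where "F \<in> faces M" "x \<in> frontier F" "y \<in> frontier F"
      using xy Site by (auto simp: dual_open_step_def)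
    then show ?thesis
    proof cases
      case 1
      have "convex hull {x, y} \<subseteq> \<Omega>"
      proof
        fix z assume z: "z \<in> convex hull {x, y}"
        have "z \<notin> K"
        proof
          assume "z \<in> K"
          then show False unfolding K_def
          proof (cases rule: trace_cases)
            case 1
            then have "z \<in> {x, y}" using hull_sites[OF \<open>{x, y} \<in> bonds M\<close>] z occupied_sites_subset by blast
            then show ?thesis using vac[OF Site] xy \<open>z \<in> K\<close> by blast
          next
            case (2 e)
            have "e \<inter> {x, y} = {}"
            proof -
              have "?S \<subseteq> K" by (auto simp: K_def trace_def)
              then show ?thesis using 2(2) vac[OF Site xy(1)] vac[OF Site xy(2)] by blast
            qed
            moreover from this have "e \<noteq> {x, y}" by auto
            ultimately show ?thesis using hull_Int[OF 2(1) \<open>{x, y} \<in> bonds M\<close>] 2(3) z by blast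
          qed
        qed
        then show "z \<in> \<Omega>" using near[OF xy(1)] mesh_hull[OF 1 z hull_inc[of x "{x, y}"]] by simp
      qed
      moreover have "path_component (convex hull {x, y}) x y"
        by (rule path_connected_component[THEN iffD1, OF convex_imp_path_connected, rule_format])
          (auto intro: hull_inc)
      ultimately show ?thesis by (rule path_component_of_subset)
    next
      case 2
      obtain z where z: "z \<in> F" using face_facts(3)[OF 2(1)] by blast
      have cl: "x \<in> closure F" "y \<in> closure F" using 2 by (auto simp: frontier_def)
      have "F \<subseteq> \<Omega>" using face[OF 2(1) cl(1) xy(1)] .
      then have "path_component \<Omega> x z" "path_component \<Omega> y z"
        using facep[OF 2(1)] cl xy\<Omega> z by blast+
      then show ?thesis using path_component_sym path_component_trans by blast
    qed
  next
    case Bond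
    then obtain F G e where F: "F \<in> faces M" "G \<in> faces M" "e \<in> bonds M" "x \<in> F" "y \<in> G"
      "convex hull e \<subseteq> frontier F \<inter> frontier G" "\<not> \<omega> e"
      using xy by (auto simp: dual_open_step_def)
    have xc: "x \<in> closure F" "y \<in> closure G" using F(4,5) closure_subset by blast+
    obtain p q where pq: "e = {p, q}" "p \<noteq> q" "p \<in> sites M" "q \<in> sites M" by (rule bond_cases[OF F(3)])
    \<comment> \<open>The path changes faces at the midpoint of the vacant bond, a point that is no
      site and lies on no other bond.\<close>
    define m where "m = midpoint p q"
    have m: "m \<in> convex hull e" unfolding m_def pq segment_convex_hull[symmetric] by simp
    have "m \<notin> e" using pq by (auto simp: m_def)
    then have ms: "m \<notin> sites M" using hull_sites[OF F(3)] m by blast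
    have "m \<notin> K"
    proof
      assume "m \<in> K"
      then show False unfolding K_def
      proof (cases rule: trace_cases)
        case 1
        then show ?thesis using ms occupied_sites_subset by blast
      next
        case (2 e')
        then have "e' \<noteq> e" using F(7) Bond by auto
        then show ?thesis using hull_Int[OF 2(1) F(3)] m 2(3) \<open>m \<notin> e\<close> by blast
      qed
    qed
    have mc: "m \<in> closure F" "m \<in> closure G" using m F(6) by (auto simp: frontier_def)
    have m\<Omega>: "m \<in> \<Omega>" by (rule near[OF xy(1) \<open>m \<notin> K\<close>]) (rule mesh_face[OF F(1) mc(1) xc(1)])
    have "path_component \<Omega> m x" "path_component \<Omega> m y"
      using facep[OF F(1) mc(1) m\<Omega> F(4)] facep[OF F(2) mc(2) m\<Omega> F(5)] face[OF F(1) xc(1) xy(1)] face[OF F(2) xc(2) xy(2)]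
      by blast+
    then show ?thesis using path_component_sym path_component_trans by blast
  qed
  have start: "u' \<in> \<Omega>"
  proof -
    have uT: "u' \<in> ?T" by (rule linked_in(1)[OF uv'(1)])
    show ?thesis
    proof (cases "kind M")
      case Site
      then show ?thesis using near[OF uT vac[OF Site uT]] mesh_ge by (simp add: nrm_eq coord1_def coord2_def)
    next
      case Bond
      then have "u' \<in> \<Union>(faces M)" using uT planar by (auto simp: dual_open_site_def planar_lattice_def)
      then obtain F where "F \<in> faces M" "u' \<in> F" by blast
      then show ?thesis using face[of F u'] uT closure_subset by blast
    qed
  qed
  have "path_component \<Omega> u' v'" using uv'(1)
  proof (induction rule: linked_induct)
    case base
    then show ?case using start by (simp add: path_component_refl)
  next
    case (step x y)
    show ?case by (rule path_component_trans[OF step.IH joint[OF step.hyps(3,4,2)]])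
  qed
  have "K \<inter> \<Omega> \<noteq> {}"
  proof (rule strip_paths_meet)
    show "path_component K u v" unfolding K_def by (rule linked_trace[OF uv(1)])
    show "K \<subseteq> {z. b \<le> f z \<and> f z \<le> b'}" unfolding K_def by (intro trace_strip linf) auto
    show "\<Omega> \<subseteq> {z. c \<le> g z \<and> g z \<le> d}" by (auto simp: \<Omega>_def)
  qed fact+
  then show False by (auto simp: \<Omega>_def)
qed

subsection \<open>Chains of faces along a connected set\<close>

text \<open>If no face reachable from \<open>L\<close> touched \<open>R\<close>, then
  \<open>L\<close> with the closures of the reachable faces and \<open>R\<close> with the closures
  of the others would split the connected set \<open>X\<close>. A common point of two closures in
  \<open>X \<inter> W\<close> is not a site; on a bond, \<open>frontier_contains_bond\<close> makes
  the two faces adjacent, and off the drawing they coincide.\<close>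

lemma face_chain:
  assumes X: "connected X" "closed L" "closed R" "closed W" "X \<subseteq> L \<union> W \<union> R"
    "X \<inter> L \<noteq> {}" "X \<inter> R \<noteq> {}" "X \<inter> L \<inter> R = {}" "bounded (X \<inter> W)" "X \<inter> W \<inter> sites M = {}"
  defines "\<F> \<equiv> {F \<in> faces M. closure F \<inter> (X \<inter> W) \<noteq> {}}"
  shows "\<exists>F\<in>\<F>. \<exists>G\<in>\<F>. closure F \<inter> (X \<inter> W \<inter> L) \<noteq> {} \<and> closure G \<inter> (X \<inter> W \<inter> R) \<noteq> {} \<and>
    linked (\<lambda>F G. \<exists>e\<in>bonds M. convex hull e \<subseteq> frontier F \<inter> frontier G \<and> convex hull e \<inter> (X \<inter> W) \<noteq> {}) \<F> F G"
proof (rule ccontr)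
  define adj where "adj F G \<longleftrightarrow> (\<exists>e\<in>bonds M. convex hull e \<subseteq> frontier F \<inter> frontier G \<and> convex hull e \<inter> (X \<inter> W) \<noteq> {})" for F G
  assume contra: "\<not> ?thesis"
  define T where "T = {G. \<exists>F\<in>\<F>. closure F \<inter> (X \<inter> W \<inter> L) \<noteq> {} \<and> linked adj \<F> F G}"
  have T\<F>: "T \<subseteq> \<F>" unfolding T_def by (auto dest: linked_in)
  have noR: "closure G \<inter> (X \<inter> W \<inter> R) = {}" if "G \<in> T" for G
    using contra that T\<F> unfolding T_def adj_def by blast
  have fin: "finite \<F>" unfolding \<F>_def using X(9) by (rule finite_faces_meeting)
  define A where "A = L \<union> (\<Union>F\<in>T. closure F \<inter> W)"
  define B where "B = R \<union> (\<Union>F\<in>\<F> - T. closure F \<inter> W)"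
  have "closed A" unfolding A_def using X T\<F> fin by (intro closed_Un closed_UN) (auto intro: finite_subset)
  moreover have "closed B" unfolding B_def using X fin by (intro closed_Un closed_UN) auto
  moreover have "X \<subseteq> A \<union> B"
  proof
    fix x assume x: "x \<in> X"
    show "x \<in> A \<union> B"
    proof (cases "x \<in> W")
      case True
      obtain F where F: "F \<in> faces M" "x \<in> closure F" using closure_faces_cover by blast
      then have "F \<in> \<F>" using x True by (auto simp: \<F>_def)
      then show ?thesis using F True by (auto simp: A_def B_def)
    next
      case False
      then show ?thesis using x X(5) by (auto simp: A_def B_def)
    qed
  qed
  moreover have "A \<inter> B \<inter> X = {}"
  proof (rule ccontr)
    assume "A \<inter> B \<inter> X \<noteq> {}"
    then obtain x where x: "x \<in> X" "x \<in> A" "x \<in> B" by blast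
    consider "x \<in> L" "x \<in> R" | F where "x \<in> L" "F \<in> \<F> - T" "x \<in> closure F" "x \<in> W"
      | F where "x \<in> R" "F \<in> T" "x \<in> closure F" "x \<in> W"
      | F G where "F \<in> T" "x \<in> closure F" "x \<in> W" "G \<in> \<F> - T" "x \<in> closure G"
      using x by (auto simp: A_def B_def)
    then show False
    proof cases
      case 1
      then show ?thesis using X(8) x by blast
    next
      case (2 F)
      then have "linked adj \<F> F F" by (intro linked_refl) auto
      then have "F \<in> T" unfolding T_def using 2 x by blast
      then show ?thesis using 2 by blast
    next
      case (3 F)
      then show ?thesis using noR[of F] x by blast
    next
      case (4 F G)
      then have FG: "F \<in> faces M" "G \<in> faces M" "F \<noteq> G" "F \<in> \<F>" "G \<in> \<F>" using T\<F> by (auto simp: \<F>_def)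
      have "x \<in> drawing M"
      proof (rule ccontr)
        assume "x \<notin> drawing M"
        then obtain H where H: "H \<in> faces M" "x \<in> H" using face_exists by blast
        have "H = K" if K: "K \<in> faces M" "x \<in> closure K" for K
        proof -
          have "H \<inter> closure K \<noteq> {}" using H(2) K(2) by blast
          then have "H \<inter> K \<noteq> {}" using open_Int_closure_eq_empty[OF face_facts(1)[OF H(1)]] by blast
          then show ?thesis using faces_disjoint H(1) K(1) by blast
        qed
        then show False using 4 FG by blast
      qed
      then obtain e where e: "e \<in> bonds M" "x \<in> convex hull e" by (auto simp: drawing_def)
      have xs: "x \<notin> sites M" using X(10) x 4 by blast
      have "convex hull e \<subseteq> frontier F" "convex hull e \<subseteq> frontier G"
        using frontier_contains_bond[OF e xs] FG 4 by blast+
      then have "adj F G" unfolding adj_def using e x 4 by blast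
      moreover obtain F0 where F0: "F0 \<in> \<F>" "closure F0 \<inter> (X \<inter> W \<inter> L) \<noteq> {}" "linked adj \<F> F0 F"
        using 4 unfolding T_def by blast
      ultimately have "linked adj \<F> F0 G" using linked_trans linked_step FG by metis
      then have "G \<in> T" unfolding T_def using F0 by blast
      then show ?thesis using 4 by blast
    qed
  qed
  moreover have "A \<inter> X \<noteq> {}" "B \<inter> X \<noteq> {}" using X(6,7) by (auto simp: A_def B_def)
  ultimately show False using X(1) unfolding connected_closed by blast
qed

definition occ_bond :: "config \<Rightarrow> complex set \<Rightarrow> bool" where
  "occ_bond \<omega> e \<longleftrightarrow> e \<in> bonds M \<and> (kind M = Bond \<longrightarrow> \<omega> e) \<and> e \<subseteq> occupied_sites M \<omega>"

lemma dual_site_of_face: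
  assumes "kind M = Bond" "F \<in> faces M"
  obtains w where "w \<in> dual_sites M" "w \<in> F"
  using assms planar unfolding planar_lattice_def by auto

text \<open>A chain of faces across bonds that are not occupied carries a dual path: through the dual sites of the
  faces for bond percolation, and through vacant end points of the bonds for site percolation.\<close>

lemma dual_path_along_faces_bond:
  assumes Bond: "kind M = Bond"
    and chain: "linked (\<lambda>F G. \<exists>e\<in>bonds M. convex hull e \<subseteq> frontier F \<inter> frontier G \<and> \<not> occ_bond \<omega> e) \<F> F G"
    and \<F>: "\<F> \<subseteq> faces M" and S: "\<And>H z. H \<in> \<F> \<Longrightarrow> z \<in> closure H \<Longrightarrow> z \<in> S"
  shows "\<exists>u v. linked (dual_open_step M \<omega>) (dual_open_sites M \<omega> \<inter> S) u v \<and> u \<in> F \<and> v \<in> G"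
    using chain
  proof (induction rule: linked_induct)
    case base
    then obtain w where "w \<in> dual_sites M" "w \<in> F" using dual_site_of_face[OF Bond] \<F> by blast
    then show ?case using S base Bond closure_subset
      by (intro exI[of _ w] conjI linked_refl) (auto simp: dual_open_site_def)
  next
    case (step H K)
    then obtain u v where uv: "linked (dual_open_step M \<omega>) (dual_open_sites M \<omega> \<inter> S) u v" "u \<in> F" "v \<in> H" by blast
    have HK: "H \<in> faces M" "K \<in> faces M" using step.hyps \<F> by auto
    obtain e where e: "e \<in> bonds M" "convex hull e \<subseteq> frontier H \<inter> frontier K" "\<not> occ_bond \<omega> e" using step.hyps by blast
    obtain w where w: "w \<in> dual_sites M" "w \<in> K" using dual_site_of_face[OF Bond HK(2)] by blast
    have ne: "\<not> \<omega> e" using e Bond by (auto simp: occ_bond_def occupied_site_def elim: bond_cases)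
    show ?case
    proof (cases "v = w")
      case True
      then show ?thesis using uv w by blast
    next
      case False
      then have "dual_open_step M \<omega> v w" using Bond HK e ne uv(3) w(2) unfolding dual_open_step_def by auto
      moreover have "w \<in> dual_open_sites M \<omega> \<inter> S" using w S[of K w] step.hyps Bond closure_subset by (auto simp: dual_open_site_def)
      ultimately show ?thesis using uv w linked_trans[OF uv(1) linked_step] linked_in(2)[OF uv(1)] by blast
    qed
  qed

lemma dual_path_along_faces:
  assumes chain: "linked (\<lambda>F G. \<exists>e\<in>bonds M. convex hull e \<subseteq> frontier F \<inter> frontier G \<and> \<not> occ_bond \<omega> e) \<F> F G"
    and \<F>: "\<F> \<subseteq> faces M" and FG: "closure F \<inter> closure G = {}"
    and S: "\<And>H z. H \<in> \<F> \<Longrightarrow> z \<in> closure H \<Longrightarrow> z \<in> S"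
  obtains u v where "linked (dual_open_step M \<omega>) (dual_open_sites M \<omega> \<inter> S) u v" "u \<in> closure F" "v \<in> closure G"
proof (cases "kind M")
  case Bond
  have "\<exists>u v. linked (dual_open_step M \<omega>) (dual_open_sites M \<omega> \<inter> S) u v \<and> u \<in> F \<and> v \<in> G"
    by (rule dual_path_along_faces_bond[OF Bond chain \<F> S])
  then obtain u v where uv: "linked (dual_open_step M \<omega>) (dual_open_sites M \<omega> \<inter> S) u v" "u \<in> F" "v \<in> G"
    by (elim exE conjE)
  show thesis by (rule that[OF uv(1) subsetD[OF closure_subset uv(2)] subsetD[OF closure_subset uv(3)]])
next
  case Site
  \<comment> \<open>As long as the chain is at \<open>F\<close> there need not be a crossed bond
    whose vacant end point could start the path. The disjoint closures of \<open>F\<close> and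
    \<open>G\<close> exclude this case at the end.\<close>
  have "G = F \<or> (\<exists>u v. linked (dual_open_step M \<omega>) (dual_open_sites M \<omega> \<inter> S) u v \<and> u \<in> closure F \<and> v \<in> frontier G)"
    using chain
  proof (induction rule: linked_induct)
    case base
    then show ?case by simp
  next
    case (step H K)
    have HK: "H \<in> faces M" "K \<in> faces M" using step.hyps \<F> by auto
    obtain e where e: "e \<in> bonds M" "convex hull e \<subseteq> frontier H \<inter> frontier K" "\<not> occ_bond \<omega> e" using step.hyps by blast
    then obtain w where w: "w \<in> e" "\<not> occupied_site M \<omega> w" using Site by (auto simp: occ_bond_def)
    have wf: "w \<in> frontier H" "w \<in> frontier K" using w(1) e(2) hull_inc[of w e] by auto
    have ws: "w \<in> sites M" using w(1) e(1) by (auto elim: bond_cases)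
    have wS: "w \<in> dual_open_sites M \<omega> \<inter> S"
      using w(2) ws Site planar S[of H w] step.hyps wf(1) 
      by (auto simp: dual_open_site_def occupied_site_def planar_lattice_def frontier_def)
    show ?case
    proof (cases "H = F")
      case True
      then show ?thesis using wf wS linked_refl[OF wS] by (auto simp: frontier_def)
    next
      case False
      then obtain u v where uv: "linked (dual_open_step M \<omega>) (dual_open_sites M \<omega> \<inter> S) u v" "u \<in> closure F" "v \<in> frontier H"
        using step.IH by blast
      have "linked (dual_open_step M \<omega>) (dual_open_sites M \<omega> \<inter> S) v w"
      proof (cases "v = w")
        case True
        then show ?thesis using linked_refl[OF wS] by simp
      next
        case False
        then have "dual_open_step M \<omega> v w" using Site HK uv(3) wf(1) unfolding dual_open_step_def by auto
        then show ?thesis using linked_in(2)[OF uv(1)] wS by (rule linked_step)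
      qed
      then show ?thesis using uv wf linked_trans by metis
    qed
  qed
  moreover have "G \<noteq> F"
  proof
    assume "G = F"
    moreover have "F \<in> faces M" using linked_in(1)[OF chain] \<F> by blast
    ultimately show False using FG face_facts(3)[of F] by auto
  qed
  ultimately show thesis using that by (auto simp: frontier_def)
qed

lemma axes_surj: "axes f g \<Longrightarrow> \<exists>z. f z = x \<and> g z = y"
  unfolding axes_def using c1_combo c2_combo by metis

lemma convex_nrm_ball: "convex {z. nrm z \<le> \<epsilon>}"
proof -
  have "{z. nrm z \<le> \<epsilon>} = c1 -` {-\<epsilon>..\<epsilon>} \<inter> c2 -` {-\<epsilon>..\<epsilon>}" by (auto simp: nrm_eq abs_le_iff)
  then show ?thesis
    by (simp add: convex_Int convex_linear_vimage linear_c1 linear_c2 convex_real_interval)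
qed

lemma continuous_nrm: "continuous_on S nrm"
  unfolding nrm_eq[abs_def] coord1_def coord2_def divide_inverse by (intro continuous_intros)

lemma compact_nrm_ball: "compact {z. nrm z \<le> \<epsilon>}"
proof -
  have "closed {z. nrm z \<le> \<epsilon>}" by (intro closed_Collect_le continuous_nrm continuous_intros)
  moreover have "bounded {z. nrm z \<le> \<epsilon>}" by (auto simp: bounded_iff_nrm)
  ultimately show ?thesis by (simp add: compact_eq_bounded_closed)
qed

lemma open_nrm_ball: "open {z. nrm (z - y) < \<epsilon>}"
  by (intro open_Collect_less continuous_on_compose2[OF continuous_nrm] continuous_intros) auto

text \<open>The dual path runs along the boundary of a thin neighbourhood of everything that is connected to the
  lower side. This boundary is connected, since the frontier of a component of the complement of a connected
  set in the plane is connected.\<close>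

lemma dual_crossing_exists:
  assumes ax: "axes f g" and cd: "c < d" and bb: "b + 4 * mesh \<le> b'"
    and no: "\<not> cross (occupied_step M \<omega>) (occupied_sites M \<omega>) g f c d b b'"
  shows "cross (dual_open_step M \<omega>) (dual_open_sites M \<omega>) f g (b + 2 * mesh) (b' - 2 * mesh) (c - 2 * mesh) (d + 2 * mesh)"
proof -
  interpret oblique f g using ax by (rule axes_oblique)
  let ?R = "occupied_step M \<omega>"
  let ?S = "occupied_sites M \<omega> \<inter> {z. b \<le> f z \<and> f z \<le> b'}"
  define SA where "SA = {v. \<exists>u. linked ?R ?S u v \<and> g u \<le> c}"
  have SA: "SA \<subseteq> ?S" unfolding SA_def by (auto dest!: linked_in(2))
  have SAd: "g v < d" if "v \<in> SA" for v using that no unfolding SA_def cross_def by force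
  have SA_step: "v \<in> SA" if h: "u \<in> SA" "?R u v" "v \<in> ?S" for u v
  proof -
    obtain u0 where u0: "linked ?R ?S u0 u" "g u0 \<le> c" using h(1) unfolding SA_def by blast
    have "linked ?R ?S u v" using h(2) linked_in(2)[OF u0(1)] h(3) by (rule linked_step)
    then have "linked ?R ?S u0 v" by (rule linked_trans[OF u0(1)])
    then show ?thesis using u0(2) unfolding SA_def by blast
  qed
  have SA_start: "v \<in> SA" if "v \<in> ?S" "g v \<le> c" for v
    using that linked_refl[of v ?S ?R] unfolding SA_def by blast
  \<comment> \<open>The half-plane below the lower side joins the clusters in \<open>SA\<close> to a
    single connected set \<open>A0\<close>.\<close>
  define H0 where "H0 = {z. g z \<le> c}"
  define A0 where "A0 = H0 \<union> trace ?R SA"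
  have clH0: "closed H0" unfolding H0_def by (intro closed_Collect_le cont continuous_intros)
  have cvH0: "convex H0"
  proof -
    have "H0 = g -` {..c}" by (auto simp: H0_def)
    then show ?thesis by (simp add: convex_linear_vimage ling convex_real_interval)
  qed
  have "SA \<subseteq> sites M" using SA occupied_sites_subset by blast
  then have clA0: "closed A0" unfolding A0_def using clH0 by (intro closed_Un closed_trace)
  have A0d: "g z \<le> d" if zA: "z \<in> A0" for z
  proof -
    have "g z \<le> d" if "z \<in> trace ?R SA"
      using that
    proof (cases rule: trace_cases)
      case (2 e)
      have "convex (g -` {..d})" by (simp add: convex_linear_vimage ling convex_real_interval)
      moreover have "e \<subseteq> g -` {..d}" using 2(2) SAd by force
      ultimately have "convex hull e \<subseteq> g -` {..d}" by (rule hull_minimal[rotated])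
      then show ?thesis using 2(3) by auto
    qed (use SAd in force)
    then show ?thesis using zA cd by (auto simp: A0_def H0_def)
  qed
  obtain h0 where h0: "h0 \<in> H0" using axes_surj[OF ax, of 0 c] by (auto simp: H0_def)
  have "path_component A0 h0 z" if zA: "z \<in> A0" for z
  proof -
    have H: "path_component A0 h0 z" if "z \<in> H0" for z
    proof -
      have "path_component H0 h0 z"
        using path_connected_component[THEN iffD1, OF convex_imp_path_connected[OF cvH0]] that h0 by blast
      moreover have "H0 \<subseteq> A0" by (simp add: A0_def)
      ultimately show ?thesis by (rule path_component_of_subset[rotated])
    qed
    have S: "path_component A0 h0 v" if v: "v \<in> SA" for v
    proof -
      obtain u where u: "linked ?R ?S u v" "g u \<le> c" using v unfolding SA_def by blast
      have "linked ?R SA u v"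
        by (rule linked_mono[OF linked_reach[OF u(1)]]) (use u(2) in \<open>auto simp: SA_def\<close>)
      then have "path_component A0 u v"
        using linked_trace path_component_of_subset[of "trace ?R SA" A0] by (auto simp: A0_def)
      then show ?thesis using H[of u] u(2) path_component_trans by (auto simp: H0_def)
    qed
    have hull: "path_component A0 h0 z" if e: "e \<in> bonds M" "e \<subseteq> SA" "z \<in> convex hull e" "convex hull e \<subseteq> A0" for e
    proof -
      obtain x where x: "x \<in> e" using e(1) by (auto elim: bond_cases)
      have "path_component (convex hull e) x z"
        using path_connected_component[THEN iffD1, OF convex_imp_path_connected, of "convex hull e"] e(3) hull_inc[OF x] by auto
      then have "path_component A0 x z" by (rule path_component_of_subset[OF e(4)])
      then show ?thesis using S x e(2) path_component_trans by blast
    qed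
    consider "z \<in> H0" | "z \<in> SA" | x y where "x \<in> SA" "y \<in> SA" "?R x y" "z \<in> convex hull {x, y}"
      using zA unfolding A0_def trace_def by blast
    then show ?thesis
    proof cases
      case 3
      then have "convex hull {x, y} \<subseteq> A0" unfolding A0_def trace_def by blast
      then show ?thesis using 3 hull[of "{x, y}"] by (auto simp: occupied_step_def)
    qed (use H S in auto)
  qed
  then have "path_connected A0"
    unfolding path_connected_component by (meson path_component_sym path_component_trans)
  then have cnA0: "connected A0" by (rule path_connected_imp_connected)
  define Q where "Q = {z. b \<le> f z \<and> f z \<le> b' \<and> c - 1 \<le> g z \<and> g z \<le> d + 2}"
  have bQ: "bounded Q"
  proof -
    have "nrm z \<le> \<bar>b\<bar> + \<bar>b'\<bar> + \<bar>c - 1\<bar> + \<bar>d + 2\<bar>" if "z \<in> Q" for z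
      using that unfolding Q_def axes_nrm[OF ax] by auto
    then show ?thesis by (auto simp: bounded_iff_nrm)
  qed
  \<comment> \<open>The sites and bonds of the window that avoid \<open>A0\<close>. They form a
    compact set at positive distance from \<open>A0\<close>, so a sufficiently thin neighbourhood of
    \<open>A0\<close> does not reach them.\<close>
  define U where "U = (sites M \<inter> Q - A0) \<union> (\<Union>e\<in>{e \<in> bonds M. convex hull e \<inter> Q \<noteq> {} \<and> convex hull e \<inter> A0 = {}}. convex hull e)"
  have "compact U"
  proof -
    have "finite (sites M \<inter> Q)" using bQ by (rule finite_sites)
    moreover have "finite {e \<in> bonds M. convex hull e \<inter> Q \<noteq> {} \<and> convex hull e \<inter> A0 = {}}"
      using finite_bonds_meeting[OF bQ] by (rule rev_finite_subset) auto
    ultimately show ?thesis unfolding U_def by (intro compact_Un compact_UN compact_hull finite_imp_compact) auto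
  qed
  moreover have "U \<inter> A0 = {}" unfolding U_def by blast
  ultimately have "\<exists>d>0. \<forall>x\<in>U. \<forall>y\<in>A0. d \<le> dist x y" by (rule separate_compact_closed[OF _ clA0])
  then obtain \<delta> where \<delta>: "\<delta> > 0" "\<forall>x\<in>U. \<forall>y\<in>A0. \<delta> \<le> dist x y" by (elim exE conjE)
  \<comment> \<open>\<open>1 / 2\<close> keeps the neighbourhood below \<open>Top\<close>;
    \<open>\<delta> / 4\<close> keeps it off \<open>U\<close>, since \<open>norm\<close> is at most
    twice \<open>nrm\<close>.\<close>
  define \<epsilon> where "\<epsilon> = min (1 / 2) (\<delta> / 4)"
  have \<epsilon>: "\<epsilon> > 0" "\<epsilon> \<le> 1 / 2" using \<delta>(1) by (auto simp: \<epsilon>_def)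
  have Ufar: "\<epsilon> < nrm (x - y)" if "x \<in> U" "y \<in> A0" for x y
    using bspec[OF bspec[OF \<delta>(2) that(1)] that(2)] norm_le_nrm[of "x - y"] \<delta>(1) by (simp add: dist_norm \<epsilon>_def min_def)
  define A where "A = (\<Union>x\<in>A0. \<Union>y\<in>{z. nrm z \<le> \<epsilon>}. {x + y})"
  have clA: "closed A" unfolding A_def by (rule closed_compact_sums[OF clA0 compact_nrm_ball])
  have cnA: "connected A"
  proof -
    have "A = (\<lambda>p. fst p + snd p) ` (A0 \<times> {z. nrm z \<le> \<epsilon>})" by (auto simp: A_def image_iff; blast)
    moreover have "connected (A0 \<times> {z. nrm z \<le> \<epsilon>})"
      by (intro connected_Times cnA0 convex_connected convex_nrm_ball)
    moreover have "continuous_on (A0 \<times> {z. nrm z \<le> \<epsilon>}) (\<lambda>p. fst p + snd p)" by (intro continuous_intros)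
    ultimately show ?thesis using connected_continuous_image by metis
  qed
  have memA: "x \<in> A" if "y \<in> A0" "nrm (x - y) \<le> \<epsilon>" for x y
    unfolding A_def using that by (intro UN_I[of y] UN_I[of "x - y"]) auto
  define Top where "Top = {z. d + 1 \<le> g z}"
  have "convex Top"
  proof -
    have "Top = g -` {d + 1..}" by (auto simp: Top_def)
    then show ?thesis by (simp add: convex_linear_vimage ling convex_real_interval)
  qed
  moreover have "Top \<subseteq> - A"
  proof
    fix z assume z: "z \<in> Top"
    show "z \<in> - A"
    proof
      assume "z \<in> A"
      then obtain x y where "x \<in> A0" "nrm y \<le> \<epsilon>" "z = x + y" by (auto simp: A_def)
      then show False using A0d[of x] z \<epsilon>(2) by (simp add: Top_def g_add axes_nrm[OF ax])
    qed
  qed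
  moreover have "- A \<noteq> {}"
  proof -
    obtain z where "g z = d + 1" using axes_surj[OF ax] by blast
    then have "z \<in> Top" by (simp add: Top_def)
    then show ?thesis using \<open>Top \<subseteq> - A\<close> by blast
  qed
  ultimately obtain C where C: "C \<in> components (- A)" "Top \<subseteq> C"
    using exists_component_superset[of Top "- A"] convex_connected by blast
  \<comment> \<open>The upper boundary of the neighbourhood \<open>A\<close>. It lies in
    \<open>A\<close>, hence off \<open>U\<close>, but at \<open>nrm\<close>-distance at least
    \<open>\<epsilon>\<close> from \<open>A0\<close>.\<close>
  define X where "X = frontier C"
  have cnX: "connected X" unfolding X_def by (rule connected_frontier_component_complement[OF cnA C(1)])
  have opC: "open C" using open_components[OF _ C(1)] clA by (simp add: open_Compl)
  have XA: "X \<subseteq> A" unfolding X_def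
    using frontier_of_components_closed_complement[OF clA C(1)] clA frontier_subset_closed by blast
  have Xfar: "\<epsilon> \<le> nrm (x - y)" if "x \<in> X" "y \<in> A0" for x y
  proof (rule ccontr)
    assume "\<not> \<epsilon> \<le> nrm (x - y)"
    then have "x \<in> {z. nrm (z - y) < \<epsilon>}" by simp
    moreover have "x \<in> closure C" using that(1) by (simp add: X_def frontier_def)
    ultimately obtain w where "w \<in> C" "nrm (w - y) < \<epsilon>"
      using open_Int_closure_eq_empty[OF open_nrm_ball, of y \<epsilon> C] by blast
    then show False using memA[OF that(2), of w] in_components_subset[OF C(1)] by auto
  qed
  have Xg: "c \<le> g x \<and> g x \<le> d + 1" if x: "x \<in> X" for x
  proof -
    have "x \<notin> A0" using Xfar[OF x, of x] \<epsilon>(1) by (auto simp: nrm_eq coord1_def coord2_def)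
    moreover have "x \<notin> C" using x opC by (simp add: X_def frontier_def interior_open)
    then have "x \<notin> Top" using C(2) by blast
    ultimately show ?thesis by (auto simp: A0_def H0_def Top_def)
  qed
  have XU: "x \<notin> U" if "x \<in> X" for x
  proof
    assume "x \<in> U"
    obtain y z where "y \<in> A0" "nrm z \<le> \<epsilon>" "x = y + z" using XA \<open>x \<in> X\<close> unfolding A_def by blast
    then show False using Ufar[OF \<open>x \<in> U\<close>, of y] by simp
  qed
  have XA0: "x \<notin> A0" if "x \<in> X" for x using Xfar[OF that, of x] \<epsilon>(1) by (auto simp: nrm_eq coord1_def coord2_def)
  define W where "W = {z. b + mesh \<le> f z \<and> f z \<le> b' - mesh}"
  have XWQ: "X \<inter> W \<subseteq> Q" using Xg mesh_ge by (force simp: W_def Q_def)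
  have nosite: "X \<inter> W \<inter> sites M = {}" using XWQ XU XA0 by (auto simp: U_def)
  \<comment> \<open>Such a bond meets \<open>A0\<close>, as \<open>X\<close> avoids
    \<open>U\<close>. If it were occupied, it would have an end in \<open>SA\<close>, then both
    ends, and the whole bond would lie in \<open>A0\<close>, which \<open>X\<close> avoids.\<close>
  have blocked: "\<not> occ_bond \<omega> e" if h: "convex hull e \<inter> (X \<inter> W) \<noteq> {}" for e
  proof
    assume "occ_bond \<omega> e"
    then have e: "e \<in> bonds M" "kind M = Bond \<longrightarrow> \<omega> e" "e \<subseteq> occupied_sites M \<omega>" by (auto simp: occ_bond_def)
    obtain x where x: "x \<in> convex hull e" "x \<in> X" "x \<in> W" using h by blast
    obtain u v where uv: "e = {u, v}" "u \<noteq> v" by (rule bond_cases[OF e(1)])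
    have eS: "e \<subseteq> ?S"
    proof
      fix w assume w: "w \<in> e"
      have "\<bar>f w - f x\<bar> \<le> mesh / 2" by (rule axes_le[OF ax mesh_hull[OF e(1) hull_inc[OF w] x(1)]])
      moreover have "b + mesh \<le> f x" "f x \<le> b' - mesh" using x(3) by (auto simp: W_def)
      ultimately have "b \<le> f w" "f w \<le> b'" using mesh_ge(1) by linarith+
      then show "w \<in> ?S" using w e(3) by auto
    qed
    have st: "?R u v" "?R v u" using e(1,2) uv by (auto simp: occupied_step_def insert_commute)
    have "e \<inter> SA = {}"
    proof (rule ccontr)
      assume "e \<inter> SA \<noteq> {}"
      then have "u \<in> SA" "v \<in> SA" using SA_step st eS uv by blast+
      then have "convex hull e \<subseteq> A0" using st(1) uv unfolding A0_def trace_def by blast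
      then show False using x XA0 by blast
    qed
    moreover have "convex hull e \<inter> A0 \<noteq> {}"
      using XU[OF x(2)] x XWQ e(1) unfolding U_def by blast
    then obtain z where z: "z \<in> convex hull e" "z \<in> A0" by blast
    have "e \<inter> SA \<noteq> {}"
    proof (cases "z \<in> H0")
      case True
      have "\<exists>w\<in>e. g w \<le> c"
      proof (rule ccontr)
        assume "\<not> ?thesis"
        then have "e \<subseteq> g -` {c<..}" by auto
        moreover have "convex (g -` {c<..})" by (simp add: convex_linear_vimage ling convex_real_interval)
        ultimately have "convex hull e \<subseteq> g -` {c<..}" by (rule hull_minimal)
        then show False using z(1) True by (auto simp: H0_def)
      qed
      then show ?thesis using SA_start eS by blast
    next
      case False
      then have "z \<in> trace ?R SA" using z(2) by (simp add: A0_def)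
      then show ?thesis
      proof (cases rule: trace_cases)
        case 1
        then have "z \<in> e" using hull_sites[OF e(1)] z(1) \<open>SA \<subseteq> sites M\<close> by blast
        then show ?thesis using 1 by blast
      next
        case (2 e')
        show ?thesis
        proof (cases "e' = e")
          case True
          then show ?thesis using 2(2) uv by blast
        next
          case False
          then have "z \<in> e' \<inter> e" using hull_Int[OF 2(1) e(1)] 2(3) z(1) by blast
          then show ?thesis using 2(2) by blast
        qed
      qed
    qed
    ultimately show False by blast
  qed
  \<comment> \<open>Every line across the strip runs from \<open>A\<close> at the bottom to
    \<open>C\<close> at the top and so meets the frontier of \<open>C\<close>; in particular
    \<open>X\<close> reaches both \<open>L\<close> and \<open>R\<close>.\<close>
  have line: "X \<inter> {z. f z = s} \<noteq> {}" for s
  proof -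
    have "{z. f z = s} = f -` {s}" by auto
    then have "convex {z. f z = s}" by (simp add: convex_linear_vimage linf)
    then have "connected {z. f z = s}" by (rule convex_connected)
    moreover obtain z1 where "f z1 = s" "g z1 = d + 1" using axes_surj[OF ax] by blast
    then have "z1 \<in> {z. f z = s} \<inter> C" using C(2) by (auto simp: Top_def)
    moreover obtain z2 where z2: "f z2 = s" "g z2 = c" using axes_surj[OF ax] by blast
    then have "z2 \<in> A" using \<epsilon>(1) by (intro memA[of z2]) (auto simp: A0_def H0_def nrm_eq coord1_def coord2_def)
    then have "z2 \<in> {z. f z = s} - C" using z2 in_components_subset[OF C(1)] by blast
    ultimately show ?thesis using connected_Int_frontier[of "{z. f z = s}" C] unfolding X_def by blast
  qed
  define L where "L = {z. f z \<le> b + mesh}"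
  define R where "R = {z. b' - mesh \<le> f z}"
  have b12: "b + mesh + mesh < b' - mesh" using bb mesh_ge by linarith
  obtain F G where FG:
    "closure F \<inter> (X \<inter> W \<inter> L) \<noteq> {}" "closure G \<inter> (X \<inter> W \<inter> R) \<noteq> {}"
    "linked (\<lambda>F G. \<exists>e\<in>bonds M. convex hull e \<subseteq> frontier F \<inter> frontier G \<and> convex hull e \<inter> (X \<inter> W) \<noteq> {})
      {F \<in> faces M. closure F \<inter> (X \<inter> W) \<noteq> {}} F G"
  proof -
    have "closed L" "closed R" unfolding L_def R_def by (intro closed_Collect_le cont continuous_intros)+
    moreover have "closed W" unfolding W_def by (intro closed_Collect_conj closed_Collect_le cont continuous_intros)
    moreover have "X \<subseteq> L \<union> W \<union> R" by (auto simp: L_def R_def W_def)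
    moreover have "X \<inter> L \<noteq> {}" using line[of "b + mesh"] by (auto simp: L_def)
    moreover have "X \<inter> R \<noteq> {}" using line[of "b' - mesh"] by (auto simp: R_def)
    moreover have "X \<inter> L \<inter> R = {}" using b12 mesh_ge by (auto simp: L_def R_def)
    moreover have "bounded (X \<inter> W)" using XWQ bQ bounded_subset by blast
    ultimately show thesis using face_chain[OF cnX _ _ _ _ _ _ _ _ nosite, of L R] that by blast
  qed
  define \<F> where "\<F> = {F \<in> faces M. closure F \<inter> (X \<inter> W) \<noteq> {}}"
  have "linked (\<lambda>F G. \<exists>e\<in>bonds M. convex hull e \<subseteq> frontier F \<inter> frontier G \<and> \<not> occ_bond \<omega> e) \<F> F G"
    using FG(3) unfolding \<F>_def by (rule linked_mono) (use blocked in blast)+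
  moreover have "\<F> \<subseteq> faces M" by (auto simp: \<F>_def)
  moreover have Fn: "F \<in> faces M" "G \<in> faces M" using linked_in[OF FG(3)] by auto
  have Fl: "f z \<le> b + mesh + mesh / 2" if "z \<in> closure F" for z
  proof -
    obtain x where x: "x \<in> closure F" "f x \<le> b + mesh" using FG(1) by (auto simp: L_def)
    show ?thesis using axes_le[OF ax mesh_face[OF Fn(1) that x(1)]] x(2) by linarith
  qed
  have Gr: "b' - mesh - mesh / 2 \<le> f z" if "z \<in> closure G" for z
  proof -
    obtain x where x: "x \<in> closure G" "b' - mesh \<le> f x" using FG(2) by (auto simp: R_def)
    show ?thesis using axes_le[OF ax mesh_face[OF Fn(2) that x(1)]] x(2) by linarith
  qed
  have "closure F \<inter> closure G = {}" using Fl Gr b12 by fastforce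
  moreover have "z \<in> {z. c - 2 * mesh \<le> g z \<and> g z \<le> d + 2 * mesh}" if H: "H \<in> \<F>" "z \<in> closure H" for H z
  proof -
    obtain x where x: "x \<in> closure H" "x \<in> X" "H \<in> faces M" using H(1) by (auto simp: \<F>_def)
    have "c - 2 * mesh \<le> g z" "g z \<le> d + 2 * mesh"
      using axes_le[OF axes_sym[OF ax] mesh_face[OF x(3) H(2) x(1)]] Xg[OF x(2)] mesh_ge(1) by linarith+
    then show ?thesis by simp
  qed
  ultimately obtain u v where uv:
    "linked (dual_open_step M \<omega>) (dual_open_sites M \<omega> \<inter> {z. c - 2 * mesh \<le> g z \<and> g z \<le> d + 2 * mesh}) u v"
    "u \<in> closure F" "v \<in> closure G"
    by (rule dual_path_along_faces)
  then show ?thesis using Fl[of u] Gr[of v] mesh_ge by (intro crossI[OF uv(1)]) linarith+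
qed

subsection \<open>The dual lattice is connected\<close>

lemma countable_sites: "countable (sites M)"
proof -
  have "sites M = (\<Union>n::nat. sites M \<inter> cball 0 (real n))"
  proof (intro equalityI subsetI)
    fix z assume z: "z \<in> sites M"
    obtain n :: nat where n: "norm z \<le> real n" by (rule that[of "nat \<lceil>norm z\<rceil>"]) (rule real_nat_ceiling_ge)
    show "z \<in> (\<Union>n::nat. sites M \<inter> cball 0 (real n))" using z n by (intro UN_I[of n]) auto
  qed auto
  moreover have "countable \<dots>" by (rule countable_UN) (auto intro!: countable_finite[OF finite_sites])
  ultimately show ?thesis by simp
qed

lemma dual_open_sites_vacant: "dual_open_sites M (\<lambda>_. False) = dual_sites M"
  by (auto simp: dual_open_site_def)

lemma dual_sites_site: "kind M = Site \<Longrightarrow> dual_sites M = sites M"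
  using planar by (auto simp: planar_lattice_def)

lemma dual_site_face:
  assumes "kind M = Bond" "w \<in> dual_sites M"
  obtains F where "F \<in> faces M" "w \<in> F"
  using assms planar unfolding planar_lattice_def by auto

lemma dual_site_unique:
  assumes "kind M = Bond" "F \<in> faces M" "w \<in> dual_sites M" "w' \<in> dual_sites M" "w \<in> F" "w' \<in> F"
  shows "w = w'"
  using assms planar unfolding planar_lattice_def by auto

lemma closure_face_unique:
  assumes "F \<in> faces M" "G \<in> faces M" "w \<in> F" "w \<in> closure G"
  shows "F = G"
proof -
  have "F \<inter> closure G \<noteq> {}" using assms by blast
  then have "F \<inter> G \<noteq> {}" using open_Int_closure_eq_empty[OF face_facts(1)[OF assms(1)]] by blast
  then show ?thesis using faces_disjoint assms by blast
qed

text \<open>For bonds, the two points are joined by a curve that avoids the countably many sites,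
  and \<open>face_chain\<close> with \<open>W = UNIV\<close> follows it; with everything vacant,
  each bond on the way can be crossed.\<close>

lemma vacant_dual_connected:
  assumes w: "w \<in> dual_sites M" "w' \<in> dual_sites M"
  shows "linked (dual_open_step M (\<lambda>_. False)) (dual_sites M) w w'"
proof (cases "kind M")
  case Site
  have "(w, w') \<in> {(x, y). {x, y} \<in> bonds M}\<^sup>*"
    using planar w dual_sites_site[OF Site] by (auto simp: planar_lattice_def)
  then show ?thesis
  proof (induction rule: rtrancl_induct)
    case base
    then show ?case using w by (simp add: linked_refl)
  next
    case (step y z)
    then have "{y, z} \<in> bonds M" by simp
    then have "y \<noteq> z" "z \<in> sites M" "{y, z} \<in> bonds M"
      by (auto elim!: bond_cases simp: doubleton_eq_iff)
    then have "dual_open_step M (\<lambda>_. False) y z" "z \<in> dual_sites M"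
      using Site dual_sites_site[OF Site] by (auto simp: dual_open_step_def)
    then have "linked (dual_open_step M (\<lambda>_. False)) (dual_sites M) y z"
      using linked_in(2)[OF step.IH] by (intro linked_step)
    then show ?case by (rule linked_trans[OF step.IH])
  qed
next
  case Bond
  show ?thesis
  proof (cases "w = w'")
    case True
    then show ?thesis using w by (simp add: linked_refl)
  next
    case False
    obtain Fw where Fw: "Fw \<in> faces M" "w \<in> Fw" using dual_site_face[OF Bond w(1)] by blast
    obtain Gw where Gw: "Gw \<in> faces M" "w' \<in> Gw" using dual_site_face[OF Bond w(2)] by blast
    have "w \<in> - sites M" "w' \<in> - sites M"
      using face_facts(4)[OF Fw(1)] face_facts(4)[OF Gw(1)] Fw Gw sites_in_drawing by blast+
    moreover have "path_connected (- sites M)"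
      by (rule path_connected_complement_countable[OF _ countable_sites]) simp
    ultimately obtain p where p: "path p" "path_image p \<subseteq> - sites M" "pathstart p = w" "pathfinish p = w'"
      unfolding path_connected_def by blast
    have ends: "w \<in> path_image p" "w' \<in> path_image p"
      using p(3,4) pathstart_in_path_image pathfinish_in_path_image by metis+
    have bp: "bounded (path_image p \<inter> UNIV)" using bounded_path_image[OF p(1)] by simp
    define \<F> where "\<F> = {F \<in> faces M. closure F \<inter> (path_image p \<inter> UNIV) \<noteq> {}}"
    have "\<exists>F\<in>\<F>. \<exists>G\<in>\<F>. closure F \<inter> (path_image p \<inter> UNIV \<inter> {w}) \<noteq> {} \<and> closure G \<inter> (path_image p \<inter> UNIV \<inter> {w'}) \<noteq> {} \<and>
      linked (\<lambda>F G. \<exists>e\<in>bonds M. convex hull e \<subseteq> frontier F \<inter> frontier G \<and> convex hull e \<inter> (path_image p \<inter> UNIV) \<noteq> {}) \<F> F G"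
      unfolding \<F>_def
      by (rule face_chain[OF connected_path_image[OF p(1)] _ _ _ _ _ _ _ bp]) (use p(2) ends False in auto)
    then obtain F G where FG: "F \<in> \<F>" "G \<in> \<F>" "w \<in> closure F" "w' \<in> closure G"
      "linked (\<lambda>F G. \<exists>e\<in>bonds M. convex hull e \<subseteq> frontier F \<inter> frontier G \<and> convex hull e \<inter> (path_image p \<inter> UNIV) \<noteq> {}) \<F> F G"
      by blast
    have eq: "F = Fw" "G = Gw" using closure_face_unique Fw Gw FG unfolding \<F>_def by blast+
    have "linked (\<lambda>F G. \<exists>e\<in>bonds M. convex hull e \<subseteq> frontier F \<inter> frontier G \<and> \<not> occ_bond (\<lambda>_. False) e) \<F> F G"
      using FG(5) by (rule linked_mono) (use Bond in \<open>auto simp: occ_bond_def\<close>)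
    then have "\<exists>u v. linked (dual_open_step M (\<lambda>_. False)) (dual_open_sites M (\<lambda>_. False) \<inter> UNIV) u v \<and> u \<in> F \<and> v \<in> G"
      by (rule dual_path_along_faces_bond[OF Bond]) (auto simp: \<F>_def)
    then obtain u v where uv: "linked (dual_open_step M (\<lambda>_. False)) (dual_sites M) u v" "u \<in> F" "v \<in> G"
      by (auto simp: dual_open_sites_vacant)
    then have "u = w" "v = w'" using dual_site_unique[OF Bond] Fw Gw w eq linked_in[OF uv(1)] by blast+
    then show ?thesis using uv(1) by simp
  qed
qed

lemma finite_dual_sites:
  assumes "bounded S"
  shows "finite (dual_sites M \<inter> S)"
proof (cases "kind M")
  case Site
  then show ?thesis using finite_sites[OF assms] dual_sites_site by simp
next
  case Bond
  have "\<exists>F. F \<in> faces M \<and> w \<in> F" if "w \<in> dual_sites M" for w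
    using dual_site_face[OF Bond that] by blast
  then obtain \<phi> where \<phi>: "\<And>w. w \<in> dual_sites M \<Longrightarrow> \<phi> w \<in> faces M \<and> w \<in> \<phi> w" by metis
  have "inj_on \<phi> (dual_sites M \<inter> S)"
    by (rule inj_onI) (metis IntD1 \<phi> dual_site_unique[OF Bond])
  moreover have "\<phi> ` (dual_sites M \<inter> S) \<subseteq> {F \<in> faces M. closure F \<inter> S \<noteq> {}}"
    using \<phi> closure_subset by fastforce
  ultimately show ?thesis using finite_faces_meeting[OF assms] inj_on_finite by blast
qed

subsection \<open>Invariance of paths\<close>

lemma face_translate:
  assumes t: "t \<in> period" and F: "F \<in> faces M"
  shows "(\<lambda>z. z + t) ` F \<in> faces M"
proof -
  have conn: "connected ((\<lambda>z. z + s) ` F)" if "F \<in> faces M" for F s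
    by (intro connected_continuous_image face_facts(2)[OF that] continuous_intros)
  have disj: "(\<lambda>z. z + s) ` F \<inter> drawing M = {}" if "F \<in> faces M" "s \<in> period" for F s
    using face_facts(4)[OF that(1)] drawing_translate[OF that(2)] by auto
  obtain z where z: "z \<in> F" using face_facts(3)[OF F] by blast
  then have "z + t \<notin> drawing M" using disj[OF F t] by blast
  then obtain F' where F': "F' \<in> faces M" "z + t \<in> F'" using face_exists by blast
  have "(\<lambda>z. z + t) ` F \<subseteq> F'"
    by (rule face_maximal[OF F'(1) conn[OF F] disj[OF F t]]) (use z F'(2) in blast)
  moreover have "(\<lambda>z. z + - t) ` F' \<subseteq> F"
    by (rule face_maximal[OF F conn[OF F'(1)] disj[OF F'(1) period_minus[OF t]]]) (use z F'(2) in force)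
  then have "F' \<subseteq> (\<lambda>z. z + t) ` F" by (force simp: image_iff)
  ultimately have "(\<lambda>z. z + t) ` F = F'" by blast
  then show ?thesis using F'(1) by simp
qed

lemma dual_step_translate:
  assumes t: "t \<in> period" and st: "dual_open_step M (\<lambda>b. \<omega> ((\<lambda>z. z + t) ` b)) x y"
  shows "dual_open_step M \<omega> (x + t) (y + t)"
proof -
  have fr: "frontier ((\<lambda>z. z + t) ` F) = (\<lambda>z. z + t) ` frontier F" for F
    using frontier_translation[of t F] by (simp add: add.commute)
  have hull: "convex hull ((\<lambda>z. z + t) ` e) = (\<lambda>z. z + t) ` (convex hull e)" for e
    using convex_hull_translation[of t e] by (simp add: add.commute)
  show ?thesis
  proof (cases "kind M")
    case Site
    then consider "x \<noteq> y" "{x, y} \<in> bonds M" | F where "x \<noteq> y" "F \<in> faces M" "x \<in> frontier F" "y \<in> frontier F"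
      using st by (auto simp: dual_open_step_def)
    then show ?thesis
    proof cases
      case 1
      then show ?thesis using bond_translate[OF t, of "{x, y}"] Site by (simp add: dual_open_step_def)
    next
      case 2
      then have "x + t \<in> frontier ((\<lambda>z. z + t) ` F)" "y + t \<in> frontier ((\<lambda>z. z + t) ` F)" by (auto simp: fr)
      then show ?thesis using face_translate[OF t 2(2)] Site 2(1) by (auto simp: dual_open_step_def)
    qed
  next
    case Bond
    then obtain F G e where F: "x \<noteq> y" "F \<in> faces M" "G \<in> faces M" "e \<in> bonds M" "x \<in> F" "y \<in> G"
      "convex hull e \<subseteq> frontier F \<inter> frontier G" "\<not> \<omega> ((\<lambda>z. z + t) ` e)"
      using st by (auto simp: dual_open_step_def)
    have "convex hull ((\<lambda>z. z + t) ` e) \<subseteq> frontier ((\<lambda>z. z + t) ` F) \<inter> frontier ((\<lambda>z. z + t) ` G)"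
      unfolding hull fr using F(7) by blast
    moreover have "(\<lambda>z. z + t) ` e \<in> bonds M" using bond_translate[OF t] F(4) by simp
    moreover have "x + t \<in> (\<lambda>z. z + t) ` F" "y + t \<in> (\<lambda>z. z + t) ` G" using F by auto
    moreover note face_translate[OF t F(2)] face_translate[OF t F(3)]
    ultimately have "\<exists>F\<in>faces M. \<exists>G\<in>faces M. \<exists>e\<in>bonds M. x + t \<in> F \<and> y + t \<in> G \<and>
      convex hull e \<subseteq> frontier F \<inter> frontier G \<and> \<not> \<omega> e"
      using F(8) by (intro bexI[of _ "(\<lambda>z. z + t) ` F"] bexI[of _ "(\<lambda>z. z + t) ` G"]
        bexI[of _ "(\<lambda>z. z + t) ` e"] conjI)
    then show ?thesis using Bond F(1) unfolding dual_open_step_def by simp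
  qed
qed

lemma dual_linked_translate:
  assumes t: "t \<in> period"
    and l: "linked (dual_open_step M (\<lambda>b. \<omega> ((\<lambda>z. z + t) ` b))) (dual_open_sites M (\<lambda>b. \<omega> ((\<lambda>z. z + t) ` b)) \<inter> U) u v"
  shows "linked (dual_open_step M \<omega>) (dual_open_sites M \<omega> \<inter> (\<lambda>z. z + t) ` U) (u + t) (v + t)"
  using l
  by (rule linked_image) (use dual_step_translate[OF t] period_dual[OF t] in \<open>auto simp: dual_open_site_def\<close>)

lemma dual_linked_translate_iff:
  assumes t: "t \<in> period"
  shows "linked (dual_open_step M (\<lambda>b. \<omega> ((\<lambda>z. z + t) ` b))) (dual_open_sites M (\<lambda>b. \<omega> ((\<lambda>z. z + t) ` b)) \<inter> U) u v
    \<longleftrightarrow> linked (dual_open_step M \<omega>) (dual_open_sites M \<omega> \<inter> (\<lambda>z. z + t) ` U) (u + t) (v + t)"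
proof
  assume r: "linked (dual_open_step M \<omega>) (dual_open_sites M \<omega> \<inter> (\<lambda>z. z + t) ` U) (u + t) (v + t)"
  define \<omega>' where "\<omega>' b = \<omega> ((\<lambda>z. z + t) ` b)" for b
  have "\<omega> = (\<lambda>b. \<omega>' ((\<lambda>z. z + - t) ` b))" by (auto simp: \<omega>'_def image_image)
  then have "linked (dual_open_step M \<omega>') (dual_open_sites M \<omega>' \<inter> (\<lambda>z. z + - t) ` (\<lambda>z. z + t) ` U) (u + t + - t) (v + t + - t)"
    using r dual_linked_translate[OF period_minus[OF t], of \<omega>' "(\<lambda>z. z + t) ` U" "u + t" "v + t"] by simp
  then show "linked (dual_open_step M (\<lambda>b. \<omega> ((\<lambda>z. z + t) ` b))) (dual_open_sites M (\<lambda>b. \<omega> ((\<lambda>z. z + t) ` b)) \<inter> U) u v"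
    by (simp add: \<omega>'_def[abs_def] image_image)
qed (rule dual_linked_translate[OF t])

lemma occupied_linked_invariant:
  assumes inv: "invariant_under M \<phi>"
    and l: "linked (occupied_step M (\<lambda>b. \<omega> (\<phi> ` b))) (occupied_sites M (\<lambda>b. \<omega> (\<phi> ` b)) \<inter> U) u v"
  shows "linked (occupied_step M \<omega>) (occupied_sites M \<omega> \<inter> \<phi> ` U) (\<phi> u) (\<phi> v)"
  using l
proof (rule linked_image)
  have b: "\<phi> ` e \<in> bonds M" if "e \<in> bonds M" for e
    using inv imageI[OF that, of "image \<phi>"] by (simp add: invariant_under_def)
  have s: "\<phi> z \<in> sites M" if "z \<in> sites M" for z
    using inv imageI[OF that, of \<phi>] by (simp add: invariant_under_def)
  show "occupied_step M \<omega> (\<phi> x) (\<phi> y)" if "occupied_step M (\<lambda>b. \<omega> (\<phi> ` b)) x y" for x y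
    using that b[of "{x, y}"] by (auto simp: occupied_step_def)
  show "\<phi> ` (occupied_sites M (\<lambda>b. \<omega> (\<phi> ` b)) \<inter> U) \<subseteq> occupied_sites M \<omega> \<inter> \<phi> ` U"
    using s by (auto simp: occupied_site_def)
qed

lemma elements_invariant:
  assumes "invariant_under M \<phi>"
  shows "image \<phi> ` elements M = elements M"
proof (cases "kind M")
  case Bond
  then show ?thesis using assms by (simp add: elements_def invariant_under_def)
next
  case Site
  have "\<phi> ` sites M = sites M" using assms by (simp add: invariant_under_def)
  moreover have "image \<phi> ` (\<lambda>v. {v}) ` sites M = (\<lambda>v. {v}) ` \<phi> ` sites M" by (simp add: image_image)
  ultimately show ?thesis using Site by (simp add: elements_def)
qed

subsection \<open>Dependence on elements in a region\<close>

definition els :: "complex set \<Rightarrow> complex set set" where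
  "els U = {b \<in> elements M. b \<subseteq> U}"

lemma els_subset: "els U \<subseteq> elements M"
  by (auto simp: els_def)

lemma els_mono: "U \<subseteq> V \<Longrightarrow> els U \<subseteq> els V"
  by (auto simp: els_def)

lemma elements_subset: "b \<in> elements M \<Longrightarrow> b \<subseteq> sites M \<and> b \<noteq> {}"
  by (cases "kind M") (auto simp: elements_def elim: bond_cases)

lemma els_disjoint: "U \<inter> V = {} \<Longrightarrow> els U \<inter> els V = {}"
  unfolding els_def using elements_subset by blast

lemma finite_els: "bounded U \<Longrightarrow> finite (els U)"
proof -
  assume "bounded U"
  then have "finite (Pow (sites M \<inter> U))" by (simp only: finite_Pow_iff finite_sites)
  moreover have "els U \<subseteq> Pow (sites M \<inter> U)" using elements_subset by (auto simp: els_def)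
  ultimately show ?thesis by (rule rev_finite_subset)
qed

lemma depends_onI:
  assumes "\<And>\<omega> \<omega>'. \<forall>b\<in>E. \<omega> b = \<omega>' b \<Longrightarrow> A \<omega> \<Longrightarrow> A \<omega>'"
  shows "depends_on A E"
  unfolding depends_on_def using assms by metis

lemma occupied_linked_depends:
  "depends_on (\<lambda>\<omega>. linked (occupied_step M \<omega>) (occupied_sites M \<omega> \<inter> U) u v) (els U)"
proof (rule depends_onI)
  fix \<omega> \<omega>'
  assume eq: "\<forall>b\<in>els U. \<omega> b = \<omega>' b" and l: "linked (occupied_step M \<omega>) (occupied_sites M \<omega> \<inter> U) u v"
  show "linked (occupied_step M \<omega>') (occupied_sites M \<omega>' \<inter> U) u v"
    using l
  proof (rule linked_mono)
    show "occupied_sites M \<omega> \<inter> U \<subseteq> occupied_sites M \<omega>' \<inter> U"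
      using eq by (auto simp: occupied_site_def els_def elements_def)
    show "occupied_step M \<omega>' x y" if "x \<in> occupied_sites M \<omega> \<inter> U" "y \<in> occupied_sites M \<omega> \<inter> U" "occupied_step M \<omega> x y" for x y
      using eq that by (auto simp: occupied_step_def els_def elements_def)
  qed
qed

text \<open>A dual step between points of \<open>U\<close> is decided by a bond that may stick out
  of \<open>U\<close>, but by no more than \<open>mesh\<close>.\<close>

definition halo :: "complex set \<Rightarrow> complex set" where
  "halo U = {z. \<exists>x\<in>U. nrm (z - x) \<le> mesh}"

lemma subset_halo: "U \<subseteq> halo U"
  using mesh_ge by (force simp: halo_def nrm_eq coord1_def coord2_def)

lemma bounded_halo: "bounded U \<Longrightarrow> bounded (halo U)"
proof -
  assume "bounded U"
  then obtain R where R: "\<And>z. z \<in> U \<Longrightarrow> nrm z \<le> R" by (auto simp: bounded_iff_nrm)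
  have "nrm z \<le> R + mesh" if "z \<in> halo U" for z
  proof -
    obtain x where "x \<in> U" "nrm (z - x) \<le> mesh" using \<open>z \<in> halo U\<close> by (auto simp: halo_def)
    then show ?thesis using nrm_triangle[of x "z - x"] R[of x] by simp
  qed
  then show ?thesis by (auto simp: bounded_iff_nrm)
qed

text \<open>Only vacancy has to be inherited by \<open>\<omega>'\<close>. This gives locality and
  monotonicity at once, and it also carries paths over from the all-vacant configuration.\<close>

lemma dual_linked_transfer:
  assumes eq: "\<forall>b\<in>els (halo U). \<omega>' b \<longrightarrow> \<omega> b" and l: "linked (dual_open_step M \<omega>) (dual_open_sites M \<omega> \<inter> U) u v"
  shows "linked (dual_open_step M \<omega>') (dual_open_sites M \<omega>' \<inter> U) u v"
  using l
proof (rule linked_mono)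
  show "dual_open_sites M \<omega> \<inter> U \<subseteq> dual_open_sites M \<omega>' \<inter> U"
    using eq subset_halo[of U] dual_sites_site by (auto simp: dual_open_site_def els_def elements_def)
  show "dual_open_step M \<omega>' x y" if h: "x \<in> dual_open_sites M \<omega> \<inter> U" "y \<in> dual_open_sites M \<omega> \<inter> U" "dual_open_step M \<omega> x y" for x y
  proof (cases "kind M")
    case Site
    then show ?thesis using h by (simp add: dual_open_step_def)
  next
    case Bond
    then obtain F G e where F: "x \<noteq> y" "F \<in> faces M" "G \<in> faces M" "e \<in> bonds M" "x \<in> F" "y \<in> G"
      "convex hull e \<subseteq> frontier F \<inter> frontier G" "\<not> \<omega> e"
      using h by (auto simp: dual_open_step_def)
    have "e \<subseteq> halo U"
    proof
      fix w assume "w \<in> e"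
      then have "w \<in> closure F" using F(7) hull_inc[of w e] by (auto simp: frontier_def)
      then have "nrm (w - x) \<le> mesh / 2" using mesh_face[OF F(2)] F(5) closure_subset by blast
      then show "w \<in> halo U" using h(1) mesh_ge by (auto simp: halo_def intro!: bexI[of _ x])
    qed
    then have "\<not> \<omega>' e" using eq F(4,8) Bond by (auto simp: els_def elements_def)
    then show ?thesis using F Bond unfolding dual_open_step_def by auto
  qed
qed

lemma dual_linked_depends:
  "depends_on (\<lambda>\<omega>. linked (dual_open_step M \<omega>) (dual_open_sites M \<omega> \<inter> U) u v) (els (halo U))"
  by (rule depends_onI) (rule dual_linked_transfer; blast)

lemma occupied_linked_up: "up_event (\<lambda>\<omega>. linked (occupied_step M \<omega>) (occupied_sites M \<omega> \<inter> U) u v)"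
  unfolding up_event_def
proof (intro allI impI)
  fix \<omega> \<omega>' :: config assume h: "\<forall>b. \<omega> b \<longrightarrow> \<omega>' b" "linked (occupied_step M \<omega>) (occupied_sites M \<omega> \<inter> U) u v"
  show "linked (occupied_step M \<omega>') (occupied_sites M \<omega>' \<inter> U) u v"
    using h(2) by (rule linked_mono) (use h(1) in \<open>auto simp: occupied_site_def occupied_step_def\<close>)
qed

lemma dual_linked_down: "up_event (\<lambda>\<omega>. \<not> linked (dual_open_step M \<omega>) (dual_open_sites M \<omega> \<inter> U) u v)"
  unfolding up_event_def using dual_linked_transfer by blast

text \<open>The location of a bond is its midpoint; convexity lets a bound for the density on a
  region apply to the elements inside it.\<close>

lemma location_in:
  assumes "b \<in> els U" "convex U"
  shows "location b \<in> U"
proof -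
  have b: "b \<in> elements M" "b \<subseteq> U" using assms(1) by (auto simp: els_def)
  have "(\<exists>v. b = {v}) \<or> (\<exists>u v. u \<noteq> v \<and> b = {u, v})"
    using b(1) by (cases "kind M") (auto simp: elements_def elim: bond_cases)
  then show ?thesis
  proof (elim disjE exE conjE)
    fix v assume "b = {v}"
    then show ?thesis using b(2) by (simp add: location_def)
  next
    fix u v assume "u \<noteq> v" "b = {u, v}"
    then have "location b = (1 / 2) *\<^sub>R u + (1 / 2) *\<^sub>R v" by (simp add: location_def scaleR_conv_of_real field_simps)
    moreover have "(1 / 2 :: real) *\<^sub>R u + (1 / 2 :: real) *\<^sub>R v \<in> U"
      using b(2) \<open>b = {u, v}\<close> assms(2) by (intro convexD) auto
    ultimately show ?thesis by simp
  qed
qed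

end

lemma depends_on_ex: "(\<And>i. depends_on (A i) E) \<Longrightarrow> depends_on (\<lambda>\<omega>. \<exists>i. A i \<omega>) E"
  unfolding depends_on_def by metis

lemma depends_on_conj_const: "depends_on A E \<Longrightarrow> depends_on (\<lambda>\<omega>. A \<omega> \<and> c) E"
  unfolding depends_on_def by metis

lemma up_event_ex: "(\<And>i. up_event (A i)) \<Longrightarrow> up_event (\<lambda>\<omega>. \<exists>i. A i \<omega>)"
  unfolding up_event_def by blast

context lattice begin

subsection \<open>Crossing events\<close>

definition ocross where
  "ocross f g x0 x1 y0 y1 \<omega> \<longleftrightarrow> cross (occupied_step M \<omega>) (occupied_sites M \<omega>) f g x0 x1 y0 y1"

definition dcross where
  "dcross f g x0 x1 y0 y1 \<omega> \<longleftrightarrow> cross (dual_open_step M \<omega>) (dual_open_sites M \<omega>) f g x0 x1 y0 y1"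

definition rect :: "(complex \<Rightarrow> real) \<Rightarrow> (complex \<Rightarrow> real) \<Rightarrow> real \<Rightarrow> real \<Rightarrow> real \<Rightarrow> real \<Rightarrow> complex set" where
  "rect f g x0 x1 y0 y1 = {z. x0 \<le> f z \<and> f z \<le> x1 \<and> y0 \<le> g z \<and> g z \<le> y1}"

lemma dcross_mono:
  "dcross f g x0 x1 y0 y1 \<omega> \<Longrightarrow> x0 \<le> x0' \<Longrightarrow> x1' \<le> x1 \<Longrightarrow> y0' \<le> y0 \<Longrightarrow> y1 \<le> y1' \<Longrightarrow> dcross f g x0' x1' y0' y1' \<omega>"
  unfolding dcross_def by (erule cross_mono) auto

lemma bounded_rect: "axes f g \<Longrightarrow> bounded (rect f g x0 x1 y0 y1)"
proof -
  assume ax: "axes f g"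
  have "nrm z \<le> \<bar>x0\<bar> + \<bar>x1\<bar> + \<bar>y0\<bar> + \<bar>y1\<bar>" if "z \<in> rect f g x0 x1 y0 y1" for z
    using that unfolding rect_def axes_nrm[OF ax] by auto
  then show ?thesis by (auto simp: bounded_iff_nrm)
qed

lemma convex_rect: "axes f g \<Longrightarrow> convex (rect f g x0 x1 y0 y1)"
proof -
  assume ax: "axes f g"
  have "rect f g x0 x1 y0 y1 = f -` {x0..x1} \<inter> g -` {y0..y1}" by (auto simp: rect_def)
  then show ?thesis using axes_linear[OF ax] axes_linear[OF axes_sym[OF ax]]
    by (simp add: convex_Int convex_linear_vimage convex_real_interval)
qed

lemma halo_rect:
  assumes "axes f g"
  shows "halo (rect f g x0 x1 y0 y1) \<subseteq> rect f g (x0 - mesh) (x1 + mesh) (y0 - mesh) (y1 + mesh)"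
proof
  fix z assume "z \<in> halo (rect f g x0 x1 y0 y1)"
  then obtain x where x: "x \<in> rect f g x0 x1 y0 y1" "nrm (z - x) \<le> mesh" by (auto simp: halo_def)
  have "\<bar>f z - f x\<bar> \<le> mesh" "\<bar>g z - g x\<bar> \<le> mesh"
    using axes_le[OF assms x(2)] axes_le[OF axes_sym[OF assms] x(2)] by auto
  then show "z \<in> rect f g (x0 - mesh) (x1 + mesh) (y0 - mesh) (y1 + mesh)"
    using x(1) unfolding rect_def mem_Collect_eq by linarith
qed

text \<open>Trimming confines the path to a bounded rectangle, so that the event depends on finitely
  many elements.\<close>

lemma ocross_iff:
  assumes ax: "axes f g" and "x0 < x1"
  shows "ocross f g x0 x1 y0 y1 \<omega> \<longleftrightarrow> (\<exists>u v. linked (occupied_step M \<omega>) (occupied_sites M \<omega> \<inter> rect f g (x0 - mesh) (x1 + mesh) y0 y1) u v \<and> f u \<le> x0 \<and> x1 \<le> f v)"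
proof -
  have eq: "occupied_sites M \<omega> \<inter> {z. x0 - mesh \<le> f z \<and> f z \<le> x1 + mesh} \<inter> {z. y0 \<le> g z \<and> g z \<le> y1}
    = occupied_sites M \<omega> \<inter> rect f g (x0 - mesh) (x1 + mesh) y0 y1" by (auto simp: rect_def)
  show ?thesis
  proof
    assume "ocross f g x0 x1 y0 y1 \<omega>"
    then have "cross (occupied_step M \<omega>) (occupied_sites M \<omega> \<inter> {z. x0 - mesh \<le> f z \<and> f z \<le> x1 + mesh}) f g x0 x1 y0 y1"
      unfolding ocross_def
      by (rule cross_trim) (use assms mesh_ge axes_le[OF ax occupied_step_length] in auto)
    then show "\<exists>u v. linked (occupied_step M \<omega>) (occupied_sites M \<omega> \<inter> rect f g (x0 - mesh) (x1 + mesh) y0 y1) u v \<and> f u \<le> x0 \<and> x1 \<le> f v"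
      unfolding cross_def eq .
  next
    assume "\<exists>u v. linked (occupied_step M \<omega>) (occupied_sites M \<omega> \<inter> rect f g (x0 - mesh) (x1 + mesh) y0 y1) u v \<and> f u \<le> x0 \<and> x1 \<le> f v"
    then show "ocross f g x0 x1 y0 y1 \<omega>" unfolding ocross_def
      by (elim exE conjE) (rule crossI, auto elim!: linked_mono simp: rect_def)
  qed
qed

lemma dcross_iff:
  assumes ax: "axes f g" and "x0 < x1"
  shows "dcross f g x0 x1 y0 y1 \<omega> \<longleftrightarrow> (\<exists>u v. linked (dual_open_step M \<omega>) (dual_open_sites M \<omega> \<inter> rect f g (x0 - mesh) (x1 + mesh) y0 y1) u v \<and> f u \<le> x0 \<and> x1 \<le> f v)"
proof -
  have eq: "dual_open_sites M \<omega> \<inter> {z. x0 - mesh \<le> f z \<and> f z \<le> x1 + mesh} \<inter> {z. y0 \<le> g z \<and> g z \<le> y1}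
    = dual_open_sites M \<omega> \<inter> rect f g (x0 - mesh) (x1 + mesh) y0 y1" by (auto simp: rect_def)
  show ?thesis
  proof
    assume "dcross f g x0 x1 y0 y1 \<omega>"
    then have "cross (dual_open_step M \<omega>) (dual_open_sites M \<omega> \<inter> {z. x0 - mesh \<le> f z \<and> f z \<le> x1 + mesh}) f g x0 x1 y0 y1"
      unfolding dcross_def
      by (rule cross_trim) (use assms mesh_ge axes_le[OF ax dual_open_step_length] in auto)
    then show "\<exists>u v. linked (dual_open_step M \<omega>) (dual_open_sites M \<omega> \<inter> rect f g (x0 - mesh) (x1 + mesh) y0 y1) u v \<and> f u \<le> x0 \<and> x1 \<le> f v"
      unfolding cross_def eq .
  next
    assume "\<exists>u v. linked (dual_open_step M \<omega>) (dual_open_sites M \<omega> \<inter> rect f g (x0 - mesh) (x1 + mesh) y0 y1) u v \<and> f u \<le> x0 \<and> x1 \<le> f v"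
    then show "dcross f g x0 x1 y0 y1 \<omega>" unfolding dcross_def
      by (elim exE conjE) (rule crossI, auto elim!: linked_mono simp: rect_def)
  qed
qed

lemma ocross_depends:
  assumes "axes f g" "x0 < x1"
  shows "depends_on (ocross f g x0 x1 y0 y1) (els (rect f g (x0 - mesh) (x1 + mesh) y0 y1))"
proof -
  have "depends_on (\<lambda>\<omega>. \<exists>u v. linked (occupied_step M \<omega>) (occupied_sites M \<omega> \<inter> rect f g (x0 - mesh) (x1 + mesh) y0 y1) u v \<and> f u \<le> x0 \<and> x1 \<le> f v)
    (els (rect f g (x0 - mesh) (x1 + mesh) y0 y1))"
    by (intro depends_on_ex depends_on_conj_const occupied_linked_depends)
  then show ?thesis using ocross_iff[OF assms] by (simp add: depends_on_def)
qed

lemma ocross_up: "axes f g \<Longrightarrow> x0 < x1 \<Longrightarrow> up_event (ocross f g x0 x1 y0 y1)"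
  using occupied_linked_up unfolding up_event_def ocross_iff by blast

lemma dcross_depends:
  assumes "axes f g" "x0 < x1"
  shows "depends_on (dcross f g x0 x1 y0 y1) (els (rect f g (x0 - 2 * mesh) (x1 + 2 * mesh) (y0 - mesh) (y1 + mesh)))"
proof -
  let ?U = "rect f g (x0 - mesh) (x1 + mesh) y0 y1"
  have "depends_on (\<lambda>\<omega>. \<exists>u v. linked (dual_open_step M \<omega>) (dual_open_sites M \<omega> \<inter> ?U) u v \<and> f u \<le> x0 \<and> x1 \<le> f v)
    (els (halo ?U))"
    by (intro depends_on_ex depends_on_conj_const dual_linked_depends)
  then have "depends_on (dcross f g x0 x1 y0 y1) (els (halo ?U))"
    using dcross_iff[OF assms] by (simp add: depends_on_def)
  moreover have "els (halo ?U) \<subseteq> els (rect f g (x0 - 2 * mesh) (x1 + 2 * mesh) (y0 - mesh) (y1 + mesh))"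
    using halo_rect[OF assms(1), of "x0 - mesh" "x1 + mesh" y0 y1] by (intro els_mono) (simp add: algebra_simps)
  ultimately show ?thesis by (rule depends_on_mono)
qed

lemma finite_els_rect: "axes f g \<Longrightarrow> finite (els (rect f g x0 x1 y0 y1))"
  by (intro finite_els bounded_rect)

lemma ocross_cover:
  assumes "axes f g" "ocross f g s (s + m) t (t + h) \<omega>" "2 * mesh \<le> m" "h \<le> real k * m"
  shows "\<exists>i\<le>k. ocross f g s (s + m) (t + real i * m) (t + real i * m + 2 * m) \<omega> \<or>
    ocross g f (t + real i * m) (t + real i * m + m) (s - m / 2) (s - m / 2 + 2 * m) \<omega>"
proof -
  have eq: "s - m / 2 + 2 * m = s + 3 * m / 2" by simp
  show ?thesis unfolding ocross_def eq
  proof (rule cross_cover[OF assms(2)[unfolded ocross_def] _ _ symp_occupied_step])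
    show "\<bar>f x - f y\<bar> \<le> mesh" if "occupied_step M \<omega> x y" for x y
      by (rule axes_le[OF assms(1) occupied_step_length[OF that]])
  qed (use mesh_ge assms(3,4) in auto)
qed

lemma dcross_cover:
  assumes "axes f g" "dcross f g s (s + m) t (t + h) \<omega>" "2 * mesh \<le> m" "h \<le> real k * m"
  shows "\<exists>i\<le>k. dcross f g s (s + m) (t + real i * m) (t + real i * m + 2 * m) \<omega> \<or>
    dcross g f (t + real i * m) (t + real i * m + m) (s - m / 2) (s - m / 2 + 2 * m) \<omega>"
proof -
  have eq: "s - m / 2 + 2 * m = s + 3 * m / 2" by simp
  show ?thesis unfolding dcross_def eq
  proof (rule cross_cover[OF assms(2)[unfolded dcross_def] _ _ symp_dual_open_step])
    show "\<bar>f x - f y\<bar> \<le> mesh" if "dual_open_step M \<omega> x y" for x y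
      by (rule axes_le[OF assms(1) dual_open_step_length[OF that]])
  qed (use mesh_ge assms(3,4) in auto)
qed

subsection \<open>Symmetry of crossing probabilities\<close>

lemma ocross_translate:
  assumes t: "t \<in> period" and ax: "axes f g"
  shows "ocross f g x0 x1 y0 y1 (\<lambda>b. \<omega> ((\<lambda>z. z + t) ` b)) \<longleftrightarrow>
    ocross f g (x0 + f t) (x1 + f t) (y0 + g t) (y1 + g t) \<omega>"
proof -
  interpret oblique f g using ax by (rule axes_oblique)
  have *: "ocross f g (x0 + f t) (x1 + f t) (y0 + g t) (y1 + g t) \<omega>"
    if oc: "ocross f g x0 x1 y0 y1 (\<lambda>b. \<omega> ((\<lambda>z. z + t) ` b))" and t: "t \<in> period" for t x0 x1 y0 y1 \<omega>
  proof -
    obtain u v where uv: "linked (occupied_step M (\<lambda>b. \<omega> ((\<lambda>z. z + t) ` b)))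
       (occupied_sites M (\<lambda>b. \<omega> ((\<lambda>z. z + t) ` b)) \<inter> {z. y0 \<le> g z \<and> g z \<le> y1}) u v" "f u \<le> x0" "x1 \<le> f v"
      using oc unfolding ocross_def cross_def by blast
    have "invariant_under M (\<lambda>z. z + t)" using t by (simp add: period_def)
    from occupied_linked_invariant[OF this uv(1)]
    have "linked (occupied_step M \<omega>) (occupied_sites M \<omega> \<inter> {z. y0 + g t \<le> g z \<and> g z \<le> y1 + g t}) (u + t) (v + t)"
      by (rule linked_mono) (auto simp: g_add)
    then show ?thesis unfolding ocross_def by (rule crossI) (use uv(2,3) in \<open>auto simp: f_add\<close>)
  qed
  show ?thesis
  proof
    assume r: "ocross f g (x0 + f t) (x1 + f t) (y0 + g t) (y1 + g t) \<omega>"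
    define \<omega>' where "\<omega>' b = \<omega> ((\<lambda>z. z + t) ` b)" for b
    have "\<omega> = (\<lambda>b. \<omega>' ((\<lambda>z. z + - t) ` b))" by (auto simp: \<omega>'_def image_image)
    then have "ocross f g (x0 + f t) (x1 + f t) (y0 + g t) (y1 + g t) (\<lambda>b. \<omega>' ((\<lambda>z. z + - t) ` b))" using r by simp
    from *[OF this period_minus[OF t]] show "ocross f g x0 x1 y0 y1 (\<lambda>b. \<omega> ((\<lambda>z. z + t) ` b))"
      using linear_neg[OF linf, of t] linear_neg[OF ling, of t] by (simp add: \<omega>'_def[abs_def])
  qed (rule *[OF _ t])
qed

lemma ocross_swap:
  assumes ax: "axes f g"
  shows "ocross f g x0 x1 y0 y1 (\<lambda>b. \<omega> (swap ` b)) \<longleftrightarrow> ocross g f (- x1) (- x0) (- y1) (- y0) \<omega>"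
proof -
  have *: "ocross g f (- x1) (- x0) (- y1) (- y0) \<omega>"
    if oc: "ocross f g x0 x1 y0 y1 (\<lambda>b. \<omega> (swap ` b))" and ax: "axes f g" for f g x0 x1 y0 y1 \<omega>
  proof -
    have gs: "g (swap z) = - f z" "f (swap z) = - g z" for z
      using ax c1_swap c2_swap by (auto simp: axes_def)
    obtain u v where uv: "linked (occupied_step M (\<lambda>b. \<omega> (swap ` b)))
       (occupied_sites M (\<lambda>b. \<omega> (swap ` b)) \<inter> {z. y0 \<le> g z \<and> g z \<le> y1}) u v" "f u \<le> x0" "x1 \<le> f v"
      using oc unfolding ocross_def cross_def by blast
    from occupied_linked_invariant[OF invariant_swap uv(1)]
    have "linked (occupied_step M \<omega>) (occupied_sites M \<omega> \<inter> {z. - y1 \<le> f z \<and> f z \<le> - y0}) (swap u) (swap v)"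
      by (rule linked_mono) (auto simp: gs)
    then have "linked (occupied_step M \<omega>) (occupied_sites M \<omega> \<inter> {z. - y1 \<le> f z \<and> f z \<le> - y0}) (swap v) (swap u)"
      by (rule linked_sym[OF _ symp_occupied_step])
    then show ?thesis unfolding ocross_def by (rule crossI) (use uv(2,3) in \<open>auto simp: gs\<close>)
  qed
  show ?thesis
  proof
    assume r: "ocross g f (- x1) (- x0) (- y1) (- y0) \<omega>"
    have "\<omega> = (\<lambda>b. \<omega> (swap ` swap ` b))" by (simp add: image_image swap_swap)
    then have "ocross g f (- x1) (- x0) (- y1) (- y0) (\<lambda>b. \<omega> (swap ` swap ` b))" using r by simp
    from *[OF this axes_sym[OF ax]] show "ocross f g x0 x1 y0 y1 (\<lambda>b. \<omega> (swap ` b))" by simp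
  qed (rule *[OF _ ax])
qed

lemma hom_prob_invariant:
  assumes "depends_on A (els U)" "bounded U" "invariant_under M \<phi>" "inj \<phi>" "0 \<le> p" "p \<le> 1"
  shows "hom_prob M p (\<lambda>\<omega>. A (\<lambda>b. \<omega> (\<phi> ` b))) = hom_prob M p A"
proof (rule hom_prob_reindex[symmetric, OF assms(1) finite_els[OF assms(2)] els_subset _ _ assms(5,6) refl])
  show "inj (image \<phi>)" using assms(4) by (intro injI) (simp add: inj_image_eq_iff)
  show "image \<phi> ` els U \<subseteq> elements M"
    using elements_invariant[OF assms(3)] els_subset by blast
qed

lemma hom_ocross_translate:
  assumes t: "t \<in> period" and ax: "axes f g" and p: "0 \<le> p" "p \<le> 1" and "x0 < x1"
  shows "hom_prob M p (ocross f g (x0 + f t) (x1 + f t) (y0 + g t) (y1 + g t)) = hom_prob M p (ocross f g x0 x1 y0 y1)"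
proof -
  have "invariant_under M (\<lambda>z. z + t)" using t by (simp add: period_def)
  moreover have "inj (\<lambda>z. z + t)" by simp
  ultimately have "hom_prob M p (\<lambda>\<omega>. ocross f g x0 x1 y0 y1 (\<lambda>b. \<omega> ((\<lambda>z. z + t) ` b))) = hom_prob M p (ocross f g x0 x1 y0 y1)"
    by (rule hom_prob_invariant[OF ocross_depends[OF ax assms(5)] bounded_rect[OF ax] _ _ p])
  then show ?thesis by (simp add: ocross_translate[OF t ax])
qed

lemma hom_ocross_swap:
  assumes ax: "axes f g" and p: "0 \<le> p" "p \<le> 1" and "x0 < x1"
  shows "hom_prob M p (ocross g f (- x1) (- x0) (- y1) (- y0)) = hom_prob M p (ocross f g x0 x1 y0 y1)"
proof -
  have "inj swap" by (metis injI swap_swap)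
  then have "hom_prob M p (\<lambda>\<omega>. ocross f g x0 x1 y0 y1 (\<lambda>b. \<omega> (swap ` b))) = hom_prob M p (ocross f g x0 x1 y0 y1)"
    by (rule hom_prob_invariant[OF ocross_depends[OF ax assms(4)] bounded_rect[OF ax] invariant_swap _ p])
  then show ?thesis by (simp add: ocross_swap[OF ax])
qed

text \<open>Periods can place a rectangle only up to one spacing, and \<open>swap\<close> exchanges
  the directions. So a bound for one rectangle at the origin is available near every position and in
  both directions.\<close>

lemma hom_ocross_shift:
  assumes ax: "axes f g" and p: "0 \<le> p" "p \<le> 1" and w: "0 < w"
  shows "\<exists>s t. x - a \<le> s \<and> s \<le> x \<and> y - a \<le> t \<and> t \<le> y \<and>
    hom_prob M p (ocross f g s (s + w) t (t + h)) = hom_prob M p (ocross c1 c2 0 w 0 h)"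
proof -
  obtain x0 y0 where xy: "hom_prob M p (ocross f g x0 (x0 + w) y0 (y0 + h)) = hom_prob M p (ocross c1 c2 0 w 0 h)"
  proof (cases "f = c1 \<and> g = c2")
    case True
    then show thesis using that[of 0 0] by simp
  next
    case False
    then have "f = c2" "g = c1" using ax by (auto simp: axes_def)
    then show thesis using that[of "- w" "- h"] hom_ocross_swap[OF axes12 p w, of h 0] by simp
  qed
  obtain z where z: "f z = x - x0" "g z = y - y0" using axes_surj[OF ax] by blast
  obtain t where t: "t \<in> period" "0 \<le> f (z - t)" "f (z - t) < a" "0 \<le> g (z - t)" "g (z - t) < a"
    using lat_reduce[OF ax] by blast
  interpret oblique f g using ax by (rule axes_oblique)
  have "hom_prob M p (ocross f g (x0 + f t) (x0 + w + f t) (y0 + g t) (y0 + h + g t)) = hom_prob M p (ocross c1 c2 0 w 0 h)"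
    using hom_ocross_translate[OF t(1) ax p, of x0 "x0 + w" y0 "y0 + h"] xy w by simp
  then show ?thesis
    using t(2-5) z by (intro exI[of _ "x0 + f t"] exI[of _ "y0 + g t"]) (auto simp: f_diff g_diff algebra_simps)
qed

subsection \<open>Decay of dual crossings\<close>

text \<open>The aspect ratio 2 is that of the windows in \<open>cross_cover\<close>, so that the
  bound reproduces itself from scale to scale.\<close>

definition short_dual_le :: "real \<Rightarrow> real \<Rightarrow> real \<Rightarrow> bool" where
  "short_dual_le p x m \<longleftrightarrow>
     (\<forall>f g s t. axes f g \<longrightarrow> hom_prob M p (dcross f g s (s + m) t (t + 2 * m)) \<le> x)"

lemma short_dual_base:
  assumes p: "0 \<le> p" "p \<le> 1" and n: "5 * mesh \<le> n"
    and c: "1 - x \<le> hom_prob M p (ocross c1 c2 0 (3 * n) 0 n)"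
  shows "short_dual_le p x (n + a)"
  unfolding short_dual_le_def
proof (intro allI impI)
  fix f g s t assume ax: "axes f g"
  interpret bernoulli_field M "\<lambda>_. p" using p by (rule bernoulli_field_const)
  have n0: "0 < 3 * n" using n mesh_ge by linarith
  obtain t' s' where ts: "t - mesh - a \<le> t'" "t' \<le> t - mesh" "s + a - a \<le> s'" "s' \<le> s + a"
    "hom_prob M p (ocross g f t' (t' + 3 * n) s' (s' + n)) = hom_prob M p (ocross c1 c2 0 (3 * n) 0 n)"
    using hom_ocross_shift[OF axes_sym[OF ax] p n0] by blast
  have dep: "depends_on (ocross g f t' (t' + 3 * n) s' (s' + n)) (els (rect g f (t' - mesh) (t' + 3 * n + mesh) s' (s' + n)))"
    using n0 by (intro ocross_depends axes_sym[OF ax]) simp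
  have fin: "finite (els (rect g f (t' - mesh) (t' + 3 * n + mesh) s' (s' + n)))"
    by (rule finite_els_rect[OF axes_sym[OF ax]])
  have "P (dcross f g s (s + (n + a)) t (t + 2 * (n + a))) \<le> P (\<lambda>\<omega>. \<not> ocross g f t' (t' + 3 * n) s' (s' + n) \<omega>)"
  proof (rule P_mono_event[OF depends_on_not[OF dep] fin els_subset], rule notI)
    fix \<omega> assume d: "dcross f g s (s + (n + a)) t (t + 2 * (n + a)) \<omega>" and o: "ocross g f t' (t' + 3 * n) s' (s' + n) \<omega>"
    \<comment> \<open>The length \<open>3 * n\<close> exceeds \<open>2 * (n + a)\<close> by enough
      for the position error \<open>a\<close> and the two margins, because
      \<open>5 * mesh \<le> n\<close>.\<close>
    have "dcross f g s' (s' + n) (t' + mesh) (t' + 3 * n - mesh) \<omega>"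
      by (rule dcross_mono[OF d]) (use ts n mesh_ge in \<open>auto simp: algebra_simps\<close>)
    then show False using occupied_blocks_dual[OF ax o[unfolded ocross_def]] by (simp add: dcross_def)
  qed
  also have "\<dots> \<le> x" using P_not[OF dep fin els_subset] ts(5) c by (simp add: hom_prob_eq)
  finally show "hom_prob M p (dcross f g s (s + (n + a)) t (t + 2 * (n + a))) \<le> x" by (simp add: hom_prob_eq)
qed

text \<open>A union bound over the \<open>k + 1\<close> windows and the two alternatives of
  \<open>dcross_cover\<close>.\<close>

lemma hom_dcross_cover:
  assumes sd: "short_dual_le p x m" and p: "0 \<le> p" "p \<le> 1" and ax: "axes f g" and m: "2 * mesh \<le> m" "h \<le> real k * m"
  shows "hom_prob M p (dcross f g s (s + m) t (t + h)) \<le> 2 * (real k + 1) * x"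
proof -
  interpret bernoulli_field M "\<lambda>_. p" using p by (rule bernoulli_field_const)
  have m0: "0 < m" using m mesh_ge by linarith
  define D where "D i = (if i \<le> k then dcross f g s (s + m) (t + real i * m) (t + real i * m + 2 * m)
    else dcross g f (t + real (i - (k + 1)) * m) (t + real (i - (k + 1)) * m + m) (s - m / 2) (s - m / 2 + 2 * m))" for i
  define E where "E i = (if i \<le> k then els (rect f g (s - 2 * mesh) (s + m + 2 * mesh) (t + real i * m - mesh) (t + real i * m + 2 * m + mesh))
    else els (rect g f (t + real (i - (k + 1)) * m - 2 * mesh) (t + real (i - (k + 1)) * m + m + 2 * mesh) (s - m / 2 - mesh) (s - m / 2 + 2 * m + mesh)))" for i
  have dep: "depends_on (D i) (E i)" "finite (E i)" "E i \<subseteq> elements M" for i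
    using dcross_depends[OF ax, of s "s + m"] dcross_depends[OF axes_sym[OF ax]] m0 finite_els_rect ax axes_sym[OF ax] els_subset
    by (auto simp: D_def E_def)
  have le: "P (D i) \<le> x" for i
  proof -
    have sd': "P (dcross f g s (s + m) t (t + 2 * m)) \<le> x" if "axes f g" for f g s t
      using sd that unfolding short_dual_le_def hom_prob_eq by blast
    show ?thesis by (cases "i \<le> k") (simp_all only: D_def if_True if_False sd'[OF ax] sd'[OF axes_sym[OF ax]])
  qed
  have "P (dcross f g s (s + m) t (t + h)) \<le> P (\<lambda>\<omega>. \<exists>i\<in>{..<2 * (k + 1)}. D i \<omega>)"
  proof (rule P_mono_event)
    show "depends_on (\<lambda>\<omega>. \<exists>i\<in>{..<2 * (k + 1)}. D i \<omega>) (\<Union>i\<in>{..<2 * (k + 1)}. E i)"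
      by (rule depends_on_bex) (rule dep)
    show "\<exists>i\<in>{..<2 * (k + 1)}. D i \<omega>" if d: "dcross f g s (s + m) t (t + h) \<omega>" for \<omega>
    proof -
      obtain i where i: "i \<le> k" "dcross f g s (s + m) (t + real i * m) (t + real i * m + 2 * m) \<omega> \<or>
         dcross g f (t + real i * m) (t + real i * m + m) (s - m / 2) (s - m / 2 + 2 * m) \<omega>"
        using dcross_cover[OF ax d m] by blast
      then have "D i \<omega> \<or> D (i + (k + 1)) \<omega>" by (auto simp: D_def)
      then show ?thesis using i(1) by (auto intro: bexI[of _ i] bexI[of _ "i + (k + 1)"])
    qed
  qed (use dep in auto)
  also have "\<dots> \<le> (\<Sum>i<2 * (k + 1). P (D i))" by (rule P_bex_le) (use dep in auto)
  also have "\<dots> \<le> (\<Sum>i<2 * (k + 1). x)" by (intro sum_mono le)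
  finally show ?thesis by (simp add: hom_prob_eq algebra_simps)
qed

text \<open>Two slabs at distance \<open>5 * mesh\<close> have disjoint regions of dependence, since
  each region sticks out by \<open>2 * mesh\<close>. The factor 12 is \<open>2 * (5 + 1)\<close>:
  the new length \<open>2 * (2 * m + 5 * mesh)\<close> is at most \<open>5 * m\<close>.\<close>

lemma short_dual_double:
  assumes sd: "short_dual_le p x m" and p: "0 \<le> p" "p \<le> 1" and m: "10 * mesh \<le> m"
  shows "short_dual_le p ((12 * x)\<^sup>2) (2 * m + 5 * mesh)"
  unfolding short_dual_le_def
proof (intro allI impI)
  fix f g s t assume ax: "axes f g"
  interpret bernoulli_field M "\<lambda>_. p" using p by (rule bernoulli_field_const)
  define m' where "m' = 2 * m + 5 * mesh"
  have m0: "0 < m" using m mesh_ge by linarith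
  define A where "A s = dcross f g s (s + m) t (t + 2 * m')" for s
  define E where "E s = els (rect f g (s - 2 * mesh) (s + m + 2 * mesh) (t - mesh) (t + 2 * m' + mesh))" for s
  have dep: "depends_on (A s) (E s)" "finite (E s)" "E s \<subseteq> elements M" for s
    unfolding A_def E_def using m0 by (auto intro!: dcross_depends ax finite_els_rect els_subset)
  have le: "P (A s) \<le> 12 * x" for s
    using hom_dcross_cover[OF sd p ax, of "2 * m'" 5 s t] m mesh_ge by (simp add: A_def hom_prob_eq m'_def)
  let ?s2 = "s + m + 5 * mesh"
  have "P (dcross f g s (s + m') t (t + 2 * m')) \<le> P (\<lambda>\<omega>. A s \<omega> \<and> A ?s2 \<omega>)"
  proof (rule P_mono_event[OF depends_on_conj[OF dep(1) dep(1)]])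
    fix \<omega> assume "dcross f g s (s + m') t (t + 2 * m') \<omega>"
    then show "A s \<omega> \<and> A ?s2 \<omega>" unfolding A_def
      by (intro conjI) (erule dcross_mono; use m0 mesh_ge in \<open>simp add: m'_def\<close>)+
  qed (use dep in auto)
  also have "\<dots> = P (A s) * P (A ?s2)"
  proof (rule P_indep[OF dep dep])
    show "E s \<inter> E ?s2 = {}" unfolding E_def
      by (rule els_disjoint) (use mesh_ge in \<open>auto simp: rect_def\<close>)
  qed
  also have "\<dots> \<le> (12 * x) * (12 * x)"
    using le P_nonneg order_trans[OF P_nonneg le] by (intro mult_mono) auto
  finally show "hom_prob M p (dcross f g s (s + (2 * m + 5 * mesh)) t (t + 2 * (2 * m + 5 * mesh))) \<le> (12 * x)\<^sup>2"
    by (simp add: hom_prob_eq m'_def power2_eq_square)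
qed

text \<open>In terms of \<open>144 * x\<close> and \<open>m + 5 * mesh\<close> the doubling step
  squares the first and doubles the second; this is the origin of the constant 144.\<close>

lemma short_dual_decay:
  assumes sd: "short_dual_le p (exp (- 1) / 144) m" and p: "0 \<le> p" "p \<le> 1" and m: "10 * mesh \<le> m"
  shows "short_dual_le p (exp (- (2 ^ j)) / 144) (2 ^ j * (m + 5 * mesh) - 5 * mesh)"
proof (induction j)
  case 0
  then show ?case using sd by simp
next
  case (Suc j)
  define y :: real where "y = 2 ^ j * (m + 5 * mesh)"
  have "1 * (m + 5 * mesh) \<le> y" unfolding y_def using m mesh_ge by (intro mult_right_mono) auto
  then have "m + 5 * mesh \<le> y" by simp
  then have y10: "10 * mesh \<le> y - 5 * mesh" using m by (smt (verit))
  from short_dual_double[OF Suc p y10[unfolded y_def]]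
  have "short_dual_le p ((12 * (exp (- (2 ^ j)) / 144))\<^sup>2) (2 * (2 ^ j * (m + 5 * mesh) - 5 * mesh) + 5 * mesh)" .
  moreover have "(12 * (exp (- (2 ^ j)) / 144))\<^sup>2 = exp (- (2 ^ Suc j)) / (144 :: real)"
  proof -
    have "exp (- (2 ^ Suc j)) = (exp (- (2 ^ j)) :: real)\<^sup>2"
      by (simp add: power2_eq_square exp_add[symmetric])
    then show ?thesis by (simp add: power2_eq_square)
  qed
  moreover have "2 * (2 ^ j * (m + 5 * mesh) - 5 * mesh) + 5 * mesh = 2 ^ Suc j * (m + 5 * mesh) - 5 * mesh" by simp
  ultimately show ?case by (simp only:)
qed

subsection \<open>Upper bound for the correlation length\<close>

abbreviation dlink :: "complex set \<Rightarrow> complex \<Rightarrow> complex \<Rightarrow> config \<Rightarrow> bool" where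
  "dlink U u v \<omega> \<equiv> linked (dual_open_step M \<omega>) (dual_open_sites M \<omega> \<inter> U) u v"

lemma dual_connectivity_dlink: "dual_connectivity M p z = hom_prob M p (dlink UNIV (dual_origin M) z)"
  by (simp add: dual_connectivity_eq)

lemma dual_exit_prob:
  assumes sd: "short_dual_le p x m" and p: "0 \<le> p" "p \<le> 1" and m: "2 * mesh \<le> m" "\<rho> + mesh \<le> m"
    and u: "nrm u \<le> \<rho>" and v: "\<rho> + m \<le> nrm v"
  shows "hom_prob M p (dlink U u v) \<le> 72 * x"
proof -
  interpret bernoulli_field M "\<lambda>_. p" using p by (rule bernoulli_field_const)
  define h where "h = \<rho> + m + mesh"
  have m0: "0 < m" using m mesh_ge by linarith
  define F where "F i = (if i < 2 then c1 else c2)" for i :: nat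
  define G where "G i = (if i < 2 then c2 else c1)" for i :: nat
  define s where "s i = (if even i then \<rho> else - (\<rho> + m))" for i :: nat
  have ax: "axes (F i) (G i)" for i by (simp add: F_def G_def axes12 axes21)
  define D where "D i = dcross (F i) (G i) (s i) (s i + m) (- h) (- h + 2 * h)" for i
  define E where "E i = els (rect (F i) (G i) (s i - 2 * mesh) (s i + m + 2 * mesh) (- h - mesh) (- h + 2 * h + mesh))" for i
  have dep: "depends_on (D i) (E i)" "finite (E i)" "E i \<subseteq> elements M" for i
    unfolding D_def E_def using m0 by (auto intro!: dcross_depends ax finite_els_rect els_subset)
  have le: "P (D i) \<le> 18 * x" for i
  proof -
    \<comment> \<open>With eight units of length per side, each side contributes
      \<open>2 * (8 + 1) * x\<close>, and the four sides \<open>72 * x\<close>.\<close>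
    have "2 * h \<le> real 8 * m" using m mesh_ge u nrm_ge0[of u] by (simp add: h_def)
    from hom_dcross_cover[OF sd p ax m(1) this, of i "s i" "- h"] show ?thesis by (simp add: D_def hom_prob_eq)
  qed
  have "P (dlink U u v) \<le> P (\<lambda>\<omega>. \<exists>i\<in>{..<4}. D i \<omega>)"
  proof (rule P_mono_event)
    show "depends_on (\<lambda>\<omega>. \<exists>i\<in>{..<4}. D i \<omega>) (\<Union>i\<in>{..<4}. E i)" by (rule depends_on_bex) (rule dep)
    show "\<exists>i\<in>{..<4::nat}. D i \<omega>" if l: "dlink U u v \<omega>" for \<omega>
    proof -
      have l: "linked (dual_open_step M \<omega>) (dual_open_sites M \<omega>) u v" using l by (auto elim: linked_mono)
      have st: "\<bar>c1 x - c1 y\<bar> \<le> mesh \<and> \<bar>c2 x - c2 y\<bar> \<le> mesh" if "dual_open_step M \<omega> x y" for x y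
        using axes_le[OF axes12 dual_open_step_length[OF that]] axes_le[OF axes21 dual_open_step_length[OF that]] by blast
      have "dcross c1 c2 \<rho> (\<rho> + m) (- h) h \<omega> \<or> dcross c1 c2 (- (\<rho> + m)) (- \<rho>) (- h) h \<omega> \<or>
        dcross c2 c1 \<rho> (\<rho> + m) (- h) h \<omega> \<or> dcross c2 c1 (- (\<rho> + m)) (- \<rho>) (- h) h \<omega>"
        unfolding dcross_def
        by (rule linked_exit[OF l _ _ _ m0 symp_dual_open_step st]) (use u v in \<open>auto simp: nrm_eq h_def\<close>)
      then have "D 0 \<omega> \<or> D 1 \<omega> \<or> D 2 \<omega> \<or> D 3 \<omega>" by (simp add: D_def F_def G_def s_def)
      then show ?thesis by (auto intro: bexI[of _ 0] bexI[of _ 1] bexI[of _ 2] bexI[of _ 3])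
    qed
  qed (use dep in auto)
  also have "\<dots> \<le> (\<Sum>i<4. P (D i))" by (rule P_bex_le) (use dep in auto)
  also have "\<dots> \<le> (\<Sum>i<(4::nat). 18 * x)" by (intro sum_mono le)
  finally show ?thesis by (simp add: hom_prob_eq)
qed

definition near_norm :: "nat \<Rightarrow> complex set" where
  "near_norm n = {z \<in> dual_sites M. \<bar>nrm z - real n\<bar> \<le> a}"

lemma max_dual_eq: "max_dual_connectivity M p n = Max (dual_connectivity M p ` near_norm n)"
  by (simp add: max_dual_connectivity_def near_norm_def nrm_def)

lemma finite_near_norm: "finite (near_norm n)"
proof -
  have "bounded {z. \<bar>nrm z - real n\<bar> \<le> a}" unfolding bounded_iff_nrm by (intro exI[of _ "real n + a"]) auto
  from finite_dual_sites[OF this] show ?thesis by (rule rev_finite_subset) (auto simp: near_norm_def)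
qed

lemma dual_origin_dual: "dual_origin M \<in> dual_sites M"
  using planar by (simp add: planar_lattice_def)

text \<open>Makes the \<open>Max\<close> in the maximal connectivity meaningful. The witness is a
  translate of the dual origin along the first axis.\<close>

lemma near_norm_nonempty:
  assumes "nrm (dual_origin M) \<le> real n"
  shows "near_norm n \<noteq> {}"
proof -
  define k where "k = \<lceil>(real n - c1 (dual_origin M)) / a\<rceil>"
  have k: "real n - c1 (dual_origin M) \<le> real_of_int k * a" "real_of_int k * a \<le> real n - c1 (dual_origin M) + a"
    using ceiling_divide_upper[OF a_pos, of "real n - c1 (dual_origin M)"]
      ceiling_divide_lower[OF a_pos, of "real n - c1 (dual_origin M)"] by (auto simp: k_def algebra_simps)
  define z where "z = dual_origin M + lat k 0"
  have "c1 z = c1 (dual_origin M) + real_of_int k * a" "c2 z = c2 (dual_origin M)"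
    by (simp_all add: z_def linear_add[OF linear_c1] linear_add[OF linear_c2] c1_lat c2_lat)
  then have "\<bar>nrm z - real n\<bar> \<le> a" using k assms a_pos by (simp add: nrm_eq)
  moreover have "z \<in> dual_sites M" using dual_origin_dual period_dual[OF lat_period] by (simp add: z_def)
  ultimately show ?thesis by (auto simp: near_norm_def)
qed

lemma dual_connectivity_01: "0 \<le> dual_connectivity M p z" "0 \<le> p \<Longrightarrow> p \<le> 1 \<Longrightarrow> dual_connectivity M p z \<le> 1"
proof -
  show "0 \<le> dual_connectivity M p z" by (simp add: dual_connectivity_def hom_prob_def)
  assume "0 \<le> p" "p \<le> 1"
  then interpret bernoulli_field M "\<lambda>_. p" by (rule bernoulli_field_const)
  show "dual_connectivity M p z \<le> 1" by (simp add: dual_connectivity_dlink hom_prob_eq P_le_1)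
qed

lemma max_dual_ge: "z \<in> near_norm n \<Longrightarrow> dual_connectivity M p z \<le> max_dual_connectivity M p n"
  unfolding max_dual_eq using finite_near_norm by (intro Max_ge) auto

text \<open>At distance \<open>X\<close> the largest available scale \<open>2 ^ j * K\<close>
  exceeds \<open>X / 2\<close>, so connectivities are at most \<open>exp (- X / (2 * K))\<close>.
  Comparing exponential rates gives the bound.\<close>

lemma corr_length_le:
  assumes sd: "short_dual_le p (exp (- 1) / 144) m" and p: "0 \<le> p" "p \<le> 1" and m: "10 * mesh \<le> m"
    and xi: "is_corr_length M p \<xi>"
  shows "\<xi> \<le> 2 * (m + 5 * mesh)"
proof -
  define K where "K = m + 5 * mesh"
  define o' where "o' = nrm (dual_origin M)"
  have K0: "0 < K" using m mesh_ge by (simp add: K_def)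
  define C where "C = a + o' + 5 * mesh"
  have bound: "max_dual_connectivity M p n \<le> exp (- (real n - C) / (2 * K))"
    if n: "4 * o' + 2 * K + a + 4 * mesh + 10 * C \<le> real n" for n
  proof -
    have o0: "0 \<le> o'" by (simp add: o'_def nrm_ge0)
    define X where "X = real n - C"
    have C0: "0 \<le> C" using o0 a_pos mesh_ge by (simp add: C_def)
    have X: "2 * K \<le> X" using n o0 mesh_ge a_pos C0 unfolding X_def by linarith
    obtain j where j: "2 ^ j * K \<le> X + 5 * mesh" "X + 5 * mesh < 2 ^ (Suc j) * K"
    proof -
      define Y where "Y = (X + 5 * mesh) / K"
      have Y1: "1 \<le> Y" using X K0 mesh_ge by (simp add: Y_def)
      obtain i where i: "Y < 2 ^ i" using real_arch_pow[of 2 Y] by auto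
      define l where "l = (LEAST i. Y < 2 ^ i)"
      have l: "Y < 2 ^ l" unfolding l_def by (rule LeastI) (rule i)
      then have "l \<noteq> 0" using Y1 by (cases l) auto
      then obtain j where j: "l = Suc j" by (cases l) auto
      then have "\<not> Y < 2 ^ j" using not_less_Least[of j "\<lambda>i. Y < 2 ^ i"] by (simp add: l_def)
      then show thesis using that[of j] l j K0 by (simp add: Y_def field_simps)
    qed
    define mj where "mj = 2 ^ j * K - 5 * mesh"
    have sdj: "short_dual_le p (exp (- (2 ^ j)) / 144) mj"
      unfolding mj_def K_def by (rule short_dual_decay[OF sd p m])
    have "X + 5 * mesh < 2 * (2 ^ j * K)" using j(2) by simp
    then have mjX: "X - 5 * mesh < 2 * mj" "mj \<le> X" using j(1) mesh_ge by (auto simp: mj_def)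
    have mj: "2 * mesh \<le> mj" "o' + mesh \<le> mj"
      using mjX(1) n K0 o0 a_pos mesh_ge(1) unfolding X_def C_def by (smt (verit))+
    have "dual_connectivity M p z \<le> exp (- (2 ^ j))" if z: "z \<in> near_norm n" for z
    proof -
      have "o' + mj \<le> nrm z" using z mjX(2) unfolding near_norm_def X_def C_def using mesh_ge by (auto simp: abs_le_iff)
      then have "dual_connectivity M p z \<le> 72 * (exp (- (2 ^ j)) / 144)"
        unfolding dual_connectivity_dlink
        by (rule dual_exit_prob[OF sdj p mj, rotated]) (simp add: o'_def)
      then show ?thesis by (rule order_trans) simp
    qed
    moreover have "near_norm n \<noteq> {}" by (rule near_norm_nonempty) (use n o0 K0 a_pos mesh_ge C0 in \<open>simp add: o'_def\<close>)
    ultimately have "max_dual_connectivity M p n \<le> exp (- (2 ^ j))"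
      unfolding max_dual_eq using finite_near_norm by (subst Max_le_iff) auto
    also have "\<dots> \<le> exp (- (real n - C) / (2 * K))"
    proof -
      have "X \<le> 2 ^ j * (2 * K)" using j(2) mesh_ge by (simp add: mult.assoc mult.left_commute)
      then have "X / (2 * K) \<le> 2 ^ j" using K0 by (simp add: pos_divide_le_eq)
      then have "- (2 ^ j) \<le> - X / (2 * K)" by simp
      then show ?thesis unfolding X_def by (simp only: exp_le_cancel_iff)
    qed
    finally show ?thesis .
  qed
  have lim1: "(\<lambda>n. max_dual_connectivity M p n powr (1 / real n)) \<longlonglongrightarrow> exp (- 1 / \<xi>)" and xi0: "0 < \<xi>"
    using xi by (auto simp: is_corr_length_def)
  have lim2: "(\<lambda>n. exp (- (real n - C) / (2 * K)) powr (1 / real n)) \<longlonglongrightarrow> exp (- 1 / (2 * K))"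
  proof -
    have L: "(\<lambda>n. exp ((- (real n - C) / (2 * K)) * (1 / real n))) \<longlonglongrightarrow> exp (- (inverse K / 2))"
      using K0 by real_asymp
    have eq: "- (inverse K / 2) = - 1 / (2 * K)" using K0 by (simp add: field_simps)
    have po: "exp x powr y = exp (x * y)" for x y :: real by (simp add: powr_def mult.commute)
    show ?thesis unfolding po by (rule L[unfolded eq])
  qed
  have "exp (- 1 / \<xi>) \<le> exp (- 1 / (2 * K))"
  proof (rule tendsto_le[OF _ lim2 lim1])
    have "eventually (\<lambda>n::nat. 4 * o' + 2 * K + a + 4 * mesh + 10 * C \<le> real n) sequentially"
      by real_asymp
    then show "eventually (\<lambda>n. max_dual_connectivity M p n powr (1 / real n) \<le> exp (- (real n - C) / (2 * K)) powr (1 / real n)) sequentially"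
    proof eventually_elim
      case (elim n)
      have "near_norm n \<noteq> {}"
        by (rule near_norm_nonempty) (use elim K0 a_pos mesh_ge nrm_ge0[of "dual_origin M"] in \<open>simp add: o'_def C_def\<close>)
      then obtain z where "z \<in> near_norm n" by blast
      then have "0 \<le> max_dual_connectivity M p n"
        using max_dual_ge[of z n p] dual_connectivity_01(1)[of p z] by linarith
      then show ?case using bound[OF elim] by (intro powr_mono2) auto
    qed
  qed simp
  then have "- 1 / \<xi> \<le> - 1 / (2 * K)" by simp
  then show ?thesis using xi0 K0 by (simp add: K_def field_simps)
qed

subsection \<open>Two-point connectivities\<close>

text \<open>By periodicity finitely many pairs are enough, which makes the radius uniform.\<close>

lemma vacant_local:
  "\<exists>r. \<forall>\<zeta>\<in>dual_sites M. \<forall>\<zeta>'\<in>dual_sites M. nrm (\<zeta>' - \<zeta>) \<le> B \<longrightarrow> dlink {z. nrm (z - \<zeta>) \<le> r} \<zeta> \<zeta>' (\<lambda>_. False)"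
proof -
  define V where "V = dual_sites M \<inter> {z. nrm z \<le> a + \<bar>B\<bar>}"
  have "finite V" unfolding V_def by (rule finite_dual_sites) (auto simp: bounded_iff_nrm)
  have one: "\<exists>r. dlink {z. nrm (z - \<zeta>) \<le> r} \<zeta> \<zeta>' (\<lambda>_. False)" if "\<zeta> \<in> V" "\<zeta>' \<in> V" for \<zeta> \<zeta>'
  proof -
    have "linked (dual_open_step M (\<lambda>_. False)) (dual_sites M) \<zeta> \<zeta>'"
      using that by (intro vacant_dual_connected) (auto simp: V_def)
    then obtain xs where xs: "xs \<noteq> []" "hd xs = \<zeta>" "last xs = \<zeta>'" "set xs \<subseteq> dual_sites M" "successively (dual_open_step M (\<lambda>_. False)) xs"
      unfolding linked_iff_list by blast
    have "dlink {z. nrm (z - \<zeta>) \<le> Max ((\<lambda>z. nrm (z - \<zeta>)) ` set xs)} \<zeta> \<zeta>' (\<lambda>_. False)"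
      unfolding linked_iff_list using xs by (intro exI[of _ xs]) (auto simp: dual_open_site_def)
    then show ?thesis by blast
  qed
  then obtain r where r: "\<And>\<zeta> \<zeta>'. \<zeta> \<in> V \<Longrightarrow> \<zeta>' \<in> V \<Longrightarrow> dlink {z. nrm (z - \<zeta>) \<le> r \<zeta> \<zeta>'} \<zeta> \<zeta>' (\<lambda>_. False)" by metis
  define r' where "r' = Max (insert 0 ((\<lambda>(\<zeta>, \<zeta>'). r \<zeta> \<zeta>') ` (V \<times> V)))"
  have r': "r \<zeta> \<zeta>' \<le> r'" if "\<zeta> \<in> V" "\<zeta>' \<in> V" for \<zeta> \<zeta>'
    unfolding r'_def using \<open>finite V\<close> that by (intro Max_ge) auto
  show ?thesis
  proof (intro exI[of _ r'] ballI impI)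
    fix \<zeta> \<zeta>' assume z: "\<zeta> \<in> dual_sites M" "\<zeta>' \<in> dual_sites M" "nrm (\<zeta>' - \<zeta>) \<le> B"
    obtain t where t: "t \<in> period" "0 \<le> c1 (\<zeta> - t)" "c1 (\<zeta> - t) < a" "0 \<le> c2 (\<zeta> - t)" "c2 (\<zeta> - t) < a"
      using lat_reduce[OF axes12] by blast
    have 1: "nrm (\<zeta> - t) \<le> a" using t by (simp add: nrm_eq)
    then have "\<zeta> - t \<in> V" using z(1) period_dual[OF period_minus[OF t(1)], of \<zeta>] by (simp add: V_def)
    moreover have "nrm (\<zeta>' - t) \<le> a + \<bar>B\<bar>"
      using nrm_triangle'[of \<zeta>' t \<zeta>] 1 z(3) by linarith
    then have "\<zeta>' - t \<in> V" using z(2) period_dual[OF period_minus[OF t(1)], of \<zeta>'] by (simp add: V_def)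
    ultimately have "dlink {z. nrm (z - (\<zeta> - t)) \<le> r'} (\<zeta> - t) (\<zeta>' - t) (\<lambda>_. False)"
      using r[of "\<zeta> - t" "\<zeta>' - t"] r'[of "\<zeta> - t" "\<zeta>' - t"] by (auto elim!: linked_mono)
    from dual_linked_translate[OF t(1), of "\<lambda>_. False", OF this]
    have "dlink ((\<lambda>z. z + t) ` {z. nrm (z - (\<zeta> - t)) \<le> r'}) (\<zeta> - t + t) (\<zeta>' - t + t) (\<lambda>_. False)" .
    then show "dlink {z. nrm (z - \<zeta>) \<le> r'} \<zeta> \<zeta>' (\<lambda>_. False)"
      by (auto elim!: linked_mono simp: algebra_simps)
  qed
qed

lemma card_els_ball: "\<exists>K. \<forall>z. card (els {w. nrm (w - z) \<le> r}) \<le> K"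
proof -
  have fin: "finite (els {w. nrm (w - z) \<le> r})" for z r
  proof (rule finite_els)
    have "nrm w \<le> r + nrm z" if "nrm (w - z) \<le> r" for w
      using that nrm_triangle[of "w - z" z] by simp
    then show "bounded {w. nrm (w - z) \<le> r}" by (auto simp: bounded_iff_nrm)
  qed
  show ?thesis
  proof (intro exI[of _ "card (els {w. nrm (w - 0) \<le> r + a})"] allI)
    fix z
    obtain t where t: "t \<in> period" "0 \<le> c1 (z - t)" "c1 (z - t) < a" "0 \<le> c2 (z - t)" "c2 (z - t) < a"
      using lat_reduce[OF axes12] by blast
    have 1: "nrm (z - t) \<le> a" using t by (simp add: nrm_eq)
    let ?h = "image (\<lambda>w. w + - t)"
    have "inj_on ?h (els {w. nrm (w - z) \<le> r})"
      by (intro inj_onI) (simp add: inj_image_eq_iff inj_def)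
    moreover have "?h ` els {w. nrm (w - z) \<le> r} \<subseteq> els {w. nrm (w - 0) \<le> r + a}"
    proof
      fix b' assume "b' \<in> ?h ` els {w. nrm (w - z) \<le> r}"
      then obtain b where b: "b \<in> elements M" "b \<subseteq> {w. nrm (w - z) \<le> r}" "b' = ?h b" by (auto simp: els_def)
      have "b' \<in> elements M"
        using elements_invariant[of "\<lambda>w. w + - t"] period_minus[OF t(1)] b(1,3) unfolding period_def by blast
      moreover have "nrm (w + - t) \<le> r + a" if "w \<in> b" for w
        using nrm_triangle'[of w t z] 1 b(2) that by auto
      ultimately show "b' \<in> els {w. nrm (w - 0) \<le> r + a}" using b(3) by (auto simp: els_def)
    qed
    ultimately show "card (els {w. nrm (w - z) \<le> r}) \<le> card (els {w. nrm (w - 0) \<le> r + a})"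
      using fin[of 0 "r + a"] by (rule card_inj_on_le)
  qed
qed

text \<open>A connection in the whole plane depends on infinitely many elements; as a countable
  union of local events it is measurable.\<close>

lemma dlink_bounded:
  "dlink UNIV u v \<omega> \<longleftrightarrow> (\<exists>n::nat. dlink {z. nrm z \<le> real n} u v \<omega>)"
proof
  assume "dlink UNIV u v \<omega>"
  then obtain xs where xs: "xs \<noteq> []" "hd xs = u" "last xs = v" "set xs \<subseteq> dual_open_sites M \<omega>" "successively (dual_open_step M \<omega>) xs"
    unfolding linked_iff_list by auto
  have "bounded (set xs)" by (simp add: finite_imp_bounded)
  then obtain R where R: "\<forall>z\<in>set xs. nrm z \<le> R" by (auto simp: bounded_iff_nrm)
  have "dlink {z. nrm z \<le> real (nat \<lceil>R\<rceil>)} u v \<omega>"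
    unfolding linked_iff_list using xs R real_nat_ceiling_ge[of R] by (intro exI[of _ xs]) fastforce
  then show "\<exists>n::nat. dlink {z. nrm z \<le> real n} u v \<omega>" by blast
qed (auto elim!: linked_mono)

lemma dlink_le_connectivity:
  assumes p: "0 \<le> p" "p \<le> 1"
  shows "hom_prob M p (dlink U (dual_origin M) z) \<le> dual_connectivity M p z"
proof -
  interpret bernoulli_field M "\<lambda>_. p" using p by (rule bernoulli_field_const)
  have meas: "{\<omega> \<in> space \<mu>. dlink {z. nrm z \<le> real n} (dual_origin M) z \<omega>} \<in> sets \<mu>" for n
  proof (rule event_sets[OF dual_linked_depends _ els_subset])
    show "finite (els (halo {z. nrm z \<le> real n}))"
      by (intro finite_els bounded_halo) (auto simp: bounded_iff_nrm)
  qed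
  have "{\<omega> \<in> space \<mu>. dlink UNIV (dual_origin M) z \<omega>} = (\<Union>n::nat. {\<omega> \<in> space \<mu>. dlink {z. nrm z \<le> real n} (dual_origin M) z \<omega>})"
    unfolding dlink_bounded by blast
  also have "\<dots> \<in> sets \<mu>"
    using meas by (intro sets.countable_UN) auto
  finally show ?thesis
    unfolding dual_connectivity_dlink hom_prob_eq perc_prob_def
    by (intro finite_measure_mono) (auto elim: linked_mono)
qed

lemma dlink_mono: "dlink U u v \<omega> \<Longrightarrow> U \<subseteq> V \<Longrightarrow> dlink V u v \<omega>"
  by (rule linked_mono) auto

text \<open>The definition of \<xi> gives the rate \<open>1 / \<xi>\<close> only in the limit. Half
  of this rate holds from some index on, and \<open>C\<close> absorbs the earlier ones.\<close>

lemma connectivity_decay: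
  assumes p: "0 \<le> p" "p \<le> 1" and xi: "is_corr_length M p \<xi>"
  shows "\<exists>C>0. \<forall>n. \<forall>z\<in>near_norm n. dual_connectivity M p z \<le> C * exp (- (real n / (2 * \<xi>)))"
proof -
  have xi0: "0 < \<xi>" and lim: "(\<lambda>n. max_dual_connectivity M p n powr (1 / real n)) \<longlonglongrightarrow> exp (- 1 / \<xi>)"
    using xi by (auto simp: is_corr_length_def)
  have "exp (- 1 / \<xi>) < exp (- (1 / (2 * \<xi>)))" using xi0 by (simp add: field_simps)
  from order_tendstoD(2)[OF lim this] obtain N where
    N: "\<And>n. N \<le> n \<Longrightarrow> max_dual_connectivity M p n powr (1 / real n) < exp (- (1 / (2 * \<xi>)))"
    by (auto simp: eventually_sequentially)
  define N' where "N' = Suc N"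
  show ?thesis
  proof (intro exI[of _ "exp (real N' / (2 * \<xi>))"] conjI allI ballI)
    fix n z assume z: "z \<in> near_norm n"
    let ?c = "dual_connectivity M p z"
    show "?c \<le> exp (real N' / (2 * \<xi>)) * exp (- (real n / (2 * \<xi>)))"
    proof (cases "N' \<le> n")
      case False
      then have "1 \<le> exp (real N' / (2 * \<xi>) - real n / (2 * \<xi>))"
        using xi0 by (simp add: divide_right_mono)
      also have "\<dots> = exp (real N' / (2 * \<xi>)) * exp (- (real n / (2 * \<xi>)))"
        by (simp flip: exp_add)
      finally show ?thesis using dual_connectivity_01(2)[OF p, of z] by linarith
    next
      case True
      then have n: "N \<le> n" "0 < n" by (auto simp: N'_def)
      have "?c powr (1 / real n) \<le> max_dual_connectivity M p n powr (1 / real n)"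
        using max_dual_ge[OF z, of p] dual_connectivity_01(1)[of p z] by (intro powr_mono2) auto
      also have "\<dots> \<le> exp (- (1 / (2 * \<xi>)))" using N[OF n(1)] by simp
      finally have "(?c powr (1 / real n)) powr real n \<le> exp (- (1 / (2 * \<xi>))) powr real n"
        by (intro powr_mono2) auto
      then have "?c \<le> exp (- (real n / (2 * \<xi>)))"
        using n(2) dual_connectivity_01(1)[of p z] by (simp add: powr_powr) (simp add: powr_def)
      also have "\<dots> \<le> exp (real N' / (2 * \<xi>)) * exp (- (real n / (2 * \<xi>)))" using xi0 by simp
      finally show ?thesis .
    qed
  qed simp
qed

text \<open>Forcing the elements near both end points to be vacant connects them, at a bounded cost, to a
  translate of the dual origin and to a dual site at a distance close to an integer.\<close>

lemma two_point_decay: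
  assumes p: "0 < p" "p < 1" and xi: "is_corr_length M p \<xi>"
  shows "\<exists>C>0. \<forall>z1\<in>dual_sites M. \<forall>z2\<in>dual_sites M. \<forall>U. bounded U \<longrightarrow>
    hom_prob M p (dlink U z1 z2) \<le> C * exp (- (nrm (z2 - z1) / (2 * \<xi>)))"
proof -
  interpret bernoulli_field M "\<lambda>_. p" using p by (intro bernoulli_field_const) auto
  have p': "0 \<le> p" "p \<le> 1" using p by auto
  have xi0: "0 < \<xi>" using xi by (simp add: is_corr_length_def)
  obtain C where C: "C > 0" "\<And>n z. z \<in> near_norm n \<Longrightarrow> dual_connectivity M p z \<le> C * exp (- (real n / (2 * \<xi>)))"
    using connectivity_decay[OF p' xi] by blast
  define B where "B = nrm (dual_origin M) + 1 + 2 * a"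
  obtain r where r: "\<And>\<zeta> \<zeta>'. \<zeta> \<in> dual_sites M \<Longrightarrow> \<zeta>' \<in> dual_sites M \<Longrightarrow> nrm (\<zeta>' - \<zeta>) \<le> B \<Longrightarrow>
      dlink {z. nrm (z - \<zeta>) \<le> r} \<zeta> \<zeta>' (\<lambda>_. False)"
    using vacant_local[of B] by blast
  obtain K where K: "\<And>z. card (els {w. nrm (w - z) \<le> r + mesh}) \<le> K" using card_els_ball by blast
  define C' where "C' = C * exp ((1 + a) / (2 * \<xi>)) / (1 - p) ^ (2 * K)"
  have C'0: "0 < C'" using C(1) p by (simp add: C'_def)
  have "hom_prob M p (dlink U z1 z2) \<le> C' * exp (- (nrm (z2 - z1) / (2 * \<xi>)))"
    if z: "z1 \<in> dual_sites M" "z2 \<in> dual_sites M" and U: "bounded U" for z1 z2 U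
  proof -
    obtain t where t: "t \<in> period" "0 \<le> c1 (z1 - t)" "c1 (z1 - t) < a" "0 \<le> c2 (z1 - t)" "c2 (z1 - t) < a"
      using lat_reduce[OF axes12] by blast
    have zt: "nrm (z1 - t) \<le> a" using t by (simp add: nrm_eq)
    define o' where "o' = dual_origin M + t"
    have o': "o' \<in> dual_sites M" using dual_origin_dual period_dual[OF t(1)] by (simp add: o'_def)
    have o'z: "o' - z1 = dual_origin M + (t - z1)" by (simp add: o'_def)
    have "nrm (o' - z1) \<le> B"
      unfolding o'z using nrm_triangle[of "dual_origin M" "t - z1"] zt nrm_minus_commute[of t z1] a_pos by (simp add: B_def)
    note l1 = r[OF z(1) o' this]
    define y where "y = z2 - t"
    obtain f g where ax: "axes f g" "nrm y = \<bar>f y\<bar>"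
    proof (cases "\<bar>c2 y\<bar> \<le> \<bar>c1 y\<bar>")
      case True
      then show thesis using that[OF axes12] by (simp add: nrm_eq)
    next
      case False
      then show thesis using that[OF axes21] by (simp add: nrm_eq)
    qed
    interpret oblique f g by (rule axes_oblique[OF ax(1)])
    define N where "N = nat \<lceil>nrm y\<rceil>"
    have N: "nrm y \<le> real N" "real N \<le> nrm y + 1" using nrm_ge0[of y] by (auto simp: N_def)
    define j where "j = \<lceil>(real N - nrm y) / a\<rceil>"
    have j: "real N - nrm y \<le> real_of_int j * a" "real_of_int j * a \<le> real N - nrm y + a"
      using ceiling_divide_upper[OF a_pos, of "real N - nrm y"] ceiling_divide_lower[OF a_pos, of "real N - nrm y"]
      by (auto simp: j_def algebra_simps)
    \<comment> \<open>Connectivities are bounded at norms close to an integer. Moving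
      \<open>z2\<close> outwards along its dominant coordinate, seen from \<open>t\<close>,
      increases the norm by exactly \<open>j\<close> spacings and brings it to within one spacing of
      \<open>N\<close>.\<close>
    define \<sigma> :: int where "\<sigma> = (if 0 \<le> f y then 1 else - 1)"
    obtain s where s: "s \<in> period" "f s = real_of_int (\<sigma> * j) * a" "g s = real_of_int 0 * a"
      using axes_lat[OF ax(1)] by blast
    define z where "z = z2 + s"
    have zd: "z \<in> dual_sites M" using z(2) period_dual[OF s(1)] by (simp add: z_def)
    have ja: "0 \<le> real_of_int j * a" using j(1) N(1) by linarith
    have fs: "\<bar>f s\<bar> = real_of_int j * a" using abs_of_nonneg[OF ja] by (simp add: s(2) \<sigma>_def abs_mult)
    have "nrm s = real_of_int j * a" using fs s(3) ja by (simp add: axes_nrm[OF ax(1)])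
    then have "nrm (z - z2) \<le> B" using j N nrm_ge0[of "dual_origin M"] a_pos by (simp add: z_def B_def)
    note l2 = r[OF \<open>z2 \<in> dual_sites M\<close> zd this]
    have "nrm (y + s) = nrm y + real_of_int j * a"
    proof -
      have "\<bar>f (y + s)\<bar> = \<bar>f y\<bar> + real_of_int j * a"
        using ja by (auto simp: f_add s(2) \<sigma>_def)
      moreover have "\<bar>g (y + s)\<bar> \<le> \<bar>f y\<bar>" using ax(2) by (simp add: g_add s(3) axes_nrm[OF ax(1)])
      ultimately show ?thesis using ax(2) ja by (simp add: axes_nrm[OF ax(1)])
    qed
    moreover have "y + s = z - t" by (simp add: y_def z_def)
    ultimately have "z - t \<in> near_norm N"
      using zd period_dual[OF period_minus[OF t(1)], of z] j by (simp add: near_norm_def)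
    then have "dual_connectivity M p (z - t) \<le> C * exp (- (real N / (2 * \<xi>)))" by (rule C(2))
    also have "\<dots> \<le> C * (exp ((1 + a) / (2 * \<xi>)) * exp (- (nrm (z2 - z1) / (2 * \<xi>))))"
    proof -
      have "nrm (z2 - z1) \<le> nrm y + a"
        using nrm_triangle'[of z2 z1 t] zt nrm_minus_commute[of t z1] by (simp add: y_def)
      then have "nrm (z2 - z1) \<le> (1 + a) + real N" using N by linarith
      then have "nrm (z2 - z1) / (2 * \<xi>) \<le> ((1 + a) + real N) / (2 * \<xi>)"
        using xi0 by (intro divide_right_mono) auto
      then have "- (real N / (2 * \<xi>)) \<le> (1 + a) / (2 * \<xi>) + - (nrm (z2 - z1) / (2 * \<xi>))"
        by (simp add: add_divide_distrib)
      then have "exp (- (real N / (2 * \<xi>))) \<le> exp ((1 + a) / (2 * \<xi>)) * exp (- (nrm (z2 - z1) / (2 * \<xi>)))"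
        unfolding exp_add[symmetric] exp_le_cancel_iff .
      then show ?thesis using C(1) by (intro mult_left_mono) auto
    qed
    finally have conn: "dual_connectivity M p (z - t) \<le> C * (exp ((1 + a) / (2 * \<xi>)) * exp (- (nrm (z2 - z1) / (2 * \<xi>))))" .
    define B1 where "B1 = {w. nrm (w - z1) \<le> r}"
    define B2 where "B2 = {w. nrm (w - z2) \<le> r}"
    define U' where "U' = U \<union> B1 \<union> B2"
    have ball: "bounded {w. nrm (w - x) \<le> R}" for x R
    proof -
      have "nrm w \<le> R + nrm x" if "nrm (w - x) \<le> R" for w
        using that nrm_triangle[of "w - x" x] by simp
      then show ?thesis by (auto simp: bounded_iff_nrm)
    qed
    have bU': "bounded U'" using U ball by (simp add: U'_def B1_def B2_def)
    have halo_ball: "halo {w. nrm (w - x) \<le> r} \<subseteq> {w. nrm (w - x) \<le> r + mesh}" for x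
    proof
      fix w assume "w \<in> halo {w. nrm (w - x) \<le> r}"
      then obtain w' where "nrm (w' - x) \<le> r" "nrm (w - w') \<le> mesh" by (auto simp: halo_def)
      then show "w \<in> {w. nrm (w - x) \<le> r + mesh}" using nrm_triangle'[of w x w'] by simp
    qed
    define E where "E = els {w. nrm (w - z1) \<le> r + mesh} \<union> els {w. nrm (w - z2) \<le> r + mesh}"
    have finE: "finite E" "E \<subseteq> elements M" using ball by (auto simp: E_def finite_els els_subset)
    have cardE: "card E \<le> 2 * K" unfolding E_def
      using card_Un_le[of "els {w. nrm (w - z1) \<le> r + mesh}" "els {w. nrm (w - z2) \<le> r + mesh}"] K[of z1] K[of z2] by linarith
    define A where "A = dlink U z1 z2"
    have depA: "depends_on (\<lambda>\<omega>. \<not> A \<omega>) (els (halo U))" unfolding A_def by (rule depends_on_not[OF dual_linked_depends])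
    have finU: "finite (els (halo U))" "finite (els (halo U'))" by (intro finite_els bounded_halo U bU')+
    have upA: "up_event (\<lambda>\<omega>. \<not> A \<omega>)" unfolding A_def by (rule dual_linked_down)
    have depB: "depends_on (\<lambda>\<omega>. \<exists>b\<in>E. \<omega> b) E" and upB: "up_event (\<lambda>\<omega>. \<exists>b\<in>E. \<omega> b)"
      by (auto simp: depends_on_def up_event_def)
    have dA: "depends_on A (els (halo U))" unfolding A_def by (rule dual_linked_depends)
    \<comment> \<open>The dual connection and the vacancy of \<open>E\<close> are both decreasing,
      so by Harris forcing the vacancy costs at most the factor
      \<open>(1 - p) ^ (2 * K)\<close>.\<close>
    have "P A * (1 - p) ^ (2 * K) \<le> P A * P (\<lambda>\<omega>. \<forall>b\<in>E. \<not> \<omega> b)"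
      using P_vacant[OF finE] p cardE by (intro mult_left_mono P_nonneg) (simp add: power_decreasing)
    also have "\<dots> \<le> P (\<lambda>\<omega>. A \<omega> \<and> (\<forall>b\<in>E. \<not> \<omega> b))"
      using P_harris_not[OF depA finU(1) els_subset upA depB finE upB] by simp
    also have "\<dots> \<le> P (dlink U' o' z)"
    proof (rule P_mono_event[OF dual_linked_depends finU(2) els_subset])
      fix \<omega> assume w: "A \<omega> \<and> (\<forall>b\<in>E. \<not> \<omega> b)"
      have "els (halo B1) \<subseteq> E" unfolding E_def B1_def using els_mono[OF halo_ball[of z1]] by blast
      then have "\<forall>b\<in>els (halo B1). \<omega> b \<longrightarrow> False" using w by blast
      then have "dlink B1 z1 o' \<omega>" by (rule dual_linked_transfer[OF _ l1[folded B1_def]])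
      then have "dlink U' z1 o' \<omega>" by (rule dlink_mono) (auto simp: U'_def)
      then have 1: "dlink U' o' z1 \<omega>" by (rule linked_sym[OF _ symp_dual_open_step])
      have "els (halo B2) \<subseteq> E" unfolding E_def B2_def using els_mono[OF halo_ball[of z2]] by blast
      then have "\<forall>b\<in>els (halo B2). \<omega> b \<longrightarrow> False" using w by blast
      then have "dlink B2 z2 z \<omega>" by (rule dual_linked_transfer[OF _ l2[folded B2_def]])
      then have 2: "dlink U' z2 z \<omega>" by (rule dlink_mono) (auto simp: U'_def)
      have "dlink U z1 z2 \<omega>" using w by (simp add: A_def)
      then have "dlink U' z1 z2 \<omega>" by (rule dlink_mono) (auto simp: U'_def)
      from linked_trans[OF linked_trans[OF 1 this] 2] show "dlink U' o' z \<omega>" .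
    qed
    also have "\<dots> = hom_prob M p (dlink ((\<lambda>z. z + - t) ` U') (dual_origin M) (z - t))"
    proof -
      let ?V = "(\<lambda>z. z + - t) ` U'"
      have eq: "dlink ?V (dual_origin M) (z - t) (\<lambda>b. \<omega> ((\<lambda>z. z + t) ` b)) = dlink U' o' z \<omega>" for \<omega>
        using dual_linked_translate_iff[OF t(1), of \<omega> ?V "dual_origin M" "z - t"]
        by (simp add: image_image o'_def)
      have "invariant_under M (\<lambda>z. z + t)" using t(1) by (simp add: period_def)
      moreover have "inj (\<lambda>z. z + t)" by simp
      moreover have "bounded (halo ?V)"
        by (intro bounded_halo) (use bounded_translation[OF bU', of "- t"] in \<open>simp add: add.commute\<close>)
      ultimately have "hom_prob M p (\<lambda>\<omega>. dlink ?V (dual_origin M) (z - t) (\<lambda>b. \<omega> ((\<lambda>z. z + t) ` b))) = hom_prob M p (dlink ?V (dual_origin M) (z - t))"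
        by (intro hom_prob_invariant[OF dual_linked_depends] p')
      then show ?thesis unfolding eq by (simp add: hom_prob_eq)
    qed
    also have "\<dots> \<le> dual_connectivity M p (z - t)" by (rule dlink_le_connectivity[OF p'])
    finally have "P A * (1 - p) ^ (2 * K) \<le> C * (exp ((1 + a) / (2 * \<xi>)) * exp (- (nrm (z2 - z1) / (2 * \<xi>))))"
      using conn by linarith
    moreover have "0 < (1 - p) ^ (2 * K)" using p by simp
    ultimately have "P A \<le> C * (exp ((1 + a) / (2 * \<xi>)) * exp (- (nrm (z2 - z1) / (2 * \<xi>)))) / (1 - p) ^ (2 * K)"
      by (simp only: pos_le_divide_eq)
    then show ?thesis by (simp add: A_def hom_prob_eq C'_def mult.assoc)
  qed
  then show ?thesis using C'0 by blast
qed

lemma dual_card: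
  "\<exists>K>0. \<forall>R\<ge>0. \<forall>z. real (card (dual_sites M \<inter> {w. nrm (w - z) \<le> R})) \<le> K * (1 + R)\<^sup>2"
proof -
  define Z where "Z = dual_sites M \<inter> {w. nrm w \<le> a}"
  have finZ: "finite Z" unfolding Z_def by (rule finite_dual_sites) (auto simp: bounded_iff_nrm)
  define K where "K = (real (card Z) + 1) * (2 / a + 2)\<^sup>2"
  have "0 < 2 / a + 2" using a_pos by (simp add: add_pos_pos)
  then have K0: "0 < K" unfolding K_def by (intro mult_pos_pos) auto
  have "real (card (dual_sites M \<inter> {w. nrm (w - z) \<le> R})) \<le> K * (1 + R)\<^sup>2" if R: "0 \<le> R" for R z
  proof -
    define I where "I x = {\<lfloor>(x - R) / a\<rfloor>..\<lfloor>(x + R) / a\<rfloor>}" for x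
    have I: "real (card (I x)) \<le> (2 / a + 2) * (1 + R)" for x
    proof -
      have "(x - R) / a \<le> (x + R) / a" using R a_pos by (simp add: divide_right_mono)
      then have "\<lfloor>(x - R) / a\<rfloor> \<le> \<lfloor>(x + R) / a\<rfloor>" by (rule floor_mono)
      then have "real (card (I x)) = real_of_int \<lfloor>(x + R) / a\<rfloor> - real_of_int \<lfloor>(x - R) / a\<rfloor> + 1"
        by (simp add: I_def)
      also have "\<dots> \<le> (x + R) / a - (x - R) / a + 2" by linarith
      also have "\<dots> = 2 * R / a + 2" by (simp add: diff_divide_distrib[symmetric])
      also have "\<dots> \<le> (2 / a + 2) * (1 + R)" using R a_pos by (simp add: field_simps)
      finally show ?thesis .
    qed
    have "dual_sites M \<inter> {w. nrm (w - z) \<le> R} \<subseteq> (\<Union>ij\<in>I (c1 z) \<times> I (c2 z). (\<lambda>v. v + lat (fst ij) (snd ij)) ` Z)"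
    proof
      fix w assume w: "w \<in> dual_sites M \<inter> {w. nrm (w - z) \<le> R}"
      let ?i = "\<lfloor>c1 w / a\<rfloor>" and ?j = "\<lfloor>c2 w / a\<rfloor>"
      have fl: "real_of_int \<lfloor>x / a\<rfloor> * a \<le> x" "x < real_of_int \<lfloor>x / a\<rfloor> * a + a" for x
        using floor_divide_lower[OF a_pos, of x] floor_divide_upper[OF a_pos, of x] by (auto simp: algebra_simps)
      have cw: "\<bar>c1 w - c1 z\<bar> \<le> R" "\<bar>c2 w - c2 z\<bar> \<le> R"
        using w by (auto simp: nrm_eq linear_diff[OF linear_c1] linear_diff[OF linear_c2])
      have "?i \<in> I (c1 z)" "?j \<in> I (c2 z)"
        using cw a_pos unfolding I_def by (auto intro!: floor_mono divide_right_mono)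
      moreover have "w - lat ?i ?j \<in> Z"
        using w fl[of "c1 w"] fl[of "c2 w"] period_dual[OF period_minus[OF lat_period], of w ?i ?j]
        by (auto simp: Z_def nrm_eq linear_diff[OF linear_c1] linear_diff[OF linear_c2] c1_lat c2_lat)
      then have "w \<in> (\<lambda>v. v + lat ?i ?j) ` Z" by (auto simp: image_iff intro!: bexI[of _ "w - lat ?i ?j"])
      ultimately show "w \<in> (\<Union>ij\<in>I (c1 z) \<times> I (c2 z). (\<lambda>v. v + lat (fst ij) (snd ij)) ` Z)"
        by (intro UN_I[of "(?i, ?j)"]) auto
    qed
    moreover have "finite (\<Union>ij\<in>I (c1 z) \<times> I (c2 z). (\<lambda>v. v + lat (fst ij) (snd ij)) ` Z)"
      using finZ by (auto simp: I_def)
    ultimately have "card (dual_sites M \<inter> {w. nrm (w - z) \<le> R}) \<le> card (\<Union>ij\<in>I (c1 z) \<times> I (c2 z). (\<lambda>v. v + lat (fst ij) (snd ij)) ` Z)"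
      by (intro card_mono)
    also have "\<dots> \<le> (\<Sum>ij\<in>I (c1 z) \<times> I (c2 z). card ((\<lambda>v. v + lat (fst ij) (snd ij)) ` Z))"
      by (rule card_UN_le) (auto simp: I_def)
    also have "\<dots> \<le> (\<Sum>ij\<in>I (c1 z) \<times> I (c2 z). card Z)" by (intro sum_mono card_image_le finZ)
    also have "\<dots> = card (I (c1 z)) * card (I (c2 z)) * card Z" by (simp add: card_cartesian_product)
    finally have "real (card (dual_sites M \<inter> {w. nrm (w - z) \<le> R})) \<le> real (card (I (c1 z))) * real (card (I (c2 z))) * real (card Z)"
      by (metis of_nat_le_iff of_nat_mult)
    also have "\<dots> \<le> ((2 / a + 2) * (1 + R)) * ((2 / a + 2) * (1 + R)) * (real (card Z) + 1)"
      using I[of "c1 z"] I[of "c2 z"] a_pos R by (intro mult_mono) auto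
    finally show ?thesis by (simp add: K_def power2_eq_square mult_ac)
  qed
  then show ?thesis using K0 by blast
qed

text \<open>A union bound over the pairs of end points. Their number is at most the square of a
  quadratic expression in the side lengths, hence the fourth power.\<close>

lemma dcross_exp_decay:
  assumes p: "0 < p" "p < 1" and xi: "is_corr_length M p \<xi>"
  shows "\<exists>C>0. \<forall>f g x0 w y0 h. axes f g \<longrightarrow> 0 < w \<longrightarrow> 0 \<le> h \<longrightarrow>
    hom_prob M p (dcross f g x0 (x0 + w) y0 (y0 + h)) \<le> C * (1 + w + h) ^ 4 * exp (- (w / (2 * \<xi>)))"
proof -
  interpret bernoulli_field M "\<lambda>_. p" using p by (intro bernoulli_field_const) auto
  have xi0: "0 < \<xi>" using xi by (simp add: is_corr_length_def)
  obtain C where C: "C > 0" "\<And>z1 z2 U. z1 \<in> dual_sites M \<Longrightarrow> z2 \<in> dual_sites M \<Longrightarrow> bounded U \<Longrightarrow>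
    hom_prob M p (dlink U z1 z2) \<le> C * exp (- (nrm (z2 - z1) / (2 * \<xi>)))"
    using two_point_decay[OF p xi] by blast
  obtain K where K: "K > 0" "\<And>R z. R \<ge> 0 \<Longrightarrow> real (card (dual_sites M \<inter> {w. nrm (w - z) \<le> R})) \<le> K * (1 + R)\<^sup>2"
    using dual_card by blast
  have "hom_prob M p (dcross f g x0 (x0 + w) y0 (y0 + h)) \<le> C * K\<^sup>2 * (1 + mesh) ^ 4 * (1 + w + h) ^ 4 * exp (- (w / (2 * \<xi>)))"
    if ax: "axes f g" and wh: "0 < w" "0 \<le> h" for f g x0 w y0 h
  proof -
    interpret oblique f g by (rule axes_oblique[OF ax])
    define U where "U = rect f g (x0 - mesh) (x0 + w + mesh) y0 (y0 + h)"
    have bU: "bounded U" unfolding U_def by (rule bounded_rect[OF ax])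
    define Z where "Z = dual_sites M \<inter> U"
    have finZ: "finite Z" unfolding Z_def by (rule finite_dual_sites[OF bU])
    define R where "R = w + h + mesh"
    have R0: "0 \<le> R" using wh mesh_ge by (simp add: R_def)
    have cZ: "real (card Z) \<le> K * ((1 + mesh) * (1 + w + h))\<^sup>2"
    proof -
      obtain z where z: "f z = x0" "g z = y0" using axes_surj[OF ax] by blast
      have "Z \<subseteq> dual_sites M \<inter> {w. nrm (w - z) \<le> R}"
        using wh mesh_ge z by (auto simp: Z_def U_def rect_def axes_nrm[OF ax] f_diff g_diff R_def abs_le_iff)
      moreover have "finite (dual_sites M \<inter> {w. nrm (w - z) \<le> R})"
      proof (rule finite_dual_sites)
        have "nrm w \<le> R + nrm z" if "nrm (w - z) \<le> R" for w
          using that nrm_triangle[of "w - z" z] by simp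
        then show "bounded {w. nrm (w - z) \<le> R}" by (auto simp: bounded_iff_nrm)
      qed
      ultimately have "card Z \<le> card (dual_sites M \<inter> {w. nrm (w - z) \<le> R})" by (intro card_mono)
      then have "real (card Z) \<le> K * (1 + R)\<^sup>2" using K(2)[OF R0, of z] by linarith
      also have "\<dots> \<le> K * ((1 + mesh) * (1 + w + h))\<^sup>2"
      proof -
        have "1 + R \<le> (1 + mesh) * (1 + w + h)" using wh mesh_ge by (simp add: R_def algebra_simps)
        then show ?thesis using R0 K(1) by (intro mult_left_mono power_mono) auto
      qed
      finally show ?thesis .
    qed
    define I where "I = {uv \<in> Z \<times> Z. f (fst uv) \<le> x0 \<and> x0 + w \<le> f (snd uv)}"
    have finI: "finite I" using finZ by (simp add: I_def)
    have "P (dcross f g x0 (x0 + w) y0 (y0 + h)) \<le> P (\<lambda>\<omega>. \<exists>uv\<in>I. dlink U (fst uv) (snd uv) \<omega>)"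
    proof (rule P_mono_event)
      show "depends_on (\<lambda>\<omega>. \<exists>uv\<in>I. dlink U (fst uv) (snd uv) \<omega>) (\<Union>uv\<in>I. els (halo U))"
        by (rule depends_on_bex) (rule dual_linked_depends)
      show "finite (\<Union>uv\<in>I. els (halo U))" using finI by (auto intro!: finite_els bounded_halo bU)
      show "(\<Union>uv\<in>I. els (halo U)) \<subseteq> elements M" using els_subset by blast
      fix \<omega> assume "dcross f g x0 (x0 + w) y0 (y0 + h) \<omega>"
      then obtain u v where uv: "dlink U u v \<omega>" "f u \<le> x0" "x0 + w \<le> f v"
        using dcross_iff[OF ax, of x0 "x0 + w"] wh unfolding U_def by auto
      then have "u \<in> Z" "v \<in> Z" using linked_in[OF uv(1)] by (auto simp: Z_def dual_open_site_def)
      then show "\<exists>uv\<in>I. dlink U (fst uv) (snd uv) \<omega>" using uv by (intro bexI[of _ "(u, v)"]) (auto simp: I_def)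
    qed
    also have "\<dots> \<le> (\<Sum>uv\<in>I. P (dlink U (fst uv) (snd uv)))"
      by (rule P_bex_le[OF finI dual_linked_depends]) (auto intro!: finite_els bounded_halo bU simp: els_subset)
    also have "\<dots> \<le> (\<Sum>uv\<in>I. C * exp (- (w / (2 * \<xi>))))"
    proof (rule sum_mono)
      fix uv assume uv: "uv \<in> I"
      then have m: "fst uv \<in> dual_sites M" "snd uv \<in> dual_sites M" by (auto simp: I_def Z_def)
      have "w \<le> f (snd uv - fst uv)" using uv by (auto simp: I_def f_diff)
      then have "w \<le> nrm (snd uv - fst uv)" by (simp add: axes_nrm[OF ax])
      then have "exp (- (nrm (snd uv - fst uv) / (2 * \<xi>))) \<le> exp (- (w / (2 * \<xi>)))" using xi0 by (simp add: divide_right_mono)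
      then have "C * exp (- (nrm (snd uv - fst uv) / (2 * \<xi>))) \<le> C * exp (- (w / (2 * \<xi>)))" using C(1) by simp
      then show "P (dlink U (fst uv) (snd uv)) \<le> C * exp (- (w / (2 * \<xi>)))"
        using C(2)[OF m bU] unfolding hom_prob_eq by linarith
    qed
    also have "\<dots> = real (card I) * (C * exp (- (w / (2 * \<xi>))))" by simp
    also have "\<dots> \<le> (K * ((1 + mesh) * (1 + w + h))\<^sup>2)\<^sup>2 * (C * exp (- (w / (2 * \<xi>))))"
    proof (rule mult_right_mono)
      have "card I \<le> card (Z \<times> Z)" using finZ by (intro card_mono) (auto simp: I_def)
      then have "real (card I) \<le> (real (card Z))\<^sup>2" by (simp add: card_cartesian_product power2_eq_square flip: of_nat_mult)
      also have "\<dots> \<le> (K * ((1 + mesh) * (1 + w + h))\<^sup>2)\<^sup>2" using cZ by (intro power_mono) auto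
      finally show "real (card I) \<le> (K * ((1 + mesh) * (1 + w + h))\<^sup>2)\<^sup>2" .
    qed (use C in simp)
    also have "\<dots> = C * K\<^sup>2 * (1 + mesh) ^ 4 * (1 + w + h) ^ 4 * exp (- (w / (2 * \<xi>)))"
      by (simp add: power_mult_distrib power_mult[symmetric] mult_ac)
    finally show ?thesis by (simp add: hom_prob_eq)
  qed
  moreover have "0 < C * K\<^sup>2 * (1 + mesh) ^ 4" using C(1) K(1) mesh_ge by simp
  ultimately show ?thesis by blast
qed

lemma ocross_complement_le:
  assumes ax: "axes f g" and p: "0 \<le> p" "p \<le> 1" and w: "0 < w" "4 * mesh < h"
  shows "1 - hom_prob M p (ocross g f c (c + w) b (b + h)) \<le>
    hom_prob M p (dcross f g (b + 2 * mesh) (b + 2 * mesh + (h - 4 * mesh)) (c - 2 * mesh) (c - 2 * mesh + (w + 4 * mesh)))"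
proof -
  interpret bernoulli_field M "\<lambda>_. p" using p by (rule bernoulli_field_const)
  have do: "depends_on (ocross g f c (c + w) b (b + h)) (els (rect g f (c - mesh) (c + w + mesh) b (b + h)))"
    using w by (intro ocross_depends axes_sym[OF ax]) simp
  have dd: "depends_on (dcross f g (b + 2 * mesh) (b + 2 * mesh + (h - 4 * mesh)) (c - 2 * mesh) (c - 2 * mesh + (w + 4 * mesh)))
     (els (rect f g (b + 2 * mesh - 2 * mesh) (b + 2 * mesh + (h - 4 * mesh) + 2 * mesh) (c - 2 * mesh - mesh) (c - 2 * mesh + (w + 4 * mesh) + mesh)))"
    using w by (intro dcross_depends ax) simp
  have "P (\<lambda>\<omega>. \<not> ocross g f c (c + w) b (b + h) \<omega>) \<le>
    P (dcross f g (b + 2 * mesh) (b + 2 * mesh + (h - 4 * mesh)) (c - 2 * mesh) (c - 2 * mesh + (w + 4 * mesh)))"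
  proof (rule P_mono_event[OF dd finite_els_rect[OF ax] els_subset])
    fix \<omega> assume n: "\<not> ocross g f c (c + w) b (b + h) \<omega>"
    have e: "b + 2 * mesh + (h - 4 * mesh) = b + h - 2 * mesh" "c - 2 * mesh + (w + 4 * mesh) = c + w + 2 * mesh" by auto
    show "dcross f g (b + 2 * mesh) (b + 2 * mesh + (h - 4 * mesh)) (c - 2 * mesh) (c - 2 * mesh + (w + 4 * mesh)) \<omega>"
      unfolding e dcross_def by (rule dual_crossing_exists[OF ax _ _ n[unfolded ocross_def]]) (use w in auto)
  qed
  then show ?thesis using P_not[OF do finite_els_rect[OF axes_sym[OF ax]] els_subset] by (simp add: hom_prob_eq)
qed

text \<open>Failure entails a dual crossing the other way, which is exponentially unlikely for fixed
  \<open>p\<close>. This gives the \<open>LEAST\<close> in the finite-size length a witness.\<close>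

lemma ocross_likely:
  assumes p: "0 < p" "p < 1" and xi: "is_corr_length M p \<xi>" and \<eta>: "0 < \<eta>"
  shows "\<exists>n::nat. 1 \<le> n \<and> 1 - \<eta> < hom_prob M p (ocross c1 c2 0 (3 * real n) 0 (real n))"
proof -
  have xi0: "0 < \<xi>" using xi by (simp add: is_corr_length_def)
  obtain C where C: "C > 0" "\<And>f g x0 w y0 h. axes f g \<Longrightarrow> 0 < w \<Longrightarrow> 0 \<le> h \<Longrightarrow>
    hom_prob M p (dcross f g x0 (x0 + w) y0 (y0 + h)) \<le> C * (1 + w + h) ^ 4 * exp (- (w / (2 * \<xi>)))"
    using dcross_exp_decay[OF p xi] by blast
  have "(\<lambda>n::nat. C * (1 + (real n - 4 * mesh) + (3 * real n + 4 * mesh)) ^ 4 * exp (- ((real n - 4 * mesh) / (2 * \<xi>)))) \<longlonglongrightarrow> 0"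
    using C(1) xi0 by real_asymp
  then have "eventually (\<lambda>n::nat. C * (1 + (real n - 4 * mesh) + (3 * real n + 4 * mesh)) ^ 4 * exp (- ((real n - 4 * mesh) / (2 * \<xi>))) < \<eta>) sequentially"
    using \<eta> by (rule order_tendstoD(2))
  moreover have "eventually (\<lambda>n::nat. 4 * mesh < real n \<and> 1 \<le> n) sequentially"
    by (intro eventually_conj eventually_ge_at_top) real_asymp
  ultimately have "eventually (\<lambda>n::nat. 1 \<le> n \<and> 1 - \<eta> < hom_prob M p (ocross c1 c2 0 (3 * real n) 0 (real n))) sequentially"
  proof eventually_elim
    case (elim n)
    have "1 - hom_prob M p (ocross c1 c2 0 (0 + 3 * real n) 0 (0 + real n)) \<le>
      hom_prob M p (dcross c2 c1 (0 + 2 * mesh) (0 + 2 * mesh + (real n - 4 * mesh)) (0 - 2 * mesh) (0 - 2 * mesh + (3 * real n + 4 * mesh)))"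
      by (rule ocross_complement_le[OF axes21]) (use p elim in auto)
    also have "\<dots> \<le> C * (1 + (real n - 4 * mesh) + (3 * real n + 4 * mesh)) ^ 4 * exp (- ((real n - 4 * mesh) / (2 * \<xi>)))"
      by (rule C(2)[OF axes21]) (use elim mesh_ge in auto)
    finally show ?case using elim by auto
  qed
  then show ?thesis by (metis (mono_tags, lifting) eventually_happens' sequentially_bot)
qed

subsection \<open>Strips without short occupied crossings\<close>

definition short_primal_le :: "real \<Rightarrow> real \<Rightarrow> real \<Rightarrow> bool" where
  "short_primal_le p x m \<longleftrightarrow>
     (\<forall>f g s t. axes f g \<longrightarrow> hom_prob M p (ocross f g s (s + m) t (t + 2 * m)) \<le> x)"

text \<open>By \<open>ocross_cover\<close> it is enough that none of \<open>2 * (k + 1)\<close>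
  windows is crossed. These events are decreasing, so the Harris inequality multiplies their
  probabilities.\<close>

lemma no_ocross_prob:
  assumes sp: "short_primal_le p (1 - \<epsilon>) m" and p: "0 \<le> p" "p \<le> 1" and \<epsilon>: "0 \<le> \<epsilon>"
    and ax: "axes f g" and m: "2 * mesh \<le> m" "h \<le> real k * m"
  shows "\<epsilon> ^ (2 * (k + 1)) \<le> hom_prob M p (\<lambda>\<omega>. \<not> ocross f g s (s + m) t (t + h) \<omega>)"
proof -
  interpret bernoulli_field M "\<lambda>_. p" using p by (rule bernoulli_field_const)
  have m0: "0 < m" using m mesh_ge by linarith
  define D where "D i = (if i \<le> k then ocross f g s (s + m) (t + real i * m) (t + real i * m + 2 * m)
    else ocross g f (t + real (i - (k + 1)) * m) (t + real (i - (k + 1)) * m + m) (s - m / 2) (s - m / 2 + 2 * m))" for i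
  define E where "E i = (if i \<le> k then els (rect f g (s - mesh) (s + m + mesh) (t + real i * m) (t + real i * m + 2 * m))
    else els (rect g f (t + real (i - (k + 1)) * m - mesh) (t + real (i - (k + 1)) * m + m + mesh) (s - m / 2) (s - m / 2 + 2 * m)))" for i
  have dep: "depends_on (D i) (E i)" "finite (E i)" "E i \<subseteq> elements M" for i
    using ocross_depends[OF ax, of s "s + m"] ocross_depends[OF axes_sym[OF ax]] m0 finite_els_rect ax axes_sym[OF ax] els_subset
    by (auto simp: D_def E_def)
  have up: "up_event (D i)" for i
    using ocross_up[OF ax, of s "s + m"] ocross_up[OF axes_sym[OF ax]] m0 by (auto simp: D_def)
  have ge: "\<epsilon> \<le> P (\<lambda>\<omega>. \<not> D i \<omega>)" for i
  proof -
    have sp': "P (ocross f g s (s + m) t (t + 2 * m)) \<le> 1 - \<epsilon>" if "axes f g" for f g s t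
      using sp that unfolding short_primal_le_def hom_prob_eq by blast
    have "P (D i) \<le> 1 - \<epsilon>"
      by (cases "i \<le> k") (simp_all only: D_def if_True if_False sp'[OF ax] sp'[OF axes_sym[OF ax]])
    then show ?thesis using P_not[OF dep] by simp
  qed
  have do: "depends_on (ocross f g s (s + m) t (t + h)) (els (rect f g (s - mesh) (s + m + mesh) t (t + h)))"
    using m0 by (intro ocross_depends ax) simp
  have "\<epsilon> ^ (2 * (k + 1)) = (\<Prod>i\<in>{..<2 * (k + 1)}. \<epsilon>)" by simp
  also have "\<dots> \<le> (\<Prod>i\<in>{..<2 * (k + 1)}. P (\<lambda>\<omega>. \<not> D i \<omega>))" by (rule prod_mono) (use ge \<epsilon> in auto)
  also have "\<dots> \<le> P (\<lambda>\<omega>. \<forall>i\<in>{..<2 * (k + 1)}. \<not> D i \<omega>)"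
    by (rule P_harris_ball) (use dep up in auto)
  also have "\<dots> \<le> P (\<lambda>\<omega>. \<not> ocross f g s (s + m) t (t + h) \<omega>)"
  proof (rule P_mono_event[OF depends_on_not[OF do] finite_els_rect[OF ax] els_subset], rule notI)
    fix \<omega> assume n: "\<forall>i\<in>{..<2 * (k + 1)}. \<not> D i \<omega>" and d: "ocross f g s (s + m) t (t + h) \<omega>"
    obtain i where i: "i \<le> k" "ocross f g s (s + m) (t + real i * m) (t + real i * m + 2 * m) \<omega> \<or>
       ocross g f (t + real i * m) (t + real i * m + m) (s - m / 2) (s - m / 2 + 2 * m) \<omega>"
      using ocross_cover[OF ax d m] by blast
    then have "D i \<omega> \<or> D (i + (k + 1)) \<omega>" by (auto simp: D_def)
    then show False using i(1) n by auto
  qed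
  finally show ?thesis by (simp add: hom_prob_eq)
qed

text \<open>A strip of thickness \<open>m\<close> and length \<open>k m\<close> has no short occupied crossing with probability at least
  \<open>\<epsilon> ^ (2 (k + 1))\<close>, and then it has a long dual crossing, of probability roughly \<open>exp (- k m / \<xi>)\<close>.\<close>

lemma corr_length_ge:
  assumes sp: "short_primal_le p (1 - \<epsilon>) m" and p: "0 < p" "p < 1" and \<epsilon>: "0 < \<epsilon>"
    and m: "2 * mesh \<le> m" and xi: "is_corr_length M p \<xi>"
  shows "m \<le> 4 * ln (1 / \<epsilon>) * \<xi>"
proof (rule ccontr)
  assume contra: "\<not> ?thesis"
  have xi0: "0 < \<xi>" using xi by (simp add: is_corr_length_def)
  obtain C where C: "C > 0" "\<And>f g x0 w y0 h. axes f g \<Longrightarrow> 0 < w \<Longrightarrow> 0 \<le> h \<Longrightarrow>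
    hom_prob M p (dcross f g x0 (x0 + w) y0 (y0 + h)) \<le> C * (1 + w + h) ^ 4 * exp (- (w / (2 * \<xi>)))"
    using dcross_exp_decay[OF p xi] by blast
  interpret bernoulli_field M "\<lambda>_. p" using p by (intro bernoulli_field_const) auto
  define l where "l = ln (1 / \<epsilon>)"
  \<comment> \<open>Up to a polynomial, \<open>exp (d - s * real k)\<close> is the ratio of the
    upper bound for the long dual crossing to the lower bound
    \<open>\<epsilon> ^ (2 * (k + 1))\<close>. If the claim failed, \<open>s\<close> would be
    positive and this ratio would tend to 0, although it is at least 1.\<close>
  define s where "s = m / (2 * \<xi>) - 2 * l"
  define d where "d = 2 * l + 2 * mesh / \<xi>"
  have s0: "0 < s"
  proof -
    have "4 * l * \<xi> < m" using contra by (simp add: l_def)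
    then have "2 * l * (2 * \<xi>) < m" by simp
    then show ?thesis using xi0 by (simp add: s_def pos_less_divide_eq)
  qed
  have m0: "0 < m" using m mesh_ge by linarith
  have "(\<lambda>k::nat. C * (1 + real k * m + m) ^ 4 * exp (d - s * real k)) \<longlonglongrightarrow> 0"
    using C(1) s0 m0 by real_asymp
  then have "eventually (\<lambda>k::nat. C * (1 + real k * m + m) ^ 4 * exp (d - s * real k) < 1) sequentially"
    by (rule order_tendstoD(2)) simp
  moreover have "eventually (\<lambda>k::nat. 4 * mesh < real k * m) sequentially" using m0 by real_asymp
  ultimately have "eventually (\<lambda>k::nat. False) sequentially"
  proof eventually_elim
    case (elim k)
    have "\<epsilon> ^ (2 * (k + 1)) \<le> hom_prob M p (\<lambda>\<omega>. \<not> ocross c2 c1 0 (0 + m) 0 (0 + real k * m) \<omega>)"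
      by (rule no_ocross_prob[OF sp]) (use p \<epsilon> m axes21 in auto)
    also have "\<dots> = 1 - hom_prob M p (ocross c2 c1 0 (0 + m) 0 (0 + real k * m))"
      using P_not[OF ocross_depends[OF axes21] finite_els_rect[OF axes21] els_subset] m0 by (simp add: hom_prob_eq)
    also have "\<dots> \<le> hom_prob M p (dcross c1 c2 (0 + 2 * mesh) (0 + 2 * mesh + (real k * m - 4 * mesh)) (0 - 2 * mesh) (0 - 2 * mesh + (m + 4 * mesh)))"
      by (rule ocross_complement_le[OF axes12]) (use p m0 elim in auto)
    also have "\<dots> \<le> C * (1 + (real k * m - 4 * mesh) + (m + 4 * mesh)) ^ 4 * exp (- ((real k * m - 4 * mesh) / (2 * \<xi>)))"
      by (rule C(2)[OF axes12]) (use elim mesh_ge m0 in auto)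
    also have "1 + (real k * m - 4 * mesh) + (m + 4 * mesh) = 1 + real k * m + m" by simp
    finally have "\<epsilon> ^ (2 * (k + 1)) \<le> C * (1 + real k * m + m) ^ 4 * exp (- ((real k * m - 4 * mesh) / (2 * \<xi>)))" .
    moreover have "\<epsilon> ^ (2 * (k + 1)) = exp (- (2 * (real k + 1) * l))"
    proof -
      have "\<epsilon> = exp (- l)" using \<epsilon> by (simp add: l_def ln_div)
      then have "\<epsilon> ^ (2 * (k + 1)) = exp (real (2 * (k + 1)) * (- l))" by (simp only: exp_of_nat_mult)
      then show ?thesis by (simp add: algebra_simps)
    qed
    ultimately have le: "exp (- (2 * (real k + 1) * l)) \<le> C * (1 + real k * m + m) ^ 4 * exp (- ((real k * m - 4 * mesh) / (2 * \<xi>)))"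
      by simp
    have "1 = exp (2 * (real k + 1) * l) * exp (- (2 * (real k + 1) * l))" by (simp flip: exp_add)
    also have "\<dots> \<le> exp (2 * (real k + 1) * l) * (C * (1 + real k * m + m) ^ 4 * exp (- ((real k * m - 4 * mesh) / (2 * \<xi>))))"
      using le by (intro mult_left_mono) auto
    also have "\<dots> = C * (1 + real k * m + m) ^ 4 * exp (2 * (real k + 1) * l - (real k * m - 4 * mesh) / (2 * \<xi>))"
      by (simp add: exp_diff exp_minus field_simps)
    also have "2 * (real k + 1) * l - (real k * m - 4 * mesh) / (2 * \<xi>) = d - s * real k"
      using xi0 by (simp add: d_def s_def field_simps)
    finally show ?case using elim by simp
  qed
  then show False by simp
qed

lemma crossing1_ocross: "crossing1 M (occupied_path M) s t w h = ocross c1 c2 s (s + w) t (t + h)"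
  and crossing2_ocross: "crossing2 M (occupied_path M) s t w h = ocross c2 c1 t (t + h) s (s + w)"
  by (auto simp: crossing1_iff crossing2_iff ocross_def fun_eq_iff)

text \<open>With positive probability all elements in reach are vacant, and then there is no
  crossing.\<close>

lemma ocross_lt_1:
  assumes ax: "axes f g" and p: "0 \<le> p" "p < 1" and x: "x0 < x1"
  shows "hom_prob M p (ocross f g x0 x1 y0 y1) < 1"
proof -
  interpret bernoulli_field M "\<lambda>_. p" using p by (intro bernoulli_field_const) auto
  define E where "E = els (rect f g (x0 - mesh) (x1 + mesh) y0 y1)"
  have dep: "depends_on (ocross f g x0 x1 y0 y1) E" "finite E" "E \<subseteq> elements M"
    unfolding E_def using x by (auto intro!: ocross_depends ax finite_els_rect els_subset)
  have no: "\<not> ocross f g x0 x1 y0 y1 (\<lambda>_. False)"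
  proof
    assume "ocross f g x0 x1 y0 y1 (\<lambda>_. False)"
    then obtain u v where uv: "linked (occupied_step M (\<lambda>_. False)) (occupied_sites M (\<lambda>_. False) \<inter> {z. y0 \<le> g z \<and> g z \<le> y1}) u v" "f u \<le> x0" "x1 \<le> f v"
      unfolding ocross_def cross_def by blast
    have "v = u" using uv(1)
    proof (induction rule: linked_induct)
      case (step x y)
      then show ?case by (cases "kind M") (auto simp: occupied_step_def occupied_site_def)
    qed simp
    then show False using uv x by simp
  qed
  have "0 < (1 - p) ^ card E" using p by simp
  also have "\<dots> = P (\<lambda>\<omega>. \<forall>b\<in>E. \<not> \<omega> b)" using P_vacant[OF dep(2,3)] by simp
  also have "\<dots> \<le> P (\<lambda>\<omega>. \<not> ocross f g x0 x1 y0 y1 \<omega>)"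
  proof (rule P_mono_event[OF depends_on_not[OF dep(1)] dep(2,3)])
    fix \<omega> assume "\<forall>b\<in>E. \<not> \<omega> b"
    then have "ocross f g x0 x1 y0 y1 \<omega> = ocross f g x0 x1 y0 y1 (\<lambda>_. False)"
      by (intro dep(1)[unfolded depends_on_def, rule_format]) auto
    then show "\<not> ocross f g x0 x1 y0 y1 \<omega>" using no by simp
  qed
  also have "\<dots> = 1 - P (ocross f g x0 x1 y0 y1)" by (rule P_not[OF dep])
  finally show ?thesis by (simp add: hom_prob_eq)
qed

end

section \<open>Correlation length and finite-size length near the threshold\<close>

locale kesten = lattice +
  fixes pc :: real
  assumes kesten: "kesten_percolation M pc"
begin

lemma pc01: "0 < pc" "pc < 1"
  using kesten by (auto simp: kesten_percolation_def is_threshold_def)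

lemma corr_length_is:
  assumes "pc < p" "p < 1"
  shows "is_corr_length M p (corr_length M p)"
proof -
  obtain x where x: "is_corr_length M p x"
    using kesten assms by (auto simp: kesten_percolation_def corr_length_regular_def)
  have "y = x" if y: "is_corr_length M p y" for y
  proof -
    have "exp (- 1 / y) = exp (- 1 / x)"
      using x y LIMSEQ_unique unfolding is_corr_length_def by blast
    then have "- 1 / y = - 1 / x" by simp
    then show ?thesis using x y by (auto simp: is_corr_length_def field_simps)
  qed
  with x have "is_corr_length M p (THE x. is_corr_length M p x)" by (rule theI)
  then show ?thesis using assms by (simp add: corr_length_def)
qed

definition lng :: "nat \<Rightarrow> real \<Rightarrow> real" where
  "lng n p = hom_prob M p (ocross c1 c2 0 (3 * real n) 0 (real n))"

lemma finite_size_length_eq: "finite_size_length M \<eta> p = (LEAST n. 1 \<le> n \<and> 1 - \<eta> < lng n p)"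
  by (simp add: finite_size_length_def crossing1_ocross lng_def)

lemma finite_size_length_props:
  assumes "pc < p" "p < 1" "0 < \<eta>"
  shows "1 \<le> finite_size_length M \<eta> p" "1 - \<eta> < lng (finite_size_length M \<eta> p) p"
proof -
  have "\<exists>n. 1 \<le> n \<and> 1 - \<eta> < lng n p"
    unfolding lng_def
    by (rule ocross_likely[OF _ assms(2) corr_length_is[OF assms(1,2)] assms(3)]) (use assms pc01 in auto)
  from LeastI_ex[OF this] show "1 \<le> finite_size_length M \<eta> p" "1 - \<eta> < lng (finite_size_length M \<eta> p) p"
    unfolding finite_size_length_eq by auto
qed

text \<open>RSW covers all large scales and \<open>ocross_lt_1\<close> the finitely many others. The
  factor 2 leaves room for moving \<open>p\<close> away from \<open>pc\<close>.\<close>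

lemma lng_pc_bound: "\<exists>\<eta>>0. \<forall>n\<ge>1. lng n pc \<le> 1 - 2 * \<eta>"
proof -
  have "RSW_bounds M pc" using kesten by (simp add: kesten_percolation_def)
  then have "\<exists>\<epsilon>>0. \<exists>n0::nat. \<forall>n\<ge>n0. crossing_bounds M pc (3 * real n) (real n) \<epsilon>"
    unfolding RSW_bounds_def by (metis zero_less_numeral)
  then obtain \<epsilon> n0 where \<epsilon>: "\<epsilon> > 0" "\<And>n. n \<ge> n0 \<Longrightarrow> crossing_bounds M pc (3 * real n) (real n) \<epsilon>" by blast
  have big: "lng n pc \<le> 1 - \<epsilon>" if "n \<ge> n0" for n
  proof -
    have "hom_prob M pc (crossing1 M (occupied_path M) 0 0 (3 * real n) (real n)) \<in> {\<epsilon>..1 - \<epsilon>}"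
      using \<epsilon>(2)[OF that] unfolding crossing_bounds_def by blast
    then show ?thesis by (simp add: crossing1_ocross lng_def)
  qed
  have lt: "lng n pc < 1" if "n \<ge> 1" for n
    unfolding lng_def using pc01 that by (intro ocross_lt_1 axes12) auto
  define S where "S = insert (\<epsilon> / 2) ((\<lambda>n. (1 - lng n pc) / 2) ` {1..<n0})"
  define \<eta> where "\<eta> = Min S"
  have "finite S" "S \<noteq> {}" by (auto simp: S_def)
  then have "\<eta> \<in> S" unfolding \<eta>_def by (rule Min_in)
  then have "\<eta> > 0" using \<epsilon>(1) lt by (auto simp: S_def)
  moreover have "lng n pc \<le> 1 - 2 * \<eta>" if "n \<ge> 1" for n
  proof (cases "n \<ge> n0")
    case True
    have "\<eta> \<le> \<epsilon> / 2" unfolding \<eta>_def using \<open>finite S\<close> by (intro Min_le) (auto simp: S_def)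
    then show ?thesis using big[OF True] by linarith
  next
    case False
    then have "\<eta> \<le> (1 - lng n pc) / 2" unfolding \<eta>_def using \<open>finite S\<close> that by (intro Min_le) (auto simp: S_def)
    then show ?thesis by (simp add: field_simps)
  qed
  ultimately show ?thesis by blast
qed

text \<open>For each of the finitely many scales below \<open>N\<close> the crossing probability is
  continuous in \<open>p\<close>, so it stays below \<open>1 - \<eta>\<close> near
  \<open>pc\<close>.\<close>

lemma finite_size_length_large:
  assumes \<eta>: "0 < \<eta>" "\<And>n. n \<ge> 1 \<Longrightarrow> lng n pc \<le> 1 - 2 * \<eta>"
  shows "\<exists>p1>pc. p1 < 1 \<and> (\<forall>p. pc < p \<and> p < p1 \<longrightarrow> N \<le> finite_size_length M \<eta> p)"
proof -
  have "eventually (\<lambda>p. \<forall>n\<in>{1..<N}. lng n p < 1 - \<eta>) (at_right pc)"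
  proof (rule eventually_ball_finite, simp, rule ballI)
    fix n assume n: "n \<in> {1..<N}"
    have "isCont (\<lambda>p. lng n p) pc"
      unfolding lng_def
      by (rule hom_prob_isCont[OF ocross_depends[OF axes12] finite_els_rect[OF axes12] els_subset]) (use n pc01 in auto)
    then have "(lng n \<longlongrightarrow> lng n pc) (at_right pc)"
      by (simp add: isCont_def filterlim_at_split)
    moreover have "lng n pc < 1 - \<eta>" using \<eta>(1) \<eta>(2)[of n] n by auto
    ultimately show "eventually (\<lambda>p. lng n p < 1 - \<eta>) (at_right pc)" by (rule order_tendstoD(2))
  qed
  then obtain b where b: "b > pc" "\<And>p. pc < p \<Longrightarrow> p < b \<Longrightarrow> \<forall>n\<in>{1..<N}. lng n p < 1 - \<eta>"
    unfolding eventually_at_right_field by blast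
  define p1 where "p1 = min b ((1 + pc) / 2)"
  have "N \<le> finite_size_length M \<eta> p" if p: "pc < p" "p < p1" for p
  proof (rule ccontr)
    assume "\<not> ?thesis"
    moreover have "p < 1" using p pc01 by (simp add: p1_def)
    ultimately have "finite_size_length M \<eta> p \<in> {1..<N}" "1 - \<eta> < lng (finite_size_length M \<eta> p) p"
      using finite_size_length_props[of p \<eta>] p \<eta>(1) by auto
    then show False using b(2)[of p] p by (force simp: p1_def)
  qed
  moreover have "pc < p1" "p1 < 1" using b(1) pc01 by (auto simp: p1_def min_less_iff_disj)
  ultimately show ?thesis by blast
qed

text \<open>Both properties are first proved in terms of \<open>L p\<close> and then converted to
  the correlation length. By \<open>low\<close> the latter is at most \<open>4 * L p\<close>, so one
  eighth of it is at most half of \<open>L p\<close>; conversely \<open>corr_length_ge\<close> on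
  the scale \<open>L p div 2\<close> bounds \<open>L p\<close> by a multiple of the correlation
  length.\<close>

lemma near_critical:
  obtains \<epsilon> n0 C p1 where "0 < \<epsilon>" "\<epsilon> \<le> 1" "0 < C" "pc < p1" "p1 < 1"
    "\<And>p n. pc < p \<Longrightarrow> p < p1 \<Longrightarrow> n0 \<le> n \<Longrightarrow> 8 * real n \<le> corr_length M p \<Longrightarrow> short_primal_le p (1 - \<epsilon>) (real n)"
    "\<And>p. pc < p \<Longrightarrow> p < p1 \<Longrightarrow> \<exists>m. 10 * mesh \<le> m \<and> m \<le> C * corr_length M p \<and> short_dual_le p (exp (- 1) / 144) m"
proof -
  have "RSW_bounds M pc" using kesten by (simp add: kesten_percolation_def)
  then obtain c where c0: "c > 0" and c': "\<forall>\<delta>. 0 < \<delta> \<and> \<delta> < 1 \<longrightarrow> (\<forall>\<rho>>0. \<exists>\<epsilon>>0. \<exists>n0::nat. \<forall>p n. pc < p \<and> p \<le> 1 \<and>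
           n0 \<le> n \<and> n \<le> finite_size_length M (c * \<delta>) p \<longrightarrow> crossing_bounds M p (\<rho> * real n) (real n) \<epsilon>)"
    unfolding RSW_bounds_def by (elim exE conjE)
  have c: "c > 0" "\<exists>\<epsilon>>0. \<exists>n0::nat. \<forall>p n. pc < p \<and> p \<le> 1 \<and>
           n0 \<le> n \<and> n \<le> finite_size_length M (c * \<delta>) p \<longrightarrow> crossing_bounds M p (\<rho> * real n) (real n) \<epsilon>"
    if "0 < \<delta>" "\<delta> < 1" "\<rho> > 0" for \<delta> \<rho>
    using c0 c'[THEN spec[of _ \<delta>], THEN mp, THEN spec[of _ \<rho>], THEN mp] that by simp_all
  obtain \<eta>0 where \<eta>0: "\<eta>0 > 0" "\<And>n. n \<ge> 1 \<Longrightarrow> lng n pc \<le> 1 - 2 * \<eta>0" using lng_pc_bound by blast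
  \<comment> \<open>The three bounds make \<open>L p\<close> large near \<open>pc\<close>, provide
    the starting value of \<open>short_dual_decay\<close>, and give \<open>\<delta> < 1\<close> for
    the RSW bounds.\<close>
  define \<eta> where "\<eta> = min \<eta>0 (min (exp (- 1) / 144) (c / 2))"
  define \<delta> where "\<delta> = \<eta> / c"
  have \<eta>: "0 < \<eta>" "\<eta> \<le> \<eta>0" "\<eta> \<le> exp (- 1) / 144" using \<eta>0 c0 by (auto simp: \<eta>_def)
  have "\<eta> \<le> c / 2" by (simp add: \<eta>_def)
  then have \<delta>: "0 < \<delta>" "\<delta> < 1" "c * \<delta> = \<eta>" using \<eta>(1) c0 by (auto simp: \<delta>_def pos_divide_less_eq)
  define L where "L p = finite_size_length M \<eta> p" for p
  obtain \<epsilon>2 n2 where 2: "\<epsilon>2 > 0" "\<And>p n. pc < p \<Longrightarrow> p \<le> 1 \<Longrightarrow> n2 \<le> n \<Longrightarrow> n \<le> L p \<Longrightarrow> crossing_bounds M p (2 * real n) (real n) \<epsilon>2"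
    using c(2)[OF \<delta>(1,2), of 2] unfolding \<delta>(3) L_def by auto
  obtain \<epsilon>3 n3 where 3: "\<epsilon>3 > 0" "\<And>p n. pc < p \<Longrightarrow> p \<le> 1 \<Longrightarrow> n3 \<le> n \<Longrightarrow> n \<le> L p \<Longrightarrow> crossing_bounds M p (1 / 2 * real n) (real n) \<epsilon>3"
    using c(2)[OF \<delta>(1,2), of "1 / 2"] unfolding \<delta>(3) L_def by auto
  define \<epsilon> where "\<epsilon> = min (1 / 2) (min \<epsilon>2 \<epsilon>3)"
  have \<epsilon>: "0 < \<epsilon>" "\<epsilon> \<le> 1 / 2" "\<epsilon> \<le> \<epsilon>2" "\<epsilon> \<le> \<epsilon>3" using 2(1) 3(1) by (auto simp: \<epsilon>_def)
  define n0 where "n0 = max n2 (max n3 (nat \<lceil>10 * mesh\<rceil>))"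
  have "nat \<lceil>10 * mesh\<rceil> \<le> n0" unfolding n0_def by (intro max.coboundedI2 max.cobounded2)
  then have n0m: "10 * mesh \<le> real n0" 
    using real_nat_ceiling_ge[of "10 * mesh"] by (simp only: order_trans of_nat_le_iff[where 'a = real, symmetric])
  have n023: "n2 \<le> n0" "n3 \<le> n0" by (auto simp: n0_def)
  note n0 = n023 n0m
  have sp: "short_primal_le p (1 - \<epsilon>) (real n)" if p: "pc < p" "p \<le> 1" and n: "n0 \<le> n" "2 * n \<le> L p" for p n
    unfolding short_primal_le_def
  proof (intro allI impI)
    fix f g s t assume ax: "axes f g"
    have A: "hom_prob M p (ocross c2 c1 s (s + real n) t (t + 2 * real n)) \<le> 1 - \<epsilon>2"
    proof -
      have "crossing_bounds M p (2 * real n) (real n) \<epsilon>2" using p n n0 by (intro 2) auto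
      then have "hom_prob M p (crossing2 M (occupied_path M) t s (2 * real n) (real n)) \<in> {\<epsilon>2..1 - \<epsilon>2}"
        unfolding crossing_bounds_def by blast
      then show ?thesis by (simp add: crossing2_ocross)
    qed
    have B: "hom_prob M p (ocross c1 c2 s (s + real n) t (t + 2 * real n)) \<le> 1 - \<epsilon>3"
    proof -
      \<comment> \<open>In this direction the rectangle has aspect ratio \<open>1 / 2\<close> on the
        scale \<open>2 * n\<close>, hence the condition \<open>2 * n \<le> L p\<close>.\<close>
      have "crossing_bounds M p (1 / 2 * real (2 * n)) (real (2 * n)) \<epsilon>3" using p n n0 by (intro 3) auto
      then have "hom_prob M p (crossing1 M (occupied_path M) s t (1 / 2 * real (2 * n)) (real (2 * n))) \<in> {\<epsilon>3..1 - \<epsilon>3}"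
        unfolding crossing_bounds_def by blast
      then show ?thesis by (simp add: crossing1_ocross)
    qed
    show "hom_prob M p (ocross f g s (s + real n) t (t + 2 * real n)) \<le> 1 - \<epsilon>"
      using ax A B \<epsilon> unfolding axes_def by auto
  qed
  obtain p1 where p1: "p1 > pc" "p1 < 1" "\<And>p. pc < p \<Longrightarrow> p < p1 \<Longrightarrow> 2 * n0 + 2 \<le> L p"
  proof -
    have "lng n pc \<le> 1 - 2 * \<eta>" if "n \<ge> 1" for n using \<eta>0(2)[OF that] \<eta>(2) by linarith
    from finite_size_length_large[OF \<eta>(1) this, of "2 * n0 + 2"] show thesis using that unfolding L_def by blast
  qed
  have sd: "short_dual_le p (exp (- 1) / 144) (real (L p) + a)" if p: "pc < p" "p < p1" for p
  proof (rule short_dual_base)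
    show "5 * mesh \<le> real (L p)" using p1(3)[OF p] n0(3) mesh_ge by linarith
    show "1 - exp (- 1) / 144 \<le> hom_prob M p (ocross c1 c2 0 (3 * real (L p)) 0 (real (L p)))"
      using finite_size_length_props(2)[of p \<eta>] p p1 \<eta> unfolding L_def lng_def by linarith
  qed (use p p1 pc01 in auto)
  have L10: "10 * mesh \<le> real (L p)" if p: "pc < p" "p < p1" for p
    using p1(3)[OF p] n0(3) mesh_ge by linarith
  have low: "corr_length M p \<le> 4 * real (L p)" if p: "pc < p" "p < p1" for p
  proof -
    have "corr_length M p \<le> 2 * (real (L p) + a + 5 * mesh)"
      by (rule corr_length_le[OF sd[OF p] _ _ _ corr_length_is]) (use p p1 pc01 L10[OF p] a_pos in auto)
    then show ?thesis using L10[OF p] mesh_ge by (smt (verit))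
  qed
  \<comment> \<open>\<open>24 = 6 * 4\<close>: \<open>corr_length_ge\<close> contributes
    \<open>4 * ln (1 / \<epsilon>)\<close>, and \<open>real (L p) + a\<close> is at most six times
    the scale \<open>n\<close> to which it is applied.\<close>
  define C where "C = 24 * ln (1 / \<epsilon>)"
  show thesis
  proof (rule that[of \<epsilon> C p1 n0])
    show "0 < \<epsilon>" "\<epsilon> \<le> 1" "pc < p1" "p1 < 1" using \<epsilon> p1 by auto
    show "0 < C" using \<epsilon> by (simp add: C_def)
    show "short_primal_le p (1 - \<epsilon>) (real n)" if "pc < p" "p < p1" "n0 \<le> n" "8 * real n \<le> corr_length M p" for p n
    proof (rule sp)
      have "2 * real n \<le> real (L p)" using low[OF that(1,2)] that(4) by linarith
      then show "2 * n \<le> L p" by linarith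
    qed (use that p1 in auto)
    show "\<exists>m. 10 * mesh \<le> m \<and> m \<le> C * corr_length M p \<and> short_dual_le p (exp (- 1) / 144) m" if p: "pc < p" "p < p1" for p
    proof (intro exI[of _ "real (L p) + a"] conjI sd[OF p])
      show "10 * mesh \<le> real (L p) + a" using L10[OF p] a_pos by linarith
      define n where "n = L p div 2"
      have n: "n0 \<le> n" "2 * n \<le> L p" "L p \<le> 2 * n + 1" using p1(3)[OF p] by (auto simp: n_def)
      have mn: "2 * mesh \<le> real n" using n(1) n0(3) mesh_ge by linarith
      have "short_primal_le p (1 - \<epsilon>) (real n)" by (rule sp) (use p p1 n in auto)
      then have "real n \<le> 4 * ln (1 / \<epsilon>) * corr_length M p"
        by (rule corr_length_ge[OF _ _ _ _ mn corr_length_is]) (use p p1 pc01 \<epsilon> in auto)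
      moreover have "real (L p) + a \<le> 6 * real n" using n(3) mn mesh_ge by linarith
      ultimately show "real (L p) + a \<le> C * corr_length M p" by (simp add: C_def)
    qed
  qed
qed

end

context lattice begin

subsection \<open>The event that there is an infinite cluster\<close>

abbreviation olink :: "complex set \<Rightarrow> complex \<Rightarrow> complex \<Rightarrow> config \<Rightarrow> bool" where
  "olink U u v \<omega> \<equiv> linked (occupied_step M \<omega>) (occupied_sites M \<omega> \<inter> U) u v"

text \<open>The outer radius \<open>i + j\<close> is never below the inner one. The bounded region,
  one \<open>mesh\<close> larger, makes the event depend on finitely many elements.\<close>

definition arm :: "nat \<Rightarrow> nat \<Rightarrow> config \<Rightarrow> bool" where
  "arm i j \<omega> \<longleftrightarrow> (\<exists>u v. olink {z. nrm z \<le> real i + real j + mesh} u v \<omega> \<and> nrm u \<le> real i \<and> real i + real j < nrm v)"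

lemma cluster_finite_bounded:
  "finite (cluster M \<omega> v) \<longleftrightarrow> bounded (cluster M \<omega> v)"
proof
  assume b: "bounded (cluster M \<omega> v)"
  have "cluster M \<omega> v \<subseteq> sites M"
    using linked_in(2) occupied_sites_subset by (fastforce simp: cluster_iff)
  then have "cluster M \<omega> v = sites M \<inter> cluster M \<omega> v" by blast
  then show "finite (cluster M \<omega> v)" using finite_sites[OF b] by simp
qed (rule finite_imp_bounded)

lemma olink_first_exit:
  assumes l: "linked (occupied_step M \<omega>) (occupied_sites M \<omega>) u w" and u: "nrm u \<le> R" and w: "R < nrm w"
  shows "\<exists>v. olink {z. nrm z \<le> R + mesh} u v \<omega> \<and> R < nrm v"
proof -
  have "(\<exists>v. olink {z. nrm z \<le> R + mesh} u v \<omega> \<and> R < nrm v) \<or> olink {z. nrm z \<le> R} u w \<omega>"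
    using l
  proof (induction rule: linked_induct)
    case base
    then show ?case using u by (intro disjI2 linked_refl) auto
  next
    case (step x y)
    show ?case
    proof (cases "\<exists>v. olink {z. nrm z \<le> R + mesh} u v \<omega> \<and> R < nrm v")
      case False
      then have ux: "olink {z. nrm z \<le> R} u x \<omega>" using step.IH by blast
      then have xR: "nrm x \<le> R" by (auto dest!: linked_in(2))
      have "nrm (y - x) \<le> mesh" using occupied_step_length[OF step.hyps(2)] nrm_minus_commute by simp
      then have yR: "nrm y \<le> R + mesh" using nrm_triangle[of x "y - x"] xR by simp
      have "olink {z. nrm z \<le> R + mesh} u x \<omega>" using ux by (rule linked_mono) (use mesh_ge in auto)
      moreover have "olink {z. nrm z \<le> R + mesh} x y \<omega>"
        using step.hyps xR yR mesh_ge by (intro linked_step) auto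
      ultimately have "olink {z. nrm z \<le> R + mesh} u y \<omega>" by (rule linked_trans)
      then have "nrm y \<le> R" using False by force
      then have "olink {z. nrm z \<le> R} x y \<omega>" using step.hyps xR by (intro linked_step) auto
      then have "olink {z. nrm z \<le> R} u y \<omega>" by (rule linked_trans[OF ux])
      then show ?thesis by (rule disjI2)
    qed (rule disjI1)
  qed
  moreover have "\<not> olink {z. nrm z \<le> R} u w \<omega>"
  proof
    assume "olink {z. nrm z \<le> R} u w \<omega>"
    then have "nrm w \<le> R" by (auto dest!: linked_in(2))
    then show False using w by simp
  qed
  ultimately show ?thesis by blast
qed

text \<open>Only finitely many sites lie in the box of radius \<open>i\<close>. If all their
  clusters were finite, the arms from this box would have bounded length.\<close>

lemma has_infinite_cluster_iff: "has_infinite_cluster M \<omega> \<longleftrightarrow> (\<exists>i. \<forall>j. arm i j \<omega>)"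
proof
  assume "has_infinite_cluster M \<omega>"
  then obtain v where v: "v \<in> sites M" "infinite (cluster M \<omega> v)" unfolding has_infinite_cluster_def by blast
  define i where "i = nat \<lceil>nrm v\<rceil>"
  have vi: "nrm v \<le> real i" unfolding i_def by (rule real_nat_ceiling_ge)
  have "arm i j \<omega>" for j
  proof -
    have "\<not> bounded (cluster M \<omega> v)" using v(2) cluster_finite_bounded by blast
    then obtain w where w: "w \<in> cluster M \<omega> v" "real i + real j < nrm w"
      unfolding bounded_iff_nrm by (meson not_le)
    then have "\<exists>x. olink {z. nrm z \<le> real i + real j + mesh} v x \<omega> \<and> real i + real j < nrm x"
      using vi by (intro olink_first_exit[of _ _ w]) (auto simp: cluster_iff)
    then show ?thesis using vi unfolding arm_def by blast
  qed
  then show "\<exists>i. \<forall>j. arm i j \<omega>" by blast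
next
  assume "\<exists>i. \<forall>j. arm i j \<omega>"
  then obtain i where i: "\<And>j. arm i j \<omega>" by blast
  show "has_infinite_cluster M \<omega>"
  proof (rule ccontr)
    assume n: "\<not> has_infinite_cluster M \<omega>"
    have "finite (sites M \<inter> {z. nrm z \<le> real i})" by (rule finite_sites) (auto simp: bounded_iff_nrm)
    then have "finite (\<Union>u\<in>sites M \<inter> {z. nrm z \<le> real i}. cluster M \<omega> u)"
      using n unfolding has_infinite_cluster_def by blast
    then have "bounded (\<Union>u\<in>sites M \<inter> {z. nrm z \<le> real i}. cluster M \<omega> u)" by (rule finite_imp_bounded)
    then obtain R where R: "\<And>w. w \<in> (\<Union>u\<in>sites M \<inter> {z. nrm z \<le> real i}. cluster M \<omega> u) \<Longrightarrow> nrm w \<le> R"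
      by (auto simp: bounded_iff_nrm)
    obtain u v where uv: "olink {z. nrm z \<le> real i + real (nat \<lceil>R\<rceil>) + mesh} u v \<omega>" "nrm u \<le> real i" "real i + real (nat \<lceil>R\<rceil>) < nrm v"
      using i unfolding arm_def by blast
    have "linked (occupied_step M \<omega>) (occupied_sites M \<omega>) u v" using uv(1) by (rule linked_mono) auto
    then have "v \<in> cluster M \<omega> u" by (simp add: cluster_iff)
    moreover have "u \<in> sites M" using linked_in(1)[OF uv(1)] by (auto simp: occupied_site_def)
    ultimately have "nrm v \<le> R" using R uv(2) by blast
    then show False using uv(3) real_nat_ceiling_ge[of R] by linarith
  qed
qed

text \<open>Increasing in \<open>m\<close> and decreasing in \<open>n\<close>, so that the existence
  of an infinite cluster becomes an iterated monotone limit of local events.\<close>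

definition arms :: "nat \<Rightarrow> nat \<Rightarrow> config \<Rightarrow> bool" where
  "arms m n \<omega> \<longleftrightarrow> (\<exists>i\<in>{..m}. \<forall>j\<in>{..n}. arm i j \<omega>)"

lemma has_infinite_cluster_arms: "has_infinite_cluster M \<omega> \<longleftrightarrow> (\<exists>m. \<forall>n. arms m n \<omega>)"
proof -
  \<comment> \<open>There are finitely many \<open>i\<close>; if each had a failing
    \<open>j\<close>, the largest of these would contradict \<open>all\<close>.\<close>
  have "(\<exists>i\<in>{..m}. \<forall>j. arm i j \<omega>)" if all: "\<forall>n. arms m n \<omega>" for m
  proof (rule ccontr)
    assume "\<not> ?thesis"
    then have "\<forall>i\<in>{..m}. \<exists>j. \<not> arm i j \<omega>" by blast
    then obtain J where J: "\<forall>i\<in>{..m}. \<not> arm i (J i) \<omega>" by metis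
    define n where "n = Max (J ` {..m})"
    have "J i \<le> n" if "i \<in> {..m}" for i unfolding n_def using that by (intro Max_ge) auto
    then show False using all J unfolding arms_def by blast
  qed
  then show ?thesis unfolding has_infinite_cluster_iff arms_def by blast
qed

lemma arms_mono: "arms m n \<omega> \<Longrightarrow> m \<le> m' \<Longrightarrow> n' \<le> n \<Longrightarrow> arms m' n' \<omega>"
  unfolding arms_def by (meson atMost_iff order_trans)

lemma arms_depends: "\<exists>E. depends_on (arms m n) E \<and> finite E \<and> E \<subseteq> elements M"
proof -
  have arm: "depends_on (arm i j) (els {z. nrm z \<le> real i + real j + mesh})" for i j
    unfolding arm_def by (intro depends_on_ex depends_on_conj_const occupied_linked_depends)
  have "depends_on (arms m n) (\<Union>i\<in>{..m}. \<Union>j\<in>{..n}. els {z. nrm z \<le> real i + real j + mesh})"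
    unfolding arms_def by (intro depends_on_bex depends_on_ball arm)
  moreover have "finite (\<Union>i\<in>{..m}. \<Union>j\<in>{..n}. els {z. nrm z \<le> real i + real j + mesh})"
    by (auto intro!: finite_els simp: bounded_iff_nrm)
  ultimately show ?thesis using els_subset by (intro exI conjI) auto
qed

lemma arms_up: "up_event (arms m n)"
proof -
  have "up_event (arm i j)" for i j
    unfolding arm_def by (intro up_event_ex) (use occupied_linked_up in \<open>auto simp: up_event_def\<close>)
  then show ?thesis unfolding arms_def up_event_def by blast
qed

definition off :: "complex set set \<Rightarrow> config \<Rightarrow> config" where
  "off E \<omega> = (\<lambda>b. \<omega> b \<and> b \<notin> E)"

text \<open>Removing finitely many elements splits a cluster into finitely many pieces: each of its points is
  joined, off the removed elements, to one of the finitely many sites at or next to them.\<close>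

lemma has_infinite_cluster_off:
  assumes E: "finite E" "E \<subseteq> elements M"
  shows "has_infinite_cluster M (off E \<omega>) \<longleftrightarrow> has_infinite_cluster M \<omega>"
proof
  assume "has_infinite_cluster M (off E \<omega>)"
  then obtain m where "\<forall>n. arms m n (off E \<omega>)" unfolding has_infinite_cluster_arms by blast
  moreover have "\<forall>b. off E \<omega> b \<longrightarrow> \<omega> b" by (simp add: off_def)
  ultimately have "\<forall>n. arms m n \<omega>" using arms_up[unfolded up_event_def, rule_format, of "off E \<omega>" \<omega>] by blast
  then show "has_infinite_cluster M \<omega>" unfolding has_infinite_cluster_arms by blast
next
  assume "has_infinite_cluster M \<omega>"
  then obtain v where v: "v \<in> sites M" "infinite (cluster M \<omega> v)" unfolding has_infinite_cluster_def by blast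
  define N where "N = insert v (\<Union>E)"
  have "finite b" if "b \<in> E" for b
    using that E(2) by (cases "kind M") (auto simp: elements_def elim: bond_cases)
  then have finN: "finite N" using E(1) by (simp add: N_def)
  define N' where "N' = N \<union> {y. \<exists>x\<in>N. {x, y} \<in> bonds M}"
  have "bounded N'"
  proof -
    obtain R where R: "\<And>z. z \<in> N \<Longrightarrow> nrm z \<le> R" using finite_imp_bounded[OF finN] by (auto simp: bounded_iff_nrm)
    have "nrm y \<le> R + mesh" if "x \<in> N" "{x, y} \<in> bonds M" for x y
    proof -
      have "nrm (y - x) \<le> mesh / 2" by (rule mesh_hull[OF that(2)]) (auto intro: hull_inc)
      then show ?thesis using nrm_triangle[of x "y - x"] R[OF that(1)] mesh_ge by simp
    qed
    then have "nrm z \<le> R + mesh" if "z \<in> N'" for z using that R mesh_ge unfolding N'_def by force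
    then show ?thesis by (auto simp: bounded_iff_nrm)
  qed
  moreover have N's: "N' \<subseteq> sites M"
  proof -
    have "N \<subseteq> sites M" using v(1) E(2) elements_subset unfolding N_def by blast
    moreover have "y \<in> sites M" if "{x, y} \<in> bonds M" for x y
      using that by (auto elim!: bond_cases simp: doubleton_eq_iff)
    ultimately show ?thesis unfolding N'_def by blast
  qed
  ultimately have finN': "finite N'" using finite_sites[of N'] by (simp add: Int_absorb1)
  have "w \<in> N' \<or> (\<exists>x\<in>N'. w \<in> cluster M (off E \<omega>) x)" if "w \<in> cluster M \<omega> v" for w
  proof -
    have "linked (occupied_step M \<omega>) (occupied_sites M \<omega>) v w" using that by (simp add: cluster_iff)
    then show ?thesis
    proof (induction rule: linked_induct)
      case base
      then show ?case by (simp add: N'_def N_def)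
    next
      case (step x y)
      show ?case
      proof (cases "y \<in> N'")
        case False
        have xyb: "{x, y} \<in> bonds M" using step.hyps by (simp add: occupied_step_def)
        have xN: "x \<notin> N" using False xyb unfolding N'_def by blast
        have yN: "y \<notin> N" using False unfolding N'_def by blast
        have st: "occupied_step M (off E \<omega>) x y"
          using step.hyps(2) xN by (auto simp: occupied_step_def off_def N_def)
        have oc: "occupied_site M (off E \<omega>) x" "occupied_site M (off E \<omega>) y"
          using step.hyps(3,4) xN yN by (auto simp: occupied_site_def off_def N_def)
        have xy: "linked (occupied_step M (off E \<omega>)) (occupied_sites M (off E \<omega>)) x y"
          using st oc by (intro linked_step) auto
        from step.IH show ?thesis
        proof
          assume "x \<in> N'"
          then show ?thesis using xy by (auto simp: cluster_iff)
        next
          assume "\<exists>x'\<in>N'. x \<in> cluster M (off E \<omega>) x'"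
          then obtain x' where "x' \<in> N'" "linked (occupied_step M (off E \<omega>)) (occupied_sites M (off E \<omega>)) x' x"
            by (auto simp: cluster_iff)
          then show ?thesis using linked_trans[OF _ xy] by (auto simp: cluster_iff)
        qed
      qed blast
    qed
  qed
  then have sub: "cluster M \<omega> v \<subseteq> N' \<union> (\<Union>x\<in>N'. cluster M (off E \<omega>) x)" by blast
  show "has_infinite_cluster M (off E \<omega>)"
  proof (rule ccontr)
    assume "\<not> has_infinite_cluster M (off E \<omega>)"
    then have "finite (N' \<union> (\<Union>x\<in>N'. cluster M (off E \<omega>) x))"
      using finN' N's unfolding has_infinite_cluster_def by blast
    then show False using sub v(2) finite_subset by blast
  qed
qed

end

locale lattice_field = lattice M + bernoulli_field M q for M q
begin

lemma P_sup_inf_limit: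
  assumes meas: "\<And>m n. {\<omega> \<in> space \<mu>. C m n \<omega>} \<in> sets \<mu>"
    and mono: "\<And>m n m' n' \<omega>. C m n \<omega> \<Longrightarrow> m \<le> m' \<Longrightarrow> n' \<le> n \<Longrightarrow> C m' n' \<omega>"
  shows "{\<omega> \<in> space \<mu>. \<exists>m. \<forall>n. C m n \<omega>} \<in> sets \<mu>"
    "(\<lambda>n. P (C m n)) \<longlonglongrightarrow> P (\<lambda>\<omega>. \<forall>n. C m n \<omega>)"
    "(\<lambda>m. P (\<lambda>\<omega>. \<forall>n. C m n \<omega>)) \<longlonglongrightarrow> P (\<lambda>\<omega>. \<exists>m. \<forall>n. C m n \<omega>)"
proof -
  have all: "{\<omega> \<in> space \<mu>. \<forall>n::nat. C m n \<omega>} = (\<Inter>n. {\<omega> \<in> space \<mu>. C m n \<omega>})" for m by auto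
  have ex: "{\<omega> \<in> space \<mu>. \<exists>m::nat. \<forall>n::nat. C m n \<omega>} = (\<Union>m. {\<omega> \<in> space \<mu>. \<forall>n. C m n \<omega>})" by auto
  have mall: "{\<omega> \<in> space \<mu>. \<forall>n::nat. C m n \<omega>} \<in> sets \<mu>" for m
    unfolding all using meas by (intro sets.countable_INT) auto
  show "{\<omega> \<in> space \<mu>. \<exists>m. \<forall>n. C m n \<omega>} \<in> sets \<mu>"
    unfolding ex using mall by (intro sets.countable_UN) auto
  show "(\<lambda>n. P (C m n)) \<longlonglongrightarrow> P (\<lambda>\<omega>. \<forall>n. C m n \<omega>)"
    unfolding perc_prob_def all
    by (rule finite_Lim_measure_decseq) (use meas mono in \<open>auto simp: decseq_def\<close>)
  have "incseq (\<lambda>m. {\<omega> \<in> space \<mu>. \<forall>n. C m n \<omega>})"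
    unfolding incseq_def using mono by blast
  then show "(\<lambda>m. P (\<lambda>\<omega>. \<forall>n. C m n \<omega>)) \<longlonglongrightarrow> P (\<lambda>\<omega>. \<exists>m. \<forall>n. C m n \<omega>)"
    unfolding perc_prob_def ex using mall by (intro finite_Lim_measure_incseq) auto
qed

lemma arms_sets: "{\<omega> \<in> space \<mu>. arms m n \<omega>} \<in> sets \<mu>"
proof -
  obtain E where "depends_on (arms m n) E" "finite E" "E \<subseteq> elements M" using arms_depends by blast
  then show ?thesis by (rule event_sets)
qed

lemma has_infinite_cluster_sets: "{\<omega> \<in> space \<mu>. has_infinite_cluster M \<omega>} \<in> sets \<mu>"
  unfolding has_infinite_cluster_arms by (rule P_sup_inf_limit(1)[OF arms_sets]) (rule arms_mono)

text \<open>Removing the elements of \<open>E\<close> does not change whether an infinite cluster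
  exists. So this event is a limit of local events off \<open>E\<close>, each of them independent of
  \<open>A\<close>.\<close>

lemma infinite_cluster_indep:
  assumes A: "depends_on A E" "finite E" "E \<subseteq> elements M"
  shows "P (\<lambda>\<omega>. has_infinite_cluster M \<omega> \<and> A \<omega>) = P (has_infinite_cluster M) * P A"
proof -
  define B where "B m n \<omega> = arms m n (off E \<omega>)" for m n \<omega>
  have X: "has_infinite_cluster M \<omega> \<longleftrightarrow> (\<exists>m. \<forall>n. B m n \<omega>)" for \<omega>
    unfolding B_def has_infinite_cluster_arms[symmetric] using has_infinite_cluster_off[OF A(2,3)] by simp
  have dep: "\<exists>F. depends_on (B m n) F \<and> finite F \<and> F \<subseteq> elements M \<and> F \<inter> E = {}" for m n
  proof -
    obtain F where F: "depends_on (arms m n) F" "finite F" "F \<subseteq> elements M" using arms_depends by blast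
    have "depends_on (B m n) (F - E)" unfolding depends_on_def B_def
    proof (intro allI impI)
      fix \<omega> \<omega>' :: config assume "\<forall>b\<in>F - E. \<omega> b = \<omega>' b"
      then have "\<forall>b\<in>F. off E \<omega> b = off E \<omega>' b" by (auto simp: off_def)
      then show "arms m n (off E \<omega>) = arms m n (off E \<omega>')" using F(1) unfolding depends_on_def by blast
    qed
    then show ?thesis using F by (intro exI[of _ "F - E"]) auto
  qed
  have mono: "B m n \<omega> \<Longrightarrow> m \<le> m' \<Longrightarrow> n' \<le> n \<Longrightarrow> B m' n' \<omega>" for m n m' n' \<omega>
    unfolding B_def by (rule arms_mono)
  have sB: "{\<omega> \<in> space \<mu>. B m n \<omega>} \<in> sets \<mu>" for m n using dep[of m n] event_sets by blast
  have sBA: "{\<omega> \<in> space \<mu>. B m n \<omega> \<and> A \<omega>} \<in> sets \<mu>" for m n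
  proof -
    have "{\<omega> \<in> space \<mu>. B m n \<omega> \<and> A \<omega>} = {\<omega> \<in> space \<mu>. B m n \<omega>} \<inter> {\<omega> \<in> space \<mu>. A \<omega>}" by auto
    then show ?thesis using sB event_sets[OF A] by simp
  qed
  have prod: "P (\<lambda>\<omega>. B m n \<omega> \<and> A \<omega>) = P (B m n) * P A" for m n
  proof -
    obtain F where "depends_on (B m n) F" "finite F" "F \<subseteq> elements M" "F \<inter> E = {}" using dep by blast
    then show ?thesis by (intro P_indep[OF _ _ _ A])
  qed
  note lim1 = P_sup_inf_limit[of "\<lambda>m n \<omega>. B m n \<omega> \<and> A \<omega>", OF sBA]
  have mono2: "B m n \<omega> \<and> A \<omega> \<Longrightarrow> m \<le> m' \<Longrightarrow> n' \<le> n \<Longrightarrow> B m' n' \<omega> \<and> A \<omega>" for m n m' n' \<omega>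
    using mono by blast
  have "P (\<lambda>\<omega>. \<forall>n. B m n \<omega> \<and> A \<omega>) = P (\<lambda>\<omega>. \<forall>n. B m n \<omega>) * P A" for m
  proof (rule LIMSEQ_unique)
    show "(\<lambda>n. P (\<lambda>\<omega>. B m n \<omega> \<and> A \<omega>)) \<longlonglongrightarrow> P (\<lambda>\<omega>. \<forall>n. B m n \<omega> \<and> A \<omega>)" by (rule lim1(2)) (rule mono2)
    show "(\<lambda>n. P (\<lambda>\<omega>. B m n \<omega> \<and> A \<omega>)) \<longlonglongrightarrow> P (\<lambda>\<omega>. \<forall>n. B m n \<omega>) * P A"
      unfolding prod by (intro tendsto_mult_right P_sup_inf_limit(2)[OF sB]) (rule mono)
  qed
  then have eq: "(\<lambda>m. P (\<lambda>\<omega>. \<forall>n. B m n \<omega> \<and> A \<omega>)) = (\<lambda>m. P (\<lambda>\<omega>. \<forall>n. B m n \<omega>) * P A)" by simp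
  have "P (\<lambda>\<omega>. \<exists>m. \<forall>n. B m n \<omega> \<and> A \<omega>) = P (\<lambda>\<omega>. \<exists>m. \<forall>n. B m n \<omega>) * P A"
  proof (rule LIMSEQ_unique)
    show "(\<lambda>m. P (\<lambda>\<omega>. \<forall>n. B m n \<omega> \<and> A \<omega>)) \<longlonglongrightarrow> P (\<lambda>\<omega>. \<exists>m. \<forall>n. B m n \<omega> \<and> A \<omega>)" by (rule lim1(3)) (rule mono2)
    show "(\<lambda>m. P (\<lambda>\<omega>. \<forall>n. B m n \<omega> \<and> A \<omega>)) \<longlonglongrightarrow> P (\<lambda>\<omega>. \<exists>m. \<forall>n. B m n \<omega>) * P A"
      unfolding eq by (intro tendsto_mult_right P_sup_inf_limit(3)[OF sB]) (rule mono)
  qed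
  moreover have "(\<exists>m. \<forall>n. B m n \<omega> \<and> A \<omega>) \<longleftrightarrow> has_infinite_cluster M \<omega> \<and> A \<omega>" for \<omega> unfolding X by blast
  ultimately show ?thesis unfolding X[symmetric] by simp
qed

text \<open>Being independent of every \<open>arms m n\<close>, the event is in the limit
  independent of itself, so its probability equals its own square.\<close>

lemma infinite_cluster_01:
  "(AE \<omega> in \<mu>. has_infinite_cluster M \<omega>) \<or> (AE \<omega> in \<mu>. \<not> has_infinite_cluster M \<omega>)"
proof -
  let ?X = "has_infinite_cluster M"
  define C where "C m n \<omega> \<longleftrightarrow> ?X \<omega> \<and> arms m n \<omega>" for m n \<omega>
  have sC: "{\<omega> \<in> space \<mu>. C m n \<omega>} \<in> sets \<mu>" for m n
  proof -
    have "{\<omega> \<in> space \<mu>. C m n \<omega>} = {\<omega> \<in> space \<mu>. ?X \<omega>} \<inter> {\<omega> \<in> space \<mu>. arms m n \<omega>}" by (auto simp: C_def)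
    then show ?thesis using has_infinite_cluster_sets arms_sets by simp
  qed
  have mono: "C m n \<omega> \<Longrightarrow> m \<le> m' \<Longrightarrow> n' \<le> n \<Longrightarrow> C m' n' \<omega>" for m n m' n' \<omega>
    unfolding C_def using arms_mono by blast
  have prod: "P (C m n) = P ?X * P (arms m n)" for m n
  proof -
    obtain E where "depends_on (arms m n) E" "finite E" "E \<subseteq> elements M" using arms_depends by blast
    then have "P (\<lambda>\<omega>. ?X \<omega> \<and> arms m n \<omega>) = P ?X * P (arms m n)" by (rule infinite_cluster_indep)
    then show ?thesis by (simp add: C_def[abs_def])
  qed
  have "P (\<lambda>\<omega>. \<forall>n. C m n \<omega>) = P ?X * P (\<lambda>\<omega>. \<forall>n. arms m n \<omega>)" for m
  proof (rule LIMSEQ_unique)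
    show "(\<lambda>n. P (C m n)) \<longlonglongrightarrow> P (\<lambda>\<omega>. \<forall>n. C m n \<omega>)" by (rule P_sup_inf_limit(2)[OF sC]) (rule mono)
    show "(\<lambda>n. P (C m n)) \<longlonglongrightarrow> P ?X * P (\<lambda>\<omega>. \<forall>n. arms m n \<omega>)"
      unfolding prod by (intro tendsto_mult_left P_sup_inf_limit(2)[OF arms_sets]) (rule arms_mono)
  qed
  then have eq: "(\<lambda>m. P (\<lambda>\<omega>. \<forall>n. C m n \<omega>)) = (\<lambda>m. P ?X * P (\<lambda>\<omega>. \<forall>n. arms m n \<omega>))" by simp
  have "P (\<lambda>\<omega>. \<exists>m. \<forall>n. C m n \<omega>) = P ?X * P (\<lambda>\<omega>. \<exists>m. \<forall>n. arms m n \<omega>)"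
  proof (rule LIMSEQ_unique)
    show "(\<lambda>m. P (\<lambda>\<omega>. \<forall>n. C m n \<omega>)) \<longlonglongrightarrow> P (\<lambda>\<omega>. \<exists>m. \<forall>n. C m n \<omega>)" by (rule P_sup_inf_limit(3)[OF sC]) (rule mono)
    show "(\<lambda>m. P (\<lambda>\<omega>. \<forall>n. C m n \<omega>)) \<longlonglongrightarrow> P ?X * P (\<lambda>\<omega>. \<exists>m. \<forall>n. arms m n \<omega>)"
      unfolding eq by (intro tendsto_mult_left P_sup_inf_limit(3)[OF arms_sets]) (rule arms_mono)
  qed
  moreover have "(\<exists>m. \<forall>n. C m n \<omega>) \<longleftrightarrow> ?X \<omega>" for \<omega> unfolding C_def has_infinite_cluster_arms by blast
  ultimately have "P ?X = P ?X * P ?X" unfolding has_infinite_cluster_arms[symmetric] by simp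
  then have "P ?X = 0 \<or> P ?X = 1" by simp
  then show ?thesis
    unfolding perc_prob_def
    using prob_Collect_eq_0[OF has_infinite_cluster_sets] prob_Collect_eq_1[OF has_infinite_cluster_sets] by blast
qed

lemma AE_iff_P:
  "(AE \<omega> in \<mu>. has_infinite_cluster M \<omega>) \<longleftrightarrow> P (has_infinite_cluster M) = 1"
  "(AE \<omega> in \<mu>. \<not> has_infinite_cluster M \<omega>) \<longleftrightarrow> P (has_infinite_cluster M) = 0"
  unfolding perc_prob_def
  using prob_Collect_eq_0[OF has_infinite_cluster_sets] prob_Collect_eq_1[OF has_infinite_cluster_sets] by blast+

end

text \<open>Monotonicity in the density holds for the local events \<open>arms\<close> and passes
  through the two limits.\<close>

lemma infinite_cluster_mono:
  assumes "lattice_field M q" "lattice_field M q'" "\<And>z. q z \<le> q' z"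
  shows "perc_prob M q (has_infinite_cluster M) \<le> perc_prob M q' (has_infinite_cluster M)"
proof -
  interpret Q: lattice_field M q by fact
  interpret Q': lattice_field M q' by fact
  have 1: "perc_prob M q (Q.arms m n) \<le> perc_prob M q' (Q.arms m n)" for m n
  proof -
    obtain E where "depends_on (Q.arms m n) E" "finite E" "E \<subseteq> elements M" using Q.arms_depends by blast
    then show ?thesis
      by (intro perc_prob_mono_density[of _ _ _ E] Q.arms_up assms(3) Q.bernoulli_field_axioms Q'.bernoulli_field_axioms)
  qed
  have 2: "perc_prob M q (\<lambda>\<omega>. \<forall>n. Q.arms m n \<omega>) \<le> perc_prob M q' (\<lambda>\<omega>. \<forall>n. Q.arms m n \<omega>)" for m
    by (rule LIMSEQ_le[OF Q.P_sup_inf_limit(2)[OF Q.arms_sets] Q'.P_sup_inf_limit(2)[OF Q'.arms_sets]])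
      (use 1 Q.arms_mono in blast)+
  show ?thesis unfolding Q.has_infinite_cluster_arms
    by (rule LIMSEQ_le[OF Q.P_sup_inf_limit(3)[OF Q.arms_sets] Q'.P_sup_inf_limit(3)[OF Q'.arms_sets]])
      (use 2 Q.arms_mono in blast)+
qed

text \<open>Two uses of \<open>ln x \<le> x - 1\<close> show that the denominator grows by no larger
  factor than the numerator; the bound \<open>exp (exp 1)\<close> ensures
  \<open>ln (ln r) \<ge> 1\<close>.\<close>

lemma ln_ln_ratio_mono:
  fixes r s :: real
  assumes "exp (exp 1) \<le> r" "r \<le> s"
  shows "r / ln (ln r) \<le> s / ln (ln s)"
proof -
  have r0: "0 < r" by (rule less_le_trans[OF exp_gt_zero assms(1)])
  have s0: "0 < s" using r0 assms(2) by simp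
  have l: "exp 1 \<le> ln r" using assms(1) r0 by (simp add: ln_ge_iff)
  have l0: "0 < ln r" by (rule less_le_trans[OF exp_gt_zero l])
  have ll: "1 \<le> ln (ln r)" using l l0 by (simp add: ln_ge_iff)
  have ls: "ln r \<le> ln s" using assms(2) r0 by simp
  have ls0: "0 < ln s" using l0 ls by linarith
  have sr: "1 \<le> s / r" using assms(2) r0 by simp
  have e1: "1 \<le> ln r" using l exp_ge_add_one_self[of 1] by linarith
  have "ln s / ln r = 1 + ln (s / r) / ln r" using l0 r0 s0 by (simp add: ln_div field_simps)
  also have "\<dots> \<le> 1 + ln (s / r)"
  proof -
    have "ln (s / r) / ln r \<le> ln (s / r) / 1" using e1 sr by (intro divide_left_mono) auto
    then show ?thesis by simp
  qed
  also have "\<dots> \<le> s / r" using ln_le_minus_one[of "s / r"] sr by simp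
  finally have "ln (ln s / ln r) \<le> ln (s / r)" using l0 ls0 r0 s0 by (simp add: divide_pos_pos)
  also have "\<dots> \<le> s / r - 1" using sr by (intro ln_le_minus_one) simp
  finally have "ln (ln s) \<le> ln (ln r) + (s / r - 1)" using l0 ls0 by (simp add: ln_div)
  also have "\<dots> \<le> ln (ln r) + ln (ln r) * (s / r - 1)"
    using ll sr by (intro add_left_mono) (simp add: mult_right_mono[of 1 "ln (ln r)" "s / r - 1", simplified])
  also have "\<dots> = ln (ln r) * (s / r)" by (simp add: algebra_simps)
  finally have "ln (ln s) * r \<le> ln (ln r) * s" using r0 by (simp add: field_simps)
  moreover have "0 < ln (ln s)"
  proof -
    have "ln (ln r) \<le> ln (ln s)" using ls l0 by simp
    then show ?thesis using ll by linarith
  qed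
  ultimately show ?thesis using ll by (simp add: field_simps)
qed

context kesten begin

subsection \<open>The inhomogeneous density\<close>

lemma corr_length_strict: "pc < p \<Longrightarrow> p < q \<Longrightarrow> q \<le> 1 \<Longrightarrow> corr_length M q < corr_length M p"
  using kesten by (auto simp: kesten_percolation_def corr_length_regular_def)

lemma corr_length_surj:
  assumes "0 \<le> r"
  shows "\<exists>p. pc < p \<and> p \<le> 1 \<and> corr_length M p = r"
proof (cases "r = 0")
  case True
  then show ?thesis using pc01 by (intro exI[of _ 1]) (simp add: corr_length_def)
next
  case False
  have "filterlim (corr_length M) at_top (at_right pc)"
    using kesten by (auto simp: kesten_percolation_def corr_length_regular_def)
  then have "eventually (\<lambda>p. r \<le> corr_length M p) (at_right pc)" unfolding filterlim_at_top by blast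
  then obtain b where b: "b > pc" "\<And>p. pc < p \<Longrightarrow> p < b \<Longrightarrow> r \<le> corr_length M p"
    unfolding eventually_at_right_field by blast
  define p0 where "p0 = (pc + min b 1) / 2"
  have p0: "pc < p0" "p0 < b" "p0 < 1" using b(1) pc01 by (auto simp: p0_def min_def)
  have "continuous_on {pc<..1} (corr_length M)"
    using kesten by (auto simp: kesten_percolation_def corr_length_regular_def)
  then have "continuous_on {p0..1} (corr_length M)" by (rule continuous_on_subset) (use p0 in auto)
  moreover have "corr_length M 1 \<le> r" using assms by (simp add: corr_length_def)
  ultimately have "\<exists>x. p0 \<le> x \<and> x \<le> 1 \<and> corr_length M x = r"
    using b(2)[OF p0(1,2)] p0 by (intro IVT2') auto
  then obtain x where "p0 \<le> x" "x \<le> 1" "corr_length M x = r" by blast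
  then show ?thesis using p0(1) by (intro exI[of _ x]) simp
qed

lemma alpha_props:
  assumes "0 \<le> r"
  shows "pc < pc + alpha M pc r" "pc + alpha M pc r \<le> 1" "corr_length M (pc + alpha M pc r) = r"
proof -
  let ?h = "\<lambda>s. corr_length M (pc + s)" and ?S = "{0<..1 - pc}"
  have inj: "inj_on ?h ?S"
  proof (rule inj_onI, rule ccontr)
    fix x y assume h: "x \<in> ?S" "y \<in> ?S" "?h x = ?h y" "x \<noteq> y"
    then consider "x < y" | "y < x" by linarith
    then show False using h corr_length_strict[of "pc + x" "pc + y"] corr_length_strict[of "pc + y" "pc + x"] by cases auto
  qed
  obtain p where p: "pc < p" "p \<le> 1" "corr_length M p = r" using corr_length_surj[OF assms] by blast
  have "r \<in> ?h ` ?S" using p by (intro image_eqI[of _ _ "p - pc"]) auto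
  then have "alpha M pc r \<in> ?S" "?h (alpha M pc r) = r"
    unfolding alpha_def
    using the_inv_into_into[OF inj _ subset_refl, of r] f_the_inv_into_f[OF inj, of r] by blast+
  then show "pc < pc + alpha M pc r" "pc + alpha M pc r \<le> 1" "corr_length M (pc + alpha M pc r) = r" by auto
qed

lemma alpha_antimono:
  assumes "0 \<le> r" "r \<le> s"
  shows "alpha M pc s \<le> alpha M pc r"
proof (rule ccontr)
  assume "\<not> ?thesis"
  then have "corr_length M (pc + alpha M pc s) < corr_length M (pc + alpha M pc r)"
    using alpha_props[OF assms(1)] alpha_props[of s] assms by (intro corr_length_strict) auto
  then show False using alpha_props(3)[OF assms(1)] alpha_props(3)[of s] assms by auto
qed

definition scale_p :: "real \<Rightarrow> real \<Rightarrow> real" where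
  "scale_p \<kappa> r = pc + alpha M pc (r / (\<kappa> * ln (ln r)))"

lemma ln_ln_pos: "exp 1 < r \<Longrightarrow> 0 < ln (ln (r :: real))"
proof -
  assume r: "exp 1 < r"
  have r0: "0 < r" by (rule less_trans[OF exp_gt_zero r])
  have "ln (exp 1) < ln r" using r r0 by (subst ln_less_cancel_iff) auto
  then have "1 < ln r" by simp
  then show "0 < ln (ln r)" by (rule ln_gt_zero)
qed

lemma scale_p_props:
  assumes "0 < \<kappa>" "exp 1 < r"
  shows "pc < scale_p \<kappa> r" "scale_p \<kappa> r \<le> 1" "corr_length M (scale_p \<kappa> r) = r / (\<kappa> * ln (ln r))"
proof -
  have "0 < r" by (rule less_trans[OF exp_gt_zero assms(2)])
  then have "0 \<le> r / (\<kappa> * ln (ln r))" using ln_ln_pos[OF assms(2)] assms(1) by simp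
  then show "pc < scale_p \<kappa> r" "scale_p \<kappa> r \<le> 1" "corr_length M (scale_p \<kappa> r) = r / (\<kappa> * ln (ln r))"
    unfolding scale_p_def using alpha_props by auto
qed

lemma inhom_density_eq:
  "inhom_density M pc \<kappa> z = (if exp 1 < nrm z then scale_p \<kappa> (nrm z) else 1)"
  by (simp add: inhom_density_def Let_def nrm_def scale_p_def)

lemma inhom_density_01: "0 < \<kappa> \<Longrightarrow> 0 \<le> inhom_density M pc \<kappa> z \<and> inhom_density M pc \<kappa> z \<le> 1"
  using scale_p_props[of \<kappa> "nrm z"] pc01 by (auto simp: inhom_density_eq)

lemma inhom_field: "0 < \<kappa> \<Longrightarrow> lattice_field M (inhom_density M pc \<kappa>)"
  using inhom_density_01 by (intro lattice_field.intro lattice_axioms bernoulli_field.intro) auto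

lemma inhom_density_mono:
  assumes "0 < \<kappa>" "\<kappa> \<le> \<kappa>'"
  shows "inhom_density M pc \<kappa> z \<le> inhom_density M pc \<kappa>' z"
proof (cases "exp 1 < nrm z")
  case True
  have r: "0 < nrm z" by (rule less_trans[OF exp_gt_zero True])
  have l: "0 < ln (ln (nrm z))" by (rule ln_ln_pos[OF True])
  have "nrm z / (\<kappa>' * ln (ln (nrm z))) \<le> nrm z / (\<kappa> * ln (ln (nrm z)))"
    using assms l r by (intro divide_left_mono mult_right_mono) auto
  moreover have "0 \<le> nrm z / (\<kappa>' * ln (ln (nrm z)))" using assms l r by simp
  ultimately show ?thesis using True alpha_antimono by (simp add: inhom_density_eq scale_p_def)
qed (simp add: inhom_density_eq)

lemma exp_exp_gt: "exp (exp 1) \<le> r \<Longrightarrow> exp 1 < (r :: real)"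
proof -
  assume "exp (exp 1) \<le> r"
  moreover have "exp (1 :: real) < exp (exp 1)" using exp_ge_add_one_self[of "1 :: real"] by (subst exp_less_cancel_iff) linarith
  ultimately show ?thesis by linarith
qed

text \<open>The correlation length grows outwards. So the density on an annulus is bounded above by
  its value at the inner radius and below by that at the outer one, which allows comparison with
  homogeneous models.\<close>

lemma scale_p_antimono:
  assumes "0 < \<kappa>" "exp (exp 1) \<le> r" "r \<le> s"
  shows "scale_p \<kappa> s \<le> scale_p \<kappa> r"
proof -
  have r0: "0 < r" by (rule less_le_trans[OF exp_gt_zero assms(2)])
  have l: "0 < ln (ln r)" using ln_ln_pos exp_exp_gt assms by blast
  have "r / ln (ln r) / \<kappa> \<le> s / ln (ln s) / \<kappa>"
    using ln_ln_ratio_mono[OF assms(2,3)] assms(1) by (intro divide_right_mono) auto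
  then have "r / (\<kappa> * ln (ln r)) \<le> s / (\<kappa> * ln (ln s))" by (simp add: field_simps)
  moreover have "0 \<le> r / (\<kappa> * ln (ln r))" using r0 l assms(1) by simp
  ultimately show ?thesis unfolding scale_p_def using alpha_antimono by simp
qed

text \<open>Far out the prescribed correlation length exceeds the one at \<open>p1\<close>, so the
  near-critical estimates apply there.\<close>

lemma scale_p_near:
  assumes "0 < \<kappa>" "pc < p1" "p1 < 1"
  shows "eventually (\<lambda>r. scale_p \<kappa> r < p1) at_top"
proof -
  have "eventually (\<lambda>r::real. corr_length M p1 < r / (\<kappa> * ln (ln r))) at_top"
    using assms(1) by real_asymp
  moreover have "eventually (\<lambda>r::real. exp 1 < r) at_top" by (rule eventually_gt_at_top)
  ultimately show ?thesis
  proof eventually_elim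
    case (elim r)
    show ?case
    proof (rule ccontr)
      assume "\<not> ?thesis"
      then have "p1 = scale_p \<kappa> r \<or> p1 < scale_p \<kappa> r" by auto
      then have "corr_length M (scale_p \<kappa> r) \<le> corr_length M p1"
        using corr_length_strict[OF assms(2) _ scale_p_props(2)[OF assms(1) elim(2)]] by auto
      then show False using scale_p_props(3)[OF assms(1) elim(2)] elim(1) by simp
    qed
  qed
qed

end

section \<open>Annuli without occupied crossings\<close>

context lattice begin

text \<open>The four strips of thickness \<open>m\<close> around the box of radius \<open>\<rho>\<close>, one for each side.\<close>

definition strip_cross :: "real \<Rightarrow> real \<Rightarrow> nat \<Rightarrow> config \<Rightarrow> bool" where
  "strip_cross \<rho> m i = ocross (if i < 2 then c1 else c2) (if i < 2 then c2 else c1)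
     (if even i then \<rho> else - (\<rho> + m)) ((if even i then \<rho> else - (\<rho> + m)) + m)
     (- (\<rho> + m + mesh)) (- (\<rho> + m + mesh) + 2 * (\<rho> + m + mesh))"

definition annulus :: "real \<Rightarrow> real \<Rightarrow> complex set" where
  "annulus r R = {z. r \<le> nrm z \<and> nrm z \<le> R}"

lemma bounded_annulus: "bounded (annulus r R)"
  by (auto simp: bounded_iff_nrm annulus_def)

lemma strip_cross_axes: "axes (if i < 2 then c1 else c2) (if i < 2 then c2 else c1)" for i :: nat
  by (simp add: axes12 axes21)

lemma strip_cross_depends:
  assumes "0 < m" "0 \<le> \<rho>"
  shows "\<exists>U. convex U \<and> U \<subseteq> annulus (\<rho> - mesh) (\<rho> + m + mesh) \<and> depends_on (strip_cross \<rho> m i) (els U)"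
proof -
  let ?f = "if i < 2 then c1 else c2" and ?g = "if i < 2 then c2 else c1"
  let ?s = "if even i then \<rho> else - (\<rho> + m)" and ?h = "\<rho> + m + mesh"
  define U where "U = rect ?f ?g (?s - mesh) (?s + m + mesh) (- ?h) (- ?h + 2 * ?h)"
  have "U \<subseteq> annulus (\<rho> - mesh) (\<rho> + m + mesh)"
  proof
    fix z assume "z \<in> U"
    then have z: "?s - mesh \<le> ?f z" "?f z \<le> ?s + m + mesh" "- ?h \<le> ?g z" "?g z \<le> ?h" by (auto simp: U_def rect_def)
    have "\<rho> - mesh \<le> \<bar>?f z\<bar>" "\<bar>?f z\<bar> \<le> ?h"
      using z(1,2) assms mesh_ge by (cases "even i"; simp; linarith)+
    moreover have "\<bar>?g z\<bar> \<le> ?h" using z(3,4) by linarith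
    ultimately show "z \<in> annulus (\<rho> - mesh) (\<rho> + m + mesh)"
      unfolding annulus_def axes_nrm[OF strip_cross_axes[of i]] by simp
  qed
  moreover have "depends_on (strip_cross \<rho> m i) (els U)"
    unfolding strip_cross_def U_def by (rule ocross_depends[OF strip_cross_axes]) (use assms in simp)
  moreover have "convex U" unfolding U_def by (rule convex_rect[OF strip_cross_axes])
  ultimately show ?thesis by blast
qed

lemma strip_cross_up: "0 < m \<Longrightarrow> up_event (strip_cross \<rho> m i)"
  unfolding strip_cross_def by (rule ocross_up[OF strip_cross_axes]) simp

lemma exit_strip_cross:
  assumes l: "linked (occupied_step M \<omega>) (occupied_sites M \<omega>) u v" and "0 < m" "nrm u \<le> \<rho>" "\<rho> + m \<le> nrm v"
  shows "\<exists>i<4. strip_cross \<rho> m i \<omega>"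
proof -
  have st: "\<bar>c1 x - c1 y\<bar> \<le> mesh \<and> \<bar>c2 x - c2 y\<bar> \<le> mesh" if "occupied_step M \<omega> x y" for x y
    using axes_le[OF axes12 occupied_step_length[OF that]] axes_le[OF axes21 occupied_step_length[OF that]] by blast
  let ?h = "\<rho> + m + mesh"
  have "ocross c1 c2 \<rho> (\<rho> + m) (- ?h) ?h \<omega> \<or> ocross c1 c2 (- (\<rho> + m)) (- \<rho>) (- ?h) ?h \<omega> \<or>
    ocross c2 c1 \<rho> (\<rho> + m) (- ?h) ?h \<omega> \<or> ocross c2 c1 (- (\<rho> + m)) (- \<rho>) (- ?h) ?h \<omega>"
    unfolding ocross_def
    by (rule linked_exit[OF l _ _ _ assms(2) symp_occupied_step st]) (use assms in \<open>auto simp: nrm_eq\<close>)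
  then have "strip_cross \<rho> m 0 \<omega> \<or> strip_cross \<rho> m 1 \<omega> \<or> strip_cross \<rho> m 2 \<omega> \<or> strip_cross \<rho> m 3 \<omega>"
    by (simp add: strip_cross_def algebra_simps)
  then show ?thesis by (auto intro: exI[of _ 0] exI[of _ 1] exI[of _ 2] exI[of _ 3])
qed

text \<open>The density in the annulus is at most \<open>p\<close>, so the absence of crossings is
  at least as likely as in the homogeneous model. The exponent counts four strips with
  \<open>2 * (k + 1)\<close> windows each.\<close>

lemma no_strip_cross_prob:
  assumes q: "bernoulli_field q" and p: "0 \<le> p" "p \<le> 1" and \<epsilon>: "0 \<le> \<epsilon>" and sp: "short_primal_le p (1 - \<epsilon>) m"
    and m: "2 * mesh \<le> m" "2 * (\<rho> + m + mesh) \<le> real k * m" and \<rho>: "0 \<le> \<rho>"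
    and qp: "\<And>z. z \<in> annulus (\<rho> - mesh) (\<rho> + m + mesh) \<Longrightarrow> q z \<le> p"
  shows "\<epsilon> ^ (8 * (k + 1)) \<le> perc_prob M q (\<lambda>\<omega>. \<forall>i\<in>{..<4}. \<not> strip_cross \<rho> m i \<omega>)"
proof -
  interpret Q: bernoulli_field M q by fact
  interpret H: bernoulli_field M "\<lambda>_. p" using p by (rule bernoulli_field_const)
  have m0: "0 < m" using m(1) mesh_ge by linarith
  have "\<exists>U. convex U \<and> U \<subseteq> annulus (\<rho> - mesh) (\<rho> + m + mesh) \<and> depends_on (strip_cross \<rho> m i) (els U)" for i
    by (rule strip_cross_depends[OF m0 \<rho>])
  then obtain U where U: "\<And>i. convex (U i)" "\<And>i. U i \<subseteq> annulus (\<rho> - mesh) (\<rho> + m + mesh)"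
    "\<And>i. depends_on (strip_cross \<rho> m i) (els (U i))" by metis
  have fin: "finite (els (U i))" for i using finite_els bounded_subset[OF bounded_annulus U(2)] by blast
  have ge: "\<epsilon> ^ (2 * (k + 1)) \<le> Q.P (\<lambda>\<omega>. \<not> strip_cross \<rho> m i \<omega>)" for i
  proof -
    have "\<epsilon> ^ (2 * (k + 1)) \<le> H.P (\<lambda>\<omega>. \<not> strip_cross \<rho> m i \<omega>)"
      unfolding strip_cross_def hom_prob_eq[symmetric]
      by (rule no_ocross_prob[OF sp p \<epsilon> strip_cross_axes m])
    moreover have "Q.P (strip_cross \<rho> m i) \<le> H.P (strip_cross \<rho> m i)"
    proof (rule perc_prob_mono_density[OF q H.bernoulli_field_axioms U(3) fin els_subset strip_cross_up[OF m0]])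
      fix b assume "b \<in> els (U i)"
      then have "location b \<in> U i" by (rule location_in[OF _ U(1)])
      then show "q (location b) \<le> p" using qp U(2) by blast
    qed
    ultimately show ?thesis using Q.P_not[OF U(3) fin els_subset] H.P_not[OF U(3) fin els_subset] by simp
  qed
  have e8: "8 * (k + 1) = 2 * (k + 1) * 4" by simp
  have "\<epsilon> ^ (8 * (k + 1)) = (\<epsilon> ^ (2 * (k + 1))) ^ 4" unfolding e8 by (rule power_mult)
  also have "\<dots> = (\<Prod>i\<in>{..<4::nat}. \<epsilon> ^ (2 * (k + 1)))" by simp
  also have "\<dots> \<le> (\<Prod>i\<in>{..<4}. Q.P (\<lambda>\<omega>. \<not> strip_cross \<rho> m i \<omega>))" by (rule prod_mono) (use ge \<epsilon> in auto)
  also have "\<dots> \<le> Q.P (\<lambda>\<omega>. \<forall>i\<in>{..<4}. \<not> strip_cross \<rho> m i \<omega>)"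
    by (rule Q.P_harris_ball[OF _ U(3) fin els_subset strip_cross_up[OF m0]]) simp
  finally show ?thesis .
qed

end

section \<open>Borel-Cantelli criteria for absence and presence of an infinite cluster\<close>

context lattice_field begin

text \<open>The second Borel-Cantelli lemma by hand. Arms of unbounded length from the box of radius
  \<open>j\<close> get through all annuli further out; these are independent, so the probability of
  this is at most \<open>exp\<close> of minus the partial sums of a divergent series.\<close>

lemma no_infinite_cluster:
  assumes m: "\<And>k. 0 < m k" "\<And>k. 0 \<le> \<rho> k" and lim: "filterlim \<rho> at_top sequentially"
    and disj: "\<And>k. \<rho> k + m k + mesh < \<rho> (Suc k) - mesh"
    and div: "\<not> summable (\<lambda>k. P (\<lambda>\<omega>. \<forall>i\<in>{..<4}. \<not> strip_cross (\<rho> k) (m k) i \<omega>))"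
  shows "AE \<omega> in \<mu>. \<not> has_infinite_cluster M \<omega>"
proof -
  define E where "E k \<omega> \<longleftrightarrow> (\<forall>i\<in>{..<4}. \<not> strip_cross (\<rho> k) (m k) i \<omega>)" for k \<omega>
  define A where "A k = annulus (\<rho> k - mesh) (\<rho> k + m k + mesh)" for k
  have dep: "depends_on (E k) (els (A k))" for k
  proof -
    have "depends_on (strip_cross (\<rho> k) (m k) i) (els (A k))" for i
    proof -
      obtain U where "U \<subseteq> A k" "depends_on (strip_cross (\<rho> k) (m k) i) (els U)"
        using strip_cross_depends[OF m(1)[of k] m(2)[of k], of i] unfolding A_def by (elim exE conjE) metis
      then show ?thesis using depends_on_mono[OF _ els_mono] by metis
    qed
    then have "depends_on (E k) (\<Union>i\<in>{..<4::nat}. els (A k))"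
      unfolding E_def by (intro depends_on_ball depends_on_not)
    then show ?thesis by (rule depends_on_mono) auto
  qed
  have fin: "finite (els (A k))" for k unfolding A_def by (intro finite_els bounded_annulus)
  have inc: "\<rho> k + m k + mesh < \<rho> l - mesh" if "k < l" for k l
    using that
  proof (induction l)
    case (Suc l)
    show ?case
    proof (cases "k = l")
      case True
      then show ?thesis using disj by simp
    next
      case False
      then have "\<rho> k + m k + mesh < \<rho> l - mesh" using Suc by simp
      moreover have "\<rho> l - mesh < \<rho> (Suc l) - mesh" using disj[of l] m(1)[of l] mesh_ge by linarith
      ultimately show ?thesis by linarith
    qed
  qed simp
  have dis: "disjoint_family_on (\<lambda>k. els (A k)) I" for I
    unfolding disjoint_family_on_def
  proof (intro ballI impI)
    fix k l :: nat assume "k \<noteq> l"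
    then consider "k < l" | "l < k" by linarith
    then show "els (A k) \<inter> els (A l) = {}"
      by cases (intro els_disjoint, use inc in \<open>fastforce simp: A_def annulus_def\<close>)+
  qed
  have zero: "P (\<lambda>\<omega>. \<forall>n. arms j n \<omega>) = 0" for j
  proof -
    obtain K where K: "\<And>k. K \<le> k \<Longrightarrow> real j \<le> \<rho> k"
      using lim unfolding filterlim_at_top eventually_sequentially by blast
    have bound: "P (\<lambda>\<omega>. \<forall>n. arms j n \<omega>) \<le> exp (- (\<Sum>k\<in>{K..<N}. P (E k)))" for N
    proof -
      have "P (\<lambda>\<omega>. \<forall>n. arms j n \<omega>) \<le> P (\<lambda>\<omega>. \<forall>k\<in>{K..<N}. \<not> E k \<omega>)"
      proof (rule P_mono_event)
        show "depends_on (\<lambda>\<omega>. \<forall>k\<in>{K..<N}. \<not> E k \<omega>) (\<Union>k\<in>{K..<N}. els (A k))"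
          by (intro depends_on_ball depends_on_not dep)
        show "finite (\<Union>k\<in>{K..<N}. els (A k))" using fin by auto
        show "(\<Union>k\<in>{K..<N}. els (A k)) \<subseteq> elements M" using els_subset by blast
        fix \<omega> assume all: "\<forall>n. arms j n \<omega>"
        show "\<forall>k\<in>{K..<N}. \<not> E k \<omega>"
        proof
          fix k assume k: "k \<in> {K..<N}"
          define n where "n = nat \<lceil>\<rho> k + m k\<rceil>"
          have "arms j n \<omega>" using all by blast
          then obtain i where i: "i \<le> j" "arm i n \<omega>" unfolding arms_def by blast
          then obtain u v where uv: "olink {z. nrm z \<le> real i + real n + mesh} u v \<omega>" "nrm u \<le> real i" "real i + real n < nrm v"
            unfolding arm_def by blast
          have "linked (occupied_step M \<omega>) (occupied_sites M \<omega>) u v" using uv(1) by (rule linked_mono) auto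
          moreover have "nrm u \<le> \<rho> k" using uv(2) i(1) K[of k] k by force
          moreover have "\<rho> k + m k \<le> nrm v" using uv(3) real_nat_ceiling_ge[of "\<rho> k + m k"] by (simp add: n_def)
          ultimately have "\<exists>i<4. strip_cross (\<rho> k) (m k) i \<omega>" using m(1) by (intro exit_strip_cross)
          then show "\<not> E k \<omega>" unfolding E_def by blast
        qed
      qed
      also have "\<dots> = (\<Prod>k\<in>{K..<N}. P (\<lambda>\<omega>. \<not> E k \<omega>))"
        by (rule P_indep_ball[OF _ depends_on_not[OF dep] fin els_subset dis]) simp
      also have "\<dots> \<le> (\<Prod>k\<in>{K..<N}. exp (- P (E k)))"
      proof (rule prod_mono, intro conjI P_nonneg)
        fix k
        have "P (\<lambda>\<omega>. \<not> E k \<omega>) = 1 - P (E k)" by (rule P_not[OF dep fin els_subset])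
        then show "P (\<lambda>\<omega>. \<not> E k \<omega>) \<le> exp (- P (E k))" using exp_ge_add_one_self[of "- P (E k)"] by simp
      qed
      also have "\<dots> = exp (- (\<Sum>k\<in>{K..<N}. P (E k)))" by (simp add: exp_sum[symmetric] sum_negf)
      finally show ?thesis .
    qed
    show ?thesis
    proof (rule ccontr)
      assume ne: "P (\<lambda>\<omega>. \<forall>n. arms j n \<omega>) \<noteq> 0"
      define x where "x = P (\<lambda>\<omega>. \<forall>n. arms j n \<omega>)"
      have x0: "0 < x" using ne P_nonneg[of "\<lambda>\<omega>. \<forall>n. arms j n \<omega>"] by (simp add: x_def)
      have le: "(\<Sum>k\<in>{K..<N}. P (E k)) \<le> - ln x" for N
      proof -
        have "ln x \<le> - (\<Sum>k\<in>{K..<N}. P (E k))" 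
        proof -
          have "x \<le> exp (- (\<Sum>k\<in>{K..<N}. P (E k)))" unfolding x_def by (rule bound)
          then have "ln x \<le> ln (exp (- (\<Sum>k\<in>{K..<N}. P (E k))))" using x0 by (subst ln_le_cancel_iff) auto
          then show ?thesis unfolding ln_exp .
        qed
        then show ?thesis by linarith
      qed
      have "summable (\<lambda>k. P (E k))"
      proof (rule summableI_nonneg_bounded)
        fix N
        show "(\<Sum>k<N. P (E k)) \<le> (\<Sum>k<K. P (E k)) + - ln x"
        proof -
          have "(\<Sum>k<N. P (E k)) \<le> (\<Sum>k\<in>{..<K} \<union> {K..<N}. P (E k))" by (rule sum_mono2) (auto intro: P_nonneg)
          also have "\<dots> = (\<Sum>k<K. P (E k)) + (\<Sum>k\<in>{K..<N}. P (E k))" by (rule sum.union_disjoint) auto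
          finally show ?thesis using le[of N] by linarith
        qed
      qed (rule P_nonneg)
      then show False using div by (simp add: E_def[abs_def])
    qed
  qed
  have "(\<lambda>j. P (\<lambda>\<omega>. \<forall>n. arms j n \<omega>)) \<longlonglongrightarrow> P (\<lambda>\<omega>. \<exists>j. \<forall>n. arms j n \<omega>)"
    by (rule P_sup_inf_limit(3)[OF arms_sets]) (rule arms_mono)
  then have "P (has_infinite_cluster M) = 0"
    unfolding zero has_infinite_cluster_arms[symmetric] using LIMSEQ_unique[OF _ tendsto_const] by blast
  then show ?thesis using AE_iff_P(2) by blast
qed

text \<open>\<open>H k\<close> runs from first coordinate \<open>2 ^ k\<close> to
  \<open>4 * 2 ^ k\<close> at heights between 0 and \<open>2 ^ k\<close>. \<open>V k\<close> rises
  from height 0 to \<open>2 * 2 ^ k\<close> with first coordinate between \<open>2 * 2 ^ k\<close>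
  and \<open>4 * 2 ^ k\<close>, so it meets both \<open>H k\<close> and \<open>H (Suc k)\<close> and
  links them.\<close>

lemma infinite_cluster_from_crossings:
  assumes sum: "summable (\<lambda>k. P (\<lambda>\<omega>. \<not> ocross c1 c2 (2 ^ k) (2 ^ k + 3 * 2 ^ k) 0 (0 + 2 ^ k) \<omega>))"
    "summable (\<lambda>k. P (\<lambda>\<omega>. \<not> ocross c2 c1 0 (0 + 2 * 2 ^ k) (2 * 2 ^ k) (2 * 2 ^ k + 2 * 2 ^ k) \<omega>))"
  shows "AE \<omega> in \<mu>. has_infinite_cluster M \<omega>"
proof -
  define H where "H k = ocross c1 c2 (2 ^ k) (2 ^ k + 3 * 2 ^ k) 0 (0 + 2 ^ k)" for k :: nat
  define V where "V k = ocross c2 c1 0 (0 + 2 * 2 ^ k) (2 * 2 ^ k) (2 * 2 ^ k + 2 * 2 ^ k)" for k :: nat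
  have sH: "{\<omega> \<in> space \<mu>. \<not> H k \<omega>} \<in> sets \<mu>" for k
    unfolding H_def by (rule event_sets[OF depends_on_not[OF ocross_depends[OF axes12]] finite_els_rect[OF axes12] els_subset]) simp
  have sV: "{\<omega> \<in> space \<mu>. \<not> V k \<omega>} \<in> sets \<mu>" for k
    unfolding V_def by (rule event_sets[OF depends_on_not[OF ocross_depends[OF axes21]] finite_els_rect[OF axes21] els_subset]) simp
  have "AE \<omega> in \<mu>. eventually (\<lambda>k. \<omega> \<in> space \<mu> - {\<omega> \<in> space \<mu>. \<not> H k \<omega>}) sequentially"
    by (rule borel_cantelli_AE1[OF sH]) (use sum(1) in \<open>auto simp: emeasure_eq_measure perc_prob_def H_def\<close>)
  moreover have "AE \<omega> in \<mu>. eventually (\<lambda>k. \<omega> \<in> space \<mu> - {\<omega> \<in> space \<mu>. \<not> V k \<omega>}) sequentially"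
    by (rule borel_cantelli_AE1[OF sV]) (use sum(2) in \<open>auto simp: emeasure_eq_measure perc_prob_def V_def\<close>)
  ultimately show ?thesis
  proof eventually_elim
    case (elim \<omega>)
    then have "eventually (\<lambda>k. H k \<omega> \<and> V k \<omega>) sequentially" by eventually_elim auto
    then obtain K where K: "\<And>k. K \<le> k \<Longrightarrow> H k \<omega> \<and> V k \<omega>" by (auto simp: eventually_sequentially)
    let ?R = "occupied_step M \<omega>" and ?S = "occupied_sites M \<omega>"
    define Q where "Q k u v \<longleftrightarrow> linked ?R (?S \<inter> {z. 0 \<le> c2 z \<and> c2 z \<le> 2 ^ k}) u v \<and> c1 u \<le> 2 ^ k \<and> 4 * 2 ^ k \<le> c1 v"
      for k :: nat and u v
    have "\<forall>k\<ge>K. \<exists>u v. Q k u v"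
    proof (intro allI impI)
      fix k assume "K \<le> k"
      then have "H k \<omega>" using K by blast
      moreover have "(2::real) ^ k + 3 * 2 ^ k = 4 * 2 ^ k" by simp
      ultimately show "\<exists>u v. Q k u v" by (simp add: H_def Q_def ocross_def cross_def)
    qed
    then obtain u v where Q: "\<And>k. K \<le> k \<Longrightarrow> Q k (u k) (v k)" by metis
    have uv: "linked ?R (?S \<inter> {z. 0 \<le> c2 z \<and> c2 z \<le> 2 ^ k}) (u k) (v k)" "c1 (u k) \<le> 2 ^ k" "4 * 2 ^ k \<le> c1 (v k)"
      if "K \<le> k" for k using Q[OF that] unfolding Q_def by simp_all
    have nxt: "linked ?R ?S (u k) (u (Suc k))" if k: "K \<le> k" for k
    proof -
      obtain u' v' where w: "linked ?R (?S \<inter> {z. 2 * 2 ^ k \<le> c1 z \<and> c1 z \<le> 4 * 2 ^ k}) u' v'" "c2 u' \<le> 0" "2 * 2 ^ k \<le> c2 v'"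
      proof -
        have "V k \<omega>" using K[OF k] by blast
        moreover have "(2::real) * 2 ^ k + 2 * 2 ^ k = 4 * 2 ^ k" by simp
        ultimately have "\<exists>u' v'. linked ?R (?S \<inter> {z. 2 * 2 ^ k \<le> c1 z \<and> c1 z \<le> 4 * 2 ^ k}) u' v' \<and> c2 u' \<le> 0 \<and> 2 * 2 ^ k \<le> c2 v'"
          by (simp add: V_def ocross_def cross_def)
        then show thesis by (elim exE conjE) (rule that)
      qed
      have p: "(0 :: real) < 2 ^ k" by simp
      have "\<exists>x. linked ?R ?S (u k) x \<and> linked ?R ?S u' x"
        by (rule occupied_crossings_meet[OF axes12 uv(1)[OF k] _ _ w(1,2)])
          (use uv(2)[OF k] uv(3)[OF k] w(3) p in linarith)+
      then obtain x where x: "linked ?R ?S (u k) x" "linked ?R ?S u' x" by blast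
      have k': "K \<le> Suc k" using k by simp
      have "\<exists>x. linked ?R ?S (u (Suc k)) x \<and> linked ?R ?S u' x"
        by (rule occupied_crossings_meet[OF axes12 uv(1)[OF k'] _ _ w(1,2)])
          (use uv(2)[OF k'] uv(3)[OF k'] w(3) p in \<open>unfold power_Suc, linarith\<close>)+
      then obtain y where y: "linked ?R ?S (u (Suc k)) y" "linked ?R ?S u' y" by blast
      have "linked ?R ?S x u'" "linked ?R ?S y (u (Suc k))" using x(2) y(1) symp_occupied_step by (auto intro: linked_sym)
      then show ?thesis using linked_trans x(1) y(2) by metis
    qed
    have uS: "linked ?R ?S (u k) (v k)" if "K \<le> k" for k using uv(1)[OF that] by (rule linked_mono) auto
    have all: "linked ?R ?S (u K) (u (K + i))" for i
    proof (induction i)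
      case 0
      have "u K \<in> ?S" by (rule linked_in(1)[OF uS]) simp
      then show ?case by (simp add: linked_refl)
    next
      case (Suc i)
      have "linked ?R ?S (u (K + i)) (u (Suc (K + i)))" by (rule nxt) simp
      then show ?case using linked_trans[OF Suc] by simp
    qed
    have "v (K + i) \<in> cluster M \<omega> (u K)" for i
    proof -
      have "linked ?R ?S (u (K + i)) (v (K + i))" by (rule uS) simp
      then show ?thesis using linked_trans[OF all] by (simp add: cluster_iff)
    qed
    moreover have "\<not> bounded (cluster M \<omega> (u K))"
    proof
      assume "bounded (cluster M \<omega> (u K))"
      then obtain B where B: "\<And>z. z \<in> cluster M \<omega> (u K) \<Longrightarrow> nrm z \<le> B" by (auto simp: bounded_iff_nrm)
      obtain i :: nat where i: "B < 2 ^ i" using real_arch_pow[of 2 B] by auto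
      have "(2::real) ^ i \<le> 2 ^ (K + i)" by (rule power_increasing) auto
      moreover have "(0::real) < 2 ^ (K + i)" by simp
      ultimately have "B < 4 * 2 ^ (K + i)" using i by linarith
      also have "\<dots> \<le> c1 (v (K + i))" by (rule uv(3)) simp
      also have "\<dots> \<le> nrm (v (K + i))" by (simp add: nrm_eq)
      finally show False using B[OF \<open>\<And>i. v (K + i) \<in> cluster M \<omega> (u K)\<close>[of i]] by simp
    qed
    moreover have "u K \<in> sites M" using linked_in(1)[OF uS[of K]] by (auto simp: occupied_site_def)
    ultimately show ?case unfolding has_infinite_cluster_def using cluster_finite_bounded by blast
  qed
qed

end

context lattice begin

text \<open>The thickness of the rectangle is filled with the largest scale \<open>2 ^ j * (m + 5 * mesh)\<close>
  of the decay estimate that fits.\<close>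

lemma ocross_failure_le:
  assumes sd: "short_dual_le p (exp (- 1) / 144) m" and p: "0 \<le> p" "p \<le> 1" and m: "10 * mesh \<le> m" "3 * m \<le> 2 * R"
    and ax: "axes f g" and w: "0 < w" "w \<le> 3 * R" and h: "R \<le> h"
  shows "1 - hom_prob M p (ocross g f c (c + w) b (b + h)) \<le> exp (- (R / (3 * m)))"
proof -
  interpret bernoulli_field M "\<lambda>_. p" using p by (rule bernoulli_field_const)
  have m0: "0 < m" using m mesh_ge by linarith
  define y where "y = m + 5 * mesh"
  have y: "0 < y" "y \<le> R" "10 * mesh \<le> y" "15 * mesh \<le> y" "2 * y \<le> 3 * m" using m m0 mesh_ge by (auto simp: y_def)
  have "eventually (\<lambda>j::nat. R < 2 ^ j * y) sequentially" using y(1) by real_asymp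
  then obtain i :: nat where i: "R < 2 ^ i * y" by (auto simp: eventually_sequentially)
  obtain j where j: "2 ^ j * y \<le> R" "R < 2 ^ Suc j * y"
  proof -
    have "\<exists>j. 2 ^ j * y \<le> R \<and> R < 2 ^ Suc j * y" using i
    proof (induction i)
      case 0
      then show ?case using y(2) by simp
    next
      case (Suc i)
      then show ?case by (cases "R < 2 ^ i * y") (auto simp: not_less)
    qed
    then show thesis using that by blast
  qed
  define m' where "m' = 2 ^ j * y - 5 * mesh"
  \<comment> \<open>As \<open>2 ^ j * y\<close> exceeds \<open>R / 2\<close>, a length
    \<open>3 * R\<close> plus margins fits into \<open>12 * m'\<close>. The resulting factor
    \<open>2 * (12 + 1)\<close> is absorbed by the denominator 144.\<close>
  have m': "2 * mesh \<le> m'" "m' \<le> h - 4 * mesh" "3 * R + 4 * mesh \<le> real 12 * m'"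
  proof -
    define Y where "Y = 2 ^ j * y"
    have Y: "y \<le> Y" "Y \<le> R" "R < 2 * Y" using j y(1) by (simp_all add: Y_def)
    have "3 * R + 64 * mesh \<le> 12 * Y" using Y y(4) mesh_ge by linarith
    then show "2 * mesh \<le> m'" "m' \<le> h - 4 * mesh" "3 * R + 4 * mesh \<le> real 12 * m'"
      using Y y(4) h mesh_ge unfolding m'_def Y_def[symmetric] by (simp_all add: algebra_simps)
  qed
  have sd': "short_dual_le p (exp (- (2 ^ j)) / 144) m'" unfolding m'_def y_def by (rule short_dual_decay[OF sd p m(1)])
  define s t where "s = b + 2 * mesh" and "t = c - 2 * mesh"
  have h4: "4 * mesh < h" using m'(1,2) mesh_ge by linarith
  have m'0: "0 < m'" using m'(1) mesh_ge by linarith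
  have "1 - hom_prob M p (ocross g f c (c + w) b (b + h)) \<le> P (dcross f g s (s + (h - 4 * mesh)) t (t + (w + 4 * mesh)))"
    unfolding s_def t_def hom_prob_eq[symmetric] by (rule ocross_complement_le[OF ax p w(1) h4])
  also have "\<dots> \<le> P (dcross f g s (s + m') t (t + (w + 4 * mesh)))"
  proof (rule P_mono_event)
    show "depends_on (dcross f g s (s + m') t (t + (w + 4 * mesh)))
      (els (rect f g (s - 2 * mesh) (s + m' + 2 * mesh) (t - mesh) (t + (w + 4 * mesh) + mesh)))"
      by (rule dcross_depends[OF ax]) (use m'0 in simp)
    show "dcross f g s (s + m') t (t + (w + 4 * mesh)) \<omega>" if "dcross f g s (s + (h - 4 * mesh)) t (t + (w + 4 * mesh)) \<omega>" for \<omega>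
      using that by (rule dcross_mono) (use m'(2) in auto)
  qed (rule finite_els_rect[OF ax] els_subset)+
  also have "\<dots> \<le> 2 * (real 12 + 1) * (exp (- (2 ^ j)) / 144)"
    unfolding hom_prob_eq[symmetric] by (rule hom_dcross_cover[OF sd' p ax m'(1)]) (use w m'(3) in linarith)
  also have "\<dots> \<le> exp (- (2 ^ j))" by simp
  also have "\<dots> \<le> exp (- (R / (3 * m)))"
  proof -
    have "2 ^ Suc j * y \<le> 2 ^ j * (3 * m)" using y(5) mult_left_mono[of "2 * y" "3 * m" "2 ^ j"] by (simp add: algebra_simps)
    then have "R \<le> 2 ^ j * (3 * m)" using j(2) by linarith
    then have "R / (3 * m) \<le> 2 ^ j" using m0 by (simp add: divide_le_eq)
    then show ?thesis by simp
  qed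
  finally show ?thesis .
qed

end

section \<open>The regimes of small and of large \<kappa>\<close>

context kesten begin

text \<open>Strips at radius \<open>R\<close> have thickness about one eighth of the correlation
  length, so their length takes about \<open>64 * \<kappa> * ln (ln R)\<close> units. Blocking then
  costs the exponent \<open>512 * \<kappa> * \<l> * ln (ln R)\<close>, up to a bounded term, and a
  coefficient of at most 1 gives a probability of order at least \<open>1 / ln R\<close>, a harmonic
  series along powers of 8.\<close>

lemma no_infinite_cluster_small_kappa:
  obtains \<kappa>0 where "0 < \<kappa>0"
    "\<And>\<kappa>. 0 < \<kappa> \<Longrightarrow> \<kappa> \<le> \<kappa>0 \<Longrightarrow> AE \<omega> in inhom_measure M pc \<kappa>. \<not> has_infinite_cluster M \<omega>"
proof -
  obtain \<epsilon> n0 C p1 where e: "0 < \<epsilon>" "\<epsilon> \<le> 1" "pc < p1" "p1 < 1"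
    and sp: "\<And>p n. pc < p \<Longrightarrow> p < p1 \<Longrightarrow> n0 \<le> n \<Longrightarrow> 8 * real n \<le> corr_length M p \<Longrightarrow> short_primal_le p (1 - \<epsilon>) (real n)"
    using near_critical by metis
  define \<l> where "\<l> = ln (1 / \<epsilon>)"
  have \<l>: "0 \<le> \<l>" "\<epsilon> = exp (- \<l>)" using e by (auto simp: \<l>_def ln_div)
  \<comment> \<open>\<open>512 = 8 * 64\<close>, from the exponent \<open>8 * (k + 1)\<close> and
    the number of units. The summand 1 avoids a division by zero when
    \<open>\<epsilon> = 1\<close>.\<close>
  define \<kappa>0 where "\<kappa>0 = 1 / (512 * (\<l> + 1))"
  show thesis
  proof (rule that)
    show "0 < \<kappa>0" using \<l>(1) by (simp add: \<kappa>0_def)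
    fix \<kappa> :: real assume \<kappa>: "0 < \<kappa>" "\<kappa> \<le> \<kappa>0"
    have \<kappa>\<l>: "512 * \<kappa> * \<l> \<le> 1"
    proof -
      have "\<kappa> * (512 * (\<l> + 1)) \<le> 1" using \<kappa>(2) \<l>(1) by (simp add: \<kappa>0_def le_divide_eq)
      then show ?thesis using \<kappa>(1) by (simp add: algebra_simps)
    qed
    define q where "q = inhom_density M pc \<kappa>"
    interpret Q: lattice_field M q unfolding q_def by (rule inhom_field[OF \<kappa>(1)])
    let ?E = "\<lambda>R n \<omega>. \<forall>i\<in>{..<4}. \<not> strip_cross (R + mesh) n i \<omega>"
    have "eventually (\<lambda>R::real. real n0 + 2 * mesh + 2 \<le> R / (\<kappa> * ln (ln R)) / 8) at_top" using \<kappa>(1) by real_asymp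
    \<comment> \<open>A thickness of at most \<open>R / 4\<close> keeps the annuli at radii
      \<open>8 ^ k\<close> disjoint.\<close>
    moreover have "eventually (\<lambda>R::real. R / (\<kappa> * ln (ln R)) / 8 \<le> R / 4) at_top" using \<kappa>(1) by real_asymp
    moreover have "eventually (\<lambda>R::real. exp (exp 1) \<le> R) at_top" by (rule eventually_ge_at_top)
    moreover have "eventually (\<lambda>R::real. 4 * mesh \<le> R) at_top" by (rule eventually_ge_at_top)
    moreover note scale_p_near[OF \<kappa>(1) e(3,4)]
    ultimately have "eventually (\<lambda>R. 4 * mesh \<le> R \<and> (\<exists>n>0. n \<le> R / 4 \<and> exp (- 16 * \<l>) / ln R \<le> Q.P (?E R n))) at_top"
    proof eventually_elim
      case (elim R)
      define L where "L = ln (ln R)"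
      define x where "x = R / (\<kappa> * L) / 8"
      define n where "n = nat \<lfloor>x\<rfloor>"
      have R1: "exp 1 < R" by (rule exp_exp_gt[OF elim(3)])
      have R0: "0 < R" by (rule less_trans[OF exp_gt_zero R1])
      have lnR: "0 < ln R"
      proof -
        have "1 < R" using R1 exp_ge_add_one_self[of 1] by linarith
        then show ?thesis by (rule ln_gt_zero)
      qed
      have L0: "0 < L" unfolding L_def by (rule ln_ln_pos[OF R1])
      have x: "real n0 + 2 * mesh + 2 \<le> x" "x \<le> R / 4" using elim(1,2) by (auto simp: x_def L_def)
      have x0: "0 < x" using x(1) mesh_ge by linarith
      have nx: "real n \<le> x" "x < real n + 1"
        using x0 by (auto simp: n_def)
      have n: "n0 \<le> n" "2 * mesh \<le> real n" "x / 2 \<le> real n" "0 < real n" using x(1) nx mesh_ge by linarith+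
      define k where "k = nat \<lceil>4 * R / real n\<rceil>"
      have k: "4 * R / real n \<le> real k" "real k \<le> 4 * R / real n + 1"
        using R0 n(4) unfolding k_def by (simp_all add: real_nat_ceiling_ge of_nat_ceiling)
      have kn: "4 * R \<le> real k * real n" using k(1) n(4) by (simp add: divide_le_eq)
      have kl: "real k \<le> 64 * \<kappa> * L + 1"
      proof -
        have "4 * R / real n \<le> 4 * R / (x / 2)" using n(3) x0 R0 by (intro divide_left_mono) auto
        also have "\<dots> = 64 * \<kappa> * L" using R0 \<kappa>(1) L0 by (simp add: x_def field_simps)
        finally show ?thesis using k(2) by linarith
      qed
      define p where "p = scale_p \<kappa> R"
      have p: "pc < p" "p < p1" "0 \<le> p" "p \<le> 1" "corr_length M p = 8 * x"
        using scale_p_props[OF \<kappa>(1) R1] elim(5) pc01 by (auto simp: p_def x_def L_def)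
      have "\<epsilon> ^ (8 * (k + 1)) \<le> Q.P (?E R (real n))"
      proof (rule no_strip_cross_prob[OF Q.bernoulli_field_axioms p(3,4)])
        show "short_primal_le p (1 - \<epsilon>) (real n)" by (rule sp[OF p(1,2) n(1)]) (use nx(1) p(5) in simp)
        show "2 * (R + mesh + real n + mesh) \<le> real k * real n" 
        proof -
          have "R + mesh + real n + mesh \<le> 2 * R" using nx(1) x(2) elim(4) R0 by linarith
          then have "2 * (R + mesh + real n + mesh) \<le> 2 * (2 * R)" by (rule mult_left_mono) simp
          also have "\<dots> \<le> real k * real n" using kn by simp
          finally show ?thesis .
        qed
        show "0 \<le> R + mesh" using R0 mesh_ge by linarith
        fix z assume "z \<in> annulus (R + mesh - mesh) (R + mesh + real n + mesh)"
        then have z: "R \<le> nrm z" by (simp add: annulus_def)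
        then have "scale_p \<kappa> (nrm z) \<le> p" unfolding p_def by (rule scale_p_antimono[OF \<kappa>(1) elim(3)])
        then show "q z \<le> p" using z R1 by (simp add: q_def inhom_density_eq)
      qed (use e n in auto)
      moreover have "exp (- 16 * \<l>) / ln R \<le> \<epsilon> ^ (8 * (k + 1))"
      proof -
        have "real (8 * (k + 1)) * \<l> \<le> (512 * \<kappa> * L + 16) * \<l>" using kl \<l>(1) by (intro mult_right_mono) auto
        also have "\<dots> = (512 * \<kappa> * \<l>) * L + 16 * \<l>" by (simp add: algebra_simps)
        also have "\<dots> \<le> 1 * L + 16 * \<l>" using \<kappa>\<l> L0 by (intro add_right_mono mult_right_mono) auto
        finally have "exp (- (L + 16 * \<l>)) \<le> exp (- (real (8 * (k + 1)) * \<l>))" by simp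
        moreover have "exp (- (real (8 * (k + 1)) * \<l>)) = \<epsilon> ^ (8 * (k + 1))"
          unfolding \<l>(2) exp_of_nat_mult[symmetric] by simp
        moreover have "exp (- (L + 16 * \<l>)) = exp (- 16 * \<l>) / ln R"
        proof -
          have "exp L = ln R" using lnR by (simp add: L_def)
          moreover have "- (L + 16 * \<l>) = - 16 * \<l> - L" by simp
          ultimately show ?thesis by (simp only: exp_diff)
        qed
        ultimately show ?thesis by (simp only:)
      qed
      ultimately show ?case using elim(4) n(4) nx(1) x(2) by (intro conjI exI[of _ "real n"]) auto
    qed
    then obtain R0 where R0: "\<And>R. R0 \<le> R \<Longrightarrow> 4 * mesh \<le> R \<and> (\<exists>n>0. n \<le> R / 4 \<and> exp (- 16 * \<l>) / ln R \<le> Q.P (?E R n))"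
      unfolding eventually_at_top_linorder by blast
    obtain K where K: "R0 < 8 ^ K" using real_arch_pow[of 8 R0] by auto
    define r where "r k = (8::real) ^ (k + Suc K)" for k
    have rR: "R0 \<le> r k" for k
    proof -
      have "(8::real) ^ K \<le> 8 ^ (k + Suc K)" by (rule power_increasing) auto
      then show ?thesis using K by (simp add: r_def)
    qed
    have "\<forall>k. \<exists>n. 0 < n \<and> n \<le> r k / 4 \<and> exp (- 16 * \<l>) / ln (r k) \<le> Q.P (?E (r k) n)" using R0[OF rR] by simp
    then have "\<exists>m. \<forall>k. 0 < m k \<and> m k \<le> r k / 4 \<and> exp (- 16 * \<l>) / ln (r k) \<le> Q.P (?E (r k) (m k))" by (rule choice)
    then obtain m where m': "\<forall>k. 0 < m k \<and> m k \<le> r k / 4 \<and> exp (- 16 * \<l>) / ln (r k) \<le> Q.P (?E (r k) (m k))" ..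
    have m: "0 < m k" "m k \<le> r k / 4" "exp (- 16 * \<l>) / ln (r k) \<le> Q.P (?E (r k) (m k))" for k using m' by simp_all
    have r4: "4 * mesh \<le> r k" for k using R0[OF rR] by blast
    have r0: "0 < r k" for k by (simp add: r_def)
    have "AE \<omega> in Q.\<mu>. \<not> has_infinite_cluster M \<omega>"
    proof (rule Q.no_infinite_cluster[OF m(1)])
      show "0 \<le> r k + mesh" for k using r0[of k] mesh_ge by linarith
      show "filterlim (\<lambda>k. r k + mesh) at_top sequentially" unfolding r_def by real_asymp
      show "r k + mesh + m k + mesh < r (Suc k) + mesh - mesh" for k
      proof -
        have "r (Suc k) = 8 * r k" by (simp add: r_def)
        then show ?thesis using m(2)[of k] r4[of k] r0[of k] by linarith
      qed
      show "\<not> summable (\<lambda>k. Q.P (?E (r k) (m k)))"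
      proof
        assume "summable (\<lambda>k. Q.P (?E (r k) (m k)))"
        then have "summable (\<lambda>k. exp (- 16 * \<l>) / ln (r k))"
        proof (rule summable_comparison_test'[of _ 0])
          fix k
          have "1 \<le> r k" unfolding r_def by (rule one_le_power) simp
          then have "0 \<le> exp (- 16 * \<l>) / ln (r k)" by simp
          then show "norm (exp (- 16 * \<l>) / ln (r k)) \<le> Q.P (?E (r k) (m k))" using m(3)[of k] by simp
        qed
        then have "summable (\<lambda>k. (exp (- 16 * \<l>) / ln 8) * inverse (real (k + Suc K)))"
          by (simp add: r_def ln_realpow divide_inverse mult_ac del: power_Suc)
        then have "summable (\<lambda>k. inverse (real (k + Suc K)))" by (subst (asm) summable_cmult_iff) simp
        then have "summable (\<lambda>k. inverse (real k))" by (subst (asm) summable_iff_shift)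
        then show False using not_summable_harmonic[where 'a=real] by simp
      qed
    qed
    then show "AE \<omega> in inhom_measure M pc \<kappa>. \<not> has_infinite_cluster M \<omega>" unfolding inhom_measure_def q_def .
  qed
qed

text \<open>All rectangles on scale \<open>R\<close> lie between the radii \<open>R / 2\<close> and
  \<open>8 * R\<close>, where the density is at least its value at \<open>8 * R\<close>. So failures
  are bounded by those in one homogeneous model per scale.\<close>

lemma infinite_cluster_large_kappa:
  "\<exists>\<kappa>>0. AE \<omega> in inhom_measure M pc \<kappa>. has_infinite_cluster M \<omega>"
proof -
  obtain \<epsilon> n0 C p1 where C: "0 < C" "pc < p1" "p1 < 1"
    and sd: "\<And>p. pc < p \<Longrightarrow> p < p1 \<Longrightarrow> \<exists>m. 10 * mesh \<le> m \<and> m \<le> C * corr_length M p \<and> short_dual_le p (exp (- 1) / 144) m"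
    using near_critical by metis
  \<comment> \<open>With \<open>L = ln (ln (8 * R))\<close> the scale of rare dual crossings is at
    most \<open>C * (8 * R / (\<kappa> * L)) = R / (6 * L)\<close>. The failure probability
    \<open>exp (- (R / (3 * m)))\<close> is then at most \<open>exp (- (2 * L))\<close>, the inverse
    square of \<open>ln (8 * R)\<close>, which is summable along powers of 2.\<close>
  define \<kappa> where "\<kappa> = 48 * C"
  have \<kappa>: "0 < \<kappa>" using C by (simp add: \<kappa>_def)
  define q where "q = inhom_density M pc \<kappa>"
  interpret Q: lattice_field M q unfolding q_def by (rule inhom_field[OF \<kappa>])
  have "eventually (\<lambda>R. scale_p \<kappa> (8 * R) < p1) at_top"
  proof -
    obtain R1 where "\<And>r. R1 \<le> r \<Longrightarrow> scale_p \<kappa> r < p1" using scale_p_near[OF \<kappa> C(2,3)] unfolding eventually_at_top_linorder by blast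
    then show ?thesis unfolding eventually_at_top_linorder by (intro exI[of _ "max 0 R1"]) auto
  qed
  moreover have "eventually (\<lambda>R::real. 2 * exp (exp 1) \<le> R) at_top" by (rule eventually_ge_at_top)
  moreover have "eventually (\<lambda>R::real. 4 * mesh \<le> R) at_top" by (rule eventually_ge_at_top)
  ultimately have "eventually (\<lambda>R. 4 * mesh \<le> R \<and> 0 < R \<and> (\<forall>f g c w b h. axes f g \<longrightarrow> 0 < w \<longrightarrow> w \<le> 3 * R \<longrightarrow> R \<le> h \<longrightarrow>
     rect g f (c - mesh) (c + w + mesh) b (b + h) \<subseteq> annulus (R / 2) (8 * R) \<longrightarrow>
     Q.P (\<lambda>\<omega>. \<not> ocross g f c (c + w) b (b + h) \<omega>) \<le> 1 / (ln (8 * R))\<^sup>2)) at_top"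
  proof eventually_elim
    case (elim R)
    have R2: "exp (exp 1) \<le> R / 2" using elim(2) by linarith
    have R0: "0 < R" using elim(2) exp_gt_zero[of "exp (1::real)"] by linarith
    have R8: "exp (exp 1) \<le> 8 * R" using R2 R0 by linarith
    have lnR: "exp 1 \<le> ln (8 * R)" using R8 R0 by (simp add: ln_ge_iff)
    have lnR0: "0 < ln (8 * R)" by (rule less_le_trans[OF exp_gt_zero lnR])
    define L where "L = ln (ln (8 * R))"
    have L1: "1 \<le> L" using lnR lnR0 by (simp add: L_def ln_ge_iff)
    define p where "p = scale_p \<kappa> (8 * R)"
    have p: "pc < p" "p < p1" "0 \<le> p" "p \<le> 1" "corr_length M p = 8 * R / (\<kappa> * L)"
      using scale_p_props[OF \<kappa> exp_exp_gt[OF R8]] elim(1) pc01 by (auto simp: p_def L_def)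
    obtain m where m: "10 * mesh \<le> m" "m \<le> C * (8 * R / (\<kappa> * L))" "short_dual_le p (exp (- 1) / 144) m"
      using sd[OF p(1,2)] p(5) by auto
    have m0: "0 < m" using m(1) mesh_ge by linarith
    have mL: "6 * m * L \<le> R"
    proof -
      have "C * (8 * R / (\<kappa> * L)) = R / (6 * L)" using C(1) by (simp add: \<kappa>_def)
      then show ?thesis using m(2) L1 by (simp add: le_divide_eq mult_ac)
    qed
    have mR: "3 * m \<le> 2 * R"
    proof -
      have "m * 1 \<le> m * L" using L1 m0 by (intro mult_left_mono) auto
      then show ?thesis using mL R0 by linarith
    qed
    interpret H: bernoulli_field M "\<lambda>_. p" using p(3,4) by (rule bernoulli_field_const)
    have "Q.P (\<lambda>\<omega>. \<not> ocross g f c (c + w) b (b + h) \<omega>) \<le> 1 / (ln (8 * R))\<^sup>2"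
      if ax: "axes f g" and w: "0 < w" "w \<le> 3 * R" and h: "R \<le> h"
        and sub: "rect g f (c - mesh) (c + w + mesh) b (b + h) \<subseteq> annulus (R / 2) (8 * R)" for f g c w b h
    proof -
      let ?U = "rect g f (c - mesh) (c + w + mesh) b (b + h)" and ?A = "ocross g f c (c + w) b (b + h)"
      have cw: "c < c + w" using w by simp
      have dep: "depends_on ?A (els ?U)" by (rule ocross_depends[OF axes_sym[OF ax] cw])
      have fin: "finite (els ?U)" by (rule finite_els_rect[OF axes_sym[OF ax]])
      have "H.P ?A \<le> Q.P ?A"
      proof (rule perc_prob_mono_density[OF H.bernoulli_field_axioms Q.bernoulli_field_axioms dep fin els_subset ocross_up[OF axes_sym[OF ax] cw]])
        fix b' assume "b' \<in> els ?U"
        then have "location b' \<in> annulus (R / 2) (8 * R)" using location_in convex_rect[OF axes_sym[OF ax]] sub by blast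
        then have z: "R / 2 \<le> nrm (location b')" "nrm (location b') \<le> 8 * R" by (auto simp: annulus_def)
        have "exp 1 < nrm (location b')" using exp_exp_gt[OF R2] z(1) by linarith
        moreover have "p \<le> scale_p \<kappa> (nrm (location b'))"
          unfolding p_def by (rule scale_p_antimono[OF \<kappa> _ z(2)]) (use R2 z(1) in linarith)
        ultimately show "p \<le> q (location b')" by (simp add: q_def inhom_density_eq)
      qed
      then have "Q.P (\<lambda>\<omega>. \<not> ?A \<omega>) \<le> 1 - hom_prob M p ?A" using Q.P_not[OF dep fin els_subset] by (simp add: hom_prob_eq)
      also have "\<dots> \<le> exp (- (R / (3 * m)))" by (rule ocross_failure_le[OF m(3) p(3,4) m(1) mR ax w h])
      also have "\<dots> \<le> exp (- (2 * L))" using mL m0 by (simp add: field_simps)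
      also have "\<dots> = 1 / (exp L)\<^sup>2" by (simp add: exp_minus exp_double divide_inverse)
      also have "\<dots> = 1 / (ln (8 * R))\<^sup>2" using lnR0 by (simp add: L_def)
      finally show ?thesis .
    qed
    then show ?case using elim(3) R0 by blast
  qed
  then obtain R1 where R1: "\<And>R. R1 \<le> R \<Longrightarrow> 4 * mesh \<le> R \<and> 0 < R \<and> (\<forall>f g c w b h. axes f g \<longrightarrow> 0 < w \<longrightarrow> w \<le> 3 * R \<longrightarrow> R \<le> h \<longrightarrow>
     rect g f (c - mesh) (c + w + mesh) b (b + h) \<subseteq> annulus (R / 2) (8 * R) \<longrightarrow>
     Q.P (\<lambda>\<omega>. \<not> ocross g f c (c + w) b (b + h) \<omega>) \<le> 1 / (ln (8 * R))\<^sup>2)"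
    unfolding eventually_at_top_linorder by (elim exE) blast
  obtain K where K: "R1 < 2 ^ K" using real_arch_pow[of 2 R1] by auto
  have s: "summable (\<lambda>k. 1 / (ln 2 * real (k + 3))\<^sup>2)"
  proof -
    have "summable (\<lambda>k. inverse ((real k)\<^sup>2))" by (rule inverse_power_summable) simp
    then have "summable (\<lambda>k. inverse ((real (k + 3))\<^sup>2))" by (subst summable_iff_shift)
    then have "summable (\<lambda>k. inverse ((ln 2)\<^sup>2) * inverse ((real (k + 3))\<^sup>2))" by (rule summable_mult)
    then show ?thesis by (simp add: power_mult_distrib divide_inverse)
  qed
  have bound: "Q.P (\<lambda>\<omega>. \<not> ocross g f c (c + w) b (b + h) \<omega>) \<le> 1 / (ln 2 * real (k + 3))\<^sup>2"
    if k: "K \<le> k" and ax: "axes f g" and w: "0 < w" "w \<le> 3 * 2 ^ k" and h: "2 ^ k \<le> h"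
      and sub: "rect g f (c - mesh) (c + w + mesh) b (b + h) \<subseteq> annulus (2 ^ k / 2) (8 * 2 ^ k)" for k f g c w b h
  proof -
    have "(2::real) ^ K \<le> 2 ^ k" using k by (rule power_increasing) simp
    then have "R1 \<le> 2 ^ k" using K by linarith
    then have "Q.P (\<lambda>\<omega>. \<not> ocross g f c (c + w) b (b + h) \<omega>) \<le> 1 / (ln (8 * 2 ^ k))\<^sup>2"
      using R1 ax w h sub by blast
    moreover have "ln (8 * 2 ^ k :: real) = ln 2 * real (k + 3)"
    proof -
      have "(8 * 2 ^ k :: real) = 2 ^ (k + 3)" by (simp add: power_add)
      then show ?thesis by (simp add: ln_realpow mult.commute del: power_add)
    qed
    ultimately show ?thesis by simp
  qed
  have mesh_k: "4 * mesh \<le> 2 ^ k" if "K \<le> k" for k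
  proof -
    have "(2::real) ^ K \<le> 2 ^ k" using that by (rule power_increasing) simp
    then have "R1 \<le> 2 ^ k" using K by linarith
    then show ?thesis using R1 by blast
  qed
  have "AE \<omega> in Q.\<mu>. has_infinite_cluster M \<omega>"
  proof (rule Q.infinite_cluster_from_crossings)
    show "summable (\<lambda>k. Q.P (\<lambda>\<omega>. \<not> ocross c1 c2 (2 ^ k) (2 ^ k + 3 * 2 ^ k) 0 (0 + 2 ^ k) \<omega>))"
    proof (rule summable_comparison_test'[OF s])
      fix k assume k: "K \<le> k"
      have "rect c1 c2 (2 ^ k - mesh) (2 ^ k + 3 * 2 ^ k + mesh) 0 (0 + 2 ^ k) \<subseteq> annulus (2 ^ k / 2) (8 * 2 ^ k)"
        using mesh_k[OF k] mesh_ge by (auto simp: rect_def annulus_def nrm_eq)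
      then show "norm (Q.P (\<lambda>\<omega>. \<not> ocross c1 c2 (2 ^ k) (2 ^ k + 3 * 2 ^ k) 0 (0 + 2 ^ k) \<omega>)) \<le> 1 / (ln 2 * real (k + 3))\<^sup>2"
        unfolding real_norm_def abs_of_nonneg[OF Q.P_nonneg] by (intro bound[OF k axes21]) auto
    qed
    show "summable (\<lambda>k. Q.P (\<lambda>\<omega>. \<not> ocross c2 c1 0 (0 + 2 * 2 ^ k) (2 * 2 ^ k) (2 * 2 ^ k + 2 * 2 ^ k) \<omega>))"
    proof (rule summable_comparison_test'[OF s])
      fix k assume k: "K \<le> k"
      have "rect c2 c1 (0 - mesh) (0 + 2 * 2 ^ k + mesh) (2 * 2 ^ k) (2 * 2 ^ k + 2 * 2 ^ k) \<subseteq> annulus (2 ^ k / 2) (8 * 2 ^ k)"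
        using mesh_k[OF k] mesh_ge by (auto simp: rect_def annulus_def nrm_eq)
      then show "norm (Q.P (\<lambda>\<omega>. \<not> ocross c2 c1 0 (0 + 2 * 2 ^ k) (2 * 2 ^ k) (2 * 2 ^ k + 2 * 2 ^ k) \<omega>)) \<le> 1 / (ln 2 * real (k + 3))\<^sup>2"
        unfolding real_norm_def abs_of_nonneg[OF Q.P_nonneg] by (intro bound[OF k axes12]) auto
    qed
  qed
  then show ?thesis using \<kappa> unfolding inhom_measure_def q_def by blast
qed

lemma inhom_mono:
  assumes "0 < \<kappa>" "\<kappa> \<le> \<kappa>'" "AE \<omega> in inhom_measure M pc \<kappa>'. \<not> has_infinite_cluster M \<omega>"
  shows "AE \<omega> in inhom_measure M pc \<kappa>. \<not> has_infinite_cluster M \<omega>"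
proof -
  have \<kappa>': "0 < \<kappa>'" using assms by linarith
  interpret Q: lattice_field M "inhom_density M pc \<kappa>" by (rule inhom_field[OF assms(1)])
  interpret Q': lattice_field M "inhom_density M pc \<kappa>'" by (rule inhom_field[OF \<kappa>'])
  have "Q'.P (has_infinite_cluster M) = 0" using assms(3) Q'.AE_iff_P(2) unfolding inhom_measure_def by blast
  then have "Q.P (has_infinite_cluster M) \<le> 0"
    using infinite_cluster_mono[OF Q.lattice_field_axioms Q'.lattice_field_axioms inhom_density_mono[OF assms(1,2)]] by simp
  then have "Q.P (has_infinite_cluster M) = 0" using Q.P_nonneg[of "has_infinite_cluster M"] by linarith
  then show ?thesis using Q.AE_iff_P(2) unfolding inhom_measure_def by blast
qed

lemma inhom_01:
  "0 < \<kappa> \<Longrightarrow> (AE \<omega> in inhom_measure M pc \<kappa>. has_infinite_cluster M \<omega>) \<or> (AE \<omega> in inhom_measure M pc \<kappa>. \<not> has_infinite_cluster M \<omega>)"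
  unfolding inhom_measure_def by (rule lattice_field.infinite_cluster_01[OF inhom_field])

lemma inhom_prob_space: "0 < \<kappa> \<Longrightarrow> prob_space (inhom_measure M pc \<kappa>)"
proof -
  assume "0 < \<kappa>"
  then interpret Q: lattice_field M "inhom_density M pc \<kappa>" by (rule inhom_field)
  show ?thesis unfolding inhom_measure_def by (rule Q.prob_space_axioms)
qed

end

theorem theorem4p1:
  fixes M :: percolation_model and pc :: real
  assumes "kesten_percolation M pc"
  shows "\<exists>\<kappa>c::real. 0 < \<kappa>c \<and>
    (\<forall>\<kappa>>\<kappa>c. AE \<omega> in inhom_measure M pc \<kappa>. has_infinite_cluster M \<omega>) \<and>
    (\<forall>\<kappa>. 0 < \<kappa> \<and> \<kappa> < \<kappa>c \<longrightarrow>
       (AE \<omega> in inhom_measure M pc \<kappa>. \<not> has_infinite_cluster M \<omega>))"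
proof -
  interpret kesten M pc
    using assms by (intro kesten.intro lattice.intro kesten_axioms.intro) (simp_all add: kesten_percolation_def)
  \<comment> \<open>The threshold is \<open>Inf S\<close>. Failure of almost sure absence is
    inherited by every larger \<kappa>, and the zero-one law turns it into almost sure
    presence.\<close>
  define S where "S = {\<kappa>. 0 < \<kappa> \<and> \<not> (AE \<omega> in inhom_measure M pc \<kappa>. \<not> has_infinite_cluster M \<omega>)}"
  obtain \<kappa>0 where \<kappa>0: "0 < \<kappa>0"
    "\<And>\<kappa>. 0 < \<kappa> \<Longrightarrow> \<kappa> \<le> \<kappa>0 \<Longrightarrow> AE \<omega> in inhom_measure M pc \<kappa>. \<not> has_infinite_cluster M \<omega>"
    using no_infinite_cluster_small_kappa by blast
  have low: "\<kappa>0 \<le> \<kappa>" if "\<kappa> \<in> S" for \<kappa> using that \<kappa>0(2)[of \<kappa>] unfolding S_def by force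
  have bdd: "bdd_below S" using low by (rule bdd_belowI)
  have ne: "S \<noteq> {}"
  proof -
    obtain \<kappa> where \<kappa>: "0 < \<kappa>" "AE \<omega> in inhom_measure M pc \<kappa>. has_infinite_cluster M \<omega>"
      using infinite_cluster_large_kappa by blast
    interpret I: prob_space "inhom_measure M pc \<kappa>" by (rule inhom_prob_space[OF \<kappa>(1)])
    have "\<not> (AE \<omega> in inhom_measure M pc \<kappa>. \<not> has_infinite_cluster M \<omega>)"
    proof
      assume "AE \<omega> in inhom_measure M pc \<kappa>. \<not> has_infinite_cluster M \<omega>"
      with \<kappa>(2) have "AE \<omega> in inhom_measure M pc \<kappa>. False" by eventually_elim simp
      then show False by simp
    qed
    then show ?thesis using \<kappa>(1) by (auto simp: S_def)
  qed
  have "\<kappa>0 \<le> Inf S" using ne low by (rule cInf_greatest)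
  then have "0 < Inf S" using \<kappa>0(1) by linarith
  moreover have "AE \<omega> in inhom_measure M pc \<kappa>. has_infinite_cluster M \<omega>" if \<kappa>: "Inf S < \<kappa>" for \<kappa>
  proof -
    obtain \<kappa>' where \<kappa>': "\<kappa>' \<in> S" "\<kappa>' < \<kappa>" using cInf_lessD[OF ne \<kappa>] by blast
    then have "\<not> (AE \<omega> in inhom_measure M pc \<kappa>. \<not> has_infinite_cluster M \<omega>)"
      using inhom_mono[of \<kappa>' \<kappa>] by (auto simp: S_def)
    then show ?thesis using inhom_01[of \<kappa>] \<kappa>' by (auto simp: S_def)
  qed
  moreover have "AE \<omega> in inhom_measure M pc \<kappa>. \<not> has_infinite_cluster M \<omega>" if "0 < \<kappa>" "\<kappa> < Inf S" for \<kappa>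
    using that cInf_lower[OF _ bdd, of \<kappa>] by (auto simp: S_def)
  ultimately show ?thesis by blast
qed

end
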